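(* Let $(X,d_X)$ be a compact connected path metric space and let $r\in X$ be a base point such that the metric Reeb graph $(G,d_G)$ of $d=d_X(r,\cdot):X\to\mathbb R$ is a finite graph. If for some $\varepsilon>0$ there exists a finite metric graph $(G',d_{G'})$ with $d_{GH}(X,G')<\varepsilon$, then \[ d_{GH}(X,G)<(\beta_1(G)+1)\,(17+8N_{E,G'}(8\varepsilon))\,\varepsilon, \] where $N_{E,G'}(8\varepsilon)$ is the number of edges of $G'$ of length at most $8\varepsilon$ and $\beta_1(G)$ is the first Betti number of $G$. In particular, if $X$ is at Gromov–Hausdorff distance less than $\varepsilon$ from a finite metric graph whose shortest edge has length larger than $8\varepsilon$, then $d_{GH}(X,G)<17(\beta_1(G)+1)\varepsilon$.
   Context: A path metric space is one in which the distance between any two points is the infimum of lengths of continuous curves joining them. Reeb graph: for $x,y\in X$ set $x\sim y$ iff $d(x)=d(y)$ and $x,y$ lie in the same path-connected component of $d^{-1}(d(x))$; $G=X/\sim$ with quotient map $\pi$, and $d$ induces $d_*:G\to\mathbb R_+$ with $d=d_*\circ\pi$. Metric structure (when $G$ is a finite topological graph): the vertex set consists of the points of degree $\neq2$, the local maxima of $d_*$, and $\pi(r)$; the edges are the connected components of the complement of the vertex set; each edge is given length equal to the absolute difference of $d_*$ at its endpoints, the distance between two points $p,p'$ of the same edge being $|d_*(p)-d_*(p')|$; $d_G$ is the resulting metric-graph metric. A finite metric graph is a finite 1-dimensional simplicial complex with each edge identified with a real segment, with the induced path metric. $d_{GH}$ is the Gromov–Hausdorff distance: half the infimum of $\eta\ge0$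 such that there is a correspondence $C$ between the two spaces (projecting surjectively onto both factors) with $|d(x,x')-d(y,y')|\le\eta$ for all $(x,y),(x',y')\in C$. *)

theory Defs
  imports "HOL-Analysis.Analysis"
begin

definition correspondence :: "'a set \<Rightarrow> 'b set \<Rightarrow> ('a \<times> 'b) set \<Rightarrow> bool" where
  "correspondence S T C \<longleftrightarrow> C \<subseteq> S \<times> T \<and> fst ` C = S \<and> snd ` C = T"

definition gh_dist :: "'a set \<Rightarrow> ('a \<Rightarrow> 'a \<Rightarrow> real) \<Rightarrow> 'b set \<Rightarrow> ('b \<Rightarrow> 'b \<Rightarrow> real) \<Rightarrow> real" where
  "gh_dist S d1 T d2 = Inf {\<eta> / 2 | \<eta>. 0 \<le> \<eta> \<and> (\<exists>C. correspondence S T C \<and>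
      (\<forall>x y x' y'. (x, y) \<in> C \<longrightarrow> (x', y') \<in> C \<longrightarrow> \<bar>d1 x x' - d2 y y'\<bar> \<le> \<eta>))}"

definition curve_length :: "'a metric \<Rightarrow> (real \<Rightarrow> 'a) \<Rightarrow> ereal" where
  "curve_length m c = (SUP (n, t) \<in> {(n::nat, t::nat \<Rightarrow> real). (\<forall>i\<le>n. t i \<in> {0..1}) \<and> (\<forall>i<n. t i \<le> t (Suc i))}.
      ereal (\<Sum>i<n. mdist m (c (t i)) (c (t (Suc i)))))"

definition path_metric_space :: "'a metric \<Rightarrow> bool" where
  "path_metric_space m \<longleftrightarrow> (\<forall>x\<in>mspace m. \<forall>y\<in>mspace m.
      ereal (mdist m x y) = (INF c \<in> {c. continuous_map (top_of_set {0..1}) (mtopology_of m) c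
                                        \<and> c 0 = x \<and> c 1 = y}. curve_length m c))"

text \<open>A topological space is a finite graph if it is Hausdorff and is the union of a finite set of
  vertices and finitely many arcs (continuous images of [0,1], injective on the open interval, with
  endpoints among the vertices, interiors pairwise disjoint and disjoint from the vertices).  The
  geometric realization of this finite graph then maps homeomorphically onto the space.\<close>
definition finite_top_graph :: "'b topology \<Rightarrow> bool" where
  "finite_top_graph T \<longleftrightarrow> Hausdorff_space T \<and>
    (\<exists>(V::'b set) (I::nat set) (\<gamma>::nat \<Rightarrow> real \<Rightarrow> 'b).
       finite V \<and> finite I \<and> V \<subseteq> topspace T \<and>
       (\<forall>i\<in>I. continuous_map (top_of_set {0..1}) T (\<gamma> i) \<and> \<gamma> i 0 \<in> V \<and> \<gamma> i 1 \<in> V \<and>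
                inj_on (\<gamma> i) {0<..<1} \<and> \<gamma> i ` {0<..<1} \<inter> V = {}) \<and>
       (\<forall>i\<in>I. \<forall>j\<in>I. i \<noteq> j \<longrightarrow> \<gamma> i ` {0<..<1} \<inter> \<gamma> j ` {0<..<1} = {}) \<and>
       topspace T = V \<union> (\<Union>i\<in>I. \<gamma> i ` {0..1}))"

definition degree_two :: "'b topology \<Rightarrow> 'b \<Rightarrow> bool" where
  "degree_two T p \<longleftrightarrow> (\<exists>U. openin T U \<and> p \<in> U \<and> subtopology T U homeomorphic_space euclideanreal)"

definition reeb_rel :: "'a metric \<Rightarrow> 'a \<Rightarrow> 'a \<Rightarrow> 'a \<Rightarrow> bool" where
  "reeb_rel m r x y \<longleftrightarrow> x \<in> mspace m \<and> y \<in> mspace m \<and> mdist m r x = mdist m r y \<and>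
     path_component_of (subtopology (mtopology_of m) {z \<in> mspace m. mdist m r z = mdist m r x}) x y"

definition reeb_proj :: "'a metric \<Rightarrow> 'a \<Rightarrow> 'a \<Rightarrow> 'a set" where
  "reeb_proj m r x = {y. reeb_rel m r x y}"

definition reeb_G :: "'a metric \<Rightarrow> 'a \<Rightarrow> 'a set set" where
  "reeb_G m r = reeb_proj m r ` mspace m"

definition reeb_top :: "'a metric \<Rightarrow> 'a \<Rightarrow> 'a set topology" where
  "reeb_top m r = topology (\<lambda>U. U \<subseteq> reeb_G m r \<and>
      openin (mtopology_of m) {x \<in> mspace m. reeb_proj m r x \<in> U})"

text \<open>The induced function d_* on G (d is constant on each class).\<close>
definition reeb_dstar :: "'a metric \<Rightarrow> 'a \<Rightarrow> 'a set \<Rightarrow> real" where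
  "reeb_dstar m r p = mdist m r (SOME x. x \<in> p)"

definition reeb_local_max :: "'a metric \<Rightarrow> 'a \<Rightarrow> 'a set \<Rightarrow> bool" where
  "reeb_local_max m r p \<longleftrightarrow> (\<exists>U. openin (reeb_top m r) U \<and> p \<in> U \<and>
      (\<forall>q\<in>U. reeb_dstar m r q \<le> reeb_dstar m r p))"

definition reeb_vertices :: "'a metric \<Rightarrow> 'a \<Rightarrow> 'a set set" where
  "reeb_vertices m r = {p \<in> reeb_G m r. \<not> degree_two (reeb_top m r) p}
      \<union> {p \<in> reeb_G m r. reeb_local_max m r p} \<union> {reeb_proj m r r}"

definition reeb_edges :: "'a metric \<Rightarrow> 'a \<Rightarrow> 'a set set set" where
  "reeb_edges m r = connected_components_of (subtopology (reeb_top m r) (reeb_G m r - reeb_vertices m r))"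

definition reeb_dist :: "'a metric \<Rightarrow> 'a \<Rightarrow> 'a set \<Rightarrow> 'a set \<Rightarrow> real" where
  "reeb_dist m r p q = Inf {(\<Sum>i < length ps - 1. \<bar>reeb_dstar m r (ps ! i) - reeb_dstar m r (ps ! Suc i)\<bar>) | ps.
      ps \<noteq> [] \<and> hd ps = p \<and> last ps = q \<and>
      (\<forall>i < length ps - 1. \<exists>e \<in> reeb_edges m r.
          ps ! i \<in> reeb_top m r closure_of e \<and> ps ! Suc i \<in> reeb_top m r closure_of e)}"

definition reeb_betti1 :: "'a metric \<Rightarrow> 'a \<Rightarrow> int" where
  "reeb_betti1 m r = int (card (reeb_edges m r)) - int (card (reeb_vertices m r))
      + int (card (connected_components_of (reeb_top m r)))"

definition simplicial_graph :: "'v set \<Rightarrow> 'v set set \<Rightarrow> bool" where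
  "simplicial_graph V E \<longleftrightarrow> finite V \<and> V \<noteq> {} \<and>
     (\<forall>e\<in>E. \<exists>u w. u \<in> V \<and> w \<in> V \<and> u \<noteq> w \<and> e = {u, w})"

text \<open>Points are barycentric coordinate functions.\<close>
definition vert_pt :: "'v \<Rightarrow> 'v \<Rightarrow> real" where
  "vert_pt v = (\<lambda>w. if w = v then 1 else 0)"

definition edge_seg :: "'v set \<Rightarrow> ('v \<Rightarrow> real) set" where
  "edge_seg e = {x. (\<forall>z\<in>e. 0 \<le> x z) \<and> (\<Sum>z\<in>e. x z) = 1 \<and> (\<forall>z. z \<notin> e \<longrightarrow> x z = 0)}"

definition mg_carrier :: "'v set \<Rightarrow> 'v set set \<Rightarrow> ('v \<Rightarrow> real) set" where
  "mg_carrier V E = vert_pt ` V \<union> (\<Union>e\<in>E. edge_seg e)"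

definition seg_dist :: "('v set \<Rightarrow> real) \<Rightarrow> 'v set \<Rightarrow> ('v \<Rightarrow> real) \<Rightarrow> ('v \<Rightarrow> real) \<Rightarrow> real" where
  "seg_dist len e x y = len e * (\<Sum>z\<in>e. \<bar>x z - y z\<bar>) / 2"

definition mg_walk :: "'v set set \<Rightarrow> ('v \<Rightarrow> real) list \<Rightarrow> 'v set list \<Rightarrow> bool" where
  "mg_walk E xs es \<longleftrightarrow> xs \<noteq> [] \<and> length es = length xs - 1 \<and>
     (\<forall>i < length es. es ! i \<in> E \<and> xs ! i \<in> edge_seg (es ! i) \<and> xs ! Suc i \<in> edge_seg (es ! i))"

definition mg_dist :: "'v set set \<Rightarrow> ('v set \<Rightarrow> real) \<Rightarrow> ('v \<Rightarrow> real) \<Rightarrow> ('v \<Rightarrow> real) \<Rightarrow> real" where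
  "mg_dist E len x y = Inf {(\<Sum>i < length es. seg_dist len (es ! i) (xs ! i) (xs ! Suc i)) | xs es.
      mg_walk E xs es \<and> hd xs = x \<and> last xs = y}"

text \<open>A finite metric graph: finite simplicial graph, positive edge lengths, connected
  (so that the path metric is finite).\<close>
definition finite_metric_graph :: "'v set \<Rightarrow> 'v set set \<Rightarrow> ('v set \<Rightarrow> real) \<Rightarrow> bool" where
  "finite_metric_graph V E len \<longleftrightarrow> simplicial_graph V E \<and> (\<forall>e\<in>E. 0 < len e) \<and>
     (\<forall>x\<in>mg_carrier V E. \<forall>y\<in>mg_carrier V E. \<exists>xs es. mg_walk E xs es \<and> hd xs = x \<and> last xs = y)"

end

theory Submission
  imports Defs
begin

text \<open>Let \<open>C\<close> be a correspondence between \<open>X\<close> and the metric graph, of distortion \<open>\<eta> < 2\<epsilon>\<close>. The Reeb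
  distance never exceeds the distance of \<open>X\<close>, because the level changes at least as much along a
  curve as between its ends. For the converse, a shortest path of the Reeb graph is lifted to \<open>X\<close>
  along almost shortest curves to \<open>r\<close>; the lift has to jump inside a level component at most
  \<open>\<beta>\<^sub>1 + 1\<close> times.

  The jumps are measured in the metric graph, cut at \<open>r'\<close> and at the highest points of its edges. A
  level component corresponds to points near one cluster of short pieces, or to points of one long
  piece, on which the height is a coordinate; jumps near the same cluster are paid for only once.
  The short edges contribute at most \<open>8\<epsilon>N + 16\<epsilon>\<close> to the diameters of the clusters. Every further
  merging of clusters costs at most \<open>16\<epsilon>\<close>, and leaves a long piece that is not needed to descend from
  some cluster to \<open>r'\<close>. A generic point of such a long piece yields a point of the Reeb graph, from
  which a path starts upwards and reaches the root without meeting any point so obtained; hence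
  there are at most \<open>\<beta>\<^sub>1\<close> of these points.\<close>

text \<open>No map between the Reeb graph and the metric graph is available, and the metric graph
  sees X only at scale \<epsilon>. What passes between them is metric: points of X at distance less
  than 2\<epsilon> are joined by a curve that stays within \<epsilon> of its ends, so chains of
  short steps in the metric graph become paths of X, while paths in X become chains of
  correspondents.

  The threshold 8\<epsilon> is twice a window of 4\<epsilon>. A point of level t corresponds to a
  height within \<eta> < 2\<epsilon> of t, and the chains used between such points keep their
  heights within 4\<epsilon> of t; a piece that extends at least 4\<epsilon> to both sides of t can
  therefore not be left by them.

  Apart from the diameter of its cluster a jump costs at most 16\<epsilon> + \<eta>: 8\<epsilon>
  from either end to the cluster, and the distortion. Writing \<beta> for the Betti number and N for
  the number of short edges, the quotient map has distortion less than 18(\<beta> + 1)\<epsilon> for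
  the jumps plus 16(\<beta> + 1)\<epsilon> + 8N\<epsilon> for the diameters. The Gromov-Hausdorff
  distance takes half of this, 17(\<beta> + 1)\<epsilon> + 4N\<epsilon>.\<close>

section \<open>Continuous induction along a path in a finite closed cover\<close>

lemma pathin_locally_in_common_piece:
  assumes path: "pathin T \<rho>" and fin: "finite P" and cl: "\<And>Q. Q \<in> P \<Longrightarrow> closedin T Q"
    and cov: "topspace T \<subseteq> \<Union>P" and x: "x \<in> {0..1}"
  shows "\<exists>d>0. \<forall>s\<in>{0..1}. \<bar>s - x\<bar> < d \<longrightarrow> (\<exists>Q\<in>P. \<rho> s \<in> Q \<and> \<rho> x \<in> Q)"
proof -
  \<comment> \<open>Discarding the finitely many closed pieces that miss \<open>\<rho> x\<close>
    leaves an open neighbourhood of it; a piece that meets this neighbourhood also contains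
    \<open>\<rho> x\<close>.\<close>
  define N where "N = topspace T - \<Union>{Q\<in>P. \<rho> x \<notin> Q}"
  have "closedin T (\<Union>{Q\<in>P. \<rho> x \<notin> Q})"
    using fin cl by (intro closedin_Union) auto
  then have oN: "openin T N" unfolding N_def by blast
  have xT: "\<rho> x \<in> topspace T"
    using path x unfolding pathin_def continuous_map_def by auto
  have "openin (top_of_set {0..1}) {s \<in> {0..1}. \<rho> s \<in> N}"
    using path oN unfolding pathin_def continuous_map_def by auto
  moreover have "x \<in> {s \<in> {0..1}. \<rho> s \<in> N}" using x xT unfolding N_def by auto
  ultimately obtain d where d: "d > 0" "\<And>s. s \<in> {0..1} \<Longrightarrow> dist s x < d \<Longrightarrow> s \<in> {s \<in> {0..1}. \<rho> s \<in> N}"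
    unfolding openin_euclidean_subtopology_iff by meson
  show ?thesis
  proof (intro exI conjI ballI impI)
    show "d > 0" by fact
    fix s :: real assume s: "s \<in> {0..1}" "\<bar>s - x\<bar> < d"
    then have sN: "\<rho> s \<in> N" using d(2)[of s] by (simp add: dist_real_def)
    then have "\<rho> s \<in> topspace T" unfolding N_def by auto
    then obtain Q where "Q \<in> P" "\<rho> s \<in> Q" using cov by blast
    with sN show "\<exists>Q\<in>P. \<rho> s \<in> Q \<and> \<rho> x \<in> Q" unfolding N_def by blast
  qed
qed

text \<open>A path may change between pieces infinitely often, so it cannot simply be cut into
  finitely many stretches inside single pieces. A transitive relation between times still spreads
  from single pieces to the whole path, because all times close to \<open>x\<close> share a piece
  with \<open>x\<close>.\<close>

lemma pathin_pieces_relation: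
  assumes path: "pathin T \<rho>" and fin: "finite P" and cl: "\<And>Q. Q \<in> P \<Longrightarrow> closedin T Q"
    and cov: "topspace T \<subseteq> \<Union>P"
    and loc: "\<And>Q s s'. Q \<in> P \<Longrightarrow> 0 \<le> s \<Longrightarrow> s \<le> s' \<Longrightarrow> s' \<le> 1 \<Longrightarrow> \<rho> s \<in> Q \<Longrightarrow> \<rho> s' \<in> Q \<Longrightarrow> R s s'"
    and trans: "\<And>a b c. 0 \<le> a \<Longrightarrow> a \<le> b \<Longrightarrow> b \<le> c \<Longrightarrow> c \<le> 1 \<Longrightarrow> R a b \<Longrightarrow> R b c \<Longrightarrow> R a c"
    and ab: "0 \<le> a" "a \<le> b" "b \<le> (1::real)"
  shows "R a b"
proof -
  have "0 \<le> a \<longrightarrow> b \<le> 1 \<longrightarrow> R a b"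
    using ab(2)
  proof (induction rule: Bolzano)
    case (trans a b c)
    then show ?case using assms(6) by auto
  next
    case (local x)
    show ?case
    proof (cases "x \<in> {0..1}")
      case False
      then show ?thesis using local ab by auto
    next
      case True
      obtain d where d: "d > 0" "\<And>s. s\<in>{0..1} \<Longrightarrow> \<bar>s - x\<bar> < d \<Longrightarrow> (\<exists>Q\<in>P. \<rho> s \<in> Q \<and> \<rho> x \<in> Q)"
        using pathin_locally_in_common_piece[OF path fin cl cov True] by meson
      have "R u v" if "u \<le> x" "x \<le> v" "v - u < d" "0 \<le> u" "v \<le> 1" for u v
      proof -
        have "u \<in> {0..1}" "v \<in> {0..1}" "\<bar>u - x\<bar> < d" "\<bar>v - x\<bar> < d" using that by auto
        then obtain Q1 Q2 where "Q1 \<in> P" "\<rho> u \<in> Q1" "\<rho> x \<in> Q1" "Q2 \<in> P" "\<rho> v \<in> Q2" "\<rho> x \<in> Q2"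
          using d(2)[of u] d(2)[of v] by meson
        then have "R u x" "R x v" using loc[of Q1 u x] loc[of Q2 x v] that by auto
        then show ?thesis using assms(6)[of u x v] that by auto
      qed
      then show ?thesis using d(1) by blast
    qed
  qed
  then show ?thesis using ab by auto
qed

section \<open>Spanning trees and merging of classes\<close>

text \<open>Every point except \<open>z\<close> picks the last edge of a shortest connection from
  \<open>z\<close>. The combinatorial distance from \<open>z\<close> grows by one along that edge,
  so the edge cannot be picked from both of its ends.\<close>

lemma connected_graph_card_le:
  fixes p q :: "'e \<Rightarrow> 'v"
  assumes fin: "finite H"
    and conn: "\<And>w. w \<in> W \<Longrightarrow> (z, w) \<in> {(x, y). \<exists>e\<in>H. (x = p e \<and> y = q e) \<or> (x = q e \<and> y = p e)}\<^sup>*"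
  shows "finite W \<and> card W \<le> card H + 1"
proof -
  let ?S = "{(x, y). \<exists>e\<in>H. (x = p e \<and> y = q e) \<or> (x = q e \<and> y = p e)}"
  define d where "d w = (LEAST n. (z, w) \<in> ?S ^^ n)" for w
  have ex: "\<exists>n. (z, w) \<in> ?S ^^ n" if "(z, w) \<in> ?S\<^sup>*" for w
    using that by (simp add: rtrancl_power)
  have dw: "(z, w) \<in> ?S ^^ (d w)" if "(z, w) \<in> ?S\<^sup>*" for w
    unfolding d_def using ex[OF that] by (rule LeastI_ex)
  have dle: "d w \<le> n" if "(z, w) \<in> ?S ^^ n" for w n
    unfolding d_def using that by (rule Least_le)
  have par: "\<exists>e\<in>H. \<exists>w'. ((w' = p e \<and> w = q e) \<or> (w' = q e \<and> w = p e)) \<and> d w = Suc (d w')"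
    if w: "w \<in> W" "w \<noteq> z" for w
  proof -
    have r: "(z, w) \<in> ?S ^^ (d w)" using dw conn w by blast
    then obtain k where k: "d w = Suc k"
      using w(2) by (cases "d w") auto
    with r obtain w' where w': "(z, w') \<in> ?S ^^ k" "(w', w) \<in> ?S" by auto
    have "d w' \<le> k" using dle w'(1) by blast
    moreover have "(z, w) \<in> ?S ^^ (Suc (d w'))"
      using dw[of w'] w' by (meson relpow_Suc_I relpow_imp_rtrancl)
    then have "d w \<le> Suc (d w')" using dle by blast
    ultimately have "d w = Suc (d w')" using k by auto
    then show ?thesis using w'(2) by blast
  qed
  then obtain \<phi> \<psi> where \<phi>: "\<And>w. w \<in> W \<Longrightarrow> w \<noteq> z \<Longrightarrow> \<phi> w \<in> H \<and> ((\<psi> w = p (\<phi> w) \<and> w = q (\<phi> w)) \<or> (\<psi> w = q (\<phi> w) \<and> w = p (\<phi> w))) \<and> d w = Suc (d (\<psi> w))"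
    by metis
  have inj: "inj_on \<phi> (W - {z})"
  proof (rule inj_onI)
    fix v w assume v: "v \<in> W - {z}" and w: "w \<in> W - {z}" and eq: "\<phi> v = \<phi> w"
    have "v = w \<or> (\<psi> v = w \<and> v = \<psi> w)" using \<phi>[of v] \<phi>[of w] v w unfolding eq by auto
    moreover have "d v = Suc (d (\<psi> v))" "d w = Suc (d (\<psi> w))" using \<phi> v w by blast+
    ultimately show "v = w" by auto
  qed
  have sub: "\<phi> ` (W - {z}) \<subseteq> H" using \<phi> by auto
  have f: "finite (W - {z})" using finite_imageD[OF finite_subset[OF sub fin] inj] .
  have c: "card (W - {z}) \<le> card H" using card_inj_on_le[OF inj sub fin] .
  have fW: "finite W" using f by simp
  moreover have "card W \<le> card (W - {z}) + 1"
    using fW by (cases "z \<in> W") (simp_all add: card_Diff_singleton_if)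
  ultimately show ?thesis using c by simp
qed

text \<open>Adding edges one at a time: two classes of diameter at most w merge, at the price of the
  length of the connecting edge, only when the number of classes drops.\<close>

lemma partition_add_edges:
  fixes D :: "'v \<Rightarrow> 'v \<Rightarrow> real" and p q :: "'e \<Rightarrow> 'v"
  assumes S: "finite S" and U: "finite U"
    and sym: "\<And>u v. u \<in> U \<Longrightarrow> v \<in> U \<Longrightarrow> D u v = D v u"
    and tri: "\<And>u v x. u \<in> U \<Longrightarrow> v \<in> U \<Longrightarrow> x \<in> U \<Longrightarrow> D u x \<le> D u v + D v x"
    and e: "\<And>e. e \<in> S \<Longrightarrow> p e \<in> U \<and> q e \<in> U \<and> 0 \<le> \<omega> e \<and> D (p e) (q e) \<le> \<omega> e"
    and P: "partition_on U P"
    and w: "\<And>K. K \<in> P \<Longrightarrow> 0 \<le> w K" "\<And>K u v. K \<in> P \<Longrightarrow> u \<in> K \<Longrightarrow> v \<in> K \<Longrightarrow> D u v \<le> w K"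
    and b: "0 \<le> b" "\<And>e. e \<in> S \<Longrightarrow> \<omega> e \<le> b"
  shows "\<exists>P' w'. partition_on U P' \<and> (\<forall>K\<in>P'. 0 \<le> w' K \<and> (\<forall>u\<in>K. \<forall>v\<in>K. D u v \<le> w' K))
    \<and> (\<forall>e\<in>S. \<exists>K\<in>P'. p e \<in> K \<and> q e \<in> K) \<and> (\<forall>K\<in>P. \<exists>K'\<in>P'. K \<subseteq> K') \<and> card P' \<le> card P
    \<and> sum w' P' \<le> sum w P + sum \<omega> S \<and> sum w' P' \<le> sum w P + b * (real (card P) - real (card P'))
    \<and> (\<forall>R. (\<forall>x y. R x y \<longrightarrow> R y x) \<longrightarrow> (\<forall>x y z. R x y \<longrightarrow> R y z \<longrightarrow> R x z) \<longrightarrow>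
        (\<forall>K\<in>P. \<forall>u\<in>K. \<forall>v\<in>K. R u v) \<longrightarrow> (\<forall>e\<in>S. R (p e) (q e)) \<longrightarrow> (\<forall>K\<in>P'. \<forall>u\<in>K. \<forall>v\<in>K. R u v))"
  using S e b(2)
proof (induction S rule: finite_induct)
  case empty
  show ?case
  proof (rule exI[of _ P], rule exI[of _ w], intro conjI)
    show "\<forall>K\<in>P. 0 \<le> w K \<and> (\<forall>u\<in>K. \<forall>v\<in>K. D u v \<le> w K)" using w by simp
    show "\<forall>K\<in>P. \<exists>K'\<in>P. K \<subseteq> K'" by blast
    show "\<forall>R. (\<forall>x y. R x y \<longrightarrow> R y x) \<longrightarrow> (\<forall>x y z. R x y \<longrightarrow> R y z \<longrightarrow> R x z) \<longrightarrow>
        (\<forall>K\<in>P. \<forall>u\<in>K. \<forall>v\<in>K. R u v) \<longrightarrow> (\<forall>e\<in>{}. R (p e) (q e)) \<longrightarrow> (\<forall>K\<in>P. \<forall>u\<in>K. \<forall>v\<in>K. R u v)"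
      by (intro allI impI)
  qed (use P in simp_all)
next
  case (insert a S)
  have "\<exists>P' w'. partition_on U P' \<and> (\<forall>K\<in>P'. 0 \<le> w' K \<and> (\<forall>u\<in>K. \<forall>v\<in>K. D u v \<le> w' K))
    \<and> (\<forall>e\<in>S. \<exists>K\<in>P'. p e \<in> K \<and> q e \<in> K) \<and> (\<forall>K\<in>P. \<exists>K'\<in>P'. K \<subseteq> K') \<and> card P' \<le> card P
    \<and> sum w' P' \<le> sum w P + sum \<omega> S \<and> sum w' P' \<le> sum w P + b * (real (card P) - real (card P'))
    \<and> (\<forall>R. (\<forall>x y. R x y \<longrightarrow> R y x) \<longrightarrow> (\<forall>x y z. R x y \<longrightarrow> R y z \<longrightarrow> R x z) \<longrightarrow>
        (\<forall>K\<in>P. \<forall>u\<in>K. \<forall>v\<in>K. R u v) \<longrightarrow> (\<forall>e\<in>S. R (p e) (q e)) \<longrightarrow> (\<forall>K\<in>P'. \<forall>u\<in>K. \<forall>v\<in>K. R u v))"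
    by (rule insert.IH[OF insert.prems(1)[OF insertI2] insert.prems(2)[OF insertI2]])
  then obtain P1 w1 where H: "partition_on U P1 \<and> (\<forall>K\<in>P1. 0 \<le> w1 K \<and> (\<forall>u\<in>K. \<forall>v\<in>K. D u v \<le> w1 K))
    \<and> (\<forall>e\<in>S. \<exists>K\<in>P1. p e \<in> K \<and> q e \<in> K) \<and> (\<forall>K\<in>P. \<exists>K'\<in>P1. K \<subseteq> K') \<and> card P1 \<le> card P
    \<and> sum w1 P1 \<le> sum w P + sum \<omega> S \<and> sum w1 P1 \<le> sum w P + b * (real (card P) - real (card P1))
    \<and> (\<forall>R. (\<forall>x y. R x y \<longrightarrow> R y x) \<longrightarrow> (\<forall>x y z. R x y \<longrightarrow> R y z \<longrightarrow> R x z) \<longrightarrow>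
        (\<forall>K\<in>P. \<forall>u\<in>K. \<forall>v\<in>K. R u v) \<longrightarrow> (\<forall>e\<in>S. R (p e) (q e)) \<longrightarrow> (\<forall>K\<in>P1. \<forall>u\<in>K. \<forall>v\<in>K. R u v))"
    by (elim exE) rule
  have 1: "partition_on U P1" "\<And>K. K \<in> P1 \<Longrightarrow> 0 \<le> w1 K"
    "\<And>K u v. K \<in> P1 \<Longrightarrow> u\<in>K \<Longrightarrow> v\<in>K \<Longrightarrow> D u v \<le> w1 K"
    "\<And>e. e\<in>S \<Longrightarrow> \<exists>K\<in>P1. p e \<in> K \<and> q e \<in> K" "\<And>K. K\<in>P \<Longrightarrow> \<exists>K'\<in>P1. K \<subseteq> K'" "card P1 \<le> card P"
    "sum w1 P1 \<le> sum w P + sum \<omega> S" "sum w1 P1 \<le> sum w P + b * (real (card P) - real (card P1))"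
    using H[THEN conjunct1] H[THEN conjunct2, THEN conjunct1] H[THEN conjunct2, THEN conjunct2, THEN conjunct1]
      H[THEN conjunct2, THEN conjunct2, THEN conjunct2, THEN conjunct1]
      H[THEN conjunct2, THEN conjunct2, THEN conjunct2, THEN conjunct2, THEN conjunct1]
      H[THEN conjunct2, THEN conjunct2, THEN conjunct2, THEN conjunct2, THEN conjunct2, THEN conjunct1]
      H[THEN conjunct2, THEN conjunct2, THEN conjunct2, THEN conjunct2, THEN conjunct2, THEN conjunct2, THEN conjunct1]
    by blast+
  have rel1: "\<forall>K\<in>P1. \<forall>u\<in>K. \<forall>v\<in>K. R u v" if "\<forall>x y. R x y \<longrightarrow> R y x" "\<forall>x y z. R x y \<longrightarrow> R y z \<longrightarrow> R x z"
    "\<forall>K\<in>P. \<forall>u\<in>K. \<forall>v\<in>K. R u v" "\<forall>e\<in>S. R (p e) (q e)" for R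
    using H[THEN conjunct2, THEN conjunct2, THEN conjunct2, THEN conjunct2, THEN conjunct2, THEN conjunct2, THEN conjunct2, THEN spec, THEN mp, THEN mp, THEN mp, THEN mp, OF that] .
  have a: "p a \<in> U" "q a \<in> U" "0 \<le> \<omega> a" "D (p a) (q a) \<le> \<omega> a" "\<omega> a \<le> b"
    using insert.prems by auto
  have finP1: "finite P1" using 1(1) U by (rule finite_elements[rotated])
  obtain K1 where K1: "K1 \<in> P1" "p a \<in> K1" using 1(1) a(1) unfolding partition_on_def by auto
  obtain K2 where K2: "K2 \<in> P1" "q a \<in> K2" using 1(1) a(2) unfolding partition_on_def by auto
  have KU: "K \<subseteq> U" if "K \<in> P1" for K using 1(1) that unfolding partition_on_def by auto
  have disj: "K \<inter> K' = {}" if "K \<in> P1" "K' \<in> P1" "K \<noteq> K'" for K K'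
    using 1(1) that unfolding partition_on_def disjoint_def by blast
  show ?case
  proof (cases "K1 = K2")
    case True
    have "sum \<omega> (insert a S) = \<omega> a + sum \<omega> S" using insert.hyps by simp
    then have 2: "sum w1 P1 \<le> sum w P + sum \<omega> (insert a S)" using 1(7) a(3) by linarith
    have 3: "\<forall>e\<in>insert a S. \<exists>K\<in>P1. p e \<in> K \<and> q e \<in> K" using 1(4) K1 K2 True by auto
    show ?thesis
    proof (rule exI[of _ P1], rule exI[of _ w1], intro conjI allI impI)
      fix R assume R: "\<forall>x y. R x y \<longrightarrow> R y x" "\<forall>x y z. R x y \<longrightarrow> R y z \<longrightarrow> R x z"
        "\<forall>K\<in>P. \<forall>u\<in>K. \<forall>v\<in>K. R u v" "\<forall>e\<in>insert a S. R (p e) (q e)"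
      show "\<forall>K\<in>P1. \<forall>u\<in>K. \<forall>v\<in>K. R u v" using rel1[OF R(1-3)] R(4) by simp
    qed (use 1(1-3,5,6,8) 2 3 in auto)
  next
    case False
    \<comment> \<open>Points of the two old classes are joined through the ends of the new edge, so
      the two old bounds and the length of the edge add up to a bound for the union. The number of
      classes drops by one, which pays for that length in the estimate with
      \<open>b\<close>.\<close>
    define P2 where "P2 = insert (K1 \<union> K2) (P1 - {K1, K2})"
    define w2 where "w2 K = (if K = K1 \<union> K2 then w1 K1 + w1 K2 + \<omega> a else w1 K)" for K
    have ne: "K1 \<union> K2 \<notin> P1 - {K1, K2}"
    proof
      assume "K1 \<union> K2 \<in> P1 - {K1, K2}"
      then have "(K1 \<union> K2) \<inter> K1 = {}" using disj K1 by blast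
      then show False using K1 by auto
    qed
    have UP: "\<Union>P1 = U" "{} \<notin> P1" using 1(1) unfolding partition_on_def by auto
    have part: "partition_on U P2"
    proof (rule partition_onI)
      have "\<Union>P2 = \<Union>P1" using K1 K2 unfolding P2_def by auto
      then show "\<Union>P2 = U" using UP by simp
      show "{} \<notin> P2" using UP(2) K1 unfolding P2_def by auto
      show "disjnt A B" if "A \<in> P2" "B \<in> P2" "A \<noteq> B" for A B
      proof -
        have *: "disjnt A' (K1 \<union> K2)" if "A' \<in> P1 - {K1, K2}" for A'
          using that disj[of A' K1] disj[of A' K2] K1 K2 unfolding disjnt_def by auto
        have **: "disjnt A' B'" if "A' \<in> P1 - {K1, K2}" "B' \<in> P1 - {K1, K2}" "A' \<noteq> B'" for A' B'
          using that disj[of A' B'] unfolding disjnt_def by auto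
        show ?thesis using that * ** unfolding P2_def by (metis disjnt_sym insert_iff)
      qed
    qed
    have c: "card P2 + 1 = card P1"
    proof -
      have "card P2 = Suc (card (P1 - {K1, K2}))"
        unfolding P2_def using finP1 ne by simp
      also have "card (P1 - {K1, K2}) = card P1 - 2"
        using K1 K2 False by (simp add: card_Diff_subset)
      moreover have "card {K1, K2} \<le> card P1" using K1 K2 finP1 by (intro card_mono) auto
      ultimately show ?thesis using False by simp
    qed
    have s: "sum w2 P2 = sum w1 P1 + \<omega> a"
    proof -
      have "sum w2 P2 = w2 (K1 \<union> K2) + sum w2 (P1 - {K1, K2})"
        unfolding P2_def using finP1 ne by simp
      also have "sum w2 (P1 - {K1, K2}) = sum w1 (P1 - {K1, K2})"
        using ne by (intro sum.cong) (auto simp: w2_def)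
      also have "\<dots> = sum w1 P1 - sum w1 {K1, K2}"
        using finP1 K1 K2 by (simp add: sum_diff)
      also have "sum w1 {K1, K2} = w1 K1 + w1 K2" using False by simp
      finally show ?thesis by (simp add: w2_def)
    qed
    have sup: "\<exists>K'\<in>P2. K \<subseteq> K'" if "K \<in> P1" for K
    proof (cases "K = K1 \<or> K = K2")
      case True
      then show ?thesis unfolding P2_def by (intro bexI[of _ "K1 \<union> K2"]) auto
    next
      case False
      then show ?thesis using that unfolding P2_def by (intro bexI[of _ K]) auto
    qed
    have diam: "D u v \<le> w2 K" if K: "K \<in> P2" "u \<in> K" "v \<in> K" for K u v
    proof (cases "K = K1 \<union> K2")
      case False
      then show ?thesis using K 1(3) unfolding P2_def w2_def by auto
    next
      case True
      have w0: "0 \<le> w1 K1" "0 \<le> w1 K2" using 1(2) K1 K2 by auto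
      have x: "D x y \<le> w1 K1 + w1 K2 + \<omega> a" if "x \<in> K1" "y \<in> K2" for x y
      proof -
        have U: "x \<in> U" "y \<in> U" using that KU K1 K2 by auto
        have "D x y \<le> D x (p a) + D (p a) y" using tri U a by blast
        also have "\<dots> \<le> D x (p a) + (D (p a) (q a) + D (q a) y)" using tri U a by auto
        also have "\<dots> \<le> w1 K1 + (\<omega> a + w1 K2)" using 1(3) K1 K2 that a by (intro add_mono) auto
        finally show ?thesis by simp
      qed
      have "D u v \<le> w1 K1 + w1 K2 + \<omega> a"
      proof -
        consider "u \<in> K1" "v \<in> K1" | "u \<in> K2" "v \<in> K2" | "u \<in> K1" "v \<in> K2" | "u \<in> K2" "v \<in> K1"
          using K True by auto
        then show ?thesis
        proof cases
          case 1 then show ?thesis using \<open>\<And>K u v. K \<in> P1 \<Longrightarrow> u\<in>K \<Longrightarrow> v\<in>K \<Longrightarrow> D u v \<le> w1 K\<close>[of K1 u v] K1 w0 a by auto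
        next
          case 2 then show ?thesis using \<open>\<And>K u v. K \<in> P1 \<Longrightarrow> u\<in>K \<Longrightarrow> v\<in>K \<Longrightarrow> D u v \<le> w1 K\<close>[of K2 u v] K2 w0 a by auto
        next
          case 3 then show ?thesis using x by auto
        next
          case 4 then show ?thesis using x[of v u] sym[of u v] KU[OF K1(1)] KU[OF K2(1)] by (auto simp: subset_iff)
        qed
      qed
      then show ?thesis by (simp add: w2_def True)
    qed
    \<comment> \<open>The clause about \<open>R\<close> expresses that nothing but the given edges
      holds a class together: whatever symmetric and transitive relation contains the initial
      classes and the edges also contains the final classes.\<close>
    have rel: "R u v" if R: "\<forall>x y. R x y \<longrightarrow> R y x" "\<forall>x y z. R x y \<longrightarrow> R y z \<longrightarrow> R x z"
      "\<forall>K\<in>P. \<forall>u\<in>K. \<forall>v\<in>K. R u v" "\<forall>e\<in>insert a S. R (p e) (q e)" and K: "K \<in> P2" "u \<in> K" "v \<in> K" for R K u v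
    proof -
      have i: "\<And>K u v. K\<in>P1 \<Longrightarrow> u\<in>K \<Longrightarrow> v\<in>K \<Longrightarrow> R u v" using rel1[OF R(1-3)] R(4) by simp
      have pa: "R (p a) (q a)" using R(4) by simp
      have x: "R x (q a)" if "x \<in> K1 \<union> K2" for x
      proof (cases "x \<in> K1")
        case True
        then have "R x (p a)" using i[OF K1(1) True K1(2)] by simp
        then show ?thesis using R(2)[rule_format, OF _ pa] by blast
      next
        case False
        then show ?thesis using that i[OF K2(1) _ K2(2)] by blast
      qed
      show ?thesis
      proof (cases "K = K1 \<union> K2")
        case True
        have u: "R u (q a)" and v: "R v (q a)" by (rule x, use K True in blast)+
        show ?thesis using R(2)[rule_format, OF u R(1)[rule_format, OF v]] .
      next
        case False
        then have "K \<in> P1" using K(1) unfolding P2_def by blast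
        then show ?thesis using i K(2,3) by blast
      qed
    qed
    show ?thesis
    proof (rule exI[of _ P2], rule exI[of _ w2], intro conjI)
      show "partition_on U P2" by fact
      show "\<forall>K\<in>P2. 0 \<le> w2 K \<and> (\<forall>u\<in>K. \<forall>v\<in>K. D u v \<le> w2 K)"
      proof
        fix K assume K: "K \<in> P2"
        have "0 \<le> w2 K" using K 1(2) K1(1) K2(1) a(3) unfolding P2_def w2_def by auto
        then show "0 \<le> w2 K \<and> (\<forall>u\<in>K. \<forall>v\<in>K. D u v \<le> w2 K)" using diam[OF K] by simp
      qed
      show "\<forall>e\<in>insert a S. \<exists>K\<in>P2. p e \<in> K \<and> q e \<in> K"
      proof
        fix e assume "e \<in> insert a S"
        then consider "e = a" | "e \<in> S" by auto
        then show "\<exists>K\<in>P2. p e \<in> K \<and> q e \<in> K"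
        proof cases
          case 1 then show ?thesis using K1 K2 unfolding P2_def by auto
        next
          case 2 
          then obtain K where "K \<in> P1" "p e \<in> K" "q e \<in> K" using 1(4) by meson
          with sup[of K] show ?thesis by auto
        qed
      qed
      show "\<forall>K\<in>P. \<exists>K'\<in>P2. K \<subseteq> K'"
      proof
        fix K assume "K \<in> P"
        then obtain K' where "K' \<in> P1" "K \<subseteq> K'" using 1(5) by meson
        with sup[of K'] show "\<exists>K'\<in>P2. K \<subseteq> K'" by (meson order_trans)
      qed
      show "card P2 \<le> card P" using c 1(6) by linarith
      show "sum w2 P2 \<le> sum w P + sum \<omega> (insert a S)"
        using s 1(7) insert.hyps by simp
      have "b * (real (card P) - real (card P2)) = b * (real (card P) - real (card P1)) + b"
        using c[symmetric] by (simp add: algebra_simps)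
      then show "sum w2 P2 \<le> sum w P + b * (real (card P) - real (card P2))"
        using s 1(8) a(5) by linarith
      show "\<forall>R. (\<forall>x y. R x y \<longrightarrow> R y x) \<longrightarrow> (\<forall>x y z. R x y \<longrightarrow> R y z \<longrightarrow> R x z) \<longrightarrow>
        (\<forall>K\<in>P. \<forall>u\<in>K. \<forall>v\<in>K. R u v) \<longrightarrow> (\<forall>e\<in>insert a S. R (p e) (q e)) \<longrightarrow> (\<forall>K\<in>P2. \<forall>u\<in>K. \<forall>v\<in>K. R u v)"
        by (intro allI impI ballI) (rule rel)
    qed
  qed
qed

section \<open>Chains with free jumps\<close>

text \<open>Only moves add to the length. Jumps are free and merely recorded, so that they can be
  priced later, when it is known which of them belong together.\<close>

inductive jump_chain :: "('a \<Rightarrow> 'a \<Rightarrow> real) \<Rightarrow> 'a set \<Rightarrow> 'a \<Rightarrow> 'a \<Rightarrow> real \<Rightarrow> ('a \<times> 'a) list \<Rightarrow> bool"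
  for d :: "'a \<Rightarrow> 'a \<Rightarrow> real" and M :: "'a set" and x :: 'a where
  start: "x \<in> M \<Longrightarrow> jump_chain d M x x 0 []"
| move: "jump_chain d M x z L js \<Longrightarrow> w \<in> M \<Longrightarrow> d z w \<le> l \<Longrightarrow> jump_chain d M x w (L + l) js"
| jump: "jump_chain d M x z L js \<Longrightarrow> w \<in> M \<Longrightarrow> jump_chain d M x w L (js @ [(z, w)])"

text \<open>Jumps with the same label are traversed only once: from the start of the first one the chain
  is shortcut to the end of the last one.\<close>

lemma (in Metric_space) jump_chain_dist_le:
  assumes "jump_chain d M x z L js"
    and c: "\<And>a b a' b'. (a, b) \<in> set js \<Longrightarrow> (a', b') \<in> set js \<Longrightarrow> lab (a, b) = lab (a', b') \<Longrightarrow> d a b' \<le> c (lab (a, b))"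
    and c0: "\<And>k. 0 \<le> c k"
  shows "d x z \<le> L + sum c (lab ` set js)"
proof -
  have c': "\<forall>j\<in>set js. \<forall>j'\<in>set js. lab j = lab j' \<longrightarrow> d (fst j) (snd j') \<le> c (lab j)" using c by fastforce
  \<comment> \<open>For the shortcut at a repeated label the induction remembers, for every label
    used so far, the start of a jump with this label, at a distance from \<open>x\<close> that does
    not yet include the price of the label.\<close>
  have "x \<in> M \<and> z \<in> M \<and> d x z \<le> L + sum c (lab ` set js) \<and>
    (\<forall>k \<in> lab ` set js. \<exists>a b. (a, b) \<in> set js \<and> a \<in> M \<and> lab (a, b) = k \<and> d x a \<le> L + sum c (lab ` set js - {k}))"
    using assms(1) c'
  proof (induction rule: jump_chain.induct)
    case start
    then show ?case by simp
  next
    case (move z L js w l)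
    note I = move.IH[OF move.prems]
    have IH: "x \<in> M" "z \<in> M" "d x z \<le> L + sum c (lab ` set js)"
      "\<And>k. k \<in> lab ` set js \<Longrightarrow> \<exists>a b. (a, b) \<in> set js \<and> a \<in> M \<and> lab (a, b) = k \<and> d x a \<le> L + sum c (lab ` set js - {k})"
      using I[THEN conjunct1] I[THEN conjunct2, THEN conjunct1] I[THEN conjunct2, THEN conjunct2, THEN conjunct1]
        I[THEN conjunct2, THEN conjunct2, THEN conjunct2, THEN bspec] .
    have l: "0 \<le> l" using nonneg[of z w] move by linarith
    have "d x w \<le> d x z + d z w" using triangle IH(1,2) move by blast
    moreover have "\<exists>a b. (a, b) \<in> set js \<and> a \<in> M \<and> lab (a, b) = k \<and> d x a \<le> L + l + sum c (lab ` set js - {k})"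
      if "k \<in> lab ` set js" for k
      using IH(4)[OF that] l by fastforce
    ultimately show ?case using IH move by auto
  next
    case (jump z L js w)
    have "\<forall>j\<in>set js. \<forall>j'\<in>set js. lab j = lab j' \<longrightarrow> d (fst j) (snd j') \<le> c (lab j)" using jump.prems by simp
    note I = jump.IH[OF this]
    have IH: "x \<in> M" "z \<in> M" "d x z \<le> L + sum c (lab ` set js)"
      "\<And>k. k \<in> lab ` set js \<Longrightarrow> \<exists>a b. (a, b) \<in> set js \<and> a \<in> M \<and> lab (a, b) = k \<and> d x a \<le> L + sum c (lab ` set js - {k})"
      using I[THEN conjunct1] I[THEN conjunct2, THEN conjunct1] I[THEN conjunct2, THEN conjunct2, THEN conjunct1]
        I[THEN conjunct2, THEN conjunct2, THEN conjunct2, THEN bspec] .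
    let ?j = "(z, w)" and ?k = "lab (z, w)"
    show ?case
    proof (cases "?k \<in> lab ` set js")
      case True
      then obtain a b where ab: "(a, b) \<in> set js" "a \<in> M" "lab (a, b) = ?k" "d x a \<le> L + sum c (lab ` set js - {?k})"
        using IH(4) by blast
      have eq: "lab ` set (js @ [?j]) = lab ` set js" using True by auto
      have "d x w \<le> d x a + d a w" using triangle IH(1) ab jump by blast
      also have "d a w \<le> c ?k" using jump.prems ab by fastforce
      finally have "d x w \<le> L + (c ?k + sum c (lab ` set js - {?k}))" using ab by simp
      also have "c ?k + sum c (lab ` set js - {?k}) = sum c (lab ` set js)"
        using True by (simp add: sum.remove)
      finally have "d x w \<le> L + sum c (lab ` set js)" .
      moreover have "\<exists>a b. (a, b) \<in> set (js @ [?j]) \<and> a \<in> M \<and> lab (a, b) = k \<and> d x a \<le> L + sum c (lab ` set js - {k})"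
        if "k \<in> lab ` set js" for k
        using IH(4)[OF that] by auto
      ultimately show ?thesis unfolding eq using IH jump by auto
    next
      case False
      have eq: "lab ` set (js @ [?j]) = insert ?k (lab ` set js)" by auto
      have "d x w \<le> d x z + d z w" using triangle IH(1,2) jump by blast
      moreover have "d z w \<le> c ?k" using jump.prems by simp
      ultimately have "d x w \<le> L + sum c (lab ` set (js @ [?j]))"
        unfolding eq using False IH(3) by simp
      moreover have "\<exists>a b. (a, b) \<in> set (js @ [?j]) \<and> a \<in> M \<and> lab (a, b) = k \<and> d x a \<le> L + sum c (lab ` set (js @ [?j]) - {k})"
        if k: "k \<in> lab ` set (js @ [?j])" for k
      proof (cases "k = ?k")
        case True
        have "insert ?k (lab ` set js) - {k} = lab ` set js" using True False by auto
        then show ?thesis unfolding eq using True IH by auto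
      next
        case ne: False
        then have "k \<in> lab ` set js" using k by auto
        then obtain a b where "(a, b) \<in> set js" "a \<in> M" "lab (a, b) = k" "d x a \<le> L + sum c (lab ` set js - {k})"
          using IH(4) by blast
        moreover have "sum c (lab ` set js - {k}) \<le> sum c (insert ?k (lab ` set js) - {k})"
          by (rule sum_mono2) (use c0 in auto)
        ultimately show ?thesis unfolding eq by fastforce
      qed
      ultimately show ?thesis using IH jump by auto
    qed
  qed
  then show ?thesis by blast
qed

section \<open>Monotone arcs in finite graphs\<close>

text \<open>The parameter interval belongs to the arc, so that an arc can be parametrized by the
  level itself, and can be split and joined without rescaling.\<close>

datatype 'b arc = Arc (arc_lo: real) (arc_hi: real) (arc_fun: "real \<Rightarrow> 'b")

definition closed_arc :: "'b arc \<Rightarrow> 'b set" where "closed_arc a = arc_fun a ` {arc_lo a..arc_hi a}"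
definition open_arc :: "'b arc \<Rightarrow> 'b set" where "open_arc a = arc_fun a ` {arc_lo a<..<arc_hi a}"

definition arc_system :: "'b topology \<Rightarrow> 'b set \<Rightarrow> 'b arc set \<Rightarrow> bool" where
  "arc_system T W A \<longleftrightarrow> finite W \<and> finite A \<and> W \<subseteq> topspace T \<and>
     (\<forall>a\<in>A. arc_lo a < arc_hi a \<and> continuous_map (top_of_set {arc_lo a..arc_hi a}) T (arc_fun a) \<and>
        arc_fun a (arc_lo a) \<in> W \<and> arc_fun a (arc_hi a) \<in> W \<and>
        inj_on (arc_fun a) {arc_lo a<..<arc_hi a} \<and> open_arc a \<inter> W = {}) \<and>
     (\<forall>a\<in>A. \<forall>b\<in>A. a \<noteq> b \<longrightarrow> open_arc a \<inter> open_arc b = {}) \<and>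
     topspace T = W \<union> (\<Union>a\<in>A. closed_arc a)"

lemma arc_systemD:
  assumes "arc_system T W A"
  shows "finite W" "finite A" "W \<subseteq> topspace T" "topspace T = W \<union> (\<Union>a\<in>A. closed_arc a)"
    and "\<And>a. a \<in> A \<Longrightarrow> arc_lo a < arc_hi a"
    and "\<And>a. a \<in> A \<Longrightarrow> continuous_map (top_of_set {arc_lo a..arc_hi a}) T (arc_fun a)"
    and "\<And>a. a \<in> A \<Longrightarrow> arc_fun a (arc_lo a) \<in> W"
    and "\<And>a. a \<in> A \<Longrightarrow> arc_fun a (arc_hi a) \<in> W"
    and "\<And>a. a \<in> A \<Longrightarrow> inj_on (arc_fun a) {arc_lo a<..<arc_hi a}"
    and "\<And>a. a \<in> A \<Longrightarrow> open_arc a \<inter> W = {}"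
    and "\<And>a b. a \<in> A \<Longrightarrow> b \<in> A \<Longrightarrow> a \<noteq> b \<Longrightarrow> open_arc a \<inter> open_arc b = {}"
  using assms unfolding arc_system_def by auto

lemma closed_arc_eq: "arc_lo a \<le> arc_hi a \<Longrightarrow> closed_arc a = {arc_fun a (arc_lo a), arc_fun a (arc_hi a)} \<union> open_arc a"
proof -
  assume "arc_lo a \<le> arc_hi a"
  then have "{arc_lo a..arc_hi a} = {arc_lo a, arc_hi a} \<union> {arc_lo a<..<arc_hi a}" by auto
  then show ?thesis unfolding closed_arc_def open_arc_def by auto
qed

lemma arc_system_cases:
  assumes "arc_system T W A" "p \<in> topspace T" "p \<notin> W"
  obtains a where "a \<in> A" "p \<in> open_arc a"
proof -
  obtain a where "a \<in> A" "p \<in> closed_arc a" using arc_systemD(4)[OF assms(1)] assms(2,3) by auto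
  then show ?thesis using that[of a] closed_arc_eq[of a] arc_systemD(5,7,8)[OF assms(1), of a] assms(3) by auto
qed

lemma compactin_subarc:
  assumes "arc_system T W A" "a \<in> A" "arc_lo a \<le> l" "u \<le> arc_hi a"
  shows "compactin T (arc_fun a ` {l..u})"
proof -
  have "compactin (top_of_set {arc_lo a..arc_hi a}) {l..u}"
    using assms(3,4) by (auto simp: compactin_subtopology)
  then show ?thesis using image_compactin arc_systemD(6)[OF assms(1,2)] by blast
qed

lemma closedin_subarc:
  assumes "Hausdorff_space T" "arc_system T W A" "a \<in> A" "arc_lo a \<le> l" "u \<le> arc_hi a"
  shows "closedin T (arc_fun a ` {l..u})"
  using compactin_subarc[OF assms(2-5)] assms(1) by (simp add: compactin_imp_closedin)

lemma closedin_closed_arc: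
  assumes "Hausdorff_space T" "arc_system T W A" "a \<in> A"
  shows "closedin T (closed_arc a)"
  unfolding closed_arc_def using closedin_subarc[OF assms] by simp

text \<open>Vertices are pieces of their own because an isolated vertex lies on no arc.\<close>

definition arc_pieces :: "'b set \<Rightarrow> 'b arc set \<Rightarrow> 'b set set" where
  "arc_pieces W A = closed_arc ` A \<union> (\<lambda>w. {w}) ` W"

lemma arc_pieces:
  assumes "Hausdorff_space T" "arc_system T W A"
  shows "finite (arc_pieces W A)" "\<And>Q. Q \<in> arc_pieces W A \<Longrightarrow> closedin T Q" "topspace T \<subseteq> \<Union>(arc_pieces W A)"
proof -
  show "finite (arc_pieces W A)" unfolding arc_pieces_def using arc_systemD(1,2)[OF assms(2)] by auto
  show "closedin T Q" if Q: "Q \<in> arc_pieces W A" for Q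
  proof (cases "Q \<in> closed_arc ` A")
    case True
    then show ?thesis using closedin_closed_arc[OF assms] by auto
  next
    case False
    then obtain w where "Q = {w}" "w \<in> W" using Q unfolding arc_pieces_def by auto
    then show ?thesis using assms(1) arc_systemD(3)[OF assms(2)] by (auto intro: closedin_Hausdorff_singleton)
  qed
  show "topspace T \<subseteq> \<Union>(arc_pieces W A)" unfolding arc_pieces_def using arc_systemD(4)[OF assms(2)] by auto
qed

lemma split_arc:
  assumes S: "arc_system T W A" and a: "a \<in> A" and t: "arc_lo a < t" "t < arc_hi a"
    and b: "b = Arc (arc_lo a) t (arc_fun a)" and c: "c = Arc t (arc_hi a) (arc_fun a)"
  shows "arc_system T (insert (arc_fun a t) W) (A - {a} \<union> {b, c})" "card (A - {a} \<union> {b, c}) = card A + 1"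
    "b \<notin> A" "c \<notin> A" "b \<noteq> c"
proof -
  let ?l = "arc_lo a" and ?u = "arc_hi a" and ?s = "arc_fun a"
  note D = arc_systemD[OF S]
  have ob: "open_arc b \<subseteq> open_arc a" and oc: "open_arc c \<subseteq> open_arc a"
    using t unfolding open_arc_def b c by auto
  have neb: "open_arc b \<noteq> {}" "open_arc c \<noteq> {}" using t unfolding open_arc_def b c by auto
  have dis: "open_arc b \<inter> open_arc c = {}"
    using D(9)[OF a] t unfolding open_arc_def b c inj_on_def by fastforce
  have pb: "?s t \<notin> open_arc b" "?s t \<notin> open_arc c" and pa: "?s t \<in> open_arc a"
    using D(9)[OF a] t unfolding open_arc_def b c inj_on_def by fastforce+
  have other: "?s t \<notin> open_arc e" if "e \<in> A" "e \<noteq> a" for e using D(11)[OF that(1) a that(2)] pa by blast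
  have bA: "b \<notin> A" 
  proof
    assume "b \<in> A"
    moreover have "b \<noteq> a" using t unfolding b by (metis arc.sel(2) less_irrefl)
    ultimately show False using D(11)[OF _ a] ob neb by blast
  qed
  have cA: "c \<notin> A" 
  proof
    assume "c \<in> A"
    moreover have "c \<noteq> a" using t unfolding c by (metis arc.sel(1) less_irrefl)
    ultimately show False using D(11)[OF _ a] oc neb by blast
  qed
  show "b \<notin> A" "c \<notin> A" by fact+
  show bc: "b \<noteq> c" unfolding b c using t by auto
  have "card (A - {a} \<union> {b, c}) = card (A - {a}) + card {b, c}"
    using D(2) bA cA by (intro card_Un_disjoint) auto
  then show "card (A - {a} \<union> {b, c}) = card A + 1"
    using bc a D(2) by (simp add: card_gt_0_iff) (metis One_nat_def Suc_pred card_gt_0_iff empty_iff)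
  have cont: "continuous_map (top_of_set {l..u}) T ?s" if "?l \<le> l" "u \<le> ?u" for l u
    using D(6)[OF a] that continuous_map_from_subtopology_mono[of "euclideanreal" "{?l..?u}" T ?s "{l..u}"] by auto
  have ca: "closed_arc a = closed_arc b \<union> closed_arc c"
  proof -
    have "{?l..?u} = {?l..t} \<union> {t..?u}" using t by auto
    then show ?thesis unfolding closed_arc_def b c by (auto simp: image_Un)
  qed
  have "?s t \<in> closed_arc a" using t unfolding closed_arc_def by auto
  then have pT: "?s t \<in> topspace T" using D(4) a by blast
  show "arc_system T (insert (?s t) W) (A - {a} \<union> {b, c})"
    unfolding arc_system_def
  proof (intro conjI)
    show "finite (insert (?s t) W)" "finite (A - {a} \<union> {b, c})" "insert (?s t) W \<subseteq> topspace T"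
      using D(1-3) pT by auto
    show "\<forall>e\<in>A - {a} \<union> {b, c}. arc_lo e < arc_hi e \<and> continuous_map (top_of_set {arc_lo e..arc_hi e}) T (arc_fun e) \<and>
        arc_fun e (arc_lo e) \<in> insert (?s t) W \<and> arc_fun e (arc_hi e) \<in> insert (?s t) W \<and>
        inj_on (arc_fun e) {arc_lo e<..<arc_hi e} \<and> open_arc e \<inter> insert (?s t) W = {}"
    proof
      fix e assume "e \<in> A - {a} \<union> {b, c}"
      then consider "e \<in> A" "e \<noteq> a" | "e = b" | "e = c" by auto
      then show "arc_lo e < arc_hi e \<and> continuous_map (top_of_set {arc_lo e..arc_hi e}) T (arc_fun e) \<and>
        arc_fun e (arc_lo e) \<in> insert (?s t) W \<and> arc_fun e (arc_hi e) \<in> insert (?s t) W \<and>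
        inj_on (arc_fun e) {arc_lo e<..<arc_hi e} \<and> open_arc e \<inter> insert (?s t) W = {}"
      proof cases
        case 1
        then show ?thesis using D(5-10)[OF 1(1)] other[OF 1] by auto
      next
        case 2
        have "inj_on ?s {?l<..<t}" using D(9)[OF a] t by (auto intro: inj_on_subset)
        moreover have "open_arc b \<inter> W = {}" using ob D(10)[OF a] by blast
        ultimately show ?thesis using t cont[of ?l t] D(7)[OF a] pb unfolding 2 by (simp add: b)
      next
        case 3
        have "inj_on ?s {t<..<?u}" using D(9)[OF a] t by (auto intro: inj_on_subset)
        moreover have "open_arc c \<inter> W = {}" using oc D(10)[OF a] by blast
        ultimately show ?thesis using t cont[of t ?u] D(8)[OF a] pb unfolding 3 by (simp add: c)
      qed
    qed
    show "\<forall>x\<in>A - {a} \<union> {b, c}. \<forall>y\<in>A - {a} \<union> {b, c}. x \<noteq> y \<longrightarrow> open_arc x \<inter> open_arc y = {}"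
    proof (intro ballI impI)
      fix x y assume x: "x \<in> A - {a} \<union> {b, c}" and y: "y \<in> A - {a} \<union> {b, c}" and ne: "x \<noteq> y"
      have *: "open_arc e \<inter> open_arc b = {}" "open_arc e \<inter> open_arc c = {}" if "e \<in> A - {a}" for e
        using D(11)[of e a] that a ob oc by auto
      show "open_arc x \<inter> open_arc y = {}"
      proof -
        have **: "open_arc b \<inter> open_arc e = {}" "open_arc c \<inter> open_arc e = {}" if "e \<in> A - {a}" for e
          using *[OF that] by (simp_all add: Int_commute)
        have dis': "open_arc c \<inter> open_arc b = {}" using dis by (simp add: Int_commute)
        consider "x \<in> A - {a}" "y \<in> A - {a}" | "x \<in> A - {a}" "y \<in> {b, c}" | "x \<in> {b, c}" "y \<in> A - {a}" | "x \<in> {b, c}" "y \<in> {b, c}"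
          using x y by blast
        then show ?thesis
        proof cases
          case 1 then show ?thesis using D(11)[of x y] ne by simp
        next
          case 2 then show ?thesis using *[OF 2(1)] by blast
        next
          case 3 then show ?thesis using **[OF 3(2)] by blast
        next
          case 4 then show ?thesis using ne dis dis' by blast
        qed
      qed
    qed
    show "topspace T = insert (?s t) W \<union> (\<Union>e\<in>A - {a} \<union> {b, c}. closed_arc e)"
      using D(4) a pT ca by auto
  qed
qed

text \<open>In a Hausdorff space compact arcs are closed, and the complement of an open subarc is a
  finite union of such arcs and of vertices.\<close>

lemma open_subarc:
  assumes H: "Hausdorff_space T" and S: "arc_system T W A" and a: "a \<in> A" and l: "arc_lo a \<le> l" "u \<le> arc_hi a"
  shows "openin T (arc_fun a ` {l<..<u})"
proof -
  note D = arc_systemD[OF S]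
  let ?s = "arc_fun a"
  show ?thesis
  proof (cases "l < u")
    case False
    then show ?thesis by simp
  next
    case lu: True
  let ?C = "\<Union>(arc_pieces W (A - {a})) \<union> ?s ` {arc_lo a..l} \<union> ?s ` {u..arc_hi a}"
  have cl: "closedin T Q" if "Q \<in> arc_pieces W (A - {a})" for Q
    using arc_pieces(2)[OF H S] that unfolding arc_pieces_def by auto
  have "closedin T (\<Union>(arc_pieces W (A - {a})))"
    by (rule closedin_Union) (use cl D(1,2) in \<open>auto simp: arc_pieces_def\<close>)
  then have "closedin T ?C"
    using closedin_subarc[OF H S a] l lu by (intro closedin_Un) auto
  moreover have "topspace T - ?C = ?s ` {l<..<u}"
  proof
    have sub: "?s ` {l<..<u} \<subseteq> open_arc a" unfolding open_arc_def using l by auto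
    have "x \<notin> ?C" if x: "x \<in> ?s ` {l<..<u}" for x
    proof -
      have xa: "x \<in> open_arc a" "x \<notin> W" using sub x D(10)[OF a] by auto
      have "x \<notin> \<Union>(arc_pieces W (A - {a}))"
      proof
        assume "x \<in> \<Union>(arc_pieces W (A - {a}))"
        then obtain e where "e \<in> A - {a}" "x \<in> closed_arc e" using xa(2) unfolding arc_pieces_def by auto
        then show False using closed_arc_eq[of e] D(5,7,8)[of e] D(11)[of e a] a xa by auto
      qed
      moreover obtain t where t: "x = ?s t" "l < t" "t < u" using x by auto
      \<comment> \<open>Injectivity is given only inside the arc. Its two ends, which may coincide,
        are distinguished from \<open>x\<close> by being vertices.\<close>
      moreover have "x \<noteq> ?s t'" if "t' \<in> {arc_lo a..l} \<union> {u..arc_hi a}" for t'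
      proof (cases "t' = arc_lo a \<or> t' = arc_hi a")
        case True
        then show ?thesis using D(7,8)[OF a] xa(2) by auto
      next
        case False
        then have "t' \<in> {arc_lo a<..<arc_hi a}" "t \<in> {arc_lo a<..<arc_hi a}" "t \<noteq> t'" using that t l lu by auto
        then show ?thesis using inj_onD[OF D(9)[OF a], of t t'] unfolding t(1) by blast
      qed
      then have "x \<notin> ?s ` {arc_lo a..l}" "x \<notin> ?s ` {u..arc_hi a}" by blast+
      ultimately show ?thesis by simp
    qed
    moreover have "?s ` {l<..<u} \<subseteq> topspace T"
    proof -
      have "closed_arc a \<subseteq> topspace T" using D(4) a by blast
      then show ?thesis using sub closed_arc_eq[of a] D(5)[OF a] by (simp add: subset_trans)
    qed
    ultimately show "?s ` {l<..<u} \<subseteq> topspace T - ?C" by (meson DiffI subsetD subsetI)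
    show "topspace T - ?C \<subseteq> ?s ` {l<..<u}"
    proof
      fix x assume x: "x \<in> topspace T - ?C"
      then have "x \<in> closed_arc a" using D(4) unfolding arc_pieces_def by auto
      then obtain t where t: "x = ?s t" "arc_lo a \<le> t" "t \<le> arc_hi a" unfolding closed_arc_def by auto
      have "\<not> t \<le> l" using x t by auto
      moreover have "\<not> u \<le> t" using x t by auto
      ultimately show "x \<in> ?s ` {l<..<u}" using t(1) by auto
    qed
  qed
  ultimately show ?thesis by (metis openin_diff openin_topspace)
  qed
qed

section \<open>Arcs parametrized by a level function\<close>

locale level_space =
  fixes T :: "'b topology" and f :: "'b \<Rightarrow> real"
  assumes Haus: "Hausdorff_space T" and cont_f: "continuous_map T euclideanreal f"
begin

definition monotone_arcs :: "'b set \<Rightarrow> 'b arc set \<Rightarrow> bool" where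
  "monotone_arcs W A \<longleftrightarrow> arc_system T W A \<and> (\<forall>a\<in>A. \<forall>t\<in>{arc_lo a..arc_hi a}. f (arc_fun a t) = t)"

text \<open>An arc is counted at its interior points and at its upper end, but not at its lower end.
  An interior point of an arc has exactly one descending arc, so the count at a point does not
  change when arcs are subdivided.\<close>

definition down_arcs :: "'b arc set \<Rightarrow> 'b \<Rightarrow> 'b arc set" where
  "down_arcs A p = {a \<in> A. p \<in> arc_fun a ` {arc_lo a<..arc_hi a}}"

definition up_arcs :: "'b arc set \<Rightarrow> 'b \<Rightarrow> 'b arc set" where
  "up_arcs A p = {a \<in> A. p \<in> arc_fun a ` {arc_lo a..<arc_hi a}}"

lemma monotone_arcsD:
  assumes "monotone_arcs W A"
  shows "arc_system T W A" "\<And>a t. a \<in> A \<Longrightarrow> arc_lo a \<le> t \<Longrightarrow> t \<le> arc_hi a \<Longrightarrow> f (arc_fun a t) = t"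
  using assms unfolding monotone_arcs_def by auto

lemma closed_arcD:
  assumes "monotone_arcs W A" "a \<in> A" "p \<in> closed_arc a"
  shows "arc_fun a (f p) = p" "arc_lo a \<le> f p" "f p \<le> arc_hi a"
  using assms(3) monotone_arcsD(2)[OF assms(1,2)] unfolding closed_arc_def by auto

lemma down_arcs_iff:
  assumes "monotone_arcs W A"
  shows "a \<in> down_arcs A p \<longleftrightarrow> a \<in> A \<and> p \<in> closed_arc a \<and> arc_lo a < f p"
proof
  assume "a \<in> down_arcs A p"
  then obtain t where t: "a \<in> A" "p = arc_fun a t" "arc_lo a < t" "t \<le> arc_hi a" unfolding down_arcs_def by auto
  then have "f p = t" using monotone_arcsD(2)[OF assms] by auto
  then show "a \<in> A \<and> p \<in> closed_arc a \<and> arc_lo a < f p" using t unfolding closed_arc_def by auto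
next
  assume R: "a \<in> A \<and> p \<in> closed_arc a \<and> arc_lo a < f p"
  then have "p = arc_fun a (f p)" "f p \<in> {arc_lo a<..arc_hi a}" using closed_arcD[OF assms, of a p] by auto
  then show "a \<in> down_arcs A p" unfolding down_arcs_def using R by blast
qed

lemma up_arcs_iff:
  assumes "monotone_arcs W A"
  shows "a \<in> up_arcs A p \<longleftrightarrow> a \<in> A \<and> p \<in> closed_arc a \<and> f p < arc_hi a"
proof
  assume "a \<in> up_arcs A p"
  then obtain t where t: "a \<in> A" "p = arc_fun a t" "arc_lo a \<le> t" "t < arc_hi a" unfolding up_arcs_def by auto
  then have "f p = t" using monotone_arcsD(2)[OF assms] by auto
  then show "a \<in> A \<and> p \<in> closed_arc a \<and> f p < arc_hi a" using t unfolding closed_arc_def by auto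
next
  assume R: "a \<in> A \<and> p \<in> closed_arc a \<and> f p < arc_hi a"
  then have "p = arc_fun a (f p)" "f p \<in> {arc_lo a..<arc_hi a}" using closed_arcD[OF assms, of a p] by auto
  then show "a \<in> up_arcs A p" unfolding up_arcs_def using R by blast
qed

lemma closed_arcs_meet:
  assumes M: "monotone_arcs W A" and "a \<in> A" "b \<in> A" "a \<noteq> b" "p \<in> closed_arc a" "p \<in> closed_arc b"
  shows "p \<in> W" "f p = arc_lo a \<or> f p = arc_hi a"
proof -
  note D = arc_systemD[OF monotone_arcsD(1)[OF M]]
  have pW: "p \<in> W"
    using assms D(11)[of a b] D(5,7,8)[of a] D(5,7,8)[of b] closed_arc_eq[of a] closed_arc_eq[of b] by auto
  then show "p \<in> W" .
  have "p \<notin> open_arc a" using pW D(10)[of a] assms by auto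
  then have "p = arc_fun a (arc_lo a) \<or> p = arc_fun a (arc_hi a)"
    using assms(2,5) closed_arc_eq[of a] D(5)[of a] by auto
  then show "f p = arc_lo a \<or> f p = arc_hi a"
    using monotone_arcsD(2)[OF M assms(2), of "arc_lo a"] monotone_arcsD(2)[OF M assms(2), of "arc_hi a"] D(5)[OF assms(2)] by auto
qed

lemma vertex_in_closed_arc:
  assumes M: "monotone_arcs W A" and "a \<in> A" "p \<in> closed_arc a" "p \<in> W"
  shows "f p = arc_lo a \<or> f p = arc_hi a"
proof -
  note D = arc_systemD[OF monotone_arcsD(1)[OF M]]
  have "p \<notin> open_arc a" using assms D(10)[of a] by auto
  then have "p = arc_fun a (arc_lo a) \<or> p = arc_fun a (arc_hi a)"
    using assms(2,3) closed_arc_eq[of a] D(5)[of a] by auto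
  then show "f p = arc_lo a \<or> f p = arc_hi a"
    using monotone_arcsD(2)[OF M assms(2), of "arc_lo a"] monotone_arcsD(2)[OF M assms(2), of "arc_hi a"] D(5)[OF assms(2)] by auto
qed

lemma nearby_in_common_arc:
  assumes M: "monotone_arcs W A" and p: "p \<in> topspace T"
  obtains N where "openin T N" "p \<in> N"
    "\<And>q. q \<in> N \<Longrightarrow> q = p \<or> (\<exists>a\<in>A. p \<in> closed_arc a \<and> q \<in> closed_arc a)"
proof -
  note S = monotone_arcsD(1)[OF M]
  note P = arc_pieces[OF Haus S]
  let ?N = "topspace T - \<Union>{Q \<in> arc_pieces W A. p \<notin> Q}"
  have "closedin T (\<Union>{Q \<in> arc_pieces W A. p \<notin> Q})"
    by (rule closedin_Union) (use P in auto)
  then have "openin T ?N" by blast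
  moreover have "p \<in> ?N" using p by auto
  moreover have "q = p \<or> (\<exists>a\<in>A. p \<in> closed_arc a \<and> q \<in> closed_arc a)" if "q \<in> ?N" for q
  proof -
    obtain Q where "Q \<in> arc_pieces W A" "q \<in> Q" using P(3) \<open>q \<in> ?N\<close> by auto
    moreover then have "p \<in> Q" using \<open>q \<in> ?N\<close> by auto
    ultimately show ?thesis unfolding arc_pieces_def by auto
  qed
  ultimately show ?thesis using that by blast
qed

definition local_min :: "'b \<Rightarrow> bool" where
  "local_min p \<longleftrightarrow> (\<exists>U. openin T U \<and> p \<in> U \<and> (\<forall>q\<in>U. f p \<le> f q))"

definition local_max :: "'b \<Rightarrow> bool" where
  "local_max p \<longleftrightarrow> (\<exists>U. openin T U \<and> p \<in> U \<and> (\<forall>q\<in>U. f q \<le> f p))"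

lemma down_arcs_nonempty:
  assumes M: "monotone_arcs W A" and p: "p \<in> topspace T" "\<not> local_min p"
  shows "down_arcs A p \<noteq> {}"
proof -
  obtain N where N: "openin T N" "p \<in> N" "\<And>q. q \<in> N \<Longrightarrow> q = p \<or> (\<exists>a\<in>A. p \<in> closed_arc a \<and> q \<in> closed_arc a)"
    using nearby_in_common_arc[OF M p(1)] by metis
  then obtain q where q: "q \<in> N" "f q < f p" using p(2) unfolding local_min_def by (meson not_le)
  then obtain a where a: "a \<in> A" "p \<in> closed_arc a" "q \<in> closed_arc a" using N(3) by fastforce
  then have "arc_lo a < f p" using closed_arcD(2)[OF M a(1,3)] q(2) by simp
  then show ?thesis using a down_arcs_iff[OF M] by blast
qed

lemma up_arcs_nonempty:
  assumes M: "monotone_arcs W A" and p: "p \<in> topspace T" "\<not> local_max p"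
  shows "up_arcs A p \<noteq> {}"
proof -
  obtain N where N: "openin T N" "p \<in> N" "\<And>q. q \<in> N \<Longrightarrow> q = p \<or> (\<exists>a\<in>A. p \<in> closed_arc a \<and> q \<in> closed_arc a)"
    using nearby_in_common_arc[OF M p(1)] by metis
  then obtain q where q: "q \<in> N" "f p < f q" using p(2) unfolding local_max_def by (meson not_le)
  then obtain a where a: "a \<in> A" "p \<in> closed_arc a" "q \<in> closed_arc a" using N(3) by fastforce
  then have "f p < arc_hi a" using closed_arcD(3)[OF M a(1,3)] q(2) by simp
  then show ?thesis using a up_arcs_iff[OF M] by blast
qed

lemma down_arcs_open_arc:
  assumes M: "monotone_arcs W A" and a: "a \<in> A" "p \<in> open_arc a"
  shows "down_arcs A p = {a}" "up_arcs A p = {a}"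
proof -
  note D = arc_systemD[OF monotone_arcsD(1)[OF M]]
  have pW: "p \<notin> W" using D(10)[of a] a by auto
  have pc: "p \<in> closed_arc a" using a closed_arc_eq[of a] D(5)[of a] by auto
  have lu: "arc_lo a < f p" "f p < arc_hi a" using a(2) monotone_arcsD(2)[OF M a(1)] unfolding open_arc_def by auto
  have u: "b = a" if "b \<in> A" "p \<in> closed_arc b" for b using closed_arcs_meet(1)[OF M that(1) a(1) _ that(2) pc] pW by auto
  show "down_arcs A p = {a}" using down_arcs_iff[OF M] u lu pc a by blast
  show "up_arcs A p = {a}" using up_arcs_iff[OF M] u lu pc a by blast
qed

lemma split_monotone:
  assumes M: "monotone_arcs W A" and p: "p \<in> topspace T - W"
  shows "\<exists>A'. monotone_arcs (insert p W) A' \<and> card A' = card A + 1 \<and> (\<forall>q. card (down_arcs A' q) = card (down_arcs A q))"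
proof -
  note S = monotone_arcsD(1)[OF M]
  note D = arc_systemD[OF S]
  obtain a where a: "a \<in> A" "p \<in> open_arc a" using arc_system_cases[OF S] p by blast
  then obtain t where t: "arc_lo a < t" "t < arc_hi a" "p = arc_fun a t" unfolding open_arc_def by auto
  define b where "b = Arc (arc_lo a) t (arc_fun a)"
  define c where "c = Arc t (arc_hi a) (arc_fun a)"
  let ?A = "A - {a} \<union> {b, c}"
  note sp = split_arc[OF S a(1) t(1,2) b_def c_def]
  have M': "monotone_arcs (insert p W) ?A"
    unfolding monotone_arcs_def using sp(1) t monotone_arcsD(2)[OF M] a(1) by (auto simp: b_def c_def)
  have "card (down_arcs ?A q) = card (down_arcs A q)" for q
  proof (cases "a \<in> down_arcs A q")
    case False
    have "b \<notin> down_arcs ?A q" "c \<notin> down_arcs ?A q"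
      using False t a(1) unfolding down_arcs_def b_def c_def by auto
    then have "down_arcs ?A q = down_arcs A q" using False unfolding down_arcs_def by auto
    then show ?thesis by simp
  next
    case True
    then have q: "q \<in> closed_arc a" "arc_lo a < f q" using down_arcs_iff[OF M] by auto
    note qa = closed_arcD[OF M a(1) q(1)]
    define e where "e = (if f q \<le> t then b else c)"
    have ee: "e \<in> down_arcs ?A q" "\<And>e'. e' \<in> {b, c} \<Longrightarrow> e' \<in> down_arcs ?A q \<Longrightarrow> e' = e"
    proof -
      have qb: "b \<in> down_arcs ?A q \<longleftrightarrow> f q \<le> t"
        using down_arcs_iff[OF M', of b q] q qa t(1,2) monotone_arcsD(2)[OF M a(1)] unfolding closed_arc_def
        by (auto simp: b_def)
      have qc: "c \<in> down_arcs ?A q \<longleftrightarrow> t < f q"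
        using down_arcs_iff[OF M', of c q] q qa t(1,2) monotone_arcsD(2)[OF M a(1)] unfolding closed_arc_def
        by (auto simp: c_def)
      show "e \<in> down_arcs ?A q" using qb qc unfolding e_def by auto
      show "e' = e" if "e' \<in> {b, c}" "e' \<in> down_arcs ?A q" for e' using that qb qc unfolding e_def by auto
    qed
    have "down_arcs ?A q = insert e (down_arcs A q - {a})"
      using ee unfolding down_arcs_def by auto
    moreover have "e \<notin> down_arcs A q" using sp(3,4) unfolding e_def down_arcs_def by auto
    moreover have "finite (down_arcs A q)" using D(2) unfolding down_arcs_def by auto
    ultimately show ?thesis using card_Suc_Diff1[of "down_arcs A q" a] True by simp
  qed
  then show ?thesis using M' sp(2) by blast
qed

lemma split_monotone_finite:
  assumes "finite F" and M: "monotone_arcs W A" and "F \<subseteq> topspace T - W"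
  shows "\<exists>A'. monotone_arcs (F \<union> W) A' \<and> card A' = card A + card F \<and> (\<forall>q. card (down_arcs A' q) = card (down_arcs A q))"
  using assms(1,3)
proof (induction F rule: finite_induct)
  case empty
  then show ?case using M by auto
next
  case (insert x F)
  then obtain A' where A': "monotone_arcs (F \<union> W) A'" "card A' = card A + card F" "\<forall>q. card (down_arcs A' q) = card (down_arcs A q)"
    by auto
  have "x \<in> topspace T - (F \<union> W)" using insert by auto
  from split_monotone[OF A'(1) this] obtain A'' where
    "monotone_arcs (insert x (F \<union> W)) A''" "card A'' = card A' + 1" "\<forall>q. card (down_arcs A'' q) = card (down_arcs A' q)" by blast
  then show ?case using A' insert.hyps by (intro exI[of _ A'']) auto
qed

text \<open>Among the vertices an arc descends only from its upper end, so the sum over the vertices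
  meets every arc exactly once.\<close>

lemma sum_card_down_arcs:
  assumes M: "monotone_arcs W A"
  shows "(\<Sum>v\<in>W. card (down_arcs A v)) = card A"
proof -
  note D = arc_systemD[OF monotone_arcsD(1)[OF M]]
  have eq: "down_arcs A v = {a\<in>A. arc_fun a (arc_hi a) = v}" if v: "v \<in> W" for v
  proof -
    have "a \<in> down_arcs A v \<longleftrightarrow> a \<in> A \<and> arc_fun a (arc_hi a) = v" for a
    proof
      assume "a \<in> down_arcs A v"
      then have a: "a \<in> A" "v \<in> closed_arc a" "arc_lo a < f v" using down_arcs_iff[OF M] by auto
      then show "a \<in> A \<and> arc_fun a (arc_hi a) = v"
        using vertex_in_closed_arc[OF M a(1,2) v] closed_arcD[OF M a(1,2)] by auto
    next
      assume "a \<in> A \<and> arc_fun a (arc_hi a) = v"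
      then show "a \<in> down_arcs A v" using D(5)[of a] unfolding down_arcs_def by force
    qed
    then show ?thesis by auto
  qed
  have "(\<Sum>v\<in>W. card (down_arcs A v)) = (\<Sum>v\<in>W. card {a\<in>A. arc_fun a (arc_hi a) = v})"
    using eq by simp
  also have "\<dots> = (\<Sum>v\<in>W. \<Sum>a\<in>{a\<in>A. arc_fun a (arc_hi a) = v}. 1)" by simp
  also have "\<dots> = (\<Sum>a\<in>A. 1)"
    using D(1,2,8) by (intro sum.group) auto
  finally show ?thesis by simp
qed

end

context level_space
begin

text \<open>Three arcs at \<open>w\<close> contain connected sets that meet pairwise only in
  \<open>w\<close>, each with a further point. Carried to the real line these become intervals
  through the image of \<open>w\<close>; two of them extend to the same side and overlap
  there.\<close>

lemma at_most_two_arcs: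
  assumes M: "monotone_arcs W A" and w: "w \<in> W" "degree_two T w"
  shows "card {a \<in> A. w \<in> closed_arc a} \<le> 2"
proof (rule ccontr)
  assume "\<not> ?thesis"
  then have "3 \<le> card {a \<in> A. w \<in> closed_arc a}" by simp
  then obtain C where "C \<subseteq> {a \<in> A. w \<in> closed_arc a}" "card C = 3" by (meson obtain_subset_with_card_n)
  then obtain a1 a2 a3 where a: "a1 \<noteq> a2" "a1 \<noteq> a3" "a2 \<noteq> a3" and C': "C = {a1, a2, a3}"
    using card_3_iff[of C] by blast
  have C: "a \<in> A \<and> w \<in> closed_arc a" if "a \<in> {a1, a2, a3}" for a
    using that \<open>C \<subseteq> _\<close> unfolding C' by blast
  obtain U where U: "openin T U" "w \<in> U" "subtopology T U homeomorphic_space euclideanreal"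
    using w(2) unfolding degree_two_def by auto
  then obtain \<phi> where \<phi>: "homeomorphic_map (subtopology T U) euclideanreal \<phi>"
    unfolding homeomorphic_space by blast
  note D = arc_systemD[OF monotone_arcsD(1)[OF M]]
  have c\<phi>: "continuous_map (subtopology T U) euclideanreal \<phi>" using \<phi> homeomorphic_imp_continuous_map by blast
  have UT: "U \<subseteq> topspace T" using U(1) openin_subset by blast
  have inj: "inj_on \<phi> U" using homeomorphic_imp_injective_map[OF \<phi>] UT by (simp add: Int_absorb1)
  have "\<exists>S. S \<subseteq> U \<and> connectedin T S \<and> w \<in> S \<and> S \<subseteq> insert w (open_arc a) \<and> (\<exists>x\<in>S. x \<noteq> w)" if "a \<in> {a1, a2, a3}" for a
  proof -
    let ?s = "arc_fun a"
    have aA: "a \<in> A" "w \<in> closed_arc a" using C that by auto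
    have end_fw: "f w = arc_lo a \<or> f w = arc_hi a" using vertex_in_closed_arc[OF M aA w(1)] .
    have sw: "?s (f w) = w" "arc_lo a \<le> f w" "f w \<le> arc_hi a" using closed_arcD[OF M aA] by auto
    have lu: "arc_lo a < arc_hi a" using D(5) aA by auto
    have "openin (top_of_set {arc_lo a..arc_hi a}) {t \<in> {arc_lo a..arc_hi a}. ?s t \<in> U}"
      using D(6)[OF aA(1)] U(1) unfolding continuous_map_def by auto
    moreover have "f w \<in> {t \<in> {arc_lo a..arc_hi a}. ?s t \<in> U}" using sw U(2) by auto
    ultimately obtain \<delta> where \<delta>: "\<delta> > 0" "\<And>t. t \<in> {arc_lo a..arc_hi a} \<Longrightarrow> dist t (f w) < \<delta> \<Longrightarrow> ?s t \<in> U"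
      unfolding openin_euclidean_subtopology_iff by blast
    define \<eta> where "\<eta> = min (\<delta>/2) ((arc_hi a - arc_lo a)/2)"
    have \<eta>: "0 < \<eta>" "\<eta> < \<delta>" "\<eta> < arc_hi a - arc_lo a" unfolding \<eta>_def using \<delta>(1) lu by (auto simp: min_def field_simps)
    define J where "J = (if f w = arc_lo a then {f w..f w + \<eta>} else {f w - \<eta>..f w})"
    have J: "J \<subseteq> {arc_lo a..arc_hi a}" "\<And>t. t \<in> J \<Longrightarrow> dist t (f w) < \<delta>" "f w \<in> J" "connected J" "\<exists>t\<in>J. t \<noteq> f w"
      unfolding J_def using end_fw \<eta> lu by (auto simp: dist_real_def intro: bexI[of _ "f w + \<eta>"] bexI[of _ "f w - \<eta>"])
    have "connectedin (top_of_set {arc_lo a..arc_hi a}) J"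
      using J(1,4) by (simp add: connectedin_subtopology)
    then have "connectedin T (?s ` J)" using connectedin_continuous_map_image D(6)[OF aA(1)] by blast
    moreover have "?s ` J \<subseteq> U" using J \<delta>(2) by blast
    moreover have "w \<in> ?s ` J" using J(3) sw(1) by force
    moreover have "?s ` J \<subseteq> insert w (open_arc a)"
    proof -
      have "t = f w \<or> t \<in> {arc_lo a<..<arc_hi a}" if "t \<in> J" for t
        using that end_fw \<eta> unfolding J_def by (auto split: if_splits)
      then show ?thesis unfolding open_arc_def using sw(1) by fastforce
    qed
    moreover have "\<exists>x\<in>?s ` J. x \<noteq> w"
    proof -
      obtain t where "t \<in> J" "t \<noteq> f w" using J(5) by auto
      moreover have "f (?s t) = t" using monotone_arcsD(2)[OF M aA(1)] J(1) \<open>t \<in> J\<close> by auto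
      ultimately show ?thesis by (metis imageI)
    qed
    ultimately show ?thesis by blast
  qed
  then obtain S where S: "\<And>a. a \<in> {a1, a2, a3} \<Longrightarrow> S a \<subseteq> U \<and> connectedin T (S a) \<and> w \<in> S a \<and> S a \<subseteq> insert w (open_arc a) \<and> (\<exists>x\<in>S a. x \<noteq> w)"
    by metis
  have meet: "S a \<inter> S b = {w}" if ab: "a \<in> {a1,a2,a3}" "b \<in> {a1,a2,a3}" "a \<noteq> b" for a b
  proof -
    have "open_arc a \<inter> open_arc b = {}" using D(11) C ab by blast
    then have "x = w" if "x \<in> S a" "x \<in> S b" for x using S[OF ab(1)] S[OF ab(2)] that by blast
    then show ?thesis using S[OF ab(1)] S[OF ab(2)] by blast
  qed
  have conn: "connected (\<phi> ` S a)" if "a \<in> {a1,a2,a3}" for a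
  proof -
    have "connectedin (subtopology T U) (S a)" using S[OF that] by (simp add: connectedin_subtopology)
    then show ?thesis using connectedin_continuous_map_image[OF c\<phi>] by fastforce
  qed
  have "\<exists>y\<in>\<phi> ` S a. y \<noteq> \<phi> w" if "a \<in> {a1,a2,a3}" for a
    using S[OF that] inj U(2) unfolding inj_on_def by (metis imageI subsetD)
  then obtain y where y: "\<And>a. a \<in> {a1,a2,a3} \<Longrightarrow> y a \<in> \<phi> ` S a \<and> y a \<noteq> \<phi> w" by metis
  have no: False if ab: "a \<in> {a1,a2,a3}" "b \<in> {a1,a2,a3}" "a \<noteq> b" "(y a < \<phi> w \<and> y b < \<phi> w) \<or> (y a > \<phi> w \<and> y b > \<phi> w)" for a b
  proof -
    \<comment> \<open>Of two points on the same side, the one closer to \<open>\<phi> w\<close> lies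
      in both intervals.\<close>
    define z where "z = (if y a < \<phi> w then max (y a) (y b) else min (y a) (y b))"
    have w: "\<phi> w \<in> \<phi> ` S a" "\<phi> w \<in> \<phi> ` S b" using S[OF ab(1)] S[OF ab(2)] by blast+
    have "z \<noteq> \<phi> w" using ab(4) unfolding z_def by auto
    moreover have "z \<in> \<phi> ` S a"
      using connectedD_interval[OF conn[OF ab(1)] w(1), of "y a" z] connectedD_interval[OF conn[OF ab(1)] _ w(1), of "y a" z] y[OF ab(1)] ab(4)
      unfolding z_def by (auto split: if_splits simp: max_def min_def)
    moreover have "z \<in> \<phi> ` S b"
      using connectedD_interval[OF conn[OF ab(2)] w(2), of "y b" z] connectedD_interval[OF conn[OF ab(2)] _ w(2), of "y b" z] y[OF ab(2)] ab(4)
      unfolding z_def by (auto split: if_splits simp: max_def min_def)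
    ultimately obtain x x' where "x \<in> S a" "x' \<in> S b" "\<phi> x = z" "\<phi> x' = z" by auto
    moreover then have "x = x'" using inj_onD[OF inj, of x x'] S[OF ab(1)] S[OF ab(2)] by auto
    ultimately have "x \<in> S a \<inter> S b" by auto
    then have "x = w" using meet[OF ab(1-3)] by auto
    then show False using \<open>\<phi> x = z\<close> \<open>z \<noteq> \<phi> w\<close> by auto
  qed
  have "y a1 \<noteq> \<phi> w" "y a2 \<noteq> \<phi> w" "y a3 \<noteq> \<phi> w" using y by auto
  then show False using no[of a1 a2] no[of a1 a3] no[of a2 a3] a by (auto simp: neq_iff)
qed

text \<open>Parametrized by level, the lower arc ends at the parameter where the upper one begins,
  so the two concatenate as they are. The result is injective because \<open>f\<close> inverts
  it.\<close>

lemma merge_arcs: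
  assumes M: "monotone_arcs W A" and w: "w \<in> W" and a: "down_arcs A w = {a}" and b: "up_arcs A w = {b}"
  shows "\<exists>A'. monotone_arcs (W - {w}) A' \<and> card A' + 1 = card A"
proof -
  note S = monotone_arcsD(1)[OF M]
  note D = arc_systemD[OF S]
  note F = monotone_arcsD(2)[OF M]
  have aA: "a \<in> A" "w \<in> closed_arc a" "arc_lo a < f w" using down_arcs_iff[OF M, of a w] a by auto
  have bA: "b \<in> A" "w \<in> closed_arc b" "f w < arc_hi b" using up_arcs_iff[OF M, of b w] b by auto
  have ha: "f w = arc_hi a" using vertex_in_closed_arc[OF M aA(1,2) w] aA(3) by auto
  have lb: "f w = arc_lo b" using vertex_in_closed_arc[OF M bA(1,2) w] bA(3) by auto
  have sa: "arc_fun a (f w) = w" and sb: "arc_fun b (f w) = w"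
    using closed_arcD(1)[OF M] aA bA by auto
  have ab: "a \<noteq> b" using ha bA(3) by auto
  define s where "s t = (if t \<le> f w then arc_fun a t else arc_fun b t)" for t
  define c where "c = Arc (arc_lo a) (arc_hi b) s"
  have fs: "f (s t) = t" if "arc_lo a \<le> t" "t \<le> arc_hi b" for t
    using F[OF aA(1), of t] F[OF bA(1), of t] that ha lb unfolding s_def by auto
  have contc: "continuous_map (top_of_set {arc_lo a..arc_hi b}) T s"
    unfolding s_def
  proof (rule continuous_map_cases_le)
    have e: "subtopology (top_of_set {arc_lo a..arc_hi b}) {x \<in> topspace (top_of_set {arc_lo a..arc_hi b}). x \<le> f w} = top_of_set {arc_lo a..arc_hi a}"
      unfolding subtopology_subtopology using ha bA(3) by (intro arg_cong[where f = top_of_set]) auto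
    show "continuous_map (subtopology (top_of_set {arc_lo a..arc_hi b}) {x \<in> topspace (top_of_set {arc_lo a..arc_hi b}). x \<le> f w}) T (arc_fun a)"
      unfolding e using D(6)[OF aA(1)] .
    have e: "subtopology (top_of_set {arc_lo a..arc_hi b}) {x \<in> topspace (top_of_set {arc_lo a..arc_hi b}). f w \<le> x} = top_of_set {arc_lo b..arc_hi b}"
      unfolding subtopology_subtopology using lb aA(3) by (intro arg_cong[where f = top_of_set]) auto
    show "continuous_map (subtopology (top_of_set {arc_lo a..arc_hi b}) {x \<in> topspace (top_of_set {arc_lo a..arc_hi b}). f w \<le> x}) T (arc_fun b)"
      unfolding e using D(6)[OF bA(1)] .
  qed (use sa sb in auto)
  have img: "s ` {l..u} = arc_fun a ` {l..f w} \<union> arc_fun b ` {f w..u}" if "l \<le> f w" "f w \<le> u" for l u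
  proof -
    have "{l..u} = {l..f w} \<union> {f w<..u}" using that by auto
    then have "s ` {l..u} = s ` {l..f w} \<union> s ` {f w<..u}" by (simp add: image_Un)
    also have "s ` {l..f w} = arc_fun a ` {l..f w}" unfolding s_def by auto
    also have "s ` {f w<..u} = arc_fun b ` {f w<..u}" unfolding s_def by auto
    also have "arc_fun a ` {l..f w} \<union> arc_fun b ` {f w<..u} = arc_fun a ` {l..f w} \<union> arc_fun b ` {f w..u}"
    proof -
      have "{f w..u} = insert (f w) {f w<..u}" using that by auto
      moreover have "arc_fun b (f w) \<in> arc_fun a ` {l..f w}" using sa sb that by (auto intro: image_eqI[of _ _ "f w"])
      ultimately show ?thesis by auto
    qed
    finally show ?thesis .
  qed
  have cc: "closed_arc c = closed_arc a \<union> closed_arc b"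
    using img[of "arc_lo a" "arc_hi b"] aA(3) bA(3) unfolding closed_arc_def c_def by (simp add: ha[symmetric] lb[symmetric])
  have oc: "open_arc c = open_arc a \<union> {w} \<union> open_arc b"
  proof -
    have "{arc_lo a<..<arc_hi b} = {arc_lo a<..<f w} \<union> {f w} \<union> {f w<..<arc_hi b}" using aA(3) bA(3) by auto
    then have "s ` {arc_lo a<..<arc_hi b} = s ` {arc_lo a<..<f w} \<union> {s (f w)} \<union> s ` {f w<..<arc_hi b}" by auto
    also have "s ` {arc_lo a<..<f w} = arc_fun a ` {arc_lo a<..<f w}" unfolding s_def by auto
    also have "s ` {f w<..<arc_hi b} = arc_fun b ` {f w<..<arc_hi b}" unfolding s_def by auto
    finally show ?thesis unfolding open_arc_def c_def using ha lb sa by (simp add: s_def)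
  qed
  have cA: "c \<notin> A" using D(10)[of c] oc w by auto
  let ?A = "insert c (A - {a, b})"
  have oth: "arc_fun e (arc_lo e) \<noteq> w" "arc_fun e (arc_hi e) \<noteq> w" if "e \<in> A" "e \<noteq> a" "e \<noteq> b" for e
  proof -
    have "e \<notin> down_arcs A w" "e \<notin> up_arcs A w" using a b that by auto
    then show "arc_fun e (arc_lo e) \<noteq> w" "arc_fun e (arc_hi e) \<noteq> w"
      unfolding down_arcs_def up_arcs_def using D(5)[OF that(1)] that(1) by force+
  qed
  have "monotone_arcs (W - {w}) ?A"
    unfolding monotone_arcs_def arc_system_def
  proof (intro conjI)
    show "finite (W - {w})" "finite ?A" "W - {w} \<subseteq> topspace T" using D(1-3) by auto
    show "\<forall>e\<in>?A. arc_lo e < arc_hi e \<and> continuous_map (top_of_set {arc_lo e..arc_hi e}) T (arc_fun e) \<and>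
        arc_fun e (arc_lo e) \<in> W - {w} \<and> arc_fun e (arc_hi e) \<in> W - {w} \<and>
        inj_on (arc_fun e) {arc_lo e<..<arc_hi e} \<and> open_arc e \<inter> (W - {w}) = {}"
    proof
      fix e assume "e \<in> ?A"
      then consider "e = c" | "e \<in> A" "e \<noteq> a" "e \<noteq> b" by auto
      then show "arc_lo e < arc_hi e \<and> continuous_map (top_of_set {arc_lo e..arc_hi e}) T (arc_fun e) \<and>
        arc_fun e (arc_lo e) \<in> W - {w} \<and> arc_fun e (arc_hi e) \<in> W - {w} \<and>
        inj_on (arc_fun e) {arc_lo e<..<arc_hi e} \<and> open_arc e \<inter> (W - {w}) = {}"
      proof cases
        case 2
        then show ?thesis using D(5-10)[OF 2(1)] oth[OF 2] by auto
      next
        case 1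
        have sl: "s (arc_lo a) = arc_fun a (arc_lo a)" "s (arc_hi b) = arc_fun b (arc_hi b)" using aA bA unfolding s_def by auto
        have "s (arc_lo a) \<noteq> w" "s (arc_hi b) \<noteq> w" using fs[of "arc_lo a"] fs[of "arc_hi b"] aA(3) bA(3) by auto
        moreover have "inj_on s {arc_lo a<..<arc_hi b}" by (rule inj_on_inverseI[of _ f]) (use fs in auto)
        moreover have "open_arc c \<inter> (W - {w}) = {}" using oc D(10)[OF aA(1)] D(10)[OF bA(1)] by auto
        ultimately show ?thesis unfolding 1 using contc sl D(7)[OF aA(1)] D(8)[OF bA(1)] aA(3) bA(3)
          by (simp add: c_def)
      qed
    qed
    have ce: "open_arc c \<inter> open_arc e = {}" if "e \<in> A - {a, b}" for e
    proof -
      have "w \<notin> open_arc e" using D(10)[of e] that w by auto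
      moreover have "open_arc a \<inter> open_arc e = {}" "open_arc b \<inter> open_arc e = {}"
        using D(11)[OF aA(1), of e] D(11)[OF bA(1), of e] that by auto
      ultimately show ?thesis unfolding oc by auto
    qed
    show "\<forall>x\<in>?A. \<forall>y\<in>?A. x \<noteq> y \<longrightarrow> open_arc x \<inter> open_arc y = {}"
    proof (intro ballI impI)
      fix x y assume "x \<in> ?A" "y \<in> ?A" "x \<noteq> y"
      then consider "x = c" "y \<in> A - {a, b}" | "y = c" "x \<in> A - {a, b}" | "x \<in> A" "y \<in> A" "x \<noteq> y" by auto
      then show "open_arc x \<inter> open_arc y = {}"
      proof cases
        case 1 then show ?thesis using ce by simp
      next
        case 2 then show ?thesis using ce[of x] by (simp add: Int_commute)
      next
        case 3 then show ?thesis using D(11) by simp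
      qed
    qed
    show "topspace T = W - {w} \<union> (\<Union>e\<in>?A. closed_arc e)"
    proof -
      have "(\<Union>e\<in>?A. closed_arc e) = closed_arc a \<union> closed_arc b \<union> (\<Union>e\<in>A - {a, b}. closed_arc e)" using cc by auto
      also have "\<dots> = (\<Union>e\<in>A. closed_arc e)" using aA(1) bA(1) by blast
      finally have e: "(\<Union>e\<in>?A. closed_arc e) = (\<Union>e\<in>A. closed_arc e)" .
      have "w \<in> (\<Union>e\<in>A. closed_arc e)" using aA(1,2) by blast
      then have "W \<union> (\<Union>e\<in>A. closed_arc e) = W - {w} \<union> (\<Union>e\<in>A. closed_arc e)" by auto
      then show ?thesis unfolding e using D(4) by simp
    qed
    show "\<forall>e\<in>?A. \<forall>t\<in>{arc_lo e..arc_hi e}. f (arc_fun e t) = t"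
      using F fs by (auto simp: c_def)
  qed
  moreover have "card ?A + 1 = card A"
  proof -
    have "card ?A = Suc (card (A - {a, b}))" using D(2) cA by simp
    moreover have "card (A - {a, b}) = card A - 2" using aA(1) bA(1) ab by (simp add: card_Diff_subset)
    moreover have "card {a, b} \<le> card A" using aA(1) bA(1) D(2) by (intro card_mono) auto
    ultimately show ?thesis using ab by simp
  qed
  ultimately show ?thesis by blast
qed

text \<open>A vertex that is no local extremum has an arc below and an arc above it, and degree two
  leaves room for no third one. Its two arcs can therefore be merged.\<close>

lemma remove_degree_two_vertex:
  assumes M: "monotone_arcs W A" and w: "w \<in> W" "degree_two T w" "\<not> local_min w" "\<not> local_max w"
  shows "\<exists>A'. monotone_arcs (W - {w}) A' \<and> card A' + 1 = card A"
proof -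
  note D = arc_systemD[OF monotone_arcsD(1)[OF M]]
  have wT: "w \<in> topspace T" using D(3) w by auto
  have ne: "down_arcs A w \<noteq> {}" "up_arcs A w \<noteq> {}" using down_arcs_nonempty[OF M wT] up_arcs_nonempty[OF M wT] w by auto
  have fin: "finite (down_arcs A w)" "finite (up_arcs A w)" using D(2) unfolding down_arcs_def up_arcs_def by auto
  have dis: "down_arcs A w \<inter> up_arcs A w = {}"
  proof -
    have False if "e \<in> down_arcs A w" "e \<in> up_arcs A w" for e
      using that vertex_in_closed_arc[OF M, of e w] w(1) down_arcs_iff[OF M, of e w] up_arcs_iff[OF M, of e w] by auto
    then show ?thesis by blast
  qed
  have "down_arcs A w \<union> up_arcs A w \<subseteq> {a \<in> A. w \<in> closed_arc a}"
    using down_arcs_iff[OF M] up_arcs_iff[OF M] by blast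
  then have "card (down_arcs A w \<union> up_arcs A w) \<le> card {a \<in> A. w \<in> closed_arc a}"
    by (rule card_mono[rotated]) (use D(2) in auto)
  then have "card (down_arcs A w) + card (up_arcs A w) \<le> 2"
    using at_most_two_arcs[OF M w(1,2)] card_Un_disjoint[OF fin dis] by simp
  moreover have "0 < card (down_arcs A w)" "0 < card (up_arcs A w)" using ne fin by (simp_all add: card_gt_0_iff)
  ultimately have "card (down_arcs A w) = 1" "card (up_arcs A w) = 1" by auto
  then obtain a b where "down_arcs A w = {a}" "up_arcs A w = {b}" by (meson card_1_singletonE)
  then show ?thesis using merge_arcs[OF M w(1)] by blast
qed

lemma remove_degree_two_vertices:
  assumes "finite F" "monotone_arcs W A" "F \<subseteq> W"
    and "\<And>w. w \<in> F \<Longrightarrow> degree_two T w \<and> \<not> local_min w \<and> \<not> local_max w"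
  shows "\<exists>A'. monotone_arcs (W - F) A' \<and> card A' + card F = card A"
  using assms
proof (induction F arbitrary: W A rule: finite_induct)
  case empty
  then show ?case by auto
next
  case (insert x F)
  obtain A' where A': "monotone_arcs (W - {x}) A'" "card A' + 1 = card A"
    using remove_degree_two_vertex[OF insert.prems(1), of x] insert.prems by auto
  have sub: "F \<subseteq> W - {x}" using insert.hyps insert.prems(2) by auto
  obtain A'' where A'': "monotone_arcs (W - {x} - F) A''" "card A'' + card F = card A'"
    using insert.IH[OF A'(1) sub] insert.prems(3) by (meson insertI2)
  have "W - {x} - F = W - insert x F" by auto
  then have "monotone_arcs (W - insert x F) A''" using A''(1) by simp
  moreover have "card A'' + card (insert x F) = card A" using A'(2) A''(2) insert.hyps by simp
  ultimately show ?case using exI[of "\<lambda>A'. monotone_arcs (W - insert x F) A' \<and> card A' + card (insert x F) = card A" A''] by simp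
qed

section \<open>Paths among monotone arcs: barriers and cut points\<close>

lemma closed_arc_eqI:
  assumes "monotone_arcs W A" "a \<in> A" "p \<in> closed_arc a" "q \<in> closed_arc a" "f p = f q"
  shows "p = q"
  using closed_arcD(1)[OF assms(1,2,3)] closed_arcD(1)[OF assms(1,2,4)] assms(5) by metis

text \<open>The parts of the descending arcs strictly above the barriers \<open>ct a\<close>,
  together with the ascending arcs, form a star around \<open>p\<close>. A path can leave it only
  through a barrier or through the upper end of an ascending arc, and both are excluded.\<close>

lemma path_must_descend:
  assumes M: "monotone_arcs W A" and path: "pathin T \<rho>" "\<rho> 0 = p"
    and ct: "\<And>a. a \<in> down_arcs A p \<Longrightarrow> arc_lo a \<le> ct a \<and> ct a < f p"
    and lev: "\<And>s b. s \<in> {0..1} \<Longrightarrow> b \<in> up_arcs A p \<Longrightarrow> f (\<rho> s) < arc_hi b"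
    and av: "\<And>s a. s \<in> {0..1} \<Longrightarrow> a \<in> down_arcs A p \<Longrightarrow> \<rho> s \<noteq> arc_fun a (ct a)"
  shows "\<rho> 1 = p \<or> (\<exists>a\<in>down_arcs A p. \<rho> 1 \<in> closed_arc a \<and> ct a < f (\<rho> 1)) \<or> (\<exists>b\<in>up_arcs A p. \<rho> 1 \<in> closed_arc b \<and> f p \<le> f (\<rho> 1))"
proof -
  note S = monotone_arcsD(1)[OF M]
  note D = arc_systemD[OF S]
  note F = monotone_arcsD(2)[OF M]
  define B where "B = {q. q = p \<or> (\<exists>a\<in>down_arcs A p. q \<in> closed_arc a \<and> ct a < f q \<and> f q \<le> f p) \<or>
     (\<exists>b\<in>up_arcs A p. q \<in> closed_arc b \<and> f p \<le> f q)}"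
  \<comment> \<open>Every arc is divided at the barrier and at \<open>p\<close>; on arcs that do not
    descend from \<open>p\<close> the first two parts degenerate to the lower end. This makes a
    single finite closed cover fit for continuous induction.\<close>
  define ct' where "ct' c = (if c \<in> down_arcs A p then ct c else arc_lo c)" for c
  define \<mu> where "\<mu> c = (if c \<in> down_arcs A p then f p else arc_lo c)" for c
  have ord: "arc_lo c \<le> ct' c" "ct' c \<le> \<mu> c" "\<mu> c \<le> arc_hi c" if "c \<in> A" for c
    using ct[of c] D(5)[OF that] closed_arcD(3)[OF M that, of p] down_arcs_iff[OF M, of c p]
    unfolding ct'_def \<mu>_def by (auto split: if_splits)
  define P where "P = (\<Union>c\<in>A. {arc_fun c ` {arc_lo c..ct' c}, arc_fun c ` {ct' c..\<mu> c}, arc_fun c ` {\<mu> c..arc_hi c}}) \<union> (\<lambda>w. {w}) ` W"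
  \<comment> \<open>Distinct arcs meet only in vertices. The points of the star on its arcs are
    above the lower ends of the descending arcs and below the upper ends of the ascending ones, so a
    point of the star that also lies on a foreign arc can only be \<open>p\<close>.\<close>
  have memB: "q = p \<or> c \<in> down_arcs A p \<and> ct c < f q \<and> f q \<le> f p \<or> c \<in> up_arcs A p \<and> f p \<le> f q"
    if c: "c \<in> A" "q \<in> closed_arc c" "q \<in> B" "\<And>b. b \<in> up_arcs A p \<Longrightarrow> f q < arc_hi b" for c q
  proof -
    consider "q = p" | a where "a \<in> down_arcs A p" "q \<in> closed_arc a" "ct a < f q" "f q \<le> f p" 
      | b where "b \<in> up_arcs A p" "q \<in> closed_arc b" "f p \<le> f q" using c(3) unfolding B_def by auto
    then show ?thesis
    proof cases
      case 1 then show ?thesis by simp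
    next
      case (2 a)
      have a: "a \<in> A" "p \<in> closed_arc a" using down_arcs_iff[OF M] 2(1) by auto
      show ?thesis
      proof (cases "a = c")
        case False
        then have "f q = arc_lo a \<or> f q = arc_hi a" using closed_arcs_meet[OF M a(1) c(1) False 2(2) c(2)] by simp
        moreover have "f q \<noteq> arc_lo a" using ct[OF 2(1)] 2(3) by auto
        ultimately have "f q = f p" using closed_arcD(3)[OF M a] 2(4) by auto
        then have "q = p" using closed_arcD(1)[OF M a] closed_arcD(1)[OF M a(1) 2(2)] by simp
        then show ?thesis by simp
      qed (use 2 in auto)
    next
      case (3 b)
      have b: "b \<in> A" "p \<in> closed_arc b" using up_arcs_iff[OF M] 3(1) by auto
      show ?thesis
      proof (cases "b = c")
        case False
        then have "f q = arc_lo b \<or> f q = arc_hi b" using closed_arcs_meet[OF M b(1) c(1) False 3(2) c(2)] by simp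
        then have "f q = f p" using c(4)[OF 3(1)] closed_arcD(2)[OF M b] 3(3) by auto
        then have "q = p" using closed_arcD(1)[OF M b] closed_arcD(1)[OF M b(1) 3(2)] by simp
        then show ?thesis by simp
      qed (use 3 in auto)
    qed
  qed
  have sub: "q \<in> closed_arc c \<and> x \<le> f q \<and> f q \<le> y" if "c \<in> A" "q \<in> arc_fun c ` {x..y}" "arc_lo c \<le> x" "y \<le> arc_hi c" for c q x y
    using that F[OF that(1)] unfolding closed_arc_def by auto
  have "\<rho> 0 \<in> B \<longrightarrow> \<rho> 1 \<in> B"
  proof (rule pathin_pieces_relation[OF path(1), of P "\<lambda>s s'. \<rho> s \<in> B \<longrightarrow> \<rho> s' \<in> B"])
    show "finite P" unfolding P_def using D(1,2) by auto
    show "closedin T Q" if QP: "Q \<in> P" for Q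
    proof (cases "Q \<in> (\<lambda>w. {w}) ` W")
      case True
      then show ?thesis using arc_pieces(2)[OF Haus S, of Q] unfolding arc_pieces_def by auto
    next
      case False
      then obtain c where c: "c \<in> A" "Q \<in> {arc_fun c ` {arc_lo c..ct' c}, arc_fun c ` {ct' c..\<mu> c}, arc_fun c ` {\<mu> c..arc_hi c}}"
        using QP False unfolding P_def by blast
      have "arc_lo c \<le> \<mu> c" "ct' c \<le> arc_hi c" using ord[OF c(1)] by linarith+
      then show ?thesis using c(2) ord[OF c(1)] closedin_subarc[OF Haus S c(1)] by auto
    qed
    show "topspace T \<subseteq> \<Union>P"
    proof
      fix q assume "q \<in> topspace T"
      then consider "q \<in> W" | c where "c \<in> A" "q \<in> closed_arc c" using D(4) by auto
      then show "q \<in> \<Union>P"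
      proof cases
        case 1 then show ?thesis unfolding P_def by auto
      next
        case (2 c)
        have "q = arc_fun c (f q)" "arc_lo c \<le> f q" "f q \<le> arc_hi c" using closed_arcD[OF M 2] by auto
        then have "q \<in> arc_fun c ` {arc_lo c..ct' c} \<or> q \<in> arc_fun c ` {ct' c..\<mu> c} \<or> q \<in> arc_fun c ` {\<mu> c..arc_hi c}"
          by (metis atLeastAtMost_iff image_eqI linear)
        then show ?thesis unfolding P_def using 2(1) by blast
      qed
    qed
    show "\<rho> s \<in> B \<longrightarrow> \<rho> s' \<in> B" if Q: "Q \<in> P" "0 \<le> s" "s \<le> s'" "s' \<le> 1" "\<rho> s \<in> Q" "\<rho> s' \<in> Q" for Q s s'
    proof
      assume sB: "\<rho> s \<in> B"
      have levs: "f (\<rho> s) < arc_hi b" "f (\<rho> s') < arc_hi b" if "b \<in> up_arcs A p" for b using lev[of s b] lev[of s' b] that Q by auto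
      consider "Q \<in> (\<lambda>w. {w}) ` W" | c where "c \<in> A" "Q = arc_fun c ` {arc_lo c..ct' c}" 
        | c where "c \<in> A" "Q = arc_fun c ` {ct' c..\<mu> c}" | c where "c \<in> A" "Q = arc_fun c ` {\<mu> c..arc_hi c}"
        using Q(1) unfolding P_def by blast
      then show "\<rho> s' \<in> B"
      proof cases
        case 1 then show ?thesis using Q(5,6) sB by auto
      next
        case (2 c)
        have c: "\<rho> s \<in> closed_arc c" "f (\<rho> s) \<le> ct' c" "\<rho> s' \<in> closed_arc c" "f (\<rho> s') \<le> ct' c"
          "arc_lo c \<le> f (\<rho> s)" "arc_lo c \<le> f (\<rho> s')"
          using sub[OF 2(1)] Q(5,6) ord[OF 2(1)] unfolding 2(2) by (meson order_trans order_refl)+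
        show ?thesis
        proof (cases "c \<in> down_arcs A p")
          case True
          then have "ct' c = ct c" unfolding ct'_def by simp
          then have lt: "f (\<rho> s) \<le> ct c" "ct c < f p" using c(2) ct[OF True] by simp_all
          then have "f (\<rho> s) < f p" by linarith
          then have False using memB[OF 2(1) c(1) sB levs(1)] lt(1) by force
          then show ?thesis ..
        next
          case False
          then have "ct' c = arc_lo c" unfolding ct'_def by simp
          then have "f (\<rho> s) = f (\<rho> s')" using c by linarith
          from closed_arc_eqI[OF M 2(1) c(1,3) this] show ?thesis using sB by simp
        qed
      next
        case (3 c)
        have c: "\<rho> s \<in> closed_arc c" "\<rho> s' \<in> closed_arc c" "ct' c \<le> f (\<rho> s')" "f (\<rho> s') \<le> \<mu> c" "ct' c \<le> f (\<rho> s)" "f (\<rho> s) \<le> \<mu> c"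
          using sub[OF 3(1)] Q(5,6) ord[OF 3(1)] unfolding 3(2) by blast+
        show ?thesis
        proof (cases "c \<in> down_arcs A p")
          case True
          have "\<rho> s' \<noteq> arc_fun c (ct c)" using av[of s' c] True Q(2-4) by simp
          then have "f (\<rho> s') \<noteq> ct c" using closed_arcD(1)[OF M 3(1) c(2)] by metis
          moreover have "ct' c = ct c" "\<mu> c = f p" using True unfolding ct'_def \<mu>_def by simp_all
          ultimately have "ct c < f (\<rho> s')" "f (\<rho> s') \<le> f p" using c(3,4) by linarith+
          then show ?thesis using True c(2) unfolding B_def by blast
        next
          case False
          then have "ct' c = arc_lo c" "\<mu> c = arc_lo c" unfolding ct'_def \<mu>_def by simp_all
          then have "f (\<rho> s) = f (\<rho> s')" using c(3-6) by linarith
          from closed_arc_eqI[OF M 3(1) c(1,2) this] show ?thesis using sB by simp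
        qed
      next
        case (4 c)
        have c: "\<rho> s \<in> closed_arc c" "\<rho> s' \<in> closed_arc c" "\<mu> c \<le> f (\<rho> s')"
          using sub[OF 4(1)] Q(5,6) ord[OF 4(1)] unfolding 4(2) by (meson order_trans order_refl)+
        show ?thesis
        proof (cases "c \<in> up_arcs A p")
          case True
          have "f p \<le> f (\<rho> s')"
          proof (cases "c \<in> down_arcs A p")
            case False
            have "p \<in> closed_arc c" "arc_fun c (f p) = p" using True up_arcs_iff[OF M, of c p] closed_arcD(1)[OF M 4(1)] by auto
            moreover have "\<not> arc_lo c < f p" using False True up_arcs_iff[OF M, of c p] down_arcs_iff[OF M, of c p] by auto
            ultimately show ?thesis using c(3) False unfolding \<mu>_def by simp
          qed (use c(3) in \<open>simp add: \<mu>_def\<close>)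
          then show ?thesis using True c(2) unfolding B_def by blast
        next
          case up: False
          from memB[OF 4(1) c(1) sB levs(1)] up
          consider "\<rho> s = p" | "c \<in> down_arcs A p" by blast
          then show ?thesis
          proof cases
            case 1
            then have "p \<in> closed_arc c" using c(1) by simp
            then have "\<not> f p < arc_hi c" "f p \<le> arc_hi c" using up up_arcs_iff[OF M, of c p] 4(1) closed_arcD(3)[OF M 4(1)] by auto
            then have hi: "f p = arc_hi c" by simp
            then have "c \<in> down_arcs A p" using down_arcs_iff[OF M, of c p] 4(1) D(5)[OF 4(1)] \<open>p \<in> closed_arc c\<close> by simp
            then have "f (\<rho> s') = f p" using c(2,3) hi closed_arcD(3)[OF M 4(1) c(2)] unfolding \<mu>_def by simp
            from closed_arc_eqI[OF M 4(1) c(2) \<open>p \<in> closed_arc c\<close> this] show ?thesis unfolding B_def by simp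
          next
            case 2
            then have pc: "p \<in> closed_arc c" using down_arcs_iff[OF M] by blast
            then have "\<not> f p < arc_hi c" "f p \<le> arc_hi c" using up up_arcs_iff[OF M, of c p] 4(1) closed_arcD(3)[OF M 4(1)] by auto
            then have "f (\<rho> s') = f p" using c(2,3) closed_arcD(3)[OF M 4(1) c(2)] 2 unfolding \<mu>_def by simp
            from closed_arc_eqI[OF M 4(1) c(2) pc this] show ?thesis unfolding B_def by simp
          qed
        qed
      qed
    qed
  qed auto
  then show ?thesis using path(2) unfolding B_def by blast
qed

text \<open>Subdividing at \<open>G\<close> adds as many arcs as points; deleting the arc directly
  below each point of \<open>G\<close> removes as many again. The remaining graph still connects
  everything to \<open>z\<close>: other vertices descend, and points of \<open>G\<close> are joined
  to \<open>z\<close> by the given paths. A connected graph has at most one vertex more than edges,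
  which is the bound.\<close>

lemma card_cut_points:
  assumes M: "monotone_arcs W A" and z: "z \<in> W" and G: "finite G" "G \<subseteq> topspace T - W"
    and nm: "\<And>p. p \<in> topspace T \<Longrightarrow> p \<noteq> z \<Longrightarrow> \<not> local_min p"
    and paths: "\<And>g. g \<in> G \<Longrightarrow> \<exists>\<rho>. pathin T \<rho> \<and> \<rho> 0 = g \<and> \<rho> 1 = z \<and> (\<forall>s\<in>{0<..1}. \<rho> s \<notin> G) \<and>
      (\<exists>d>0. \<forall>s. 0 < s \<longrightarrow> s < d \<longrightarrow> f g < f (\<rho> s))"
  shows "card G + card W \<le> card A + 1"
proof -
  obtain B where B: "monotone_arcs (G \<union> W) B" "card B = card A + card G" "\<And>q. card (down_arcs B q) = card (down_arcs A q)"
    using split_monotone_finite[OF G(1) M G(2)] by blast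
  note S = monotone_arcsD(1)[OF B(1)]
  note D = arc_systemD[OF S]
  note F = monotone_arcsD(2)[OF B(1)]
  let ?hi = "\<lambda>a. arc_fun a (arc_hi a)" and ?lo = "\<lambda>a. arc_fun a (arc_lo a)"
  \<comment> \<open>The arcs left after deleting the one below each point of \<open>G\<close>. After
    subdivision every point of \<open>G\<close> is the upper end of exactly one arc.\<close>
  define H where "H = {a\<in>B. ?hi a \<notin> G}"
  define E where "E = {(x, y). \<exists>e\<in>H. (x = ?lo e \<and> y = ?hi e) \<or> (x = ?hi e \<and> y = ?lo e)}"
  have symE: "(x, y) \<in> E\<^sup>* \<Longrightarrow> (y, x) \<in> E\<^sup>*" for x y
  proof -
    have "sym E" unfolding sym_def E_def by auto
    then show "(x, y) \<in> E\<^sup>* \<Longrightarrow> (y, x) \<in> E\<^sup>*" using sym_rtrancl unfolding sym_def by blast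
  qed
  have down: "a \<in> down_arcs B v \<longleftrightarrow> a \<in> B \<and> ?hi a = v" if "v \<in> G \<union> W" for a v
  proof
    assume "a \<in> down_arcs B v"
    then have a: "a \<in> B" "v \<in> closed_arc a" "arc_lo a < f v" using down_arcs_iff[OF B(1)] by auto
    then show "a \<in> B \<and> ?hi a = v"
      using vertex_in_closed_arc[OF B(1) a(1,2) that] closed_arcD[OF B(1) a(1,2)] by auto
  next
    assume "a \<in> B \<and> ?hi a = v"
    then show "a \<in> down_arcs B v" using D(5)[of a] unfolding down_arcs_def by force
  qed
  have cH: "card H + card G = card B"
  proof -
    have one: "card (down_arcs B g) = 1" if "g \<in> G" for g
    proof -
      have "g \<in> topspace T" "g \<notin> W" using G(2) that by auto
      then obtain a where "a \<in> A" "g \<in> open_arc a" using arc_system_cases[OF monotone_arcsD(1)[OF M]] by metis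
      then have "down_arcs A g = {a}" using down_arcs_open_arc[OF M] by blast
      then show ?thesis using B(3)[of g] by simp
    qed
    have "B - H = (\<Union>g\<in>G. down_arcs B g)" using down unfolding H_def by auto
    moreover have "card (\<Union>g\<in>G. down_arcs B g) = (\<Sum>g\<in>G. card (down_arcs B g))"
    proof (rule card_UN_disjoint)
      show "\<forall>g\<in>G. finite (down_arcs B g)" using D(2) unfolding down_arcs_def by auto
      show "\<forall>i\<in>G. \<forall>j\<in>G. i \<noteq> j \<longrightarrow> down_arcs B i \<inter> down_arcs B j = {}" using down by auto
    qed (use G in auto)
    ultimately have "card (B - H) = card G" using one by simp
    moreover have "H \<subseteq> B" unfolding H_def by auto
    ultimately show ?thesis using D(2) by (metis add.commute card_mono card_Diff_subset finite_subset le_add_diff_inverse)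
  qed
  \<comment> \<open>A retraction of the points outside \<open>G\<close> to vertices in the graph
    \<open>H\<close>: on a deleted arc they go to the lower end, since from there they cannot cross
    into the point of \<open>G\<close> above. Along a path that avoids \<open>G\<close> the image
    stays in one component.\<close>
  define \<kappa> where "\<kappa> q = (if q \<in> W then q else let a = (SOME a. a \<in> B \<and> q \<in> open_arc a) in if ?hi a \<in> G then ?lo a else ?hi a)" for q
  have \<kappa>: "(\<kappa> q, if ?hi a \<in> G then ?lo a else ?hi a) \<in> E\<^sup>*" if a: "a \<in> B" "q \<in> closed_arc a" "q \<notin> G" for a q
  proof (cases "q \<in> W")
    case True
    then have "q = ?lo a \<or> q = ?hi a" 
      using vertex_in_closed_arc[OF B(1) a(1,2)] closed_arcD(1)[OF B(1) a(1,2)] by auto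
    moreover have "(?lo a, ?hi a) \<in> E" if "?hi a \<notin> G" using a(1) that unfolding E_def H_def by blast
    ultimately show ?thesis using True a(3) unfolding \<kappa>_def by auto
  next
    case False
    then have qo: "q \<in> open_arc a" using closed_arc_eq[of a] D(5,7,8)[OF a(1)] a(2,3) by auto
    have "(SOME a. a \<in> B \<and> q \<in> open_arc a) = a"
      by (rule some_equality) (use a(1) qo D(11) in blast)+
    then show ?thesis using False unfolding \<kappa>_def by simp
  qed
  have piece: "(\<kappa> q, \<kappa> q') \<in> E\<^sup>*" if "Q \<in> arc_pieces (G \<union> W) B" "q \<in> Q" "q' \<in> Q" "q \<notin> G" "q' \<notin> G" for Q q q'
  proof (cases "Q \<in> closed_arc ` B")
    case True
    then obtain a where a: "a \<in> B" "Q = closed_arc a" by auto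
    show ?thesis using \<kappa>[OF a(1), of q] symE[OF \<kappa>[OF a(1), of q']] that a(2) by (meson rtrancl_trans)
  next
    case False
    then show ?thesis using that unfolding arc_pieces_def by auto
  qed
  have conn_g: "(z, g) \<in> E\<^sup>*" if g: "g \<in> G" for g
  proof -
    obtain \<rho> d where \<rho>: "pathin T \<rho>" "\<rho> 0 = g" "\<rho> 1 = z" "\<And>s. 0 < s \<Longrightarrow> s \<le> 1 \<Longrightarrow> \<rho> s \<notin> G"
      "d > 0" "\<And>s. 0 < s \<Longrightarrow> s < d \<Longrightarrow> f g < f (\<rho> s)"
      using paths[OF g] by (metis greaterThanAtMost_iff)
    note P = arc_pieces[OF Haus S]
    obtain d' where d': "d' > 0" "\<And>s. s\<in>{0..1} \<Longrightarrow> \<bar>s - 0\<bar> < d' \<Longrightarrow> \<exists>Q\<in>arc_pieces (G \<union> W) B. \<rho> s \<in> Q \<and> \<rho> 0 \<in> Q"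
      using pathin_locally_in_common_piece[OF \<rho>(1) P, of 0] by (metis atLeastAtMost_iff zero_le_one order_refl)
    define a where "a = min (min d d') 1 / 2"
    have a: "0 < a" "a < d" "a < d'" "a \<le> 1" unfolding a_def using \<rho>(5) d'(1) by auto
    obtain Q where Q: "Q \<in> arc_pieces (G \<union> W) B" "\<rho> a \<in> Q" "g \<in> Q" using d'(2)[of a] a \<rho>(2) by auto
    have lev: "f g < f (\<rho> a)" using \<rho>(6) a by auto
    then have "Q \<in> closed_arc ` B" using Q unfolding arc_pieces_def by auto
    then obtain b where b: "b \<in> B" "Q = closed_arc b" by auto
    \<comment> \<open>Since the path starts upwards, the arc it enters has \<open>g\<close> as its
      lower end, hence is not the arc deleted below \<open>g\<close>.\<close>
    have gl: "g = ?lo b"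
      using vertex_in_closed_arc[OF B(1) b(1), of g] Q b g closed_arcD(1)[OF B(1) b(1), of g] closed_arcD(3)[OF B(1) b(1), of "\<rho> a"] lev by auto
    have "(\<kappa> (\<rho> a), if ?hi b \<in> G then ?lo b else ?hi b) \<in> E\<^sup>*" using \<kappa>[OF b(1), of "\<rho> a"] Q(2) b(2) \<rho>(4)[of a] a by simp
    moreover have "(?hi b, ?lo b) \<in> E" if "?hi b \<notin> G" using that b(1) unfolding E_def H_def by blast
    ultimately have 1: "(\<kappa> (\<rho> a), g) \<in> E\<^sup>*" unfolding gl by (auto split: if_splits)
    have "0 < a \<longrightarrow> (\<kappa> (\<rho> a), \<kappa> (\<rho> 1)) \<in> E\<^sup>*"
    proof (rule pathin_pieces_relation[OF \<rho>(1) P, where R = "\<lambda>s s'. 0 < s \<longrightarrow> (\<kappa> (\<rho> s), \<kappa> (\<rho> s')) \<in> E\<^sup>*"])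
      show "0 < s \<longrightarrow> (\<kappa> (\<rho> s), \<kappa> (\<rho> s')) \<in> E\<^sup>*"
        if "Q \<in> arc_pieces (G \<union> W) B" "0 \<le> s" "s \<le> s'" "s' \<le> 1" "\<rho> s \<in> Q" "\<rho> s' \<in> Q" for Q s s'
        using piece[OF that(1,5,6)] \<rho>(4)[of s] \<rho>(4)[of s'] that by auto
    next
      fix a b c :: real assume "a \<le> b" and "0 < a \<longrightarrow> (\<kappa> (\<rho> a), \<kappa> (\<rho> b)) \<in> E\<^sup>*" "0 < b \<longrightarrow> (\<kappa> (\<rho> b), \<kappa> (\<rho> c)) \<in> E\<^sup>*"
      then show "0 < a \<longrightarrow> (\<kappa> (\<rho> a), \<kappa> (\<rho> c)) \<in> E\<^sup>*" by (meson order_less_le_trans rtrancl_trans)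
    qed (use a in auto)
    moreover have "\<kappa> z = z" using z unfolding \<kappa>_def by simp
    ultimately have "(\<kappa> (\<rho> a), z) \<in> E\<^sup>*" using a \<rho>(3) by simp
    then show ?thesis using 1 symE by (meson rtrancl_trans)
  qed
  \<comment> \<open>Induction on the number of lower vertices. A vertex outside \<open>G\<close> and
    different from \<open>z\<close> descends along an arc that is not deleted; the lower end of that
    arc may belong to \<open>G\<close>, in which case the paths take over.\<close>
  have conn: "(z, w) \<in> E\<^sup>*" if "w \<in> G \<union> W" for w
    using that
  proof (induction "card {v \<in> G \<union> W. f v < f w}" arbitrary: w rule: less_induct)
    case less
    show ?case
    proof (cases "w \<in> G \<or> w = z")
      case True
      then show ?thesis using conn_g by auto
    next
      case False
      then have w: "w \<in> topspace T" "w \<noteq> z" "w \<notin> G" using less.prems D(3) by auto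
      obtain a where "a \<in> down_arcs B w" using down_arcs_nonempty[OF B(1) w(1) nm[OF w(1,2)]] by auto
      then have a: "a \<in> B" "?hi a = w" using down[OF less.prems] by auto
      have lo: "?lo a \<in> G \<union> W" "f (?lo a) < f w" using D(7)[OF a(1)] F[OF a(1)] D(5)[OF a(1)] a(2) by (auto simp del: Un_iff)
      have "{v \<in> G \<union> W. f v < f (?lo a)} \<subset> {v \<in> G \<union> W. f v < f w}" using lo by auto
      then have "card {v \<in> G \<union> W. f v < f (?lo a)} < card {v \<in> G \<union> W. f v < f w}"
        by (rule psubset_card_mono[rotated]) (use D(1) in auto)
      then have "(z, ?lo a) \<in> E\<^sup>*" using less.hyps lo by blast
      moreover have "(?lo a, w) \<in> E" using a w(3) unfolding E_def H_def by blast
      ultimately show ?thesis by (rule rtrancl_into_rtrancl)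
    qed
  qed
  have "finite H" unfolding H_def using D(2) by auto
  then have "card (G \<union> W) \<le> card H + 1"
    using connected_graph_card_le[of H "G \<union> W" z ?lo ?hi] conn unfolding E_def by blast
  moreover have "card (G \<union> W) = card G + card W"
    using G arc_systemD(1)[OF monotone_arcsD(1)[OF M]] by (intro card_Un_disjoint) auto
  ultimately show ?thesis using cH B(2) by linarith
qed

end

section \<open>Straightening the arcs of a finite graph\<close>

lemma split_system_finite:
  assumes "finite F" "arc_system T W A" "F \<subseteq> topspace T - W"
  shows "\<exists>A'. arc_system T (F \<union> W) A'"
  using assms(1,3)
proof (induction F rule: finite_induct)
  case empty
  then show ?case using assms(2) by auto
next
  case (insert x F)
  then obtain A' where A': "arc_system T (F \<union> W) A'" by auto
  have "x \<in> topspace T" "x \<notin> F \<union> W" using insert by auto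
  then obtain a where a: "a \<in> A'" "x \<in> open_arc a" using arc_system_cases[OF A'] by metis
  then obtain t where t: "arc_lo a < t" "t < arc_hi a" "x = arc_fun a t" unfolding open_arc_def by auto
  show ?case using split_arc(1)[OF A' a(1) t(1,2) refl refl] unfolding t(3)[symmetric] by auto
qed

lemma arc_subset_topspace:
  assumes "arc_system T W A" "a \<in> A"
  shows "closed_arc a \<subseteq> topspace T" "open_arc a \<subseteq> closed_arc a" "open_arc a \<subseteq> topspace T"
proof -
  show c: "closed_arc a \<subseteq> topspace T" unfolding arc_systemD(4)[OF assms(1)] using assms(2) by (intro le_supI2) (rule UN_upper)
  show o: "open_arc a \<subseteq> closed_arc a" unfolding open_arc_def closed_arc_def by (intro image_mono) auto
  show "open_arc a \<subseteq> topspace T" using c o by (rule order_trans[rotated])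
qed

lemma open_interval_homeomorphic_real:
  assumes "l < (u::real)"
  shows "top_of_set {l<..<u} homeomorphic_space euclideanreal"
proof -
  have "{l<..<u} = ball ((l + u)/2) ((u - l)/2)" by (rule greaterThanLessThan_eq_ball)
  also have "\<dots> homeomorphic ball (0::real) 1" using assms by (intro homeomorphic_balls) auto
  also have "\<dots> homeomorphic (UNIV::real set)" by (rule homeomorphic_ball01_UNIV)
  finally have "{l<..<u} homeomorphic (UNIV::real set)" .
  then obtain g h :: "real \<Rightarrow> real" where "homeomorphism {l<..<u} UNIV g h" unfolding homeomorphic_def by blast
  then have "homeomorphic_maps (top_of_set {l<..<u}) euclideanreal g h"
    unfolding homeomorphic_maps_def homeomorphism_def by (auto simp: continuous_map_in_subtopology)
  then show ?thesis unfolding homeomorphic_space_def by blast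
qed

context level_space
begin

lemma continuous_on_arc:
  assumes "arc_system T W A" "a \<in> A"
  shows "continuous_on {arc_lo a..arc_hi a} (\<lambda>t. f (arc_fun a t))"
proof -
  have "continuous_map (top_of_set {arc_lo a..arc_hi a}) euclideanreal (f \<circ> arc_fun a)"
    using continuous_map_compose[OF arc_systemD(6)[OF assms] cont_f] .
  then show ?thesis by (simp add: o_def)
qed

lemma interior_extremum_of_arc:
  assumes S: "arc_system T W A" "a \<in> A" and t: "arc_lo a \<le> l" "l < t" "t < u" "u \<le> arc_hi a"
  shows "(\<And>t'. l < t' \<Longrightarrow> t' < u \<Longrightarrow> f (arc_fun a t) \<le> f (arc_fun a t')) \<Longrightarrow> local_min (arc_fun a t)"
    and "(\<And>t'. l < t' \<Longrightarrow> t' < u \<Longrightarrow> f (arc_fun a t') \<le> f (arc_fun a t)) \<Longrightarrow> local_max (arc_fun a t)"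
proof -
  have "openin T (arc_fun a ` {l<..<u})" using open_subarc[OF Haus S t(1,4)] .
  moreover have "arc_fun a t \<in> arc_fun a ` {l<..<u}" using t by auto
  ultimately show "(\<And>t'. l < t' \<Longrightarrow> t' < u \<Longrightarrow> f (arc_fun a t) \<le> f (arc_fun a t')) \<Longrightarrow> local_min (arc_fun a t)"
    "(\<And>t'. l < t' \<Longrightarrow> t' < u \<Longrightarrow> f (arc_fun a t') \<le> f (arc_fun a t)) \<Longrightarrow> local_max (arc_fun a t)"
    unfolding local_min_def local_max_def by (intro exI[of _ "arc_fun a ` {l<..<u}"]; force)+
qed

text \<open>The level has a minimum between two local maxima. If it is attained at one of the
  maxima, then the points next to it have no larger value, so the minimum is also attained in
  between, which gives a forbidden local minimum.\<close>

lemma local_max_unique_on_arc: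
  assumes S: "arc_system T W A" "a \<in> A" and nm: "\<And>p. p \<in> open_arc a \<Longrightarrow> \<not> local_min p"
    and t: "arc_lo a < t1" "t1 < t2" "t2 < arc_hi a"
    and lm: "local_max (arc_fun a t1)" "local_max (arc_fun a t2)"
  shows False
proof -
  let ?s = "arc_fun a"
  have nomin: "\<exists>t'. t1 < t' \<and> t' < t2 \<and> f (?s t') < f (?s t)" if "t1 < t" "t < t2" for t
  proof (rule ccontr)
    assume "\<not> ?thesis"
    then have "local_min (?s t)" using interior_extremum_of_arc(1)[OF S, of t1 t t2] t that by (meson less_imp_le not_le)
    moreover have "?s t \<in> open_arc a" using that t unfolding open_arc_def by auto
    ultimately show False using nm by blast
  qed
  have cont: "continuous_on {t1..t2} (\<lambda>t. f (?s t))"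
    by (rule continuous_on_subset[OF continuous_on_arc[OF S]]) (use t in auto)
  obtain m where m: "m \<in> {t1..t2}" "\<And>t. t \<in> {t1..t2} \<Longrightarrow> f (?s m) \<le> f (?s t)"
    using continuous_attains_inf[of "{t1..t2}" "\<lambda>t. f (?s t)"] cont t by auto
  have mm: "m = t1 \<or> m = t2"
  proof (rule ccontr)
    assume "\<not> ?thesis"
    then have "t1 < m" "m < t2" using m(1) by auto
    from nomin[OF this] show False using m(2) by (meson atLeastAtMost_iff less_imp_le not_le)
  qed
  obtain U where U: "openin T U" "?s m \<in> U" "\<And>q. q \<in> U \<Longrightarrow> f q \<le> f (?s m)"
    using mm lm unfolding local_max_def by metis
  have "openin (top_of_set {arc_lo a..arc_hi a}) {t \<in> {arc_lo a..arc_hi a}. ?s t \<in> U}"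
    using arc_systemD(6)[OF S] U(1) unfolding continuous_map_def by auto
  moreover have "m \<in> {t \<in> {arc_lo a..arc_hi a}. ?s t \<in> U}" using m(1) t U(2) by auto
  ultimately obtain d where d: "d > 0" "\<And>t. t \<in> {arc_lo a..arc_hi a} \<Longrightarrow> dist t m < d \<Longrightarrow> ?s t \<in> U"
    unfolding openin_euclidean_subtopology_iff by blast
  define h where "h = min d (t2 - t1) / 2"
  define t where "t = (if m = t1 then t1 + h else t2 - h)"
  have h: "0 < h" "h < d" "h < t2 - t1" unfolding h_def using d(1) \<open>t1 < t2\<close> by (auto simp: min_def field_simps)
  have t': "t1 < t" "t < t2" "dist t m < d" unfolding t_def using mm h by (auto simp: dist_real_def)
  have "?s t \<in> U" using d(2)[of t] t' \<open>arc_lo a < t1\<close> \<open>t2 < arc_hi a\<close> by auto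
  then have "f (?s t) \<le> f (?s m)" using U(3) by blast
  then show False using nomin[OF t'(1,2)] m(2) by (smt (verit) atLeastAtMost_iff)
qed

lemma finite_local_max:
  assumes S: "arc_system T W A" and nm: "\<And>p. p \<in> topspace T \<Longrightarrow> p \<notin> W \<Longrightarrow> \<not> local_min p"
  shows "finite {p \<in> topspace T - W. local_max p}"
proof -
  note D = arc_systemD[OF S]
  have fin: "finite {p \<in> open_arc a. local_max p}" if a: "a \<in> A" for a
  proof -
    have oa: "open_arc a \<subseteq> topspace T" using arc_subset_topspace(3)[OF S a] .
    have "\<And>p. p \<in> open_arc a \<Longrightarrow> \<not> local_min p" using nm oa D(10)[OF a] by blast
    note un = local_max_unique_on_arc[OF S a this]
    have "p = q" if pq: "p \<in> {p \<in> open_arc a. local_max p}" "q \<in> {p \<in> open_arc a. local_max p}" for p q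
    proof -
      obtain t1 t2 where t: "p = arc_fun a t1" "q = arc_fun a t2" "arc_lo a < t1" "t1 < arc_hi a" "arc_lo a < t2" "t2 < arc_hi a"
        using pq unfolding open_arc_def by auto
      then have "\<not> t1 < t2" "\<not> t2 < t1" using un[of t1 t2] un[of t2 t1] pq by auto
      then show ?thesis using t by auto
    qed
    then show ?thesis by (metis (no_types, lifting) finite.simps is_singletonI' is_singleton_def)
  qed
  have "{p \<in> topspace T - W. local_max p} \<subseteq> (\<Union>a\<in>A. {p \<in> open_arc a. local_max p})"
  proof
    fix p assume p: "p \<in> {p \<in> topspace T - W. local_max p}"
    then have "p \<in> topspace T" "p \<notin> W" by auto
    then obtain a where "a \<in> A" "p \<in> open_arc a" using arc_system_cases[OF S] by metis
    then show "p \<in> (\<Union>a\<in>A. {p \<in> open_arc a. local_max p})" using p by auto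
  qed
  then show ?thesis using fin D(2) by (meson finite_UN finite_subset)
qed

text \<open>As in Rolle's theorem, equal levels at two parameters force an extremum in between; if
  both extreme values occur only at the ends, the level is constant and every point in between is a
  local minimum.\<close>

lemma level_injective_on_arc:
  assumes S: "arc_system T W A" "a \<in> A" and nm: "\<And>p. p \<in> open_arc a \<Longrightarrow> \<not> local_min p \<and> \<not> local_max p"
  shows "inj_on (\<lambda>t. f (arc_fun a t)) {arc_lo a..arc_hi a}"
proof -
  let ?g = "\<lambda>t. f (arc_fun a t)"
  have no: False if t: "arc_lo a \<le> t1" "t1 < t2" "t2 \<le> arc_hi a" "?g t1 = ?g t2" for t1 t2
  proof -
    have cont: "continuous_on {t1..t2} ?g"
      by (rule continuous_on_subset[OF continuous_on_arc[OF S]]) (use t in auto)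
    obtain m where m: "m \<in> {t1..t2}" "\<And>t. t \<in> {t1..t2} \<Longrightarrow> ?g m \<le> ?g t"
      using continuous_attains_inf[of "{t1..t2}" ?g] cont t by auto
    obtain n where n: "n \<in> {t1..t2}" "\<And>t. t \<in> {t1..t2} \<Longrightarrow> ?g t \<le> ?g n"
      using continuous_attains_sup[of "{t1..t2}" ?g] cont t by auto
    have opn: "arc_fun a t \<in> open_arc a" if "t1 < t" "t < t2" for t using that t unfolding open_arc_def by auto
    have mm: "m = t1 \<or> m = t2"
    proof (rule ccontr)
      assume "\<not> ?thesis"
      then have "t1 < m" "m < t2" using m(1) by auto
      then show False using interior_extremum_of_arc(1)[OF S, of t1 m t2] m(2) t nm opn by (meson atLeastAtMost_iff less_imp_le)
    qed
    have nn: "n = t1 \<or> n = t2"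
    proof (rule ccontr)
      assume "\<not> ?thesis"
      then have "t1 < n" "n < t2" using n(1) by auto
      then show False using interior_extremum_of_arc(2)[OF S, of t1 n t2] n(2) t nm opn by (meson atLeastAtMost_iff less_imp_le)
    qed
    have const: "?g t' = ?g t1" if "t' \<in> {t1..t2}" for t' 
      using m(2)[OF that] n(2)[OF that] mm nn t(4) by (metis order_antisym)
    let ?c = "(t1 + t2)/2"
    have c: "t1 < ?c" "?c < t2" using t by auto
    have "local_min (arc_fun a ?c)"
    proof (rule interior_extremum_of_arc(1)[OF S, of t1 _ t2])
      fix t' assume "t1 < t'" "t' < t2"
      then have "?g t' = ?g t1" "?g ?c = ?g t1" using const[of t'] const[of ?c] c by simp_all
      then show "?g ?c \<le> ?g t'" by linarith
    qed (use t c in simp_all)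
    then show False using nm opn c by blast
  qed
  show ?thesis
  proof (rule inj_onI)
    fix x y assume "x \<in> {arc_lo a..arc_hi a}" "y \<in> {arc_lo a..arc_hi a}" "?g x = ?g y"
    then show "x = y" using no[of x y] no[of y x] by (cases x y rule: linorder_cases) auto
  qed
qed

text \<open>The level may fall along the given arc, and inverting it then reverses the direction.
  This is why only the set of the two ends is kept, not their order.\<close>

lemma reparametrize_by_level:
  assumes S: "arc_system T W A" "a \<in> A" and inj: "inj_on (\<lambda>t. f (arc_fun a t)) {arc_lo a..arc_hi a}"
  shows "\<exists>b. arc_lo b < arc_hi b \<and> continuous_map (top_of_set {arc_lo b..arc_hi b}) T (arc_fun b) \<and>
     closed_arc b = closed_arc a \<and> open_arc b = open_arc a \<and> (\<forall>t\<in>{arc_lo b..arc_hi b}. f (arc_fun b t) = t) \<and>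
     {arc_fun b (arc_lo b), arc_fun b (arc_hi b)} = {arc_fun a (arc_lo a), arc_fun a (arc_hi a)}"
proof -
  let ?g = "\<lambda>t. f (arc_fun a t)" and ?l = "arc_lo a" and ?u = "arc_hi a"
  have lu: "?l < ?u" using arc_systemD(5)[OF S] .
  note cont = continuous_on_arc[OF S]
  define h where "h = the_inv_into {?l..?u} ?g"
  define l' where "l' = min (?g ?l) (?g ?u)"
  define u' where "u' = max (?g ?l) (?g ?u)"
  have ne: "?g ?l \<noteq> ?g ?u" using inj lu unfolding inj_on_def by fastforce
  have seg: "closed_segment ?l ?u = {?l..?u}" "open_segment ?l ?u = {?l<..<?u}"
    using lu by (simp_all add: closed_segment_eq_real_ivl open_segment_eq_real_ivl)
  have img: "?g ` {?l..?u} = {l'..u'}"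
    using continuous_injective_image_segment_1[of ?l ?u ?g] cont inj unfolding seg l'_def u'_def
    by (simp add: closed_segment_eq_real_ivl min_def max_def)
  have img': "?g ` {?l<..<?u} = {l'<..<u'}"
    using continuous_injective_image_open_segment_1[of ?l ?u ?g] cont inj unfolding seg l'_def u'_def
    by (simp add: open_segment_eq_real_ivl min_def max_def)
  have hg: "h (?g t) = t" if "t \<in> {?l..?u}" for t unfolding h_def using the_inv_into_f_f[OF inj that] .
  have h1: "h ` {l'..u'} = {?l..?u}" unfolding img[symmetric] image_image using hg by force
  have h2: "h ` {l'<..<u'} = {?l<..<?u}" unfolding img'[symmetric] image_image using hg by force
  have ch: "continuous_on {l'..u'} h" unfolding img[symmetric] h_def by (rule continuous_on_inv_into[OF cont _ inj]) auto
  define b where "b = Arc l' u' (arc_fun a \<circ> h)"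
  have lu': "l' < u'" unfolding l'_def u'_def using ne by auto
  have gh: "?g (h t) = t" if "t \<in> {l'..u'}" for t
  proof -
    obtain x where "x \<in> {?l..?u}" "t = ?g x" using \<open>t \<in> {l'..u'}\<close> img by (metis imageE)
    then show ?thesis using hg by simp
  qed
  have "continuous_map (top_of_set {l'..u'}) (top_of_set {?l..?u}) h"
    using ch h1 by (auto simp: continuous_map_in_subtopology)
  then have "continuous_map (top_of_set {l'..u'}) T (arc_fun a \<circ> h)"
    using continuous_map_compose arc_systemD(6)[OF S] by blast
  moreover have "closed_arc b = closed_arc a" unfolding closed_arc_def b_def arc.sel h1[symmetric] by (simp add: image_image)
  moreover have "open_arc b = open_arc a" unfolding open_arc_def b_def arc.sel h2[symmetric] by (simp add: image_image)
  moreover have "{(arc_fun a \<circ> h) l', (arc_fun a \<circ> h) u'} = {arc_fun a ?l, arc_fun a ?u}"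
    using hg[of ?l] hg[of ?u] lu unfolding l'_def u'_def by (auto simp: min_def max_def)
  ultimately show ?thesis using lu' gh by (intro exI[of _ b]) (simp add: b_def)
qed

lemma monotone_arcs_exist:
  assumes S: "arc_system T W A" and nm: "\<And>p. p \<in> topspace T \<Longrightarrow> p \<notin> W \<Longrightarrow> \<not> local_min p \<and> \<not> local_max p"
  shows "\<exists>A'. monotone_arcs W A'"
proof -
  note D = arc_systemD[OF S]
  have "\<exists>b. arc_lo b < arc_hi b \<and> continuous_map (top_of_set {arc_lo b..arc_hi b}) T (arc_fun b) \<and>
     closed_arc b = closed_arc a \<and> open_arc b = open_arc a \<and> (\<forall>t\<in>{arc_lo b..arc_hi b}. f (arc_fun b t) = t) \<and>
     {arc_fun b (arc_lo b), arc_fun b (arc_hi b)} = {arc_fun a (arc_lo a), arc_fun a (arc_hi a)}" if a: "a \<in> A" for a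
  proof -
    have oa: "open_arc a \<subseteq> topspace T" using arc_subset_topspace(3)[OF S a] .
    have "\<And>p. p \<in> open_arc a \<Longrightarrow> \<not> local_min p \<and> \<not> local_max p" using nm oa D(10)[OF a] by blast
    from reparametrize_by_level[OF S a level_injective_on_arc[OF S a this]] show ?thesis .
  qed
  then have "\<forall>a\<in>A. \<exists>b. arc_lo b < arc_hi b \<and> continuous_map (top_of_set {arc_lo b..arc_hi b}) T (arc_fun b) \<and>
     closed_arc b = closed_arc a \<and> open_arc b = open_arc a \<and> (\<forall>t\<in>{arc_lo b..arc_hi b}. f (arc_fun b t) = t) \<and>
     {arc_fun b (arc_lo b), arc_fun b (arc_hi b)} = {arc_fun a (arc_lo a), arc_fun a (arc_hi a)}" by (rule ballI)
  from bchoice[OF this] obtain c where C: "\<forall>a\<in>A. arc_lo (c a) < arc_hi (c a) \<and> continuous_map (top_of_set {arc_lo (c a)..arc_hi (c a)}) T (arc_fun (c a)) \<and>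
     closed_arc (c a) = closed_arc a \<and> open_arc (c a) = open_arc a \<and> (\<forall>t\<in>{arc_lo (c a)..arc_hi (c a)}. f (arc_fun (c a) t) = t) \<and>
     {arc_fun (c a) (arc_lo (c a)), arc_fun (c a) (arc_hi (c a))} = {arc_fun a (arc_lo a), arc_fun a (arc_hi a)}" by (elim exE)
  note C' = C[THEN bspec]
  note c = C'[THEN conjunct1] C'[THEN conjunct2, THEN conjunct1] C'[THEN conjunct2, THEN conjunct2, THEN conjunct1]
      C'[THEN conjunct2, THEN conjunct2, THEN conjunct2, THEN conjunct1]
      C'[THEN conjunct2, THEN conjunct2, THEN conjunct2, THEN conjunct2, THEN conjunct1]
      C'[THEN conjunct2, THEN conjunct2, THEN conjunct2, THEN conjunct2, THEN conjunct2]
  have ends: "arc_fun (c a) (arc_lo (c a)) \<in> W" "arc_fun (c a) (arc_hi (c a)) \<in> W" if "a \<in> A" for a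
  proof -
    have "{arc_fun (c a) (arc_lo (c a)), arc_fun (c a) (arc_hi (c a))} \<subseteq> W"
      unfolding c(6)[OF that] using D(7,8)[OF that] by simp
    then show "arc_fun (c a) (arc_lo (c a)) \<in> W" "arc_fun (c a) (arc_hi (c a)) \<in> W" by simp_all
  qed
  have "arc_system T W (c ` A)"
    unfolding arc_system_def
  proof (intro conjI)
    show "finite W" "finite (c ` A)" "W \<subseteq> topspace T" using D(1-3) by auto
    show "topspace T = W \<union> (\<Union>b\<in>c ` A. closed_arc b)" using D(4) c(3) by simp
    show "\<forall>x\<in>c ` A. \<forall>y\<in>c ` A. x \<noteq> y \<longrightarrow> open_arc x \<inter> open_arc y = {}"
    proof (intro ballI impI)
      fix x y assume "x \<in> c ` A" "y \<in> c ` A" "x \<noteq> y"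
      then obtain a b where "a \<in> A" "b \<in> A" "x = c a" "y = c b" "a \<noteq> b" by blast
      then show "open_arc x \<inter> open_arc y = {}" using c(4) D(11) by simp
    qed
    show "\<forall>b\<in>c ` A. arc_lo b < arc_hi b \<and> continuous_map (top_of_set {arc_lo b..arc_hi b}) T (arc_fun b) \<and>
        arc_fun b (arc_lo b) \<in> W \<and> arc_fun b (arc_hi b) \<in> W \<and> inj_on (arc_fun b) {arc_lo b<..<arc_hi b} \<and> open_arc b \<inter> W = {}"
    proof
      fix b assume "b \<in> c ` A"
      then obtain a where a: "a \<in> A" "b = c a" by blast
      have "inj_on (arc_fun b) {arc_lo b<..<arc_hi b}"
        unfolding a(2) by (rule inj_on_inverseI[of _ f]) (use c(5)[OF a(1)] in simp)
      then show "arc_lo b < arc_hi b \<and> continuous_map (top_of_set {arc_lo b..arc_hi b}) T (arc_fun b) \<and>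
        arc_fun b (arc_lo b) \<in> W \<and> arc_fun b (arc_hi b) \<in> W \<and> inj_on (arc_fun b) {arc_lo b<..<arc_hi b} \<and> open_arc b \<inter> W = {}"
        using c(1,2)[OF a(1)] ends[OF a(1)] c(4)[OF a(1)] D(10)[OF a(1)] unfolding a(2) by simp
    qed
  qed
  moreover have "\<forall>b\<in>c ` A. \<forall>t\<in>{arc_lo b..arc_hi b}. f (arc_fun b t) = t" using c(5) by (intro ballI) auto
  ultimately show ?thesis unfolding monotone_arcs_def by blast
qed

lemma open_arc_homeomorphic_real:
  assumes M: "monotone_arcs W A" and a: "a \<in> A"
  shows "subtopology T (open_arc a) homeomorphic_space euclideanreal"
proof -
  note D = arc_systemD[OF monotone_arcsD(1)[OF M]]
  let ?s = "arc_fun a" and ?J = "{arc_lo a<..<arc_hi a}"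
  have oa: "open_arc a \<subseteq> topspace T" using D(4) a closed_arc_eq[of a] D(5)[OF a] by auto
  have fs: "f (?s t) = t" if "t \<in> ?J" for t using monotone_arcsD(2)[OF M a] that by auto
  have "continuous_map (subtopology T (open_arc a)) (top_of_set ?J) f"
    unfolding continuous_map_in_subtopology
    using continuous_map_from_subtopology[OF cont_f] fs unfolding open_arc_def by auto
  moreover have "continuous_map (top_of_set ?J) (subtopology T (open_arc a)) ?s"
    unfolding continuous_map_in_subtopology
  proof
    show "continuous_map (top_of_set ?J) T ?s"
      by (rule continuous_map_from_subtopology_mono[OF D(6)[OF a]]) auto
  qed (auto simp: open_arc_def)
  moreover have "?s (f q) = q" if "q \<in> open_arc a" for q using that fs unfolding open_arc_def by auto
  ultimately have "homeomorphic_maps (subtopology T (open_arc a)) (top_of_set ?J) f ?s"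
    unfolding homeomorphic_maps_def using fs by auto
  then have "subtopology T (open_arc a) homeomorphic_space top_of_set ?J" unfolding homeomorphic_space_def by blast
  then show ?thesis using open_interval_homeomorphic_real[OF D(5)[OF a]] homeomorphic_space_trans by blast
qed

lemma finite_top_graph_arc_system:
  assumes "finite_top_graph T"
  shows "\<exists>W A. arc_system T W A"
proof -
  obtain V I and \<gamma> :: "nat \<Rightarrow> real \<Rightarrow> 'b" where g: "finite V" "finite I" "V \<subseteq> topspace T"
    "\<And>i. i\<in>I \<Longrightarrow> continuous_map (top_of_set {0..1}) T (\<gamma> i) \<and> \<gamma> i 0 \<in> V \<and> \<gamma> i 1 \<in> V \<and>
                inj_on (\<gamma> i) {0<..<1} \<and> \<gamma> i ` {0<..<1} \<inter> V = {}"
    "\<And>i j. i\<in>I \<Longrightarrow> j\<in>I \<Longrightarrow> i \<noteq> j \<Longrightarrow> \<gamma> i ` {0<..<1} \<inter> \<gamma> j ` {0<..<1} = {}"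
    "topspace T = V \<union> (\<Union>i\<in>I. \<gamma> i ` {0..1})"
    using assms unfolding finite_top_graph_def by metis
  have "arc_system T V ((\<lambda>i. Arc 0 1 (\<gamma> i)) ` I)"
    unfolding arc_system_def using g(1-4,6)
    by (auto simp: open_arc_def closed_arc_def) (metis (no_types, lifting) g(5) disjoint_iff greaterThanLessThan_iff imageI)
  then show ?thesis by blast
qed

lemma monotone_arcs_on_vertices:
  assumes g: "finite_top_graph T" and z: "z \<in> topspace T"
    and nm: "\<And>p. p \<in> topspace T \<Longrightarrow> p \<noteq> z \<Longrightarrow> \<not> local_min p"
  defines "V \<equiv> {p \<in> topspace T. \<not> degree_two T p} \<union> {p \<in> topspace T. local_max p} \<union> {z}"
  shows "\<exists>A. monotone_arcs V A"
proof -
  obtain W0 A0 where S0: "arc_system T W0 A0" using finite_top_graph_arc_system[OF g] by blast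
  obtain A1 where S1: "arc_system T (({z} - W0) \<union> W0) A1"
    using split_system_finite[OF _ S0, of "{z} - W0"] z by blast
  let ?W1 = "({z} - W0) \<union> W0"
  let ?L = "{p \<in> topspace T - ?W1. local_max p}"
  have "finite ?L" by (rule finite_local_max[OF S1]) (use nm in auto)
  then obtain A2 where S2: "arc_system T (?L \<union> ?W1) A2" using split_system_finite[OF _ S1, of ?L] by blast
  let ?W = "?L \<union> ?W1"
  have "\<And>p. p \<in> topspace T \<Longrightarrow> p \<notin> ?W \<Longrightarrow> \<not> local_min p \<and> \<not> local_max p" using nm by auto
  then obtain A3 where M: "monotone_arcs ?W A3" using monotone_arcs_exist[OF S2] by blast
  note D = arc_systemD[OF monotone_arcsD(1)[OF M]]
  have "p \<in> ?W" if p: "p \<in> topspace T" "\<not> degree_two T p" for p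
  proof (rule ccontr)
    assume "p \<notin> ?W"
    then obtain a where a: "a \<in> A3" "p \<in> open_arc a" using arc_system_cases[OF monotone_arcsD(1)[OF M] p(1)] by metis
    have "openin T (open_arc a)" unfolding open_arc_def using open_subarc[OF Haus monotone_arcsD(1)[OF M] a(1)] by simp
    then show False using p(2) a open_arc_homeomorphic_real[OF M a(1)] unfolding degree_two_def by blast
  qed
  then have VW: "V \<subseteq> ?W" unfolding V_def by auto
  have "\<exists>A'. monotone_arcs (?W - (?W - V)) A' \<and> card A' + card (?W - V) = card A3"
  proof (rule remove_degree_two_vertices[OF _ M])
    show "degree_two T w \<and> \<not> local_min w \<and> \<not> local_max w" if "w \<in> ?W - V" for w
      using that D(3) nm unfolding V_def by auto
  qed (use D(1) in auto)
  moreover have "?W - (?W - V) = V" using VW by auto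
  ultimately show ?thesis by auto
qed

text \<open>In the complement of the vertices an open arc is open, and it is closed as the trace of
  its closed arc. Being connected, it is a component, so the arcs are in bijection with the edges
  that the Reeb graph has by definition.\<close>

lemma connected_components_arcs:
  assumes M: "monotone_arcs V A"
  shows "connected_components_of (subtopology T (topspace T - V)) = open_arc ` A" "inj_on open_arc A"
    "\<And>a. a \<in> A \<Longrightarrow> T closure_of (open_arc a) = closed_arc a"
proof -
  note S = monotone_arcsD(1)[OF M]
  note D = arc_systemD[OF S]
  let ?Y = "subtopology T (topspace T - V)"
  have ne: "open_arc a \<noteq> {}" if "a \<in> A" for a using D(5)[OF that] unfolding open_arc_def by auto
  show "inj_on open_arc A" 
  proof (rule inj_onI, rule ccontr)
    fix a b assume "a \<in> A" "b \<in> A" "open_arc a = open_arc b" "a \<noteq> b"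
    then show False using D(11)[of a b] ne[of a] by simp
  qed
  have oa: "open_arc a \<subseteq> topspace T - V" if "a \<in> A" for a
    using arc_subset_topspace(3)[OF S that] D(10)[OF that] by (simp add: disjoint_eq_subset_Compl Diff_eq)
  have con: "connectedin T (open_arc a)" if "a \<in> A" for a
  proof -
    have "connectedin (top_of_set {arc_lo a..arc_hi a}) {arc_lo a<..<arc_hi a}" 
      by (auto simp: connectedin_subtopology)
    then show ?thesis unfolding open_arc_def using connectedin_continuous_map_image D(6)[OF that] by blast
  qed
  have comp: "connected_component_of_set ?Y x = open_arc a" if a: "a \<in> A" "x \<in> open_arc a" for a x
  proof
    have cl: "closedin ?Y (open_arc a)"
    proof -
      have "open_arc a = closed_arc a \<inter> (topspace T - V)"
        using oa[OF a(1)] closed_arc_eq[of a] D(5,7,8)[OF a(1)] by auto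
      then show ?thesis using closedin_closed_arc[OF Haus S a(1)] by (auto simp: closedin_subtopology)
    qed
    have op: "openin ?Y (open_arc a)"
      using open_subarc[OF Haus S a(1), of "arc_lo a" "arc_hi a"] oa[OF a(1)] unfolding open_arc_def[symmetric]
      by (auto simp: openin_subtopology)
    have xY: "x \<in> topspace ?Y" using a(2) oa[OF a(1)] by auto
    have "connectedin ?Y (connected_component_of_set ?Y x)" by (rule connectedin_connected_component_of)
    from connectedin_clopen_cases[OF this cl op] show "connected_component_of_set ?Y x \<subseteq> open_arc a"
      using a(2) xY connected_component_of_refl[of ?Y x] unfolding disjnt_def by blast
    have "connectedin ?Y (open_arc a)" using con[OF a(1)] oa[OF a(1)] by (simp add: connectedin_subtopology)
    then show "open_arc a \<subseteq> connected_component_of_set ?Y x" using a(2) by (rule connected_component_of_maximal)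
  qed
  show "connected_components_of ?Y = open_arc ` A"
  proof
    show "connected_components_of ?Y \<subseteq> open_arc ` A"
    proof
      fix C assume "C \<in> connected_components_of ?Y"
      then obtain x where x: "x \<in> topspace T" "x \<notin> V" "C = connected_component_of_set ?Y x"
        unfolding connected_components_of_def by auto
      then obtain a where "a \<in> A" "x \<in> open_arc a" using arc_system_cases[OF S] by metis
      then show "C \<in> open_arc ` A" using comp x(3) by auto
    qed
    show "open_arc ` A \<subseteq> connected_components_of ?Y"
    proof
      fix C assume "C \<in> open_arc ` A"
      then obtain a where a: "a \<in> A" "C = open_arc a" by auto
      then obtain x where x: "x \<in> open_arc a" using ne by auto
      then have "x \<in> topspace ?Y" using oa[OF a(1)] by auto
      then show "C \<in> connected_components_of ?Y" unfolding connected_components_of_def using comp[OF a(1) x] a(2) by auto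
    qed
  qed
  show "T closure_of (open_arc a) = closed_arc a" if a: "a \<in> A" for a
  proof
    show "T closure_of open_arc a \<subseteq> closed_arc a"
      using closedin_closed_arc[OF Haus S a] closed_arc_eq[of a] D(5)[OF a] by (intro closure_of_minimal) auto
    have "arc_fun a ` (top_of_set {arc_lo a..arc_hi a} closure_of {arc_lo a<..<arc_hi a}) \<subseteq> T closure_of (arc_fun a ` {arc_lo a<..<arc_hi a})"
      using D(6)[OF a] continuous_map_image_closure_subset by blast
    moreover have "top_of_set {arc_lo a..arc_hi a} closure_of {arc_lo a<..<arc_hi a} = {arc_lo a..arc_hi a}"
    proof -
      have "{arc_lo a..arc_hi a} \<inter> {arc_lo a<..<arc_hi a} = {arc_lo a<..<arc_hi a}" by auto
      then show ?thesis using closure_greaterThanLessThan[OF D(5)[OF a]] by (simp add: closure_of_subtopology)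
    qed
    ultimately show "closed_arc a \<subseteq> T closure_of open_arc a" unfolding closed_arc_def open_arc_def by simp
  qed
qed

end

lemma sum_concat_partition:
  fixes g :: "'c \<Rightarrow> 'c \<Rightarrow> real"
  assumes "t n = t' 0"
  defines "u \<equiv> (\<lambda>i. if i \<le> n then t i else t' (i - n))"
  shows "(\<Sum>i<n + k. g (u i) (u (Suc i))) = (\<Sum>i<n. g (t i) (t (Suc i))) + (\<Sum>i<k. g (t' i) (t' (Suc i)))"
proof (induction k)
  case 0
  have "(\<Sum>i<n. g (u i) (u (Suc i))) = (\<Sum>i<n. g (t i) (t (Suc i)))"
    by (rule sum.cong) (simp_all add: u_def)
  then show ?case by simp
next
  case (Suc k)
  have 1: "u (n + k) = t' k"
  proof (cases "k = 0")
    case True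
    then show ?thesis unfolding u_def using assms(1) by simp
  next
    case False
    then have "\<not> n + k \<le> n" by simp
    then show ?thesis unfolding u_def by simp
  qed
  have "\<not> Suc (n + k) \<le> n" by simp
  then have 2: "u (Suc (n + k)) = t' (Suc k)" unfolding u_def by simp
  have "(\<Sum>i<n + Suc k. g (u i) (u (Suc i))) = (\<Sum>i<n + k. g (u i) (u (Suc i))) + g (u (n + k)) (u (Suc (n + k)))"
    by (simp only: add_Suc_right sum.lessThan_Suc)
  also have "\<dots> = (\<Sum>i<n. g (t i) (t (Suc i))) + (\<Sum>i<k. g (t' i) (t' (Suc i))) + g (t' k) (t' (Suc k))"
    by (simp only: Suc.IH 1 2)
  finally show ?case by (simp only: sum.lessThan_Suc add.assoc)
qed

section \<open>The Reeb graph\<close>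

locale path_metric =
  fixes m :: "'a metric"
  assumes compact: "compact_space (mtopology_of m)"
    and connected: "connected_space (mtopology_of m)"
    and pms: "path_metric_space m"
begin

sublocale M: Metric_space "mspace m" "mdist m"
  by (rule Metric_space_mspace_mdist)

text \<open>The length of \<open>c\<close> exceeds the distance of its ends by at most \<delta>. It
  is expressed by the partition sums, which keeps all later estimates in the reals.\<close>

definition near_geodesic :: "'a \<Rightarrow> 'a \<Rightarrow> real \<Rightarrow> (real \<Rightarrow> 'a) \<Rightarrow> bool" where
  "near_geodesic x y \<delta> c \<longleftrightarrow> pathin (mtopology_of m) c \<and> c 0 = x \<and> c 1 = y \<and>
    (\<forall>n t. (\<forall>i\<le>n. t i \<in> {0..1}) \<longrightarrow> (\<forall>i<n. t i \<le> t (Suc i)) \<longrightarrow>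
       (\<Sum>i<n. mdist m (c (t i)) (c (t (Suc i)))) \<le> mdist m x y + \<delta>)"

lemma near_geodesic_exists:
  assumes "x \<in> mspace m" "y \<in> mspace m" "0 < \<delta>"
  shows "\<exists>c. near_geodesic x y \<delta> c"
proof -
  have "(INF c \<in> {c. continuous_map (top_of_set {0..1}) (mtopology_of m) c \<and> c 0 = x \<and> c 1 = y}. curve_length m c) < ereal (mdist m x y + \<delta>)"
  proof -
    have "ereal (mdist m x y) = (INF c \<in> {c. continuous_map (top_of_set {0..1}) (mtopology_of m) c \<and> c 0 = x \<and> c 1 = y}. curve_length m c)"
      using pms[unfolded path_metric_space_def, THEN bspec, THEN bspec, OF assms(1,2)] .
    moreover have "ereal (mdist m x y) < ereal (mdist m x y + \<delta>)" using assms(3) by simp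
    ultimately show ?thesis by (simp only:)
  qed
  then obtain c where c: "continuous_map (top_of_set {0..1}) (mtopology_of m) c" "c 0 = x" "c 1 = y"
    "curve_length m c < ereal (mdist m x y + \<delta>)" unfolding INF_less_iff by auto
  have "(\<Sum>i<n. mdist m (c (t i)) (c (t (Suc i)))) \<le> mdist m x y + \<delta>"
    if t: "\<forall>i\<le>n. t i \<in> {0..1}" "\<forall>i<n. t i \<le> t (Suc i)" for n :: nat and t :: "nat \<Rightarrow> real"
  proof -
    have "ereal (\<Sum>i<n. mdist m (c (t i)) (c (t (Suc i)))) \<le> curve_length m c"
      unfolding curve_length_def by (rule SUP_upper2[of "(n, t)"]) (use t in auto)
    then have "ereal (\<Sum>i<n. mdist m (c (t i)) (c (t (Suc i)))) < ereal (mdist m x y + \<delta>)" using c(4) by (rule order_le_less_trans)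
    then show ?thesis by simp
  qed
  then have "near_geodesic x y \<delta> c" unfolding near_geodesic_def pathin_def using c(1-3) by blast
  show ?thesis by (rule exI[where x = c]) fact
qed

lemma pathin_mspace: "pathin (mtopology_of m) c \<Longrightarrow> s \<in> {0..1} \<Longrightarrow> c s \<in> mspace m"
  unfolding pathin_def continuous_map_def by auto

lemma near_geodesic_two_legs:
  assumes "near_geodesic x y \<delta> c" "s \<in> {0..1}"
  shows "mdist m x (c s) + mdist m (c s) y \<le> mdist m x y + \<delta>"
proof -
  have c: "c 0 = x" "c 1 = y" using assms(1) unfolding near_geodesic_def by blast+
  define t where "t = (\<lambda>i::nat. if i = 0 then 0 else if i = 1 then s else 1)"
  have "\<forall>i\<le>2. t i \<in> {0..1}" "\<forall>i<2. t i \<le> t (Suc i)" using assms(2) unfolding t_def by auto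
  then have "(\<Sum>i<2. mdist m (c (t i)) (c (t (Suc i)))) \<le> mdist m x y + \<delta>"
    using assms(1) unfolding near_geodesic_def by blast
  moreover have "t 0 = 0" "t (Suc 0) = s" "t (Suc (Suc 0)) = 1" unfolding t_def by auto
  ultimately show ?thesis using c by (simp add: numeral_2_eq_2)
qed

lemma near_geodesicD:
  assumes "near_geodesic x y \<delta> c"
  shows "pathin (mtopology_of m) c" "c 0 = x" "c 1 = y"
  using assms unfolding near_geodesic_def by blast+

end

section \<open>The quotient topology and its graph structure\<close>

locale reeb_space = path_metric m for m :: "'a metric" +
  fixes r :: 'a
  assumes r: "r \<in> mspace m"
    and graph: "finite_top_graph (reeb_top m r)"
begin

abbreviation lvl :: "'a \<Rightarrow> real" where "lvl x \<equiv> mdist m r x"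
abbreviation proj :: "'a \<Rightarrow> 'a set" where "proj \<equiv> reeb_proj m r"
abbreviation T :: "'a set topology" where "T \<equiv> reeb_top m r"
abbreviation f :: "'a set \<Rightarrow> real" where "f \<equiv> reeb_dstar m r"

lemma reeb_rel_refl: "x \<in> mspace m \<Longrightarrow> reeb_rel m r x x"
  unfolding reeb_rel_def by (simp add: path_component_of_refl)

lemma reeb_rel_sym: "reeb_rel m r x y \<Longrightarrow> reeb_rel m r y x"
  unfolding reeb_rel_def by (auto intro: path_component_of_sym)

lemma reeb_rel_trans: "reeb_rel m r x y \<Longrightarrow> reeb_rel m r y z \<Longrightarrow> reeb_rel m r x z"
  unfolding reeb_rel_def using path_component_of_trans by fastforce

lemma proj_eq_iff: "x \<in> mspace m \<Longrightarrow> y \<in> mspace m \<Longrightarrow> proj x = proj y \<longleftrightarrow> reeb_rel m r x y"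
  unfolding reeb_proj_def using reeb_rel_refl reeb_rel_sym reeb_rel_trans by blast

lemma mem_proj: "x \<in> mspace m \<Longrightarrow> x \<in> proj x"
  unfolding reeb_proj_def using reeb_rel_refl by simp

lemma mem_reeb_G:
  assumes "p \<in> reeb_G m r" "x \<in> p"
  shows "x \<in> mspace m" "proj x = p"
proof -
  obtain y where y: "y \<in> mspace m" "p = proj y" using assms(1) unfolding reeb_G_def by auto
  then have "reeb_rel m r y x" using assms(2) unfolding reeb_proj_def by simp
  then show "x \<in> mspace m" unfolding reeb_rel_def by simp
  then show "proj x = p" using proj_eq_iff y reeb_rel_sym[OF \<open>reeb_rel m r y x\<close>] by simp
qed

lemma proj_in_G: "x \<in> mspace m \<Longrightarrow> proj x \<in> reeb_G m r"
  unfolding reeb_G_def by simp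

lemma mem_proj_iff: "p \<in> reeb_G m r \<Longrightarrow> x \<in> p \<longleftrightarrow> x \<in> mspace m \<and> proj x = p"
  using mem_reeb_G mem_proj by blast

lemma f_proj: assumes "x \<in> mspace m" shows "f (proj x) = lvl x"
proof -
  have "(SOME y. y \<in> proj x) \<in> proj x" using mem_proj[OF assms] by (rule someI)
  then have "reeb_rel m r x (SOME y. y \<in> proj x)" unfolding reeb_proj_def by simp
  then show ?thesis unfolding reeb_dstar_def reeb_rel_def by simp
qed

lemma openin_T: "openin T U \<longleftrightarrow> U \<subseteq> reeb_G m r \<and> openin (mtopology_of m) {x \<in> mspace m. proj x \<in> U}"
proof -
  have "istopology (\<lambda>U. U \<subseteq> reeb_G m r \<and> openin (mtopology_of m) {x \<in> mspace m. proj x \<in> U})"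
    unfolding istopology_def
  proof (intro conjI allI impI)
    fix S U assume "S \<subseteq> reeb_G m r \<and> openin (mtopology_of m) {x \<in> mspace m. proj x \<in> S}"
      and "U \<subseteq> reeb_G m r \<and> openin (mtopology_of m) {x \<in> mspace m. proj x \<in> U}"
    moreover have "{x \<in> mspace m. proj x \<in> S \<inter> U} = {x \<in> mspace m. proj x \<in> S} \<inter> {x \<in> mspace m. proj x \<in> U}" by auto
    ultimately show "S \<inter> U \<subseteq> reeb_G m r" "openin (mtopology_of m) {x \<in> mspace m. proj x \<in> S \<inter> U}" by auto
  next
    fix \<K> assume "\<forall>K\<in>\<K>. K \<subseteq> reeb_G m r \<and> openin (mtopology_of m) {x \<in> mspace m. proj x \<in> K}"
    moreover have "{x \<in> mspace m. proj x \<in> \<Union>\<K>} = (\<Union>K\<in>\<K>. {x \<in> mspace m. proj x \<in> K})" by auto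
    ultimately show "\<Union>\<K> \<subseteq> reeb_G m r" "openin (mtopology_of m) {x \<in> mspace m. proj x \<in> \<Union>\<K>}" by auto
  qed
  then show ?thesis unfolding reeb_top_def by simp
qed

lemma topspace_T: "topspace T = reeb_G m r"
proof -
  have "{x \<in> mspace m. proj x \<in> reeb_G m r} = topspace (mtopology_of m)" using proj_in_G by auto
  then have "openin T (reeb_G m r)" unfolding openin_T using openin_topspace[of "mtopology_of m"] by simp
  then show ?thesis using openin_T openin_subset openin_topspace by (metis subset_antisym)
qed

lemma continuous_proj: "continuous_map (mtopology_of m) T proj"
  unfolding continuous_map_def using openin_T topspace_T proj_in_G by auto

lemma continuous_lvl: "continuous_map (mtopology_of m) euclideanreal lvl"
  using r by (intro continuous_map_mdist) auto

lemma continuous_f: "continuous_map T euclideanreal f"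
proof -
  have "openin T {p \<in> topspace T. f p \<in> U}" if "open U" for U
  proof -
    have "{x \<in> mspace m. proj x \<in> {p \<in> topspace T. f p \<in> U}} = {x \<in> topspace (mtopology_of m). lvl x \<in> U}"
      using f_proj proj_in_G topspace_T by auto
    then show ?thesis unfolding openin_T using continuous_lvl that topspace_T unfolding continuous_map_def by auto
  qed
  then show ?thesis unfolding continuous_map_def by auto
qed

sublocale level_space T f
  using graph continuous_f unfolding finite_top_graph_def by unfold_locales auto

lemma f_nonneg: "p \<in> reeb_G m r \<Longrightarrow> 0 \<le> f p"
  unfolding reeb_G_def using f_proj by auto

lemma f_root: "f (proj r) = 0" using f_proj[OF r] r by simp

lemma f_zero: "p \<in> reeb_G m r \<Longrightarrow> f p = 0 \<Longrightarrow> p = proj r"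
  unfolding reeb_G_def using f_proj r by auto

text \<open>Along a curve to \<open>r\<close> that is almost shortest up to \<open>h/2\<close>, the
  level has dropped by at least \<open>h/2\<close> once the distance from \<open>x\<close> is
  \<open>h\<close>.\<close>

lemma not_local_min:
  assumes p: "p \<in> topspace T" "p \<noteq> proj r"
  shows "\<not> local_min p"
proof
  assume "local_min p"
  then obtain U where U: "openin T U" "p \<in> U" "\<And>q. q \<in> U \<Longrightarrow> f p \<le> f q" unfolding local_min_def by blast
  obtain x where x: "x \<in> mspace m" "p = proj x" using p(1) topspace_T unfolding reeb_G_def by auto
  have "openin M.mtopology {y \<in> mspace m. proj y \<in> U}" using U(1) unfolding openin_T mtopology_of_def by simp
  then obtain e where e: "e > 0" "M.mball x e \<subseteq> {y \<in> mspace m. proj y \<in> U}"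
    using U(2) x unfolding M.openin_mtopology by blast
  have pos: "0 < lvl x" using x r p(2) by (metis M.mdist_pos_eq)
  define h where "h = min e (lvl x) / 2"
  have h: "0 < h" "h < e" "h < lvl x" unfolding h_def using e(1) pos by auto
  obtain c where ng: "near_geodesic x r (h/2) c" using near_geodesic_exists[OF x(1) r, of "h/2"] h by auto
  note c = near_geodesicD[OF ng] near_geodesic_two_legs[OF ng]
  have "continuous_map (top_of_set {0..1}) euclideanreal (\<lambda>s. mdist m x (c s))"
    using c(1) x(1) unfolding pathin_def by (intro continuous_map_mdist) auto
  then have "continuous_on {0..1} (\<lambda>s. mdist m x (c s))" by simp
  moreover have "mdist m x (c 0) \<le> h" "h \<le> mdist m x (c 1)" using c(2,3) x h by (auto simp: M.commute)
  ultimately obtain s where s: "0 \<le> s" "s \<le> 1" "mdist m x (c s) = h" using IVT'[of "\<lambda>s. mdist m x (c s)" 0 h 1] by auto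
  have cs: "c s \<in> mspace m" using pathin_mspace c(1) s by auto
  have "proj (c s) \<in> U" using e(2) s(3) h x(1) cs by auto
  then have "lvl x \<le> lvl (c s)" using U(3) f_proj cs x by metis
  moreover have "mdist m x (c s) + mdist m (c s) r \<le> mdist m x r + h/2" using c(4) s by auto
  ultimately show False using s(3) h(1) by (simp add: M.commute)
qed

definition arcs :: "'a set arc set" where
  "arcs = (SOME A. monotone_arcs (reeb_vertices m r) A)"

lemma monotone_arcs: "monotone_arcs (reeb_vertices m r) arcs"
proof -
  have z: "proj r \<in> topspace T" using topspace_T proj_in_G r by simp
  have "reeb_vertices m r = {p \<in> topspace T. \<not> degree_two T p} \<union> {p \<in> topspace T. local_max p} \<union> {proj r}"
    unfolding reeb_vertices_def topspace_T reeb_local_max_def local_max_def by auto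
  then have "\<exists>A. monotone_arcs (reeb_vertices m r) A"
    using monotone_arcs_on_vertices[OF graph z not_local_min] by simp
  then show ?thesis unfolding arcs_def by (rule someI_ex)
qed

lemmas arc_sys = monotone_arcsD(1)[OF monotone_arcs]
lemmas arcsD = arc_systemD[OF arc_sys]

lemma reeb_edges_eq: "reeb_edges m r = open_arc ` arcs"
  unfolding reeb_edges_def using connected_components_arcs(1)[OF monotone_arcs] topspace_T by simp

lemma reeb_betti1_eq: "reeb_betti1 m r = int (card arcs) - int (card (reeb_vertices m r)) + 1"
proof -
  have "connected_space T"
  proof -
    have "connectedin T (proj ` topspace (mtopology_of m))"
      using connectedin_continuous_map_image[OF continuous_proj] connected unfolding connectedin_topspace[symmetric] by blast
    then show ?thesis unfolding connectedin_topspace[symmetric] topspace_T reeb_G_def by simp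
  qed
  moreover have "topspace T \<noteq> {}" using topspace_T proj_in_G r by auto
  ultimately have "connected_components_of T = {topspace T}"
    unfolding connected_components_of_eq_singleton by auto
  moreover have "card (reeb_edges m r) = card arcs"
    unfolding reeb_edges_eq using connected_components_arcs(2)[OF monotone_arcs] by (rule card_image)
  ultimately show ?thesis unfolding reeb_betti1_def by simp
qed

lemma arc_points:
  assumes "a \<in> arcs" "p \<in> closed_arc a"
  shows "p \<in> reeb_G m r"
  using arc_subset_topspace(1)[OF arc_sys assms(1)] assms(2) topspace_T by auto

lemma G_nonempty: "p \<in> reeb_G m r \<Longrightarrow> \<exists>x. x \<in> p" unfolding reeb_G_def using mem_proj by auto

lemma closedin_class:
  assumes "p \<in> reeb_G m r"
  shows "closedin (mtopology_of m) p"
proof -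
  have "closedin T {p}" using Haus assms topspace_T by (simp add: closedin_Hausdorff_singleton)
  then have "closedin (mtopology_of m) {x \<in> topspace (mtopology_of m). proj x \<in> {p}}"
    using closedin_continuous_map_preimage[OF continuous_proj] by blast
  moreover have "{x \<in> topspace (mtopology_of m). proj x \<in> {p}} = p" using mem_proj_iff[OF assms] by auto
  ultimately show ?thesis by simp
qed

lemma connectedin_class:
  assumes "p \<in> reeb_G m r"
  shows "connectedin (mtopology_of m) p"
proof -
  obtain x where x: "x \<in> mspace m" "p = proj x" using assms unfolding reeb_G_def by auto
  let ?S = "subtopology (mtopology_of m) {z \<in> mspace m. lvl z = lvl x}"
  have "p = path_component_of_set ?S x"
  proof -
    have "reeb_rel m r x y \<longleftrightarrow> path_component_of ?S x y" for y
      using x(1) path_component_in_topspace[of ?S x y] unfolding reeb_rel_def by auto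
    then show ?thesis unfolding x(2) reeb_proj_def by auto
  qed
  then have "path_connectedin ?S p" using path_connectedin_path_component_of by metis
  then show ?thesis using path_connectedin_imp_connectedin by (metis path_connectedin_subtopology)
qed

section \<open>Classes on shortest ways to the root\<close>

text \<open>The level is 1-Lipschitz, so the inequality is an equality: some point of the class
  \<open>q\<close> lies metrically between \<open>x\<close> and \<open>r\<close>. This replaces the
  statement that a shortest curve from \<open>x\<close> to \<open>r\<close> passes through
  \<open>q\<close>.\<close>

definition descends :: "'a set \<Rightarrow> 'a set" where
  "descends q = {x \<in> mspace m. \<exists>y\<in>q. mdist m x y \<le> lvl x - f q}"

text \<open>The set is the projection of a closed set of pairs along a compact factor. Closedness
  serves both for passing to limits along an arc and for the connectedness of a class.\<close>

lemma closedin_descends: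
  assumes "q \<in> reeb_G m r"
  shows "closedin (mtopology_of m) (descends q)"
proof -
  let ?X = "mtopology_of m"
  let ?P = "prod_topology ?X ?X"
  have "continuous_map ?P euclideanreal (\<lambda>z. lvl (fst z) - f q - mdist m (fst z) (snd z))"
    using r by (intro continuous_map_diff continuous_map_mdist) (auto intro: continuous_map_fst continuous_map_snd)
  then have 1: "closedin ?P {z \<in> topspace ?P. lvl (fst z) - f q - mdist m (fst z) (snd z) \<in> {0..}}"
    by (rule closedin_continuous_map_preimage) simp
  have 2: "closedin ?P {z \<in> topspace ?P. snd z \<in> q}"
    by (rule closedin_continuous_map_preimage[OF continuous_map_snd closedin_class[OF assms]])
  have "closedin ?X (fst ` ({z \<in> topspace ?P. lvl (fst z) - f q - mdist m (fst z) (snd z) \<in> {0..}} \<inter> {z \<in> topspace ?P. snd z \<in> q}))"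
    using Abstract_Topological_Spaces.closed_map_fst[OF compact, of ?X] closedin_Int[OF 1 2] unfolding closed_map_def by blast
  moreover have "fst ` ({z \<in> topspace ?P. lvl (fst z) - f q - mdist m (fst z) (snd z) \<in> {0..}} \<inter> {z \<in> topspace ?P. snd z \<in> q}) = descends q"
    unfolding descends_def using mem_reeb_G(1)[OF assms] by (force simp: image_iff)
  ultimately show ?thesis by simp
qed

lemma dist_to_class_attained:
  assumes q: "q \<in> reeb_G m r" and x: "x \<in> mspace m" and c: "\<And>y. y \<in> q \<Longrightarrow> k < mdist m x y"
  shows "\<exists>\<delta>>0. \<forall>y\<in>q. k + \<delta> < mdist m x y"
proof -
  have "compactin (mtopology_of m) q" using closedin_compact_space[OF compact closedin_class[OF q]] .
  moreover have "continuous_map (mtopology_of m) euclideanreal (mdist m x)" using x by (intro continuous_map_mdist) auto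
  ultimately have "compact (mdist m x ` q)" using image_compactin by fastforce
  moreover have "mdist m x ` q \<noteq> {}" using G_nonempty[OF q] by auto
  ultimately obtain y where y: "y \<in> q" "\<And>y'. y' \<in> q \<Longrightarrow> mdist m x y \<le> mdist m x y'"
    using compact_attains_inf[of "mdist m x ` q"] by auto
  show ?thesis
    by (rule exI[of _ "(mdist m x y - k)/2"]) (use c[OF y(1)] y(2) in \<open>force simp: field_simps\<close>)
qed


text \<open>If no class \<open>q a\<close> lay on a shortest way from \<open>x\<close>, then by
  compactness each would cost a definite amount more than the levels allow. A sufficiently short
  curve from \<open>x\<close> to \<open>r\<close> would then miss them all without climbing to the
  top of an ascending arc, and with the classes \<open>q a\<close> as barriers it could never get
  down to \<open>r\<close>.\<close>

lemma descend:
  assumes x: "x \<in> mspace m" "proj x \<noteq> proj r"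
    and q: "\<And>a. a \<in> down_arcs arcs (proj x) \<Longrightarrow> q a \<in> closed_arc a \<and> f (q a) < lvl x"
  shows "\<exists>a\<in>down_arcs arcs (proj x). x \<in> descends (q a)"
proof (rule ccontr)
  assume no: "\<not> ?thesis"
  let ?p = "proj x"
  have p: "?p \<in> reeb_G m r" using proj_in_G x by simp
  have fin: "finite (down_arcs arcs ?p)" "finite (up_arcs arcs ?p)" using arcsD(2) unfolding down_arcs_def up_arcs_def by auto
  have qG: "q a \<in> reeb_G m r" if "a \<in> down_arcs arcs ?p" for a
    using arc_points q[OF that] that unfolding down_arcs_def by blast
  have "\<exists>\<delta>>0. \<forall>y\<in>q a. lvl x - f (q a) + \<delta> < mdist m x y" if a: "a \<in> down_arcs arcs ?p" for a
    by (rule dist_to_class_attained[OF qG[OF a] x(1)]) (use no a x(1) in \<open>auto simp: descends_def not_le\<close>)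
  then obtain \<delta> where \<delta>: "\<And>a. a \<in> down_arcs arcs ?p \<Longrightarrow> 0 < \<delta> a"
    "\<And>a y. a \<in> down_arcs arcs ?p \<Longrightarrow> y \<in> q a \<Longrightarrow> lvl x - f (q a) + \<delta> a < mdist m x y" by metis
  \<comment> \<open>The allowed excess stays below every gap \<delta>, so no barrier can be hit, and
    below the room that is left on the ascending arcs. Adding \<open>1\<close> to the set keeps it
    nonempty when there are no arcs above or below.\<close>
  have "\<exists>e>0. (\<forall>a\<in>down_arcs arcs ?p. e < \<delta> a) \<and> (\<forall>b\<in>up_arcs arcs ?p. e < arc_hi b - lvl x)"
  proof -
    let ?S = "\<delta> ` down_arcs arcs ?p \<union> (\<lambda>b. arc_hi b - lvl x) ` up_arcs arcs ?p \<union> {1}"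
    have pos: "0 < s" if "s \<in> ?S" for s
      using that \<delta>(1) up_arcs_iff[OF monotone_arcs] f_proj[OF x(1)] by auto
    have fS: "finite ?S" using fin by simp
    have "?S \<noteq> {}" by simp
    then have M0: "0 < Min ?S" using pos Min_in[OF fS] by blast
    have lt: "Min ?S / 2 < s" if "s \<in> ?S" for s
    proof -
      have "Min ?S \<le> s" using Min_le[OF fS that] .
      then show ?thesis using M0 by linarith
    qed
    show ?thesis
    proof (intro exI[of _ "Min ?S / 2"] conjI ballI)
      show "0 < Min ?S / 2" using M0 by simp
    qed (rule lt, simp)+
  qed
  then obtain e where e: "e > 0" "\<And>a. a \<in> down_arcs arcs ?p \<Longrightarrow> e < \<delta> a" "\<And>b. b \<in> up_arcs arcs ?p \<Longrightarrow> e < arc_hi b - lvl x"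
    by blast
  obtain c where ng: "near_geodesic x r e c" using near_geodesic_exists[OF x(1) r e(1)] by blast
  note c = near_geodesicD[OF ng] near_geodesic_two_legs[OF ng]
  have cX: "c s \<in> mspace m" if "s \<in> {0..1}" for s using pathin_mspace[OF c(1) that] .
  have leg: "mdist m x (c s) + lvl (c s) \<le> lvl x + e" if "s \<in> {0..1}" for s
    using c(4)[OF that] by (simp add: M.commute)
  have path: "pathin T (proj \<circ> c)" using c(1) continuous_proj unfolding pathin_def by (rule continuous_map_compose)
  have "(proj \<circ> c) 1 = ?p \<or> (\<exists>a\<in>down_arcs arcs ?p. (proj \<circ> c) 1 \<in> closed_arc a \<and> f (q a) < f ((proj \<circ> c) 1))
      \<or> (\<exists>b\<in>up_arcs arcs ?p. (proj \<circ> c) 1 \<in> closed_arc b \<and> f ?p \<le> f ((proj \<circ> c) 1))"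
  proof (rule path_must_descend[OF monotone_arcs path])
    show "(proj \<circ> c) 0 = ?p" using c(2) by simp
    show "arc_lo a \<le> f (q a) \<and> f (q a) < f ?p" if "a \<in> down_arcs arcs ?p" for a
      using q[OF that] closed_arcD(2)[OF monotone_arcs, of a "q a"] that f_proj[OF x(1)] unfolding down_arcs_def by auto
    show "f ((proj \<circ> c) s) < arc_hi b" if "s \<in> {0..1}" "b \<in> up_arcs arcs ?p" for s b
      using leg[OF that(1)] e(3)[OF that(2)] f_proj[OF cX[OF that(1)]] M.nonneg[of x "c s"] unfolding comp_def by linarith
    show "(proj \<circ> c) s \<noteq> arc_fun a (f (q a))" if s: "s \<in> {0..1}" and a: "a \<in> down_arcs arcs ?p" for s a
    proof
      assume "(proj \<circ> c) s = arc_fun a (f (q a))"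
      also have "\<dots> = q a" using closed_arcD(1)[OF monotone_arcs, of a "q a"] q[OF a] a unfolding down_arcs_def by auto
      finally have eq: "proj (c s) = q a" by simp
      then have "c s \<in> q a" using mem_proj[OF cX[OF s]] by simp
      then have "lvl x - f (q a) + \<delta> a < mdist m x (c s)" using \<delta>(2) a by blast
      moreover have "lvl (c s) = f (q a)" using f_proj[OF cX[OF s]] eq by simp
      ultimately show False using leg[OF s] e(2)[OF a] by simp
    qed
  qed
  moreover have "(proj \<circ> c) 1 = proj r" using c(3) by simp
  ultimately consider "?p = proj r" | a where "a \<in> down_arcs arcs ?p" "f (q a) < 0" | "f ?p \<le> 0"
    using f_root by auto
  then show False
  proof cases
    case (2 a)
    then show ?thesis using f_nonneg[OF qG[OF 2(1)]] by simp
  next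
    case 3
    then have "f ?p = 0" using f_nonneg[OF p] by simp
    then show ?thesis using f_zero[OF p] x(2) by simp
  qed (use x in simp)
qed

text \<open>At the points strictly between \<open>q\<close> and \<open>p\<close> only one arc
  descends, so every element of their classes descends to \<open>q\<close>. The point
  \<open>p\<close> is a limit of them, and the image of the compact set \<open>descends q\<close> is
  closed.\<close>

lemma ex_descends:
  assumes a: "a \<in> arcs" "p \<in> closed_arc a" "q \<in> closed_arc a" "f q < f p"
  shows "\<exists>x\<in>p. x \<in> descends q"
proof -
  have pG: "p \<in> reeb_G m r" and qG: "q \<in> reeb_G m r" using arc_points a by blast+
  note pa = closed_arcD[OF monotone_arcs a(1,2)] and qa = closed_arcD[OF monotone_arcs a(1,3)]
  have "compactin T (proj ` descends q)"
    using image_compactin[OF closedin_compact_space[OF compact closedin_descends[OF qG]] continuous_proj] .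
  then have cl: "closedin T (proj ` descends q)" using Haus by (rule compactin_imp_closedin[rotated])
  have "arc_fun a ` {f q<..<f p} \<subseteq> proj ` descends q"
  proof
    fix p' assume "p' \<in> arc_fun a ` {f q<..<f p}"
    then obtain t where t: "p' = arc_fun a t" "f q < t" "t < f p" by auto
    then have po: "p' \<in> open_arc a" unfolding open_arc_def using pa qa by auto
    have ft: "f p' = t" using monotone_arcsD(2)[OF monotone_arcs a(1), of t] t pa qa by simp
    have p'G: "p' \<in> reeb_G m r" using arc_points[OF a(1)] arc_subset_topspace(2)[OF arc_sys a(1)] po by blast
    then obtain x where x: "x \<in> p'" using G_nonempty by blast
    have xX: "x \<in> mspace m" "proj x = p'" using mem_reeb_G[OF p'G x] by auto
    have d: "down_arcs arcs p' = {a}" using down_arcs_open_arc(1)[OF monotone_arcs a(1) po] .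
    have "p' \<noteq> proj r" using f_root f_nonneg[OF qG] ft t by auto
    then have "\<exists>b\<in>down_arcs arcs (proj x). x \<in> descends q"
      using descend[of x "\<lambda>_. q"] xX d a(3) f_proj[OF xX(1)] ft t by auto
    then show "p' \<in> proj ` descends q" using xX by auto
  qed
  then have "T closure_of (arc_fun a ` {f q<..<f p}) \<subseteq> proj ` descends q" using cl by (rule closure_of_minimal)
  moreover have "arc_fun a ` (top_of_set {arc_lo a..arc_hi a} closure_of {f q<..<f p}) \<subseteq> T closure_of (arc_fun a ` {f q<..<f p})"
    using continuous_map_image_closure_subset[OF arcsD(6)[OF a(1)]] .
  moreover have "f p \<in> top_of_set {arc_lo a..arc_hi a} closure_of {f q<..<f p}"
  proof -
    have "{arc_lo a..arc_hi a} \<inter> {f q<..<f p} = {f q<..<f p}" using pa qa by auto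
    then show ?thesis using a(4) pa qa by (simp add: closure_of_subtopology)
  qed
  ultimately have "p \<in> proj ` descends q" using pa(1) by (metis imageI subsetD)
  then obtain x where "x \<in> descends q" "proj x = p" by auto
  then show ?thesis using mem_proj unfolding descends_def by auto
qed

text \<open>With only two descending arcs, the class \<open>p\<close> is covered by two closed sets,
  one for each arc, and meets both of them. A class is connected, so the two sets meet inside it.
  This saves the jump at a local maximum of a walk.\<close>

lemma ex_descends_both:
  assumes p: "p \<in> reeb_G m r" "p \<noteq> proj r" and d: "down_arcs arcs p = {a, b}"
    and q: "q \<in> closed_arc a" "f q < f p" "q' \<in> closed_arc b" "f q' < f p"
  shows "\<exists>x\<in>p. x \<in> descends q \<and> x \<in> descends q'"
proof (cases "a = b")
  case False
  have a: "a \<in> arcs" "p \<in> closed_arc a" and b: "b \<in> arcs" "p \<in> closed_arc b"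
    using down_arcs_iff[OF monotone_arcs] d by blast+
  have qG: "q \<in> reeb_G m r" "q' \<in> reeb_G m r" using arc_points a b q by blast+
  have cov: "p \<subseteq> descends q \<union> descends q'"
  proof
    fix x assume x: "x \<in> p"
    have xX: "x \<in> mspace m" "proj x = p" using mem_reeb_G[OF p(1) x] by auto
    have "\<exists>c\<in>down_arcs arcs (proj x). x \<in> descends (if c = a then q else q')"
    proof (rule descend[OF xX(1)])
      show "proj x \<noteq> proj r" using xX p by simp
      fix c assume "c \<in> down_arcs arcs (proj x)"
      then have "c = a \<or> c = b" using xX d by simp
      moreover have "f p = lvl x" using f_proj[OF xX(1)] xX(2) by simp
      ultimately show "(if c = a then q else q') \<in> closed_arc c \<and> f (if c = a then q else q') < lvl x"
        using q False by auto
    qed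
    then show "x \<in> descends q \<union> descends q'" by (auto split: if_splits)
  qed
  have "descends q \<inter> p \<noteq> {}" "descends q' \<inter> p \<noteq> {}"
    using ex_descends[OF a q(1,2)] ex_descends[OF b q(3,4)] by auto
  then have "descends q \<inter> descends q' \<inter> p \<noteq> {}"
    using connectedin_class[OF p(1)] closedin_descends[OF qG(1)] closedin_descends[OF qG(2)] cov
    unfolding connectedin_closedin by blast
  then show ?thesis by blast
next
  case True
  then have d': "down_arcs arcs p = {a}" using d by simp
  have a: "a \<in> arcs" "p \<in> closed_arc a" using down_arcs_iff[OF monotone_arcs] d by blast+
  obtain x where x: "x \<in> p" using G_nonempty[OF p(1)] by blast
  have xX: "x \<in> mspace m" "proj x = p" using mem_reeb_G[OF p(1) x] by auto
  have "x \<in> descends q" "x \<in> descends q'"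
    using descend[of x "\<lambda>_. q"] descend[of x "\<lambda>_. q'"] xX d' q p(2) True f_proj[OF xX(1)] by auto
  then show ?thesis using x by blast
qed


section \<open>Walks in the Reeb graph and their lengths\<close>

definition edge_step :: "'a set \<Rightarrow> 'a set \<Rightarrow> bool" where
  "edge_step p q \<longleftrightarrow> (\<exists>a\<in>arcs. p \<in> closed_arc a \<and> q \<in> closed_arc a)"

definition edge_walk :: "'a set \<Rightarrow> 'a set \<Rightarrow> (nat \<Rightarrow> 'a set) \<Rightarrow> nat \<Rightarrow> bool" where
  "edge_walk p q n k \<longleftrightarrow> n 0 = p \<and> n k = q \<and> (\<forall>i<k. edge_step (n i) (n (Suc i)))"

definition walk_sum :: "(nat \<Rightarrow> 'a set) \<Rightarrow> nat \<Rightarrow> real" where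
  "walk_sum n k = (\<Sum>i<k. \<bar>f (n i) - f (n (Suc i))\<bar>)"

lemma edge_walk_append:
  assumes "edge_walk p q n k" "edge_walk q s n' k'"
  shows "\<exists>u. edge_walk p s u (k + k') \<and> walk_sum u (k + k') = walk_sum n k + walk_sum n' k'"
proof -
  define u where "u = (\<lambda>i. if i \<le> k then n i else n' (i - k))"
  have eq: "n k = n' 0" using assms unfolding edge_walk_def by simp
  have "walk_sum u (k + k') = walk_sum n k + walk_sum n' k'"
    unfolding walk_sum_def u_def using sum_concat_partition[of n k n' "\<lambda>x y. \<bar>f x - f y\<bar>" k'] eq by simp
  moreover have "edge_walk p s u (k + k')"
    unfolding edge_walk_def
  proof (intro conjI allI impI)
    show "u 0 = p" using assms(1) unfolding edge_walk_def u_def by simp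
    show "u (k + k') = s" using assms eq unfolding edge_walk_def u_def by (cases "k' = 0") auto
    fix i assume i: "i < k + k'"
    show "edge_step (u i) (u (Suc i))"
    proof (cases "i < k")
      case True
      then show ?thesis using assms(1) unfolding edge_walk_def u_def by simp
    next
      case False
      then have "u i = n' (i - k)" using eq unfolding u_def by auto
      moreover have "u (Suc i) = n' (Suc (i - k))" using False unfolding u_def by (simp add: Suc_diff_le)
      ultimately show ?thesis using assms(2) i False unfolding edge_walk_def by simp
    qed
  qed
  ultimately show ?thesis by blast
qed

lemma walk_sum_nonneg: "0 \<le> walk_sum n k" unfolding walk_sum_def by (intro sum_nonneg) auto

lemma reeb_dist_eq: "reeb_dist m r p q = Inf {walk_sum n k | n k. edge_walk p q n k}"
proof -
  have step: "(\<exists>e \<in> reeb_edges m r. x \<in> T closure_of e \<and> y \<in> T closure_of e) \<longleftrightarrow> edge_step x y" for x y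
    unfolding reeb_edges_eq edge_step_def using connected_components_arcs(3)[OF monotone_arcs] by auto
  let ?A = "{(\<Sum>i < length ps - 1. \<bar>f (ps ! i) - f (ps ! Suc i)\<bar>) | ps. ps \<noteq> [] \<and> hd ps = p \<and> last ps = q \<and>
      (\<forall>i < length ps - 1. edge_step (ps ! i) (ps ! Suc i))}"
  have "?A = {walk_sum n k | n k. edge_walk p q n k}"
  proof (intro equalityI subsetI)
    fix v assume "v \<in> ?A"
    then obtain ps where ps: "v = (\<Sum>i < length ps - 1. \<bar>f (ps ! i) - f (ps ! Suc i)\<bar>)" "ps \<noteq> []" "hd ps = p" "last ps = q"
      "\<forall>i < length ps - 1. edge_step (ps ! i) (ps ! Suc i)" by blast
    then have "edge_walk p q ((!) ps) (length ps - 1)" unfolding edge_walk_def by (simp add: hd_conv_nth last_conv_nth)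
    moreover have "v = walk_sum ((!) ps) (length ps - 1)" unfolding walk_sum_def ps(1) by simp
    ultimately show "v \<in> {walk_sum n k | n k. edge_walk p q n k}" by blast
  next
    fix v assume "v \<in> {walk_sum n k | n k. edge_walk p q n k}"
    then obtain n k where n: "v = walk_sum n k" "edge_walk p q n k" by blast
    define ps where "ps = map n [0..<Suc k]"
    have nth: "ps ! i = n i" if "i \<le> k" for i using that unfolding ps_def by (metis add_0 diff_zero length_upt less_Suc_eq_le nth_map nth_upt)
    have len: "length ps - 1 = k" "ps \<noteq> []" unfolding ps_def by simp_all
    have "hd ps = p" "last ps = q" using nth[of 0] nth[of k] len n(2) unfolding edge_walk_def by (simp_all add: hd_conv_nth last_conv_nth)
    moreover have "\<forall>i < length ps - 1. edge_step (ps ! i) (ps ! Suc i)" using n(2) nth len unfolding edge_walk_def by simp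
    moreover have "v = (\<Sum>i < length ps - 1. \<bar>f (ps ! i) - f (ps ! Suc i)\<bar>)"
      unfolding n(1) walk_sum_def len(1) by (rule sum.cong) (simp_all add: nth)
    ultimately show "v \<in> ?A" using len(2) by blast
  qed
  then show ?thesis unfolding reeb_dist_def step by simp
qed

lemma reeb_dist_le_walk_sum:
  assumes "edge_walk p q n k"
  shows "reeb_dist m r p q \<le> walk_sum n k"
  unfolding reeb_dist_eq by (rule cInf_lower) (use assms walk_sum_nonneg in \<open>auto intro!: bdd_belowI[of _ 0]\<close>)

text \<open>A relation between two times, so that continuous induction applies to it. The walk is
  compared with a partition sum of the curve, because partition sums over consecutive intervals
  concatenate just as walks do.\<close>

definition followed_by_walk :: "(real \<Rightarrow> 'a) \<Rightarrow> real \<Rightarrow> real \<Rightarrow> bool" where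
  "followed_by_walk c a b \<longleftrightarrow> (\<exists>N t n k. t 0 = a \<and> t N = b \<and> (\<forall>i\<le>N. a \<le> t i \<and> t i \<le> b) \<and> (\<forall>i<N. t i \<le> t (Suc i)) \<and>
     edge_walk (proj (c a)) (proj (c b)) n k \<and> walk_sum n k \<le> (\<Sum>i<N. mdist m (c (t i)) (c (t (Suc i)))))"

lemma followed_by_walk_trans:
  assumes "a \<le> b" "b \<le> c'" "followed_by_walk c a b" "followed_by_walk c b c'"
  shows "followed_by_walk c a c'"
proof -
  obtain N t n k where 1: "t 0 = a" "t N = b" "\<forall>i\<le>N. a \<le> t i \<and> t i \<le> b" "\<forall>i<N. t i \<le> t (Suc i)"
     "edge_walk (proj (c a)) (proj (c b)) n k" "walk_sum n k \<le> (\<Sum>i<N. mdist m (c (t i)) (c (t (Suc i))))"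
    using assms(3) unfolding followed_by_walk_def by (elim exE conjE)
  obtain N' t' n' k' where 2: "t' 0 = b" "t' N' = c'" "\<forall>i\<le>N'. b \<le> t' i \<and> t' i \<le> c'" "\<forall>i<N'. t' i \<le> t' (Suc i)"
     "edge_walk (proj (c b)) (proj (c c')) n' k'" "walk_sum n' k' \<le> (\<Sum>i<N'. mdist m (c (t' i)) (c (t' (Suc i))))"
    using assms(4) unfolding followed_by_walk_def by (elim exE conjE)
  define u where "u = (\<lambda>i. if i \<le> N then t i else t' (i - N))"
  have eq: "t N = t' 0" using 1 2 by simp
  have s: "(\<Sum>i<N + N'. mdist m (c (u i)) (c (u (Suc i)))) = (\<Sum>i<N. mdist m (c (t i)) (c (t (Suc i)))) + (\<Sum>i<N'. mdist m (c (t' i)) (c (t' (Suc i))))"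
    unfolding u_def using sum_concat_partition[of t N t' "\<lambda>x y. mdist m (c x) (c y)" N'] eq by simp
  obtain w where w: "edge_walk (proj (c a)) (proj (c c')) w (k + k')" "walk_sum w (k + k') = walk_sum n k + walk_sum n' k'"
    using edge_walk_append[OF 1(5) 2(5)] by blast
  have "u 0 = a" using 1 unfolding u_def by simp
  moreover have "u (N + N') = c'" using 1 2 unfolding u_def by (cases "N' = 0") auto
  moreover have "\<forall>i\<le>N + N'. a \<le> u i \<and> u i \<le> c'"
  proof (intro allI impI)
    fix i assume i: "i \<le> N + N'"
    show "a \<le> u i \<and> u i \<le> c'"
    proof (cases "i \<le> N")
      case True
      then have "a \<le> t i \<and> t i \<le> b" using 1(3) by blast
      then show ?thesis using True assms(2) unfolding u_def by simp
    next
      case False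
      then have "b \<le> t' (i - N) \<and> t' (i - N) \<le> c'" using 2(3) i by simp
      then show ?thesis using False assms(1) unfolding u_def by simp
    qed
  qed
  moreover have "\<forall>i<N + N'. u i \<le> u (Suc i)"
  proof (intro allI impI)
    fix i assume i: "i < N + N'"
    show "u i \<le> u (Suc i)"
    proof (cases "i < N")
      case True
      then show ?thesis using 1(4) unfolding u_def by simp
    next
      case False
      then have "u i = t' (i - N)" using eq unfolding u_def by auto
      moreover have "u (Suc i) = t' (Suc (i - N))" using False unfolding u_def by (simp add: Suc_diff_le)
      moreover have "i - N < N'" using i False by simp
      ultimately show ?thesis using 2(4) by simp
    qed
  qed
  moreover have "walk_sum w (k + k') \<le> (\<Sum>i<N + N'. mdist m (c (u i)) (c (u (Suc i))))"
    unfolding s w(2) using 1(6) 2(6) by (rule add_mono)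
  ultimately show ?thesis unfolding followed_by_walk_def using w(1) by blast
qed

lemma lvl_diff_le: "x \<in> mspace m \<Longrightarrow> y \<in> mspace m \<Longrightarrow> \<bar>lvl x - lvl y\<bar> \<le> mdist m x y"
  using M.mdist_reverse_triangle[OF r, of x y] M.triangle[OF r, of x y] M.triangle[OF r, of y x] M.commute[of x y] by (simp add: abs_le_iff)

lemma reeb_dist_le:
  assumes "x \<in> mspace m" "y \<in> mspace m"
  shows "reeb_dist m r (proj x) (proj y) \<le> mdist m x y"
proof (rule field_le_epsilon)
  fix \<delta> :: real assume "0 < \<delta>"
  then obtain c where ng: "near_geodesic x y \<delta> c" using near_geodesic_exists[OF assms] by blast
  note c = near_geodesicD[OF ng]
  have path: "pathin T (proj \<circ> c)" using c(1) continuous_proj unfolding pathin_def by (rule continuous_map_compose)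
  have "followed_by_walk c 0 1"
  proof (rule pathin_pieces_relation[OF path arc_pieces[OF Haus arc_sys]])
    fix a b c' :: real assume "a \<le> b" "b \<le> c'" "followed_by_walk c a b" "followed_by_walk c b c'"
    then show "followed_by_walk c a c'" by (rule followed_by_walk_trans)
  next
    fix Q and s s' :: real
    assume Q: "Q \<in> arc_pieces (reeb_vertices m r) arcs" "0 \<le> s" "s \<le> s'" "s' \<le> 1" "(proj \<circ> c) s \<in> Q" "(proj \<circ> c) s' \<in> Q"
    have X: "c s \<in> mspace m" "c s' \<in> mspace m" using pathin_mspace[OF c(1)] Q by auto
    define t where "t = (\<lambda>i::nat. if i = 0 then s else s')"
    have "\<exists>n k. edge_walk (proj (c s)) (proj (c s')) n k \<and> walk_sum n k \<le> mdist m (c s) (c s')"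
    proof (cases "Q \<in> closed_arc ` arcs")
      case True
      define n where "n = (\<lambda>i::nat. if i = 0 then proj (c s) else proj (c s'))"
      have "edge_walk (proj (c s)) (proj (c s')) n 1" using True Q(5,6) unfolding edge_walk_def edge_step_def n_def by auto
      moreover have "walk_sum n 1 \<le> mdist m (c s) (c s')"
        unfolding walk_sum_def n_def using lvl_diff_le[OF X] f_proj[OF X(1)] f_proj[OF X(2)] by simp
      ultimately show ?thesis by blast
    next
      case False
      then have "proj (c s) = proj (c s')" using Q unfolding arc_pieces_def by auto
      then have "edge_walk (proj (c s)) (proj (c s')) (\<lambda>_. proj (c s)) 0" "walk_sum (\<lambda>_. proj (c s)) 0 \<le> mdist m (c s) (c s')"
        unfolding edge_walk_def walk_sum_def by simp_all
      then show ?thesis by blast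
    qed
    then obtain n k where n: "edge_walk (proj (c s)) (proj (c s')) n k" "walk_sum n k \<le> mdist m (c s) (c s')" by blast
    have "t 0 = s" "t 1 = s'" "\<forall>i\<le>1. s \<le> t i \<and> t i \<le> s'" "\<forall>i<1. t i \<le> t (Suc i)"
      "walk_sum n k \<le> (\<Sum>i<1. mdist m (c (t i)) (c (t (Suc i))))"
      using Q n(2) unfolding t_def by auto
    then show "followed_by_walk c s s'" unfolding followed_by_walk_def using n(1) by blast
  qed auto
  then obtain N t n k where 1: "t 0 = 0" "t N = 1" "\<forall>i\<le>N. 0 \<le> t i \<and> t i \<le> 1" "\<forall>i<N. t i \<le> t (Suc i)"
     "edge_walk (proj (c 0)) (proj (c 1)) n k" "walk_sum n k \<le> (\<Sum>i<N. mdist m (c (t i)) (c (t (Suc i))))"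
    unfolding followed_by_walk_def by (elim exE conjE)
  have "\<forall>i\<le>N. t i \<in> {0..1}" using 1(3) by simp
  then have "(\<Sum>i<N. mdist m (c (t i)) (c (t (Suc i)))) \<le> mdist m x y + \<delta>" using ng 1(4) unfolding near_geodesic_def by blast
  then show "reeb_dist m r (proj x) (proj y) \<le> mdist m x y + \<delta>"
    using reeb_dist_le_walk_sum[OF 1(5)] 1(6) c(2,3) by simp
qed

lemma reeb_walk_exists:
  assumes "p \<in> reeb_G m r" "q \<in> reeb_G m r" "reeb_dist m r p q < s"
  shows "\<exists>n k. edge_walk p q n k \<and> walk_sum n k < s"
proof -
  have "\<exists>n k. edge_walk p q n k"
  proof -
    obtain x y where xy: "x \<in> mspace m" "proj x = p" "y \<in> mspace m" "proj y = q" using assms unfolding reeb_G_def by auto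
    obtain c where ng: "near_geodesic x y 1 c" using near_geodesic_exists xy by fastforce
    note c = near_geodesicD[OF ng]
    have path: "pathin T (proj \<circ> c)" using c(1) continuous_proj unfolding pathin_def by (rule continuous_map_compose)
    have "\<exists>n k. edge_walk ((proj \<circ> c) 0) ((proj \<circ> c) 1) n k"
    proof (rule pathin_pieces_relation[OF path arc_pieces[OF Haus arc_sys], where R = "\<lambda>a b. \<exists>n k. edge_walk ((proj \<circ> c) a) ((proj \<circ> c) b) n k"])
      fix a b d :: real assume "\<exists>n k. edge_walk ((proj \<circ> c) a) ((proj \<circ> c) b) n k" "\<exists>n k. edge_walk ((proj \<circ> c) b) ((proj \<circ> c) d) n k"
      then show "\<exists>n k. edge_walk ((proj \<circ> c) a) ((proj \<circ> c) d) n k" using edge_walk_append by meson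
    next
      fix Q and s s' :: real
      assume Q: "Q \<in> arc_pieces (reeb_vertices m r) arcs" "(proj \<circ> c) s \<in> Q" "(proj \<circ> c) s' \<in> Q"
      show "\<exists>n k. edge_walk ((proj \<circ> c) s) ((proj \<circ> c) s') n k"
      proof (cases "Q \<in> closed_arc ` arcs")
        case True
        then have "edge_walk ((proj \<circ> c) s) ((proj \<circ> c) s') (\<lambda>i. if i = 0 then (proj \<circ> c) s else (proj \<circ> c) s') 1"
          using Q unfolding edge_walk_def edge_step_def by auto
        then show ?thesis by blast
      next
        case False
        then have "edge_walk ((proj \<circ> c) s) ((proj \<circ> c) s') (\<lambda>_. (proj \<circ> c) s) 0"
          using Q unfolding arc_pieces_def edge_walk_def by auto
        then show ?thesis by blast
      qed
    qed auto
    then show ?thesis using c(2,3) xy by simp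
  qed
  then have 1: "{walk_sum n k | n k. edge_walk p q n k} \<noteq> {}" by blast
  have 2: "Inf {walk_sum n k | n k. edge_walk p q n k} < s" using assms(3) unfolding reeb_dist_eq .
  from cInf_lessD[OF 1 2] obtain v where "v \<in> {walk_sum n k | n k. edge_walk p q n k}" "v < s" by blast
  then show ?thesis by blast
qed

text \<open>Take the least number of steps. By the triangle inequality for levels, cutting out a
  loop or replacing a stretch by one step along a common arc does not lengthen the walk, so either
  would contradict minimality. Distinctness lets surplus arcs be counted once; the absence of
  shortcuts makes the arcs before and after a turning point different.\<close>

lemma shortest_walk:
  assumes w: "edge_walk p q n k" "walk_sum n k \<le> s"
  obtains n k where "edge_walk p q n k" "walk_sum n k \<le> s"
    "\<And>i j. i < j \<Longrightarrow> j \<le> k \<Longrightarrow> n i \<noteq> n j" "\<And>i j. Suc i < j \<Longrightarrow> j \<le> k \<Longrightarrow> \<not> edge_step (n i) (n j)"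
proof -
  define P where "P k \<longleftrightarrow> (\<exists>n. edge_walk p q n k \<and> walk_sum n k \<le> s)" for k
  have "P k" unfolding P_def using w by blast
  define l where "l = (LEAST k. P k)"
  have Pl: "P l" unfolding l_def using \<open>P k\<close> by (rule LeastI)
  have least: "\<not> P k'" if "k' < l" for k' using that not_less_Least unfolding l_def by blast
  obtain n where n: "edge_walk p q n l" "walk_sum n l \<le> s" using Pl unfolding P_def by blast
  have pre: "edge_walk p (n i) n i" if "i \<le> l" for i using n(1) that unfolding edge_walk_def by simp
  have suf: "edge_walk (n j) q (\<lambda>k. n (k + j)) (l - j)" if "j \<le> l" for j using n(1) that unfolding edge_walk_def by simp
  have tel: "\<bar>f (n i) - f (n j)\<bar> \<le> (\<Sum>k\<in>{i..<j}. \<bar>f (n k) - f (n (Suc k))\<bar>)" if "i \<le> j" for i j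
    using that
  proof (induction rule: dec_induct)
    case (step j)
    have "\<bar>f (n i) - f (n (Suc j))\<bar> \<le> \<bar>f (n i) - f (n j)\<bar> + \<bar>f (n j) - f (n (Suc j))\<bar>" by simp
    then show ?case using step by simp
  qed simp
  have sum: "walk_sum n i + (\<Sum>k\<in>{i..<j}. \<bar>f (n k) - f (n (Suc k))\<bar>) + walk_sum (\<lambda>k. n (k + j)) (l - j) = walk_sum n l" if "i \<le> j" "j \<le> l" for i j
  proof -
    let ?h = "\<lambda>k. \<bar>f (n k) - f (n (Suc k))\<bar>"
    have "walk_sum (\<lambda>k. n (k + j)) (l - j) = (\<Sum>k\<in>{j..<l}. ?h k)"
      unfolding walk_sum_def lessThan_atLeast0 using sum.shift_bounds_nat_ivl[of ?h 0 j "l - j"] that by simp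
    then show ?thesis unfolding walk_sum_def lessThan_atLeast0
      using sum.atLeastLessThan_concat[of 0 i j ?h] sum.atLeastLessThan_concat[of 0 j l ?h] that by simp
  qed
  show ?thesis
  proof (rule that[OF n])
    fix i j assume ij: "i < j" "j \<le> l"
    show "n i \<noteq> n j"
    proof
      assume eq: "n i = n j"
      have "edge_walk p (n j) n i" using pre[of i] ij eq by simp
      from edge_walk_append[OF this suf[OF ij(2)]] obtain u where u: "edge_walk p q u (i + (l - j))"
        "walk_sum u (i + (l - j)) = walk_sum n i + walk_sum (\<lambda>k. n (k + j)) (l - j)" by blast
      have "walk_sum u (i + (l - j)) \<le> walk_sum n l"
        using sum[of i j] tel[of i j] ij u(2) abs_ge_zero[of "f (n i) - f (n j)"] by linarith
      then have "P (i + (l - j))" unfolding P_def using u(1) n(2) by (meson order_trans)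
      moreover have "i + (l - j) < l" using ij by linarith
      ultimately show False using least by blast
    qed
  next
    fix i j assume ij: "Suc i < j" "j \<le> l"
    show "\<not> edge_step (n i) (n j)"
    proof
      assume st: "edge_step (n i) (n j)"
      define h where "h = (\<lambda>k::nat. if k = 0 then n i else n j)"
      have h: "edge_walk (n i) (n j) h 1" "walk_sum h 1 = \<bar>f (n i) - f (n j)\<bar>"
        using st unfolding edge_walk_def walk_sum_def h_def by auto
      obtain v where v: "edge_walk p (n j) v (i + 1)" "walk_sum v (i + 1) = walk_sum n i + walk_sum h 1"
        using edge_walk_append[OF pre h(1)] ij by auto
      from edge_walk_append[OF v(1) suf[OF ij(2)]] obtain u where u: "edge_walk p q u (i + 1 + (l - j))"
        "walk_sum u (i + 1 + (l - j)) = walk_sum v (i + 1) + walk_sum (\<lambda>k. n (k + j)) (l - j)" by blast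
      have "walk_sum u (i + 1 + (l - j)) \<le> walk_sum n l"
        using sum[of i j] tel[of i j] ij u(2) v(2) h(2) by linarith
      then have "P (i + 1 + (l - j))" unfolding P_def using u(1) n(2) by (meson order_trans)
      moreover have "i + 1 + (l - j) < l" using ij by linarith
      ultimately show False using least by blast
    qed
  qed
qed

lemma descends_unique:
  assumes p: "p \<in> reeb_G m r" "z \<in> p" "card (down_arcs arcs p) = 1"
    and a: "a \<in> down_arcs arcs p" "q \<in> closed_arc a" "f q < f p"
  shows "z \<in> descends q"
proof -
  have z: "z \<in> mspace m" "proj z = p" using mem_reeb_G[OF p(1,2)] by auto
  have d: "down_arcs arcs p = {a}" using p(3) a(1) by (metis card_1_singletonE singletonD)
  have "p \<noteq> proj r" using a f_root f_nonneg arc_points[OF _ a(2)] unfolding down_arcs_def by fastforce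
  then have "\<exists>b\<in>down_arcs arcs (proj z). z \<in> descends q"
    using descend[OF z(1), of "\<lambda>_. q"] z d a f_proj[OF z(1)] by auto
  then show ?thesis by blast
qed

section \<open>Lifting walks to the space and counting the jumps\<close>

definition excess :: "'a set set \<Rightarrow> int" where
  "excess N = (\<Sum>p\<in>N - {proj r}. int (card (down_arcs arcs p)) - 1)"

lemma card_down_arcs_pos:
  assumes "p \<in> reeb_G m r" "p \<noteq> proj r"
  shows "1 \<le> card (down_arcs arcs p)"
proof -
  have "down_arcs arcs p \<noteq> {}" using down_arcs_nonempty[OF monotone_arcs] not_local_min assms topspace_T by simp
  moreover have "finite (down_arcs arcs p)" using arcsD(2) unfolding down_arcs_def by simp
  ultimately have "0 < card (down_arcs arcs p)" by (simp add: card_gt_0_iff)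
  then show ?thesis by simp
qed

text \<open>Interior points of arcs contribute nothing, and every vertex except the root contributes
  a nonnegative amount. Over all vertices the descending arcs are all arcs, so the sum is at most
  the number of arcs minus the number of vertices other than the root, which is the Betti
  number.\<close>

lemma excess_le:
  assumes "finite N" "N \<subseteq> reeb_G m r"
  shows "excess N \<le> reeb_betti1 m r"
proof -
  let ?V = "reeb_vertices m r"
  let ?h = "\<lambda>p. int (card (down_arcs arcs p)) - 1"
  have V: "finite ?V" "?V \<subseteq> reeb_G m r" using arcsD(1,3) topspace_T by auto
  have root: "proj r \<in> ?V" unfolding reeb_vertices_def by simp
  have out: "?h p = 0" if pN: "p \<in> N - {proj r}" "p \<notin> ?V" for p
  proof -
    have "p \<in> topspace T" using pN assms topspace_T by auto
    then obtain a where "a \<in> arcs" "p \<in> open_arc a" using arc_system_cases[OF arc_sys _ pN(2)] by blast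
    then show ?thesis using down_arcs_open_arc(1)[OF monotone_arcs] by simp
  qed
  have nn: "0 \<le> ?h p" if "p \<in> ?V - {proj r}" for p using card_down_arcs_pos[of p] that V by auto
  have "excess N = sum ?h ((N - {proj r}) \<inter> ?V)"
    unfolding excess_def using out assms(1) by (intro sum.mono_neutral_right) auto
  also have "\<dots> \<le> sum ?h (?V - {proj r})"
    by (rule sum_mono2) (use V nn in auto)
  also have "\<dots> = (\<Sum>p\<in>?V - {proj r}. int (card (down_arcs arcs p))) - int (card (?V - {proj r}))"
    by (simp add: sum_subtractf)
  also have "\<dots> \<le> (\<Sum>p\<in>?V. int (card (down_arcs arcs p))) - int (card (?V - {proj r}))"
    using V by (intro diff_right_mono sum_mono2) auto
  also have "(\<Sum>p\<in>?V. int (card (down_arcs arcs p))) = int (card arcs)"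
    using sum_card_down_arcs[OF monotone_arcs] by (simp add: of_nat_sum[symmetric] del: of_nat_sum)
  also have "int (card (?V - {proj r})) = int (card ?V) - 1"
    using card_Suc_Diff1[OF V(1) root] by linarith
  finally show ?thesis unfolding reeb_betti1_eq by simp
qed


definition fibre_jumps :: "('a \<times> 'a) list \<Rightarrow> bool" where
  "fibre_jumps js \<longleftrightarrow> (\<forall>(z, w)\<in>set js. z \<in> mspace m \<and> w \<in> mspace m \<and> proj z = proj w)"

definition reach :: "'a \<Rightarrow> 'a \<Rightarrow> real \<Rightarrow> int \<Rightarrow> bool" where
  "reach x z s b \<longleftrightarrow> (\<exists>L js. jump_chain (mdist m) (mspace m) x z L js \<and> L \<le> s \<and> int (length js) \<le> b \<and> fibre_jumps js)"

lemma reach_move: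
  assumes "reach x z s b" "w \<in> mspace m" "mdist m z w \<le> l" "s + l \<le> s'" "b \<le> b'"
  shows "reach x w s' b'"
proof -
  obtain L js where 1: "jump_chain (mdist m) (mspace m) x z L js" "L \<le> s" "int (length js) \<le> b" "fibre_jumps js"
    using assms(1) unfolding reach_def by (elim exE conjE)
  have "L + l \<le> s'" "int (length js) \<le> b'" using 1 assms(4,5) by linarith+
  then show ?thesis unfolding reach_def using jump_chain.move[OF 1(1) assms(2,3)] 1(4) by blast
qed

lemma reach_jump:
  assumes "reach x z s b" "p \<in> reeb_G m r" "z \<in> p" "w \<in> p" "b + 1 \<le> b'"
  shows "reach x w s b'"
proof -
  obtain L js where 1: "jump_chain (mdist m) (mspace m) x z L js" "L \<le> s" "int (length js) \<le> b" "fibre_jumps js"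
    using assms(1) unfolding reach_def by (elim exE conjE)
  have zw: "z \<in> mspace m" "w \<in> mspace m" "proj z = proj w" using mem_reeb_G[OF assms(2)] assms(3,4) by auto
  have "fibre_jumps (js @ [(z, w)])" using 1(4) zw unfolding fibre_jumps_def by auto
  moreover have "int (length (js @ [(z, w)])) \<le> b'" using 1(3) assms(5) by simp
  ultimately show ?thesis unfolding reach_def using jump_chain.jump[OF 1(1) zw(2)] 1(2) by blast
qed

lemma reach_mono: "reach x z s b \<Longrightarrow> b \<le> b' \<Longrightarrow> reach x z s b'"
  unfolding reach_def by (meson order_trans)

text \<open>A descending step is lifted from wherever the chain is, an ascending one from its top. A jump
  is needed where an ascent begins, and where several arcs descend from a point; at a local maximum
  of the walk with exactly two descending arcs some point of the class descends along both.\<close>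

lemma walk_lift:
  assumes p: "p \<in> reeb_G m r" "x \<in> p" and y: "y \<in> q" and w: "edge_walk p q n k"
    and dist: "\<And>i j. i < j \<Longrightarrow> j \<le> k \<Longrightarrow> n i \<noteq> n j"
    and short: "\<And>i j. Suc i < j \<Longrightarrow> j \<le> k \<Longrightarrow> \<not> edge_step (n i) (n j)"
  shows "reach x y (walk_sum n k) (reeb_betti1 m r + 1)"
proof -
  have n0: "n 0 = p" "n k = q" using w unfolding edge_walk_def by auto
  have "\<forall>i. \<exists>a. i < k \<longrightarrow> a \<in> arcs \<and> n i \<in> closed_arc a \<and> n (Suc i) \<in> closed_arc a"
    using w unfolding edge_walk_def edge_step_def by blast
  then obtain \<alpha> where \<alpha>: "\<And>i. i < k \<Longrightarrow> \<alpha> i \<in> arcs \<and> n i \<in> closed_arc (\<alpha> i) \<and> n (Suc i) \<in> closed_arc (\<alpha> i)" by metis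
  have nG: "n i \<in> reeb_G m r" if "i \<le> k" for i
  proof (cases "i = 0")
    case False
    then obtain j where "i = Suc j" by (cases i) auto
    then show ?thesis using \<alpha>[of j] arc_points that by auto
  qed (use n0 p in simp)
  have neq: "f (n i) \<noteq> f (n (Suc i))" if "i < k" for i
    using closed_arc_eqI[OF monotone_arcs] \<alpha>[OF that] dist[of i "Suc i"] that by auto
  have down: "\<alpha> i \<in> down_arcs arcs (n i)" "n i \<noteq> proj r" if "i < k" "f (n (Suc i)) < f (n i)" for i
  proof -
    show "\<alpha> i \<in> down_arcs arcs (n i)"
      using down_arcs_iff[OF monotone_arcs] \<alpha>[OF that(1)] closed_arcD(2)[OF monotone_arcs, of "\<alpha> i" "n (Suc i)"] that(2) by auto
    show "n i \<noteq> proj r" using that(2) f_nonneg[OF nG[of "Suc i"]] f_root that(1) by auto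
  qed
  have up: "\<alpha> i \<in> down_arcs arcs (n (Suc i))" "n (Suc i) \<noteq> proj r" if "i < k" "f (n i) < f (n (Suc i))" for i
  proof -
    show "\<alpha> i \<in> down_arcs arcs (n (Suc i))"
      using down_arcs_iff[OF monotone_arcs] \<alpha>[OF that(1)] closed_arcD(2)[OF monotone_arcs, of "\<alpha> i" "n i"] that(2) by auto
    show "n (Suc i) \<noteq> proj r" using that(2) f_nonneg[OF nG[of i]] f_root that(1) by auto
  qed
  have dp: "1 \<le> card (down_arcs arcs (n i))" if "i \<le> k" "n i \<noteq> proj r" for i using card_down_arcs_pos[OF nG[OF that(1)] that(2)] .
  \<comment> \<open>The surplus descending arcs at the i-th point; they pay for the jumps made
    there.\<close>
  define dd where "dd i = (if n i = proj r then 0 else int (card (down_arcs arcs (n i))) - 1)" for i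
  define \<Omega> where "\<Omega> i = (\<Sum>j<i. dd j)" for i
  have \<Omega>S: "\<Omega> (Suc i) = \<Omega> i + dd i" for i unfolding \<Omega>_def by simp
  have dd0: "0 \<le> dd i" if "i \<le> k" for i using dp[OF that] unfolding dd_def by (cases "n i = proj r") simp_all
  have WS: "walk_sum n (Suc i) = walk_sum n i + \<bar>f (n i) - f (n (Suc i))\<bar>" for i unfolding walk_sum_def by simp
  \<comment> \<open>The i-th point is reached by a descent; the start is treated as such.\<close>
  define D where "D i \<longleftrightarrow> i = 0 \<or> f (n i) < f (n (i - 1))" for i
  have desc: "\<exists>y\<in>q'. y \<in> mspace m \<and> mdist m z y \<le> lvl z - f q'" if "z \<in> descends q'" "q' \<in> reeb_G m r" for z q'
    using that mem_reeb_G(1) unfolding descends_def by blast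
  \<comment> \<open>After a descent one point of the class has been reached. An ascent is lifted
    from its top downwards, so any point that descends along the arc just used may serve as the
    target, and the choice is postponed until the continuation is known. The additional
    \<open>1\<close> stands for the jump at the beginning of the ascent, which is not yet
    paid.\<close>
  have St: "if D i then \<exists>z\<in>n i. reach x z (walk_sum n i) (\<Omega> i)
     else \<forall>z\<in>n i. z \<in> descends (n (i - 1)) \<longrightarrow> reach x z (walk_sum n i) (\<Omega> i + 1)" if "i \<le> k" for i
    using that
  proof (induction i)
    case 0
    have "jump_chain (mdist m) (mspace m) x x 0 []" using mem_reeb_G(1)[OF p] by (rule jump_chain.start)
    then have "reach x x (walk_sum n 0) (\<Omega> 0)" unfolding reach_def walk_sum_def \<Omega>_def fibre_jumps_def by auto
    then show ?case using n0 p unfolding D_def by auto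
  next
    case (Suc i)
    then have i: "i < k" "i \<le> k" by auto
    note IH = Suc.IH[OF i(2)]
    note a = \<alpha>[OF i(1)]
    have G: "n i \<in> reeb_G m r" "n (Suc i) \<in> reeb_G m r" using nG Suc.prems by auto
    have lv: "lvl z = f (n j)" if "z \<in> n j" "j \<le> k" for z j
      using f_proj[OF mem_reeb_G(1)[OF nG[OF that(2)] that(1)]] mem_reeb_G(2)[OF nG[OF that(2)] that(1)] by simp
    have go_down: "\<exists>z\<in>n (Suc i). reach x z (walk_sum n (Suc i)) (\<Omega> (Suc i))"
      if z: "z \<in> n i" "z \<in> descends (n (Suc i))" "reach x z (walk_sum n i) (\<Omega> (Suc i))" and lt: "f (n (Suc i)) < f (n i)" for z
    proof -
      obtain y where y: "y \<in> n (Suc i)" "y \<in> mspace m" "mdist m z y \<le> lvl z - f (n (Suc i))" using desc[OF z(2) G(2)] by blast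
      have "reach x y (walk_sum n (Suc i)) (\<Omega> (Suc i))"
        by (rule reach_move[OF z(3) y(2,3)]) (use lv[OF z(1) i(2)] lt in \<open>simp_all add: WS\<close>)
      then show ?thesis using y(1) by blast
    qed
    have go_up: "reach x z (walk_sum n (Suc i)) b"
      if y: "y \<in> n i" "reach x y (walk_sum n i) b" and z: "z \<in> n (Suc i)" "mdist m z y \<le> lvl z - f (n i)" and lt: "f (n i) < f (n (Suc i))" for y z b
    proof (rule reach_move[OF y(2)])
      show "z \<in> mspace m" using mem_reeb_G(1)[OF G(2) z(1)] .
      show "mdist m y z \<le> lvl z - f (n i)" using z(2) by (simp add: M.commute)
      show "walk_sum n i + (lvl z - f (n i)) \<le> walk_sum n (Suc i)" using lv[OF z(1)] Suc.prems lt by (simp add: WS)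
    qed simp
    show ?case
    proof (cases "f (n (Suc i)) < f (n i)")
      case dn: True
      note da = down[OF i(1) dn]
      have ddi: "dd i = int (card (down_arcs arcs (n i))) - 1" unfolding dd_def using da(2) by simp
      have "\<exists>z\<in>n i. z \<in> descends (n (Suc i)) \<and> reach x z (walk_sum n i) (\<Omega> (Suc i))"
      proof (cases "D i")
        case True
        then obtain z where z: "z \<in> n i" "reach x z (walk_sum n i) (\<Omega> i)" using IH by auto
        show ?thesis
        proof (cases "card (down_arcs arcs (n i)) = 1")
          case True
          have "z \<in> descends (n (Suc i))" using descends_unique[OF G(1) z(1) True da(1)] a dn by blast
          then show ?thesis using z reach_mono[OF z(2)] dd0[OF i(2)] \<Omega>S by (metis le_add_same_cancel1)
        next
          case False
          obtain z2 where z2: "z2 \<in> n i" "z2 \<in> descends (n (Suc i))" using ex_descends a dn by blast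
          have "reach x z2 (walk_sum n i) (\<Omega> (Suc i))"
            by (rule reach_jump[OF z(2) G(1) z(1) z2(1)]) (use False dp[OF i(2) da(2)] in \<open>simp add: \<Omega>S ddi\<close>)
          then show ?thesis using z2 by blast
        qed
      next
        case False
        then have reachable: "\<forall>z\<in>n i. z \<in> descends (n (i - 1)) \<longrightarrow> reach x z (walk_sum n i) (\<Omega> i + 1)" using IH by simp
        from False obtain j where j: "i = Suc j" unfolding D_def by (cases i) auto
        have jk: "j < k" using i j by simp
        have lt: "f (n j) < f (n i)" using False neq[OF jk] j unfolding D_def by auto
        note ua = up(1)[OF jk, folded j, OF lt]
        note aj = \<alpha>[OF jk, folded j]
        \<comment> \<open>If the walk turned back on the same arc, its neighbours before and after
          the turning point would lie on a common arc, a shortcut.\<close>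
        have ne: "\<alpha> j \<noteq> \<alpha> i" using short[of j "Suc i"] i j aj a unfolding edge_step_def by auto
        have sub: "{\<alpha> j, \<alpha> i} \<subseteq> down_arcs arcs (n i)" using ua da(1) by simp
        have finD: "finite (down_arcs arcs (n i))" using arcsD(2) unfolding down_arcs_def by simp
        have two: "2 \<le> card (down_arcs arcs (n i))" using card_mono[OF finD sub] ne by simp
        show ?thesis
        proof (cases "card (down_arcs arcs (n i)) = 2")
          case True
          \<comment> \<open>No jump is made here, so the one surplus arc is free to pay for the jump
            pending since the ascent began.\<close>
          have "down_arcs arcs (n i) = {\<alpha> j, \<alpha> i}" using card_subset_eq[OF finD sub] True ne by simp
          then obtain z where z: "z \<in> n i" "z \<in> descends (n j)" "z \<in> descends (n (Suc i))"
            using ex_descends_both[OF G(1) da(2), of "\<alpha> j" "\<alpha> i" "n j" "n (Suc i)"] aj a lt dn by blast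
          have "reach x z (walk_sum n i) (\<Omega> i + 1)" using reachable z j by simp
          then have "reach x z (walk_sum n i) (\<Omega> (Suc i))" by (rule reach_mono) (use True in \<open>simp add: \<Omega>S ddi\<close>)
          then show ?thesis using z by blast
        next
          case False
          obtain z where z: "z \<in> n i" "z \<in> descends (n j)" using ex_descends aj lt by blast
          obtain z2 where z2: "z2 \<in> n i" "z2 \<in> descends (n (Suc i))" using ex_descends a dn by blast
          have "reach x z (walk_sum n i) (\<Omega> i + 1)" using reachable z j by simp
          then have "reach x z2 (walk_sum n i) (\<Omega> (Suc i))"
            by (rule reach_jump[OF _ G(1) z(1) z2(1)]) (use False two in \<open>simp add: \<Omega>S ddi\<close>)
          then show ?thesis using z2 by blast
        qed
      qed
      then obtain z where "z \<in> n i" "z \<in> descends (n (Suc i))" "reach x z (walk_sum n i) (\<Omega> (Suc i))" by blast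
      from go_down[OF this dn] show ?thesis using dn unfolding D_def by simp
    next
      case False
      then have up': "f (n i) < f (n (Suc i))" using neq[OF i(1)] by auto
      have "reach x z (walk_sum n (Suc i)) (\<Omega> (Suc i) + 1)" if z: "z \<in> n (Suc i)" "z \<in> descends (n i)" for z
      proof -
        obtain y where y: "y \<in> n i" "y \<in> mspace m" "mdist m z y \<le> lvl z - f (n i)" using desc[OF z(2) G(1)] by blast
        have "reach x y (walk_sum n i) (\<Omega> (Suc i) + 1)"
        proof (cases "D i")
          case True
          then obtain z' where z': "z' \<in> n i" "reach x z' (walk_sum n i) (\<Omega> i)" using IH by auto
          show ?thesis by (rule reach_jump[OF z'(2) G(1) z'(1) y(1)]) (use dd0[OF i(2)] in \<open>simp add: \<Omega>S\<close>)
        next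
          case False
          then have reachable: "\<forall>z\<in>n i. z \<in> descends (n (i - 1)) \<longrightarrow> reach x z (walk_sum n i) (\<Omega> i + 1)" using IH by simp
          from False obtain j where j: "i = Suc j" unfolding D_def by (cases i) auto
          have jk: "j < k" using i j by simp
          have lt: "f (n j) < f (n i)" using False neq[OF jk] j unfolding D_def by auto
          note ua = up[OF jk, folded j, OF lt]
          note aj = \<alpha>[OF jk, folded j]
          show ?thesis
          proof (cases "card (down_arcs arcs (n i)) = 1")
            case True
            have "y \<in> descends (n j)" using descends_unique[OF G(1) y(1) True ua(1)] aj lt by blast
            then have "reach x y (walk_sum n i) (\<Omega> i + 1)" using reachable y(1) j by simp
            then show ?thesis by (rule reach_mono) (use dd0[OF i(2)] in \<open>simp add: \<Omega>S\<close>)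
          next
            case False
            obtain z' where z': "z' \<in> n i" "z' \<in> descends (n j)" using ex_descends aj lt by blast
            have "reach x z' (walk_sum n i) (\<Omega> i + 1)" using reachable z' j by simp
            then show ?thesis
              by (rule reach_jump[OF _ G(1) z'(1) y(1)]) (use False dp[OF i(2) ua(2)] ua(2) in \<open>simp add: \<Omega>S dd_def\<close>)
          qed
        qed
        from go_up[OF y(1) this z(1) y(3) up'] show ?thesis .
      qed
      then show ?thesis using up' unfolding D_def by simp
    qed
  qed
  \<comment> \<open>The points of the walk are distinct, so no surplus arc of the Reeb graph is
    counted twice.\<close>
  have "\<Omega> (Suc k) \<le> reeb_betti1 m r"
  proof -
    have inj: "inj_on n {..k}" using dist by (intro inj_onI) (metis atMost_iff linorder_neqE_nat)
    have "\<Omega> (Suc k) = (\<Sum>j\<in>{..k}. dd j)" unfolding \<Omega>_def lessThan_Suc_atMost ..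
    also have "\<dots> = (\<Sum>v\<in>n ` {..k}. if v = proj r then 0 else int (card (down_arcs arcs v)) - 1)"
      unfolding sum.reindex[OF inj] by (simp add: dd_def)
    also have "\<dots> = excess (n ` {..k})"
      unfolding excess_def by (rule sum.mono_neutral_cong_right) auto
    finally show ?thesis using excess_le[of "n ` {..k}"] nG by auto
  qed
  \<comment> \<open>The final \<open>+ 1\<close> is the jump to \<open>y\<close> itself after a
    descent, or the jump still pending after an ascent. In the second case a further jump to
    \<open>y\<close> occurs only if the last point has a surplus arc to pay for it.\<close>
  moreover have "reach x y (walk_sum n k) (\<Omega> (Suc k) + 1)"
  proof -
    have G: "n k \<in> reeb_G m r" and yk: "y \<in> n k" using nG n0 y by auto
    show ?thesis
    proof (cases "D k")
      case True
      then obtain z where z: "z \<in> n k" "reach x z (walk_sum n k) (\<Omega> k)" using St[of k] by auto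
      show ?thesis by (rule reach_jump[OF z(2) G z(1) yk]) (use dd0[of k] in \<open>simp add: \<Omega>S\<close>)
    next
      case False
      then have reachable: "\<forall>z\<in>n k. z \<in> descends (n (k - 1)) \<longrightarrow> reach x z (walk_sum n k) (\<Omega> k + 1)" using St[of k] by simp
      from False obtain j where j: "k = Suc j" unfolding D_def by (cases k) auto
      have jk: "j < k" using j by simp
      have lt: "f (n j) < f (n k)" using False neq[OF jk] j unfolding D_def by auto
      note ua = up[OF jk, folded j, OF lt]
      note aj = \<alpha>[OF jk, folded j]
      show ?thesis
      proof (cases "card (down_arcs arcs (n k)) = 1")
        case True
        have "y \<in> descends (n j)" using descends_unique[OF G yk True ua(1)] aj lt by blast
        then have "reach x y (walk_sum n k) (\<Omega> k + 1)" using reachable yk j by simp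
        then show ?thesis by (rule reach_mono) (use dd0[of k] in \<open>simp add: \<Omega>S\<close>)
      next
        case False
        obtain z' where z': "z' \<in> n k" "z' \<in> descends (n j)" using ex_descends aj lt by blast
        have "reach x z' (walk_sum n k) (\<Omega> k + 1)" using reachable z' j by simp
        then show ?thesis
          by (rule reach_jump[OF _ G z'(1) yk]) (use False dp[of k] ua(2) in \<open>simp add: \<Omega>S dd_def\<close>)
      qed
    qed
  qed
  ultimately show ?thesis by (metis reach_mono add_le_cancel_right)
qed

lemma reach_of_reeb_dist:
  assumes x: "x \<in> mspace m" and y: "y \<in> mspace m" and s: "reeb_dist m r (proj x) (proj y) < s"
  shows "reach x y s (reeb_betti1 m r + 1)"
proof -
  obtain n k where n: "edge_walk (proj x) (proj y) n k" "walk_sum n k < s"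
    using reeb_walk_exists[OF proj_in_G[OF x] proj_in_G[OF y] s] by blast
  show ?thesis
  proof (rule shortest_walk[OF n(1) less_imp_le[OF n(2)]])
    fix n' k' assume n': "edge_walk (proj x) (proj y) n' k'" "walk_sum n' k' \<le> s"
      "\<And>i j. i < j \<Longrightarrow> j \<le> k' \<Longrightarrow> n' i \<noteq> n' j" "\<And>i j. Suc i < j \<Longrightarrow> j \<le> k' \<Longrightarrow> \<not> edge_step (n' i) (n' j)"
    have "reach x y (walk_sum n' k') (reeb_betti1 m r + 1)"
      using walk_lift[OF proj_in_G[OF x] mem_proj[OF x] mem_proj[OF y] n'(1,3,4)] .
    then show "reach x y s (reeb_betti1 m r + 1)" using n'(2) unfolding reach_def by (meson order_trans)
  qed
qed

end

section \<open>Relations on intervals and crossing times of paths\<close>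

text \<open>A variant of continuous induction for relations that are not tied to a cover: symmetry
  turns closeness to a centre \<open>x\<close> from both sides into a relation across
  \<open>x\<close>.\<close>

lemma interval_relation:
  assumes ab: "a \<le> (b::real)"
    and sym: "\<And>s t. R s t \<Longrightarrow> R t s"
    and trans: "\<And>s t u. a \<le> t \<Longrightarrow> t \<le> b \<Longrightarrow> R s t \<Longrightarrow> R t u \<Longrightarrow> R s u"
    and loc: "\<And>x. a \<le> x \<Longrightarrow> x \<le> b \<Longrightarrow> \<exists>d>0. \<forall>s. a \<le> s \<longrightarrow> s \<le> b \<longrightarrow> \<bar>s - x\<bar> < d \<longrightarrow> R s x"
  shows "R a b"
proof -
  have "a \<le> a \<longrightarrow> b \<le> b \<longrightarrow> R a b"
    using ab
  proof (induction rule: Bolzano[where P = "\<lambda>u v. a \<le> u \<longrightarrow> v \<le> b \<longrightarrow> R u v"])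
    case (trans u v w)
    show ?case using assms(3)[of v u w] trans by auto
  next
    case (local x)
    then obtain d where d: "d > 0" "\<forall>s. a \<le> s \<longrightarrow> s \<le> b \<longrightarrow> \<bar>s - x\<bar> < d \<longrightarrow> R s x" using loc[of x] by auto
    have "R u v" if "u \<le> x" "x \<le> v" "v - u < d" "a \<le> u" "v \<le> b" for u v
    proof -
      have "\<bar>u - x\<bar> < d" "\<bar>v - x\<bar> < d" "u \<le> b" "a \<le> v" using that by auto
      then have "R u x" "R v x" using d(2) that(4,5) by blast+
      then show ?thesis using assms(3)[of x u v] sym local by blast
    qed
    then show ?case using d(1) by blast
  qed
  then show ?thesis by simp
qed

lemma pathin_join:
  assumes g: "pathin X g" and h: "pathin X h" and e: "g 1 = h 0"
  shows "pathin X (\<lambda>t. if t \<le> 1/2 then g (2 * t) else h (2 * t - 1))"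
proof -
  have "continuous_map (top_of_set {0..1}) X (\<lambda>t. if t \<le> 1/2 then g (2 * t) else h (2 * t - 1))"
  proof (rule continuous_map_cases_le)
    have "continuous_on ({0..1} \<inter> {x \<in> topspace (top_of_set {0..1}). x \<le> 1/2}) (\<lambda>t::real. 2 * t)" by (intro continuous_intros)
    then have "continuous_map (top_of_set ({0..1} \<inter> {x \<in> topspace (top_of_set {0..1}). x \<le> 1/2})) (top_of_set {0..1}) (\<lambda>t::real. 2 * t)"
      by (auto simp: continuous_map_in_subtopology)
    from continuous_map_compose[OF this g[unfolded pathin_def]]
    show "continuous_map (subtopology (top_of_set {0..1}) {x \<in> topspace (top_of_set {0..1}). x \<le> 1/2}) X (\<lambda>t. g (2 * t))"
      unfolding subtopology_subtopology by (simp add: o_def)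
    have "continuous_on ({0..1} \<inter> {x \<in> topspace (top_of_set {0..1}). 1/2 \<le> x}) (\<lambda>t::real. 2 * t - 1)" by (intro continuous_intros)
    then have "continuous_map (top_of_set ({0..1} \<inter> {x \<in> topspace (top_of_set {0..1}). 1/2 \<le> x})) (top_of_set {0..1}) (\<lambda>t::real. 2 * t - 1)"
      by (auto simp: continuous_map_in_subtopology)
    from continuous_map_compose[OF this h[unfolded pathin_def]]
    show "continuous_map (subtopology (top_of_set {0..1}) {x \<in> topspace (top_of_set {0..1}). 1/2 \<le> x}) X (\<lambda>t. h (2 * t - 1))"
      unfolding subtopology_subtopology by (simp add: o_def)
    show "g (2 * t) = h (2 * t - 1)" if "t \<in> topspace (top_of_set {0..1})" "t = 1/2" for t
      unfolding that(2) using e by simp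
  qed (auto intro!: continuous_intros)
  then show ?thesis unfolding pathin_def .
qed

lemma last_crossing:
  fixes \<phi> :: "'a \<Rightarrow> real"
  assumes c: "pathin X c" and \<phi>: "continuous_map X euclideanreal \<phi>" and l: "\<phi> (c 0) < l" "l < \<phi> (c 1)"
  shows "\<exists>c'. pathin X c' \<and> \<phi> (c' 0) = l \<and> c' 1 = c 1 \<and> (\<forall>s\<in>{0<..1}. l < \<phi> (c' s))"
proof -
  have cont: "continuous_on {0..1} (\<phi> \<circ> c)"
    using continuous_map_compose[OF c[unfolded pathin_def] \<phi>] by simp
  \<comment> \<open>Its largest element is the last time at which the level is at most
    \<open>l\<close>; the path is followed from there on.\<close>
  define S where "S = {s \<in> {0..1}. \<phi> (c s) \<le> l}"
  have "closed S" unfolding S_def using continuous_closed_preimage[OF cont, of "{..l}"] by (auto simp: vimage_def Int_def)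
  moreover have "bounded S" unfolding S_def by (rule bounded_subset[of "{0..1}"]) auto
  ultimately have "compact S" by (simp add: compact_eq_bounded_closed)
  moreover have "0 \<in> S" unfolding S_def using l by auto
  ultimately obtain a where a: "a \<in> S" "\<And>s. s \<in> S \<Longrightarrow> s \<le> a" using compact_attains_sup[of S] by blast
  have a01: "0 \<le> a" "a \<le> 1" "\<phi> (c a) \<le> l" using a(1) unfolding S_def by auto
  have above: "l < \<phi> (c s)" if "a < s" "s \<le> 1" for s using a(2)[of s] that a01 unfolding S_def by force
  have eq: "\<phi> (c a) = l"
  proof (rule ccontr)
    assume "\<phi> (c a) \<noteq> l"
    then have lt: "\<phi> (c a) < l" using a01 by simp
    have "continuous_on {a..1} (\<phi> \<circ> c)" by (rule continuous_on_subset[OF cont]) (use a01 in auto)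
    then obtain s where s: "a \<le> s" "s \<le> 1" "(\<phi> \<circ> c) s = l" using IVT'[of "\<phi> \<circ> c" a l 1] lt l a01 by auto
    then have "s \<noteq> a" using lt by auto
    then show False using above[of s] s by auto
  qed
  have "a \<noteq> 1" using eq l by auto
  then have a1: "a < 1" using a01 by simp
  define c' where "c' t = c (a + t * (1 - a))" for t
  have rng: "a + t * (1 - a) \<in> {0..1}" if "t \<in> {0..1}" for t
  proof -
    define k where "k = t * (1 - a)"
    have "k \<le> 1 - a" "0 \<le> k" using that a1 unfolding k_def by (auto intro: mult_left_le_one_le)
    then show ?thesis using a01 unfolding k_def[symmetric] by simp
  qed
  have "continuous_map (top_of_set {0..1}) (top_of_set {0..1}) (\<lambda>t. a + t * (1 - a))"
    using rng by (auto simp: continuous_map_in_subtopology intro!: continuous_intros)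
  from continuous_map_compose[OF this c[unfolded pathin_def]] have "pathin X c'" unfolding pathin_def c'_def comp_def .
  moreover have "\<phi> (c' 0) = l" "c' 1 = c 1" using eq unfolding c'_def by simp_all
  moreover have "l < \<phi> (c' s)" if s: "s \<in> {0<..1}" for s
  proof -
    have "0 < s * (1 - a)" using s a1 by simp
    then show ?thesis using above[of "a + s * (1 - a)"] rng[of s] s unfolding c'_def by auto
  qed
  ultimately show ?thesis by blast
qed

context reeb_space
begin

text \<open>The count of cut points for paths given in \<open>X\<close>, where the comparison with
  the metric graph produces them.\<close>

lemma card_le_betti1:
  assumes G: "finite G" "G \<subseteq> reeb_G m r - reeb_vertices m r"
    and paths: "\<And>g. g \<in> G \<Longrightarrow> \<exists>c. pathin (mtopology_of m) c \<and> proj (c 0) = g \<and> c 1 = r \<and> (\<forall>s\<in>{0<..1}. proj (c s) \<notin> G) \<and>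
      (\<exists>d>0. \<forall>s. 0 < s \<longrightarrow> s < d \<longrightarrow> s \<le> 1 \<longrightarrow> f g < lvl (c s))"
  shows "int (card G) \<le> reeb_betti1 m r"
proof -
  have "card G + card (reeb_vertices m r) \<le> card arcs + 1"
  proof (rule card_cut_points[OF monotone_arcs _ G(1)])
    show "proj r \<in> reeb_vertices m r" unfolding reeb_vertices_def by simp
    show "G \<subseteq> topspace T - reeb_vertices m r" using G topspace_T by simp
    show "\<not> local_min p" if "p \<in> topspace T" "p \<noteq> proj r" for p using not_local_min[OF that] .
    fix g assume "g \<in> G"
    then obtain c d where c: "pathin (mtopology_of m) c" "proj (c 0) = g" "c 1 = r" "\<forall>s\<in>{0<..1}. proj (c s) \<notin> G"
      "d > 0" "\<forall>s. 0 < s \<longrightarrow> s < d \<longrightarrow> s \<le> 1 \<longrightarrow> f g < lvl (c s)" using paths by meson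
    have "pathin T (proj \<circ> c)" using c(1) continuous_proj unfolding pathin_def by (rule continuous_map_compose)
    moreover have "f g < f ((proj \<circ> c) s)" if "0 < s" "s < min d 1" for s
      using c(6) that f_proj[OF pathin_mspace[OF c(1), of s]] by auto
    moreover have "0 < min d 1" using c(5) by simp
    ultimately show "\<exists>\<rho>. pathin T \<rho> \<and> \<rho> 0 = g \<and> \<rho> 1 = proj r \<and> (\<forall>s\<in>{0<..1}. \<rho> s \<notin> G) \<and> (\<exists>d>0. \<forall>s. 0 < s \<longrightarrow> s < d \<longrightarrow> f g < f (\<rho> s))"
      using c(2-4) by (intro exI[of _ "proj \<circ> c"] conjI exI[of _ "min d 1"] allI impI) auto
  qed
  then show ?thesis unfolding reeb_betti1_eq by linarith
qed

end

section \<open>Comparison with a graph cut into cells\<close>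

text \<open>A metric graph approximating X, cut into cells: short cells (Sh and connectors Co, which are
  used only to join vertices) and long cells, on which the height above r' increases at unit speed.\<close>

locale cell_approximation = reeb_space m r for m :: "'a metric" and r :: 'a +
  fixes P :: "'p set" and D :: "'p \<Rightarrow> 'p \<Rightarrow> real" and C :: "('a \<times> 'p) set" and r' :: 'p
    and \<epsilon> \<eta> :: real and U :: "'p set" and Sh Co Lg :: "'c set" and cl :: "'c \<Rightarrow> real" and pr :: "'c \<Rightarrow> real \<Rightarrow> 'p"
  assumes D_refl: "\<And>x. x \<in> P \<Longrightarrow> D x x = 0"
    and D_sym: "\<And>x y. x \<in> P \<Longrightarrow> y \<in> P \<Longrightarrow> D x y = D y x"
    and D_tri: "\<And>x y z. x \<in> P \<Longrightarrow> y \<in> P \<Longrightarrow> z \<in> P \<Longrightarrow> D x z \<le> D x y + D y z"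
    and D_nonneg: "\<And>x y. x \<in> P \<Longrightarrow> y \<in> P \<Longrightarrow> 0 \<le> D x y"
    and corr: "correspondence (mspace m) P C"
    and distortion: "\<And>x x' y y'. (x, x') \<in> C \<Longrightarrow> (y, y') \<in> C \<Longrightarrow> \<bar>mdist m x y - D x' y'\<bar> \<le> \<eta>"
    and rr: "(r, r') \<in> C" and eta: "0 \<le> \<eta>" "\<eta> < 2 * \<epsilon>"
    and U: "finite U" "U \<subseteq> P" "r' \<in> U"
    and fin: "finite Sh" "finite Co" "finite Lg" and disj: "(Sh \<union> Co) \<inter> Lg = {}"
    and cl_pos: "\<And>c. c \<in> Sh \<union> Co \<union> Lg \<Longrightarrow> 0 < cl c"
    and pr_P: "\<And>c s. c \<in> Sh \<union> Co \<union> Lg \<Longrightarrow> 0 \<le> s \<Longrightarrow> s \<le> cl c \<Longrightarrow> pr c s \<in> P"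
    and pr_dist: "\<And>c s t. c \<in> Sh \<union> Co \<union> Lg \<Longrightarrow> 0 \<le> s \<Longrightarrow> s \<le> cl c \<Longrightarrow> 0 \<le> t \<Longrightarrow> t \<le> cl c \<Longrightarrow> D (pr c s) (pr c t) \<le> \<bar>s - t\<bar>"
    and pr_ends: "\<And>c. c \<in> Sh \<union> Co \<union> Lg \<Longrightarrow> pr c 0 \<in> U \<and> pr c (cl c) \<in> U"
    and pr_interior: "\<And>c s. c \<in> Sh \<union> Co \<union> Lg \<Longrightarrow> 0 < s \<Longrightarrow> s < cl c \<Longrightarrow> pr c s \<notin> U"
    and pr_disjoint: "\<And>c c' s s'. c \<in> Sh \<union> Co \<union> Lg \<Longrightarrow> c' \<in> Sh \<union> Co \<union> Lg \<Longrightarrow> 0 < s \<Longrightarrow> s < cl c \<Longrightarrow> 0 < s' \<Longrightarrow> s' < cl c' \<Longrightarrow>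
        pr c s = pr c' s' \<Longrightarrow> c = c'"
    and cover: "P = U \<union> (\<Union>c\<in>Sh \<union> Co \<union> Lg. pr c ` {0..cl c})"
    and short: "\<And>c. c \<in> Sh \<union> Co \<Longrightarrow> cl c \<le> 16 * \<epsilon>"
    and long: "\<And>c. c \<in> Lg \<Longrightarrow> 8 * \<epsilon> < cl c"
    and ascending: "\<And>c s. c \<in> Lg \<Longrightarrow> 0 \<le> s \<Longrightarrow> s \<le> cl c \<Longrightarrow> D r' (pr c s) = D r' (pr c 0) + s"
    and chain: "\<And>x y k. x \<in> P \<Longrightarrow> y \<in> P \<Longrightarrow> D x y < k \<Longrightarrow>
        (x, y) \<in> {(p, q). p \<in> P \<and> q \<in> P \<and> (\<exists>c\<in>Sh \<union> Co \<union> Lg. p \<in> pr c ` {0..cl c} \<and> q \<in> pr c ` {0..cl c})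
            \<and> D x p + D p y < k \<and> D x q + D q y < k}\<^sup>*"
    and downward: "\<And>v. v \<in> U \<Longrightarrow> v \<noteq> r' \<Longrightarrow> (\<exists>c\<in>Lg. pr c (cl c) = v) \<or>
        (\<exists>c\<in>Sh. (pr c 0 = v \<and> D r' (pr c (cl c)) < D r' v) \<or> (pr c (cl c) = v \<and> D r' (pr c 0) < D r' v))"
begin

abbreviation cells :: "'c set" where "cells \<equiv> Sh \<union> Co \<union> Lg"
abbreviation ht :: "'p \<Rightarrow> real" where "ht \<equiv> D r'"
abbreviation top_pt :: "'c \<Rightarrow> 'p" where "top_pt c \<equiv> pr c (cl c)"
abbreviation bot_pt :: "'c \<Rightarrow> 'p" where "bot_pt c \<equiv> pr c 0"

lemma eps_pos: "0 < \<epsilon>" using eta by simp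

lemma r'_P: "r' \<in> P" using U by blast

lemma ht_lipschitz: "x \<in> P \<Longrightarrow> y \<in> P \<Longrightarrow> ht y \<le> ht x + D x y"
  using D_tri[OF r'_P] by simp

lemma C_points: "(x, x') \<in> C \<Longrightarrow> x \<in> mspace m \<and> x' \<in> P"
  using corr unfolding correspondence_def by auto

lemma C_right: "x \<in> mspace m \<Longrightarrow> \<exists>x'. (x, x') \<in> C"
  using corr unfolding correspondence_def by force

lemma C_left: "x' \<in> P \<Longrightarrow> \<exists>x. (x, x') \<in> C"
  using corr unfolding correspondence_def by force

lemma ht_lvl: "(x, x') \<in> C \<Longrightarrow> \<bar>lvl x - ht x'\<bar> \<le> \<eta>"
  using distortion[OF rr] by simp

lemma D_le: "(x, x') \<in> C \<Longrightarrow> (y, y') \<in> C \<Longrightarrow> D x' y' \<le> mdist m x y + \<eta>"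
  using distortion[of x x' y y'] by auto

lemma d_le: "(x, x') \<in> C \<Longrightarrow> (y, y') \<in> C \<Longrightarrow> mdist m x y \<le> D x' y' + \<eta>"
  using distortion[of x x' y y'] by auto

lemma U_end:
  assumes "c \<in> cells" "0 \<le> s" "s \<le> cl c" "pr c s \<in> U"
  shows "s = 0 \<or> s = cl c"
  using pr_interior[OF assms(1), of s] assms by force

text \<open>The classes are formed in two stages because their diameters are controlled differently.
  Starting from singletons, the cells of \<open>Sh\<close> give \<open>P0\<close> at the price of
  their total length. Joining further along connectors, of length at most 16\<epsilon>, is charged
  by the number of classes that disappear between \<open>P0\<close> and \<open>P1\<close>.\<close>

lemma clusters_exist:
  "\<exists>P0 P1 w. partition_on U P0 \<and> partition_on U P1 \<and>
     (\<forall>K\<in>P1. 0 \<le> w K \<and> (\<forall>u\<in>K. \<forall>v\<in>K. D u v \<le> w K)) \<and>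
     (\<forall>c\<in>Sh. \<exists>K\<in>P0. bot_pt c \<in> K \<and> top_pt c \<in> K) \<and>
     (\<forall>c\<in>Sh \<union> Co. \<exists>K\<in>P1. bot_pt c \<in> K \<and> top_pt c \<in> K) \<and>
     sum w P1 \<le> sum cl Sh + 16 * \<epsilon> * (real (card P0) - real (card P1)) \<and>
     (\<forall>R. (\<forall>x y. R x y \<longrightarrow> R y x) \<longrightarrow> (\<forall>x y z. R x y \<longrightarrow> R y z \<longrightarrow> R x z) \<longrightarrow> (\<forall>u\<in>U. R u u) \<longrightarrow>
        (\<forall>c\<in>Sh \<union> Co. R (bot_pt c) (top_pt c)) \<longrightarrow> (\<forall>K\<in>P1. \<forall>u\<in>K. \<forall>v\<in>K. R u v))"
proof -
  let ?S = "(\<lambda>u. {u}) ` U"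
  have symU: "D u v = D v u" if "u \<in> U" "v \<in> U" for u v using D_sym U(2) that by blast
  have triU: "D u x \<le> D u v + D v x" if "u \<in> U" "v \<in> U" "x \<in> U" for u v x using D_tri U(2) that by blast
  have e: "bot_pt c \<in> U \<and> top_pt c \<in> U \<and> 0 \<le> cl c \<and> D (bot_pt c) (top_pt c) \<le> cl c" if "c \<in> cells" for c
    using pr_ends[OF that] cl_pos[OF that] pr_dist[OF that, of 0 "cl c"] by auto
  have part: "partition_on U ?S" by (rule partition_onI) (auto simp: disjnt_def)
  have w0: "D u v \<le> (\<lambda>_. 0) K" if "K \<in> ?S" "u \<in> K" "v \<in> K" for K u v using that D_refl U(2) by auto
  have b16: "0 \<le> 16 * \<epsilon>" using eps_pos by simp
  have eSh: "bot_pt c \<in> U \<and> top_pt c \<in> U \<and> 0 \<le> cl c \<and> D (bot_pt c) (top_pt c) \<le> cl c" if "c \<in> Sh" for c using e that by simp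
  have eCo: "bot_pt c \<in> U \<and> top_pt c \<in> U \<and> 0 \<le> cl c \<and> D (bot_pt c) (top_pt c) \<le> cl c" if "c \<in> Co" for c using e that by simp
  have sSh: "cl c \<le> 16 * \<epsilon>" if "c \<in> Sh" for c using short that by simp
  have sCo: "cl c \<le> 16 * \<epsilon>" if "c \<in> Co" for c using short that by simp
  have w00: "0 \<le> (\<lambda>_. 0::real) K" if "K \<in> ?S" for K by simp
  have "\<exists>P0 w'. partition_on U P0 \<and> (\<forall>K\<in>P0. 0 \<le> w' K \<and> (\<forall>u\<in>K. \<forall>v\<in>K. D u v \<le> w' K))
    \<and> (\<forall>e\<in>Sh. \<exists>K\<in>P0. bot_pt e \<in> K \<and> top_pt e \<in> K) \<and> (\<forall>K\<in>?S. \<exists>K'\<in>P0. K \<subseteq> K') \<and> card P0 \<le> card ?S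
    \<and> sum w' P0 \<le> sum (\<lambda>_. 0) ?S + sum cl Sh \<and> sum w' P0 \<le> sum (\<lambda>_. 0) ?S + 16 * \<epsilon> * (real (card ?S) - real (card P0))
    \<and> (\<forall>R. (\<forall>x y. R x y \<longrightarrow> R y x) \<longrightarrow> (\<forall>x y z. R x y \<longrightarrow> R y z \<longrightarrow> R x z) \<longrightarrow>
        (\<forall>K\<in>?S. \<forall>u\<in>K. \<forall>v\<in>K. R u v) \<longrightarrow> (\<forall>e\<in>Sh. R (bot_pt e) (top_pt e)) \<longrightarrow> (\<forall>K\<in>P0. \<forall>u\<in>K. \<forall>v\<in>K. R u v))"
    by (rule partition_add_edges[where D = D and p = bot_pt and q = top_pt and \<omega> = cl and w = "\<lambda>_. 0" and b = "16 * \<epsilon>"]) (fact fin(1) U(1) symU triU eSh part w00 w0 b16 sSh)+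
  then obtain P0 w' where 1: "partition_on U P0 \<and> (\<forall>K\<in>P0. 0 \<le> w' K \<and> (\<forall>u\<in>K. \<forall>v\<in>K. D u v \<le> w' K))
    \<and> (\<forall>e\<in>Sh. \<exists>K\<in>P0. bot_pt e \<in> K \<and> top_pt e \<in> K) \<and> (\<forall>K\<in>?S. \<exists>K'\<in>P0. K \<subseteq> K') \<and> card P0 \<le> card ?S
    \<and> sum w' P0 \<le> sum (\<lambda>_. 0) ?S + sum cl Sh \<and> sum w' P0 \<le> sum (\<lambda>_. 0) ?S + 16 * \<epsilon> * (real (card ?S) - real (card P0))
    \<and> (\<forall>R. (\<forall>x y. R x y \<longrightarrow> R y x) \<longrightarrow> (\<forall>x y z. R x y \<longrightarrow> R y z \<longrightarrow> R x z) \<longrightarrow>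
        (\<forall>K\<in>?S. \<forall>u\<in>K. \<forall>v\<in>K. R u v) \<longrightarrow> (\<forall>e\<in>Sh. R (bot_pt e) (top_pt e)) \<longrightarrow> (\<forall>K\<in>P0. \<forall>u\<in>K. \<forall>v\<in>K. R u v))"
    by (elim exE) rule
  note 1 = 1[THEN conjunct1] 1[THEN conjunct2, THEN conjunct1] 1[THEN conjunct2, THEN conjunct2, THEN conjunct1]
    1[THEN conjunct2, THEN conjunct2, THEN conjunct2, THEN conjunct2, THEN conjunct2, THEN conjunct1]
    1[THEN conjunct2, THEN conjunct2, THEN conjunct2, THEN conjunct2, THEN conjunct2, THEN conjunct2, THEN conjunct2]
  have w1: "0 \<le> w' K" "D u v \<le> w' K" if "K \<in> P0" "u \<in> K" "v \<in> K" for K u v using 1(2) that by auto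
  have w1': "0 \<le> w' K" if "K \<in> P0" for K using 1(2) that by auto
  have "\<exists>P1 w. partition_on U P1 \<and> (\<forall>K\<in>P1. 0 \<le> w K \<and> (\<forall>u\<in>K. \<forall>v\<in>K. D u v \<le> w K))
    \<and> (\<forall>e\<in>Co. \<exists>K\<in>P1. bot_pt e \<in> K \<and> top_pt e \<in> K) \<and> (\<forall>K\<in>P0. \<exists>K'\<in>P1. K \<subseteq> K') \<and> card P1 \<le> card P0
    \<and> sum w P1 \<le> sum w' P0 + sum cl Co \<and> sum w P1 \<le> sum w' P0 + 16 * \<epsilon> * (real (card P0) - real (card P1))
    \<and> (\<forall>R. (\<forall>x y. R x y \<longrightarrow> R y x) \<longrightarrow> (\<forall>x y z. R x y \<longrightarrow> R y z \<longrightarrow> R x z) \<longrightarrow>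
        (\<forall>K\<in>P0. \<forall>u\<in>K. \<forall>v\<in>K. R u v) \<longrightarrow> (\<forall>e\<in>Co. R (bot_pt e) (top_pt e)) \<longrightarrow> (\<forall>K\<in>P1. \<forall>u\<in>K. \<forall>v\<in>K. R u v))"
    by (rule partition_add_edges[where D = D and p = bot_pt and q = top_pt and \<omega> = cl and w = "w'" and b = "16 * \<epsilon>"]) (fact fin(2) U(1) symU triU eCo 1(1) w1' w1(2) b16 sCo)+
  then obtain P1 w where 2: "partition_on U P1 \<and> (\<forall>K\<in>P1. 0 \<le> w K \<and> (\<forall>u\<in>K. \<forall>v\<in>K. D u v \<le> w K))
    \<and> (\<forall>e\<in>Co. \<exists>K\<in>P1. bot_pt e \<in> K \<and> top_pt e \<in> K) \<and> (\<forall>K\<in>P0. \<exists>K'\<in>P1. K \<subseteq> K') \<and> card P1 \<le> card P0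
    \<and> sum w P1 \<le> sum w' P0 + sum cl Co \<and> sum w P1 \<le> sum w' P0 + 16 * \<epsilon> * (real (card P0) - real (card P1))
    \<and> (\<forall>R. (\<forall>x y. R x y \<longrightarrow> R y x) \<longrightarrow> (\<forall>x y z. R x y \<longrightarrow> R y z \<longrightarrow> R x z) \<longrightarrow>
        (\<forall>K\<in>P0. \<forall>u\<in>K. \<forall>v\<in>K. R u v) \<longrightarrow> (\<forall>e\<in>Co. R (bot_pt e) (top_pt e)) \<longrightarrow> (\<forall>K\<in>P1. \<forall>u\<in>K. \<forall>v\<in>K. R u v))"
    by (elim exE) rule
  note 2 = 2[THEN conjunct1] 2[THEN conjunct2, THEN conjunct1] 2[THEN conjunct2, THEN conjunct2, THEN conjunct1]
    2[THEN conjunct2, THEN conjunct2, THEN conjunct2, THEN conjunct1]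
    2[THEN conjunct2, THEN conjunct2, THEN conjunct2, THEN conjunct2, THEN conjunct2, THEN conjunct2, THEN conjunct1]
    2[THEN conjunct2, THEN conjunct2, THEN conjunct2, THEN conjunct2, THEN conjunct2, THEN conjunct2, THEN conjunct2]
  show ?thesis
  proof (rule exI[of _ P0], rule exI[of _ P1], rule exI[of _ w], intro conjI)
    show "\<forall>c\<in>Sh \<union> Co. \<exists>K\<in>P1. bot_pt c \<in> K \<and> top_pt c \<in> K"
    proof
      fix c assume "c \<in> Sh \<union> Co"
      then consider "c \<in> Co" | "c \<in> Sh" by blast
      then show "\<exists>K\<in>P1. bot_pt c \<in> K \<and> top_pt c \<in> K"
      proof cases
        case 1 then show ?thesis using 2(3) by simp
      next
        case c: 2
        then obtain K where K: "K \<in> P0" "bot_pt c \<in> K" "top_pt c \<in> K" using 1(3) by meson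
        then obtain K' where "K' \<in> P1" "K \<subseteq> K'" using 2(4) by meson
        then show ?thesis using K by blast
      qed
    qed
    show "sum w P1 \<le> sum cl Sh + 16 * \<epsilon> * (real (card P0) - real (card P1))" using 1(4) 2(5) by simp
    show "\<forall>R. (\<forall>x y. R x y \<longrightarrow> R y x) \<longrightarrow> (\<forall>x y z. R x y \<longrightarrow> R y z \<longrightarrow> R x z) \<longrightarrow> (\<forall>u\<in>U. R u u) \<longrightarrow>
        (\<forall>c\<in>Sh \<union> Co. R (bot_pt c) (top_pt c)) \<longrightarrow> (\<forall>K\<in>P1. \<forall>u\<in>K. \<forall>v\<in>K. R u v)"
    proof (rule allI, rule impI, rule impI, rule impI, rule impI)
      fix R assume R: "\<forall>x y. R x y \<longrightarrow> R y x" "\<forall>x y z. R x y \<longrightarrow> R y z \<longrightarrow> R x z" "\<forall>u\<in>U. R u u"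
        "\<forall>c\<in>Sh \<union> Co. R (bot_pt c) (top_pt c)"
      have s: "\<forall>K\<in>?S. \<forall>u\<in>K. \<forall>v\<in>K. R u v" using R(3) by simp
      have "\<forall>e\<in>Sh. R (bot_pt e) (top_pt e)" "\<forall>e\<in>Co. R (bot_pt e) (top_pt e)" using R(4) by simp_all
      from 2(6)[THEN spec, THEN mp, THEN mp, THEN mp, THEN mp, OF R(1,2) 1(5)[THEN spec, THEN mp, THEN mp, THEN mp, THEN mp, OF R(1,2) s this(1)] this(2)]
      show "\<forall>K\<in>P1. \<forall>u\<in>K. \<forall>v\<in>K. R u v" .
    qed
  qed (fact 1(1,3) 2(1,2))+
qed

end

section \<open>Clusters and the long cells that lead down from them\<close>

locale clustered_approximation = cell_approximation +
  fixes P0 P1 :: "'b set set" and w :: "'b set \<Rightarrow> real"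
  assumes P0: "partition_on U P0" and P1: "partition_on U P1"
    and w_nonneg: "\<And>K. K \<in> P1 \<Longrightarrow> 0 \<le> w K" and w_diam: "\<And>K u v. K \<in> P1 \<Longrightarrow> u \<in> K \<Longrightarrow> v \<in> K \<Longrightarrow> D u v \<le> w K"
    and P0_Sh: "\<And>c. c \<in> Sh \<Longrightarrow> \<exists>K\<in>P0. bot_pt c \<in> K \<and> top_pt c \<in> K"
    and P1_short: "\<And>c. c \<in> Sh \<union> Co \<Longrightarrow> \<exists>K\<in>P1. bot_pt c \<in> K \<and> top_pt c \<in> K"
    and w_sum: "sum w P1 \<le> sum cl Sh + 16 * \<epsilon> * (real (card P0) - real (card P1))"
    and P1_conn: "\<And>R K u v. \<lbrakk>\<And>x y. R x y \<Longrightarrow> R y x; \<And>x y z. R x y \<Longrightarrow> R y z \<Longrightarrow> R x z; \<And>u. u \<in> U \<Longrightarrow> R u u;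
        \<And>c. c \<in> Sh \<union> Co \<Longrightarrow> R (bot_pt c) (top_pt c); K \<in> P1; u \<in> K; v \<in> K\<rbrakk> \<Longrightarrow> R u v"
begin

definition blob where "blob u = (THE K. K \<in> P1 \<and> u \<in> K)"

lemma blob: assumes "u \<in> U" shows "blob u \<in> P1" "u \<in> blob u"
proof -
  obtain K where K: "K \<in> P1" "u \<in> K" using P1 assms unfolding partition_on_def by blast
  have "\<exists>!K. K \<in> P1 \<and> u \<in> K"
  proof (rule ex1I[of _ K])
    fix K' assume "K' \<in> P1 \<and> u \<in> K'"
    then show "K' = K" using K P1 unfolding partition_on_def disjoint_def by blast
  qed (use K in simp)
  then have "blob u \<in> P1 \<and> u \<in> blob u" unfolding blob_def by (rule theI')
  then show "blob u \<in> P1" "u \<in> blob u" by auto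
qed

lemma blob_eq:
  assumes "K \<in> P1" "u \<in> K"
  shows "blob u = K"
proof -
  have "u \<in> U" using P1 assms unfolding partition_on_def by auto
  note b = blob[OF this]
  show ?thesis
  proof (rule ccontr)
    assume "blob u \<noteq> K"
    then have "blob u \<inter> K = {}" using P1 b(1) assms(1) unfolding partition_on_def disjoint_def by simp
    then show False using b(2) assms(2) by blast
  qed
qed

lemma blob_short: "c \<in> Sh \<union> Co \<Longrightarrow> blob (top_pt c) = blob (bot_pt c)"
  using P1_short[of c] blob_eq by fastforce

text \<open>From a lowest point of \<open>K\<close> a cell of \<open>Sh\<close> cannot lead further
  down, since its other end would be a lower point of \<open>K\<close>. By the assumption on
  descents this point is the top of a long cell.\<close>

lemma lowest_is_top:
  assumes K: "K \<subseteq> U" "K \<noteq> {}" "r' \<notin> K" and Sh: "\<And>c. c \<in> Sh \<Longrightarrow> bot_pt c \<in> K \<longleftrightarrow> top_pt c \<in> K"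
  shows "\<exists>c\<in>Lg. top_pt c \<in> K \<and> (\<forall>u\<in>K. ht (top_pt c) \<le> ht u)"
proof -
  have finK: "finite K" using K U(1) finite_subset by blast
  then have "finite (ht ` K)" "ht ` K \<noteq> {}" using K by auto
  then have "Min (ht ` K) \<in> ht ` K" by (rule Min_in)
  then obtain v where v: "v \<in> K" "ht v = Min (ht ` K)" by auto
  have low: "ht v \<le> ht u" if "u \<in> K" for u unfolding v(2) using finK that by simp
  have "v \<in> U" "v \<noteq> r'" using K v by auto
  from downward[OF this] show ?thesis
  proof
    assume "\<exists>c\<in>Lg. top_pt c = v" then show ?thesis using v low by blast
  next
    assume "\<exists>c\<in>Sh. (bot_pt c = v \<and> ht (top_pt c) < ht v) \<or> (top_pt c = v \<and> ht (bot_pt c) < ht v)"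
    then obtain c u where c: "c \<in> Sh" "u \<in> K" "ht u < ht v" using Sh v(1) by metis
    then show ?thesis using low by force
  qed
qed

lemma class_closed:
  assumes Q: "partition_on U Q" "\<And>c. c \<in> Sh \<Longrightarrow> \<exists>K\<in>Q. bot_pt c \<in> K \<and> top_pt c \<in> K" and K: "K \<in> Q" and c: "c \<in> Sh"
  shows "bot_pt c \<in> K \<longleftrightarrow> top_pt c \<in> K"
proof -
  obtain K' where K': "K' \<in> Q" "bot_pt c \<in> K'" "top_pt c \<in> K'" using Q(2)[OF c] by blast
  have "K \<inter> K' = {} \<or> K = K'" using Q(1) K K'(1) unfolding partition_on_def disjoint_def by blast
  then show ?thesis using K' by blast
qed

lemma class_leg:
  assumes Q: "partition_on U Q" "\<And>c. c \<in> Sh \<Longrightarrow> \<exists>K\<in>Q. bot_pt c \<in> K \<and> top_pt c \<in> K" and K: "K \<in> Q" "r' \<notin> K"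
  shows "\<exists>c\<in>Lg. top_pt c \<in> K \<and> (\<forall>u\<in>K. ht (top_pt c) \<le> ht u)"
  by (rule lowest_is_top) (use Q(1) K class_closed[OF Q K(1)] in \<open>auto simp: partition_on_def\<close>)

definition leg where "leg K = (SOME c. c \<in> Lg \<and> top_pt c \<in> K \<and> (\<forall>u\<in>K. ht (top_pt c) \<le> ht u))"

lemma leg:
  assumes "K \<in> P1" "r' \<notin> K"
  shows "leg K \<in> Lg" "top_pt (leg K) \<in> K" "\<And>u. u \<in> K \<Longrightarrow> ht (top_pt (leg K)) \<le> ht u"
proof -
  have "\<exists>c. c \<in> Lg \<and> top_pt c \<in> K \<and> (\<forall>u\<in>K. ht (top_pt c) \<le> ht u)"
    using class_leg[OF P1 _ assms, OF P1_short] unfolding Bex_def by simp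
  then have "leg K \<in> Lg \<and> top_pt (leg K) \<in> K \<and> (\<forall>u\<in>K. ht (top_pt (leg K)) \<le> ht u)" unfolding leg_def by (rule someI_ex)
  then show "leg K \<in> Lg" "top_pt (leg K) \<in> K" "\<And>u. u \<in> K \<Longrightarrow> ht (top_pt (leg K)) \<le> ht u" by auto
qed

definition removed where "removed = Lg - leg ` (P1 - {blob r'})"

lemma card_classes_minus:
  assumes Q: "partition_on U Q"
  shows "finite Q" "\<exists>K\<in>Q. r' \<in> K \<and> (\<forall>K'\<in>Q - {K}. r' \<notin> K')"
proof -
  show "finite Q" using finite_elements[OF U(1) Q] .
  obtain K where "K \<in> Q" "r' \<in> K" using U(3) Q unfolding partition_on_def by auto
  moreover have "r' \<notin> K'" if "K' \<in> Q - {K}" for K'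
    using Q calculation that unfolding partition_on_def disjoint_def by blast
  ultimately show "\<exists>K\<in>Q. r' \<in> K \<and> (\<forall>K'\<in>Q - {K}. r' \<notin> K')" by blast
qed

text \<open>Each class of \<open>P0\<close> without \<open>r'\<close> contains the top of a long
  cell, and different classes give different cells, so there are at least \<open>card P0 - 1\<close>
  long cells. The legs of the classes of \<open>P1\<close> use up at most \<open>card P1 - 1\<close>
  of them.\<close>

lemma card_removed: "real (card P0) - real (card P1) \<le> real (card removed)"
proof -
  obtain K0 where K0: "K0 \<in> P0" "r' \<in> K0" "\<And>K'. K' \<in> P0 - {K0} \<Longrightarrow> r' \<notin> K'" using card_classes_minus(2)[OF P0] by blast
  have leg0: "\<exists>c. c \<in> Lg \<and> top_pt c \<in> K" if "K \<in> P0 - {K0}" for K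
    using class_leg[OF P0 P0_Sh, of K] K0(3)[OF that] that unfolding Bex_def by auto
  then obtain l where l: "\<And>K. K \<in> P0 - {K0} \<Longrightarrow> l K \<in> Lg \<and> top_pt (l K) \<in> K" by metis
  have "inj_on l (P0 - {K0})"
  proof (rule inj_onI)
    fix A B assume A: "A \<in> P0 - {K0}" and B: "B \<in> P0 - {K0}" and eq: "l A = l B"
    then have "top_pt (l A) \<in> A \<inter> B" using l[OF A] l[OF B] by simp
    then show "A = B" using P0 A B unfolding partition_on_def disjoint_def by blast
  qed
  then have 1: "card (P0 - {K0}) \<le> card Lg"
    by (rule card_inj_on_le) (use l fin(3) in auto)
  have f0: "finite P0" and f1: "finite P1" using card_classes_minus(1) P0 P1 by auto
  have 2: "card P0 \<le> card Lg + 1" using 1 card_Suc_Diff1[OF f0 K0(1)] by simp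
  have r1: "blob r' \<in> P1" using blob(1)[OF U(3)] .
  have "leg ` (P1 - {blob r'}) \<subseteq> Lg"
  proof
    fix c assume "c \<in> leg ` (P1 - {blob r'})"
    then obtain K where K: "K \<in> P1" "K \<noteq> blob r'" "c = leg K" by auto
    then have "r' \<notin> K" using blob_eq by blast
    then show "c \<in> Lg" using leg(1) K by simp
  qed
  then have "card removed = card Lg - card (leg ` (P1 - {blob r'}))"
    unfolding removed_def using f1 by (intro card_Diff_subset) auto
  moreover have "card (leg ` (P1 - {blob r'})) \<le> card (P1 - {blob r'})" using f1 by (intro card_image_le) auto
  moreover have "card (P1 - {blob r'}) + 1 = card P1" using card_Suc_Diff1[OF f1 r1] by simp
  ultimately show ?thesis using 2 by linarith
qed

section \<open>Labels of points near a level\<close>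

text \<open>A long cell stands for itself only if it extends 4\<epsilon> beyond \<open>t\<close> on
  both sides; otherwise it belongs to the cluster at the end close to \<open>t\<close>. Having
  length more than 8\<epsilon>, it cannot have both ends close to \<open>t\<close>.\<close>

definition cell_label :: "real \<Rightarrow> 'c \<Rightarrow> 'b set + 'c" where
  "cell_label t c = (if c \<in> Lg then
      (if ht (top_pt c) < t + 4 * \<epsilon> then Inl (blob (top_pt c))
       else if t - 4 * \<epsilon> < ht (bot_pt c) then Inl (blob (bot_pt c)) else Inr c)
     else Inl (blob (bot_pt c)))"

definition open_cell where "open_cell c = pr c ` {0<..<cl c}"

definition label :: "real \<Rightarrow> 'b \<Rightarrow> 'b set + 'c" where
  "label t p = (if p \<in> U then Inl (blob p) else cell_label t (THE c. c \<in> cells \<and> p \<in> open_cell c))"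

lemma cell_point:
  assumes "p \<in> P" "p \<notin> U"
  shows "\<exists>c s. c \<in> cells \<and> p = pr c s \<and> 0 \<le> s \<and> s \<le> cl c"
proof -
  have "p \<in> (\<Union>c\<in>cells. pr c ` {0..cl c})" using assms cover by blast
  then obtain c s where "c \<in> cells" "s \<in> {0..cl c}" "p = pr c s" by (elim UN_E imageE)
  then show ?thesis by (intro exI[of _ c] exI[of _ s]) simp
qed

lemma the_cell: "c \<in> cells \<Longrightarrow> p \<in> open_cell c \<Longrightarrow> (THE c. c \<in> cells \<and> p \<in> open_cell c) = c"
  by (rule the_equality) (use pr_disjoint in \<open>auto simp: open_cell_def\<close>)

lemma open_cell_U: "c \<in> cells \<Longrightarrow> open_cell c \<inter> U = {}"
  using pr_interior unfolding open_cell_def by auto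

lemma label_open: "c \<in> cells \<Longrightarrow> p \<in> open_cell c \<Longrightarrow> label t p = cell_label t c"
  unfolding label_def using the_cell open_cell_U by auto

text \<open>The only question is the two ends, which are vertices and carry the label of their own
  cluster. If the height of an end is within 4\<epsilon> of \<open>t\<close>, the cell has the label
  of the cluster at exactly that end.\<close>

lemma label_cell:
  assumes c: "c \<in> cells" and s: "0 \<le> s" "s \<le> cl c" and near: "\<bar>ht (pr c s) - t\<bar> < 4 * \<epsilon>"
  shows "label t (pr c s) = cell_label t c"
proof (cases "pr c s \<in> U")
  case False
  then have "s \<noteq> 0" "s \<noteq> cl c" using pr_ends[OF c] by auto
  then have "pr c s \<in> open_cell c" unfolding open_cell_def using s by auto
  then show ?thesis by (rule label_open[OF c])
next
  case True
  then have lab: "label t (pr c s) = Inl (blob (pr c s))" unfolding label_def by simp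
  show ?thesis
  proof (cases "c \<in> Lg")
    case False
    then have "c \<in> Sh \<union> Co" using c by blast
    then have "blob (pr c s) = blob (bot_pt c)" using U_end[OF c s True] blob_short by auto
    then show ?thesis using False lab unfolding cell_label_def by simp
  next
    case L: True
    have len: "ht (top_pt c) = ht (bot_pt c) + cl c" using ascending[OF L, of "cl c"] cl_pos[OF c] by simp
    from U_end[OF c s True] show ?thesis
    proof
      assume "s = 0"
      then have "\<not> ht (top_pt c) < t + 4 * \<epsilon>" "t - 4 * \<epsilon> < ht (bot_pt c)" using near len long[OF L] by (auto simp: abs_less_iff)
      then show ?thesis using L lab \<open>s = 0\<close> unfolding cell_label_def by simp
    next
      assume "s = cl c"
      then show ?thesis using L lab near unfolding cell_label_def by (simp add: abs_less_iff)
    qed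
  qed
qed

text \<open>An almost shortest connection from \<open>x\<close> to \<open>y\<close> runs through
  cells, and each of its points is close enough to \<open>t\<close> in height for the label to be
  that of the cell. Consecutive points share a cell, so the label never changes.\<close>

lemma label_close:
  assumes x: "x \<in> P" "y \<in> P" "D x y < k" and near: "\<And>q. q \<in> P \<Longrightarrow> D x q + D q y < k \<Longrightarrow> \<bar>ht q - t\<bar> < 4 * \<epsilon>"
  shows "label t x = label t y"
  using chain[OF x]
proof (induction rule: rtrancl_induct)
  case (step p q)
  then obtain c where c: "c \<in> cells" "p \<in> pr c ` {0..cl c}" "q \<in> pr c ` {0..cl c}" and pq: "p \<in> P" "q \<in> P" "D x p + D p y < k" "D x q + D q y < k"
    by auto
  obtain s s' where s: "p = pr c s" "0 \<le> s" "s \<le> cl c" "q = pr c s'" "0 \<le> s'" "s' \<le> cl c" using c by auto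
  have "label t p = cell_label t c" using label_cell[OF c(1) s(2,3)] near[OF pq(1,3)] s(1) by simp
  moreover have "label t q = cell_label t c" using label_cell[OF c(1) s(5,6)] near[OF pq(2,4)] s(4) by simp
  ultimately show ?case using step.IH by simp
qed simp

text \<open>The correspondents are less than 2\<epsilon> apart. Their heights are within \<eta> of
  \<open>t\<close>, so on a connection shorter than 2\<epsilon> the height differs from
  \<open>t\<close> by less than \<eta> + 2\<epsilon>, which is below 4\<epsilon>.\<close>

lemma label_same_level:
  assumes C: "(z, z') \<in> C" "(v, v') \<in> C" and l: "lvl z = t" "lvl v = t" and d: "mdist m z v < 2 * \<epsilon> - \<eta>"
  shows "label t z' = label t v'"
proof (rule label_close)
  show P: "z' \<in> P" "v' \<in> P" using C C_points by auto
  show "D z' v' < 2 * \<epsilon>" using D_le[OF C] d by simp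
  fix q assume q: "q \<in> P" "D z' q + D q v' < 2 * \<epsilon>"
  have "\<bar>ht q - ht z'\<bar> \<le> D z' q" using ht_lipschitz[OF P(1) q(1)] ht_lipschitz[OF q(1) P(1)] D_sym[OF P(1) q(1)] by simp
  moreover have "0 \<le> D q v'" using D_nonneg q P by simp
  moreover have "\<bar>t - ht z'\<bar> \<le> \<eta>" using ht_lvl[OF C(1)] l by simp
  ultimately show "\<bar>ht q - t\<bar> < 4 * \<epsilon>" using q(2) eta by linarith
qed

lemma pathin_close:
  assumes g: "pathin (mtopology_of m) g" and x: "x \<in> {0..1}" and e: "0 < e"
  shows "\<exists>d>0. \<forall>s. 0 \<le> s \<longrightarrow> s \<le> 1 \<longrightarrow> \<bar>s - x\<bar> < d \<longrightarrow> mdist m (g s) (g x) < e"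
proof -
  have gx: "g x \<in> mspace m" using pathin_mspace[OF g x] .
  have "continuous_map (top_of_set {0..1}) euclideanreal (\<lambda>s. mdist m (g s) (g x))"
    using g gx unfolding pathin_def by (intro continuous_map_mdist) auto
  then have "continuous_on {0..1} (\<lambda>s. mdist m (g s) (g x))" by simp
  then obtain d where d: "d > 0" "\<And>s. s \<in> {0..1} \<Longrightarrow> dist s x < d \<Longrightarrow> dist (mdist m (g s) (g x)) (mdist m (g x) (g x)) < e"
    using x e unfolding continuous_on_iff by blast
  have "mdist m (g s) (g x) < e" if "0 \<le> s" "s \<le> 1" "\<bar>s - x\<bar> < d" for s
    using d(2)[of s] that gx by (simp add: dist_real_def)
  then show ?thesis using d(1) by blast
qed

text \<open>Points with the same projection are joined by a path within their level set, and along
  it the label is locally constant, whichever correspondents are chosen. The label at the level of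
  the point is thus an invariant of the point in the Reeb graph.\<close>

lemma label_fibre:
  assumes C: "(z, z') \<in> C" "(v, v') \<in> C" and pr: "proj z = proj v"
  shows "label (lvl z) z' = label (lvl z) v'"
proof -
  have X: "z \<in> mspace m" "v \<in> mspace m" using C C_points by auto
  have "reeb_rel m r z v" using proj_eq_iff[OF X] pr by simp
  then have "path_component_of (subtopology (mtopology_of m) {y \<in> mspace m. lvl y = lvl z}) z v"
    unfolding reeb_rel_def by (elim conjE)
  then obtain g where g: "pathin (subtopology (mtopology_of m) {y \<in> mspace m. lvl y = lvl z}) g" "g 0 = z" "g 1 = v"
    unfolding path_component_of_def by blast
  then have gX: "pathin (mtopology_of m) g" and gl: "\<And>s. s \<in> {0..1} \<Longrightarrow> lvl (g s) = lvl z \<and> g s \<in> mspace m"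
    unfolding pathin_def continuous_map_in_subtopology by auto
  define R where "R s s' \<longleftrightarrow> (\<forall>a b. (g s, a) \<in> C \<longrightarrow> (g s', b) \<in> C \<longrightarrow> label (lvl z) a = label (lvl z) b)" for s s'
  have "R 0 1"
  proof (rule interval_relation)
    show "R s t \<Longrightarrow> R t s" for s t unfolding R_def by metis
    show "R s u" if st: "0 \<le> t" "t \<le> 1" "R s t" "R t u" for s t u
    proof -
      obtain b where "(g t, b) \<in> C" using C_right gl[of t] st by auto
      then show ?thesis using st unfolding R_def by metis
    qed
    show "\<exists>d>0. \<forall>s. 0 \<le> s \<longrightarrow> s \<le> 1 \<longrightarrow> \<bar>s - x\<bar> < d \<longrightarrow> R s x" if x: "0 \<le> x" "x \<le> 1" for x
    proof -
      obtain d where d: "d > 0" "\<forall>s. 0 \<le> s \<longrightarrow> s \<le> 1 \<longrightarrow> \<bar>s - x\<bar> < d \<longrightarrow> mdist m (g s) (g x) < 2 * \<epsilon> - \<eta>"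
        using pathin_close[OF gX, of x "2 * \<epsilon> - \<eta>"] x eta by auto
      have "R s x" if s: "0 \<le> s" "s \<le> 1" "\<bar>s - x\<bar> < d" for s
        unfolding R_def
      proof (intro allI impI)
        fix a b assume "(g s, a) \<in> C" "(g x, b) \<in> C"
        then show "label (lvl z) a = label (lvl z) b"
          using label_same_level[of "g s" a "g x" b "lvl z"] gl[of s] gl[of x] d(2) s x by simp
      qed
      then show ?thesis using d(1) by blast
    qed
  qed simp
  then show ?thesis unfolding R_def using g(2,3) C by metis
qed

text \<open>On a cell of length at most 16\<epsilon> one end is within 8\<epsilon>, and both ends
  are in the cluster. On a long cell the height is within \<eta> of the level and the end in
  question within 4\<epsilon>, so the distance to that end is at most 4\<epsilon> + \<eta> <
  6\<epsilon>.\<close>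

lemma label_Inl:
  assumes C: "(z, z') \<in> C" and lab: "label (lvl z) z' = Inl b"
  shows "b \<in> P1" "\<exists>v\<in>b. v \<in> P \<and> D z' v \<le> 8 * \<epsilon>"
proof -
  have zP: "z' \<in> P" using C C_points by auto
  have goal: "b \<in> P1 \<and> (\<exists>v\<in>b. v \<in> P \<and> D z' v \<le> 8 * \<epsilon>)"
  proof (cases "z' \<in> U")
    case True
    then have "b = blob z'" using lab unfolding label_def by simp
    then show ?thesis using blob[OF True] zP D_refl[OF zP] eps_pos by force
  next
    case False
    then obtain c s where c: "c \<in> cells" "z' = pr c s" "0 \<le> s" "s \<le> cl c" using cell_point[OF zP False] by metis
    have ends: "bot_pt c \<in> U" "top_pt c \<in> U" "bot_pt c \<in> P" "top_pt c \<in> P" using pr_ends[OF c(1)] U(2) by auto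
    have Db: "D z' (bot_pt c) \<le> s" and Dt: "D z' (top_pt c) \<le> cl c - s"
      using pr_dist[OF c(1,3,4), of 0] pr_dist[OF c(1,3,4), of "cl c"] c(2,3,4) cl_pos[OF c(1)] by auto
    have "s \<noteq> 0" "s \<noteq> cl c" using False c(2) ends by auto
    then have "z' \<in> open_cell c" unfolding open_cell_def using c by auto
    then have lab': "cell_label (lvl z) c = Inl b" using lab label_open[OF c(1)] by simp
    show ?thesis
    proof (cases "c \<in> Lg")
      case False
      then have sc: "c \<in> Sh \<union> Co" using c(1) by blast
      have b: "b = blob (bot_pt c)" using lab' False unfolding cell_label_def by simp
      have "bot_pt c \<in> b" "top_pt c \<in> b" using blob(2)[OF ends(1)] blob(2)[OF ends(2)] blob_short[OF sc] b by auto
      moreover have "D z' (bot_pt c) \<le> 8 * \<epsilon> \<or> D z' (top_pt c) \<le> 8 * \<epsilon>" using Db Dt short[OF sc] by linarith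
      moreover have "b \<in> P1" using b blob(1)[OF ends(1)] by simp
      ultimately show ?thesis
        using bexI[of "\<lambda>v. v \<in> P \<and> D z' v \<le> 8 * \<epsilon>" "bot_pt c" b] bexI[of "\<lambda>v. v \<in> P \<and> D z' v \<le> 8 * \<epsilon>" "top_pt c" b] ends(3,4)
        by argo
    next
      case L: True
      have hz: "ht z' = ht (bot_pt c) + s" "ht (top_pt c) = ht (bot_pt c) + cl c"
        using ascending[OF L c(3,4)] ascending[OF L, of "cl c"] c(2) cl_pos[OF c(1)] by simp_all
      have near: "\<bar>lvl z - ht z'\<bar> \<le> \<eta>" using ht_lvl[OF C] .
      consider "ht (top_pt c) < lvl z + 4 * \<epsilon>" "b = blob (top_pt c)" | "lvl z - 4 * \<epsilon> < ht (bot_pt c)" "b = blob (bot_pt c)"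
        using lab' L unfolding cell_label_def by (auto split: if_splits)
      then show ?thesis
      proof cases
        case 1
        then have "D z' (top_pt c) \<le> 8 * \<epsilon>" using Dt hz near eta by linarith
        then show ?thesis using 1(2) blob[OF ends(2)] ends by (simp; intro bexI[of _ "top_pt c"]; simp)
      next
        case 2
        then have "D z' (bot_pt c) \<le> 8 * \<epsilon>" using Db hz near eta by linarith
        then show ?thesis using 2(2) blob[OF ends(1)] ends by (simp; intro bexI[of _ "bot_pt c"]; simp)
      qed
    qed
  qed
  then show "b \<in> P1" "\<exists>v\<in>b. v \<in> P \<and> D z' v \<le> 8 * \<epsilon>" by auto
qed

lemma label_Inr:
  assumes p: "p \<in> P" "label t p = Inr c"
  shows "c \<in> Lg" "p \<in> open_cell c" "t + 4 * \<epsilon> \<le> ht (top_pt c)" "ht (bot_pt c) \<le> t - 4 * \<epsilon>"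
proof -
  have pU: "p \<notin> U" using p unfolding label_def by auto
  then obtain c' s where c: "c' \<in> cells" "p = pr c' s" "0 \<le> s" "s \<le> cl c'" using cell_point[OF p(1)] by metis
  have "s \<noteq> 0" "s \<noteq> cl c'" using pU c pr_ends[OF c(1)] by auto
  then have o: "p \<in> open_cell c'" unfolding open_cell_def using c by auto
  then have "cell_label t c' = Inr c" using p label_open[OF c(1)] by simp
  then have "c' = c" "c \<in> Lg" "t + 4 * \<epsilon> \<le> ht (top_pt c)" "ht (bot_pt c) \<le> t - 4 * \<epsilon>" 
    unfolding cell_label_def by (auto split: if_splits)
  then show "c \<in> Lg" "p \<in> open_cell c" "t + 4 * \<epsilon> \<le> ht (top_pt c)" "ht (bot_pt c) \<le> t - 4 * \<epsilon>" using o by auto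
qed

text \<open>The way leads 8\<epsilon> to the cluster, through it, and 8\<epsilon> back; \<eta> is
  the distortion. The levels of the two points may differ, which is what allows jumps near one
  cluster to be grouped although they occur at different levels.\<close>

lemma dist_label_Inl:
  assumes "(z, z') \<in> C" "(v, v') \<in> C" "label (lvl z) z' = Inl b" "label (lvl v) v' = Inl b"
  shows "mdist m z v \<le> 16 * \<epsilon> + \<eta> + w b"
proof -
  obtain x where x: "x \<in> b" "x \<in> P" "D z' x \<le> 8 * \<epsilon>" using label_Inl(2)[OF assms(1,3)] by (elim bexE conjE)
  obtain y where y: "y \<in> b" "y \<in> P" "D v' y \<le> 8 * \<epsilon>" using label_Inl(2)[OF assms(2,4)] by (elim bexE conjE)
  have P: "z' \<in> P" "v' \<in> P" using assms C_points by auto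
  have "D z' v' \<le> D z' x + (D x y + D y v')" using D_tri[of z' x v'] D_tri[of x y v'] P x y by simp
  also have "D x y \<le> w b" using w_diam[OF label_Inl(1)[OF assms(1,3)] x(1) y(1)] .
  also have "D y v' \<le> 8 * \<epsilon>" using y D_sym[of y v'] P by simp
  finally have "D z' v' \<le> 16 * \<epsilon> + w b" using x by simp
  then show ?thesis using d_le[OF assms(1,2)] by simp
qed

text \<open>On a long cell the height is a coordinate. Points of the same level have correspondents
  whose heights differ by at most 2\<eta>, so they are at distance at most 3\<eta> in
  \<open>X\<close>.\<close>

lemma dist_label_Inr:
  assumes C: "(z, z') \<in> C" "(v, v') \<in> C" and l: "lvl v = lvl z" and lab: "label (lvl z) z' = Inr c" "label (lvl z) v' = Inr c"
  shows "mdist m z v \<le> 16 * \<epsilon> + \<eta>"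
proof -
  have P: "z' \<in> P" "v' \<in> P" using C C_points by auto
  note z = label_Inr[OF P(1) lab(1)] and v = label_Inr[OF P(2) lab(2)]
  obtain s t where s: "z' = pr c s" "0 < s" "s < cl c" "v' = pr c t" "0 < t" "t < cl c"
    using z(2) v(2) unfolding open_cell_def by auto
  have "D z' v' \<le> \<bar>s - t\<bar>" using pr_dist[of c s t] z(1) s by simp
  moreover have "ht z' - ht v' = s - t" using ascending[OF z(1), of s] ascending[OF z(1), of t] s by simp
  moreover have "\<bar>lvl z - ht z'\<bar> \<le> \<eta>" "\<bar>lvl z - ht v'\<bar> \<le> \<eta>" using ht_lvl[OF C(1)] ht_lvl[OF C(2)] l by simp_all
  ultimately have "D z' v' \<le> 2 * \<eta>" by linarith
  then show ?thesis using d_le[OF C] eta by linarith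
qed


lemma label_near:
  assumes C: "(v, v') \<in> C" "(u, u') \<in> C" and d: "mdist m v u < \<epsilon>"
  shows "label (lvl u) v' = label (lvl u) u'"
proof (rule label_close)
  show P: "v' \<in> P" "u' \<in> P" using C C_points by auto
  have X: "v \<in> mspace m" "u \<in> mspace m" using C C_points by auto
  show "D v' u' < \<epsilon> + \<eta>" using D_le[OF C] d by simp
  fix q assume q: "q \<in> P" "D v' q + D q u' < \<epsilon> + \<eta>"
  \<comment> \<open>The bounds through \<open>v'\<close> and through \<open>u'\<close> are averaged:
    the height of \<open>q\<close> differs from the level of \<open>u\<close> by less than
    \<epsilon> + 3\<eta>/2, which is below 4\<epsilon>.\<close>
  have "ht q \<le> ht v' + D v' q" "ht v' \<le> ht q + D v' q" using ht_lipschitz[OF P(1) q(1)] ht_lipschitz[OF q(1) P(1)] D_sym[OF P(1) q(1)] by simp_all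
  moreover have "ht q \<le> ht u' + D q u'" "ht u' \<le> ht q + D q u'" using ht_lipschitz[OF P(2) q(1)] ht_lipschitz[OF q(1) P(2)] D_sym[OF P(2) q(1)] by simp_all
  moreover have "\<bar>lvl u - ht u'\<bar> \<le> \<eta>" "\<bar>lvl v - ht v'\<bar> \<le> \<eta>" "\<bar>lvl v - lvl u\<bar> \<le> mdist m v u"
    using ht_lvl[OF C(1)] ht_lvl[OF C(2)] lvl_diff_le[OF X] by simp_all
  ultimately show "\<bar>ht q - lvl u\<bar> < 4 * \<epsilon>" using q(2) eta d unfolding abs_less_iff abs_le_iff by linarith
qed

section \<open>Paths along cells, and the markers of the removed cells\<close>

text \<open>With half of the available slack, a near geodesic from \<open>x\<close> to
  \<open>y\<close> has length less than 2\<epsilon>, so each of its points is within \<epsilon> of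
  one of the ends.\<close>

lemma near_connects:
  assumes X: "x \<in> mspace m" "y \<in> mspace m" and d: "mdist m x y < 2 * \<epsilon>"
    and Q: "\<And>z. z \<in> mspace m \<Longrightarrow> mdist m x z < \<epsilon> \<or> mdist m y z < \<epsilon> \<Longrightarrow> z \<in> Q"
  shows "path_component_of (subtopology (mtopology_of m) Q) x y"
proof -
  have d': "0 < (2 * \<epsilon> - mdist m x y) / 2" using d by simp
  obtain c where ng: "near_geodesic x y ((2 * \<epsilon> - mdist m x y) / 2) c" using near_geodesic_exists[OF X d'] by (elim exE)
  note c = near_geodesicD[OF ng] near_geodesic_two_legs[OF ng]
  have "c s \<in> Q" if s: "s \<in> {0..1}" for s
  proof (rule Q)
    show cs: "c s \<in> mspace m" using pathin_mspace[OF c(1) s] .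
    have "mdist m x (c s) + mdist m (c s) y < 2 * \<epsilon>" using c(4)[OF s] d by argo
    then show "mdist m x (c s) < \<epsilon> \<or> mdist m y (c s) < \<epsilon>" using M.commute[of y "c s"] by argo
  qed
  then have "pathin (subtopology (mtopology_of m) Q) c"
    using c(1) unfolding pathin_def by (auto simp: continuous_map_in_subtopology)
  then show ?thesis unfolding path_component_of_def using c(2,3) by (intro exI[of _ c] conjI)
qed

text \<open>Parameters of the cell that differ by less than \<open>2 * \<epsilon> - \<eta>\<close>
  have correspondents at distance less than 2\<epsilon>, which are joined by short curves. This
  produces a path of \<open>X\<close> that follows the cell, although the correspondence is not
  continuous.\<close>

lemma cell_connects:
  assumes c: "c \<in> cells" and a: "(x, bot_pt c) \<in> C" and b: "(y, top_pt c) \<in> C"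
    and Q: "\<And>v s z. 0 \<le> s \<Longrightarrow> s \<le> cl c \<Longrightarrow> (v, pr c s) \<in> C \<Longrightarrow> z \<in> mspace m \<Longrightarrow> mdist m v z < \<epsilon> \<Longrightarrow> z \<in> Q"
  shows "path_component_of (subtopology (mtopology_of m) Q) x y"
proof -
  define R where "R s t \<longleftrightarrow> (\<forall>u v. (u, pr c s) \<in> C \<longrightarrow> (v, pr c t) \<in> C \<longrightarrow> path_component_of (subtopology (mtopology_of m) Q) u v)" for s t
  have "R 0 (cl c)"
  proof (rule interval_relation)
    show "0 \<le> cl c" using cl_pos[OF c] by simp
    show "R s t \<Longrightarrow> R t s" for s t unfolding R_def using path_component_of_sym by metis
    show "R s u" if st: "0 \<le> t" "t \<le> cl c" "R s t" "R t u" for s t u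
      unfolding R_def
    proof (intro allI impI)
      fix p q assume pq: "(p, pr c s) \<in> C" "(q, pr c u) \<in> C"
      obtain v where v: "(v, pr c t) \<in> C" using C_left[OF pr_P[OF c st(1,2)]] by (elim exE)
      show "path_component_of (subtopology (mtopology_of m) Q) p q"
        using st(3,4) pq v unfolding R_def by (intro path_component_of_trans[of _ p v q]) simp_all
    qed
    show "\<exists>d>0. \<forall>s. 0 \<le> s \<longrightarrow> s \<le> cl c \<longrightarrow> \<bar>s - t\<bar> < d \<longrightarrow> R s t" if t: "0 \<le> t" "t \<le> cl c" for t
    proof (intro exI[of _ "2 * \<epsilon> - \<eta>"] conjI allI impI)
      show "0 < 2 * \<epsilon> - \<eta>" using eta by simp
      fix s assume s: "0 \<le> s" "s \<le> cl c" "\<bar>s - t\<bar> < 2 * \<epsilon> - \<eta>"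
      show "R s t" unfolding R_def
      proof (intro allI impI)
        fix u v assume uv: "(u, pr c s) \<in> C" "(v, pr c t) \<in> C"
        have "D (pr c s) (pr c t) \<le> \<bar>s - t\<bar>" using pr_dist[OF c s(1,2) t] .
        then have "mdist m u v < 2 * \<epsilon>" using d_le[OF uv] s(3) by simp
        then show "path_component_of (subtopology (mtopology_of m) Q) u v"
          using Q[OF s(1,2) uv(1)] Q[OF t uv(2)] uv C_points by (intro near_connects) auto
      qed
    qed
  qed
  then show ?thesis unfolding R_def using a b by simp
qed

text \<open>A path of \<open>X\<close> that follows the cell upwards crosses a level in the middle
  of the cell. By the invariance of labels, the whole level component met there stays near the open
  cell, so its class in the Reeb graph marks this cell and no other.\<close>

lemma cell_marker:
  assumes c: "c \<in> Lg" and xt: "(xt, top_pt c) \<in> C"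
  shows "\<exists>h. pathin (mtopology_of m) h \<and> h 1 = xt \<and> proj (h 0) \<notin> reeb_vertices m r \<and>
    (\<forall>s\<in>{0<..1}. lvl (h 0) < lvl (h s)) \<and>
    (\<forall>s\<in>{0..1}. \<exists>v t. 0 \<le> t \<and> t \<le> cl c \<and> (v, pr c t) \<in> C \<and> mdist m v (h s) < \<epsilon>) \<and>
    (\<forall>w v v'. w \<in> mspace m \<longrightarrow> proj w = proj (h 0) \<longrightarrow> (v, v') \<in> C \<longrightarrow> mdist m v w < \<epsilon> \<longrightarrow> v' \<in> open_cell c)"
proof -
  have cc: "c \<in> cells" using c by simp
  have len: "ht (top_pt c) = ht (bot_pt c) + cl c" using ascending[OF c, of "cl c"] cl_pos[OF cc] by simp
  have "finite (reeb_vertices m r)" using arcsD(1) .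
  \<comment> \<open>A cell longer than 8\<epsilon> leaves an open interval of heights at distance
    more than 4\<epsilon> from both ends. Leaving out the finitely many levels of vertices makes the
    class at this level an interior point of an arc.\<close>
  then have "infinite ({ht (bot_pt c) + 4 * \<epsilon> <..< ht (top_pt c) - 4 * \<epsilon>} - f ` reeb_vertices m r)"
    using len long[OF c] by (intro Diff_infinite_finite) (auto simp: infinite_Ioo)
  then obtain l where l: "ht (bot_pt c) + 4 * \<epsilon> < l" "l < ht (top_pt c) - 4 * \<epsilon>" "l \<notin> f ` reeb_vertices m r"
    by (metis Diff_iff ex_in_conv greaterThanLessThan_iff infinite_imp_nonempty)
  obtain xb where xb: "(xb, bot_pt c) \<in> C" using C_left pr_P[OF cc, of 0] cl_pos[OF cc] by fastforce
  define Q where "Q = {z \<in> mspace m. \<exists>v t. 0 \<le> t \<and> t \<le> cl c \<and> (v, pr c t) \<in> C \<and> mdist m v z < \<epsilon>}"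
  have "path_component_of (subtopology (mtopology_of m) Q) xb xt"
    by (rule cell_connects[OF cc xb xt]) (unfold Q_def, blast)
  then obtain g where g: "pathin (subtopology (mtopology_of m) Q) g" "g 0 = xb" "g 1 = xt" unfolding path_component_of_def by (elim exE conjE)
  \<comment> \<open>The correspondents of the two ends have levels within \<eta> < 2\<epsilon> of
    the heights, so \<open>l\<close> separates them. Starting at the last crossing of
    \<open>l\<close>, the path runs above the level of the marker.\<close>
  have low: "lvl (g 0) < l" "l < lvl (g 1)" using ht_lvl[OF xb] ht_lvl[OF xt] l g(2,3) eta by auto
  have "continuous_map (subtopology (mtopology_of m) Q) euclideanreal lvl" by (rule continuous_map_from_subtopology[OF continuous_lvl])
  from last_crossing[OF g(1) this low]
  obtain h where h: "pathin (subtopology (mtopology_of m) Q) h" "lvl (h 0) = l" "h 1 = xt" "\<forall>s\<in>{0<..1}. l < lvl (h s)"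
    unfolding g(3) by (elim exE conjE)
  have hX: "pathin (mtopology_of m) h" and hQ: "\<And>s. s \<in> {0..1} \<Longrightarrow> h s \<in> Q"
    using h(1) unfolding pathin_def by (auto simp: continuous_map_in_subtopology)
  have h0X: "h 0 \<in> mspace m" using hQ[of 0] unfolding Q_def by simp
  obtain z' where z': "(h 0, z') \<in> C" using C_right[OF h0X] by (elim exE)
  have lab0: "label l z' = Inr c"
  proof -
    obtain v t where v: "0 \<le> t" "t \<le> cl c" "(v, pr c t) \<in> C" "mdist m v (h 0) < \<epsilon>" using hQ[of 0] unfolding Q_def by auto
    have "label l (pr c t) = label l z'" using label_near[OF v(3) z' v(4)] h(2) by simp
    moreover have "\<bar>ht (pr c t) - l\<bar> < 4 * \<epsilon>"
    proof -
      have vX: "v \<in> mspace m" using v(3) C_points by simp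
      have "\<bar>lvl v - ht (pr c t)\<bar> \<le> \<eta>" "\<bar>lvl v - l\<bar> \<le> mdist m v (h 0)" using ht_lvl[OF v(3)] lvl_diff_le[OF vX h0X] h(2) by auto
      then show ?thesis using v(4) eta by linarith
    qed
    then have "label l (pr c t) = cell_label l c" by (rule label_cell[OF cc v(1,2)])
    moreover have "cell_label l c = Inr c" using c l unfolding cell_label_def by simp
    ultimately show ?thesis by simp
  qed
  \<comment> \<open>The label is carried over twice: from \<open>h 0\<close> to \<open>w\<close>
    within the class, and from \<open>w\<close> to \<open>v\<close> by closeness.\<close>
  have marked: "v' \<in> open_cell c" if w: "w \<in> mspace m" "proj w = proj (h 0)" "(v, v') \<in> C" "mdist m v w < \<epsilon>" for w v v'
  proof -
    obtain w' where w': "(w, w') \<in> C" using C_right[OF w(1)] by (elim exE)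
    have "f (proj w) = f (proj (h 0))" using w(2) by simp
    then have lw: "lvl w = l" using f_proj[OF w(1)] f_proj[OF h0X] h(2) by simp
    have "label l w' = Inr c" using label_fibre[OF z' w' w(2)[symmetric]] lab0 h(2) by simp
    then have "label l v' = Inr c" using label_near[OF w(3) w' w(4)] lw by simp
    then show ?thesis using label_Inr(2) C_points[OF w(3)] by blast
  qed
  have "proj (h 0) \<notin> reeb_vertices m r"
  proof
    assume "proj (h 0) \<in> reeb_vertices m r"
    then have "f (proj (h 0)) \<in> f ` reeb_vertices m r" by (rule imageI)
    then show False using f_proj[OF h0X] h(2) l(3) by simp
  qed
  moreover have "\<forall>s\<in>{0..1}. \<exists>v t. 0 \<le> t \<and> t \<le> cl c \<and> (v, pr c t) \<in> C \<and> mdist m v (h s) < \<epsilon>"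
    using hQ unfolding Q_def by simp
  ultimately show ?thesis using hX h(2-4) marked by (intro exI[of _ h] conjI) simp_all
qed

text \<open>The markers of the removed cells are cut points of the Reeb graph. From a marker the
  path first climbs along its own cell to the top and then goes down through clusters and legs,
  which are not removed cells and hence stay away from all markers.\<close>

theorem card_removed_le: "int (card removed) \<le> reeb_betti1 m r"
proof -
  have sub: "removed \<subseteq> Lg" unfolding removed_def by blast
  have cells_sub: "removed \<subseteq> cells" using sub by blast
  have ex_xt: "\<exists>xt. (xt, top_pt c) \<in> C" if "c \<in> removed" for c
    using C_left[OF pr_P[of c "cl c"]] cl_pos[of c] that cells_sub by fastforce
  then obtain xt where xt: "\<And>c. c \<in> removed \<Longrightarrow> (xt c, top_pt c) \<in> C" by metis
  define marks where "marks c h \<longleftrightarrow> pathin (mtopology_of m) h \<and> h 1 = xt c \<and> proj (h 0) \<notin> reeb_vertices m r \<and>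
    (\<forall>s\<in>{0<..1}. lvl (h 0) < lvl (h s)) \<and>
    (\<forall>s\<in>{0..1}. \<exists>v t. 0 \<le> t \<and> t \<le> cl c \<and> (v, pr c t) \<in> C \<and> mdist m v (h s) < \<epsilon>) \<and>
    (\<forall>w v v'. w \<in> mspace m \<longrightarrow> proj w = proj (h 0) \<longrightarrow> (v, v') \<in> C \<longrightarrow> mdist m v w < \<epsilon> \<longrightarrow> v' \<in> open_cell c)" for c h
  have "\<exists>h. marks c h" if "c \<in> removed" for c
    unfolding marks_def by (rule cell_marker[OF subsetD[OF sub that] xt[OF that]])
  then obtain h where h: "\<And>c. c \<in> removed \<Longrightarrow> marks c (h c)" by metis
  have h1: "pathin (mtopology_of m) (h c)" "h c 1 = xt c" "proj (h c 0) \<notin> reeb_vertices m r"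
      "\<And>s. s \<in> {0<..1} \<Longrightarrow> lvl (h c 0) < lvl (h c s)"
      "\<And>s. s \<in> {0..1} \<Longrightarrow> \<exists>v t. 0 \<le> t \<and> t \<le> cl c \<and> (v, pr c t) \<in> C \<and> mdist m v (h c s) < \<epsilon>"
      "\<And>w v v'. w \<in> mspace m \<Longrightarrow> proj w = proj (h c 0) \<Longrightarrow> (v, v') \<in> C \<Longrightarrow> mdist m v w < \<epsilon> \<Longrightarrow> v' \<in> open_cell c"
    if "c \<in> removed" for c
    using h[OF that] unfolding marks_def by simp_all
  define g where "g c = proj (h c 0)" for c
  define G where "G = g ` removed"
  have hX: "h c s \<in> mspace m" if "c \<in> removed" "s \<in> {0..1}" for c s using pathin_mspace[OF h1(1)[OF that(1)] that(2)] .
  have same: "c = d" if cd: "c \<in> cells" "d \<in> removed" "pr c t \<in> open_cell d" "0 \<le> t" "t \<le> cl c" for c d t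
  proof -
    have d: "d \<in> cells" using cd(2) cells_sub by blast
    have "pr c t \<notin> U" using open_cell_U[OF d] cd(3) by blast
    then have "t \<noteq> 0" "t \<noteq> cl c" using pr_ends[OF cd(1)] by auto
    then have t: "0 < t" "t < cl c" using cd(4,5) by auto
    obtain s where s: "0 < s" "s < cl d" "pr c t = pr d s" using cd(3) unfolding open_cell_def by auto
    show ?thesis by (rule pr_disjoint[OF cd(1) d t s])
  qed
  \<comment> \<open>A path close to the cell \<open>c\<close> can only meet classes that mark
    \<open>c\<close>, because open cells are disjoint. Taken at time 0 this also shows that the
    markers are distinct.\<close>
  have own: "d = c" if cd: "c \<in> removed" "d \<in> removed" "s \<in> {0..1}" "proj (h c s) = g d" for c d s
  proof -
    obtain v t where v: "0 \<le> t" "t \<le> cl c" "(v, pr c t) \<in> C" "mdist m v (h c s) < \<epsilon>" using h1(5)[OF cd(1,3)] by (elim exE conjE)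
    have "pr c t \<in> open_cell d" using h1(6)[OF cd(2) hX[OF cd(1,3)] _ v(3,4)] cd(4) unfolding g_def by simp
    then show ?thesis using same[OF _ cd(2) _ v(1,2)] cells_sub cd(1) by blast
  qed
  have inj: "inj_on g removed"
  proof (rule inj_onI)
    fix c d assume cd: "c \<in> removed" "d \<in> removed" "g c = g d"
    then show "c = d" using own[OF cd(1,2), of 0] unfolding g_def by simp
  qed
  \<comment> \<open>The part of \<open>X\<close> outside the marked classes. \<open>R\<close> joins
    points of the metric graph whose correspondents, all of them, can be joined inside this part,
    which makes \<open>R\<close> transitive in spite of the many possible correspondents.\<close>
  define Q where "Q = {z \<in> mspace m. proj z \<notin> G}"
  define R where "R u v \<longleftrightarrow> u \<in> P \<and> v \<in> P \<and> (\<forall>x y. (x, u) \<in> C \<longrightarrow> (y, v) \<in> C \<longrightarrow> path_component_of (subtopology (mtopology_of m) Q) x y)" for u v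
  have Qnear: "z \<in> Q" if z: "(v, v') \<in> C" "\<And>c. c \<in> removed \<Longrightarrow> v' \<notin> open_cell c" "z \<in> mspace m" "mdist m v z < \<epsilon>" for v v' z
  proof -
    have "proj z \<noteq> g c" if "c \<in> removed" for c using h1(6)[OF that z(3) _ z(1,4)] z(2)[OF that] unfolding g_def by auto
    then show ?thesis using z(3) unfolding Q_def G_def by auto
  qed
  have UQ: "u \<notin> open_cell c" if "u \<in> U" "c \<in> removed" for u c using open_cell_U that cells_sub by blast
  have Rsym: "R u v \<Longrightarrow> R v u" for u v unfolding R_def using path_component_of_sym by metis
  have Rtrans: "R u x" if uvx: "R u v" "R v x" for u v x
  proof -
    obtain y where y: "(y, v) \<in> C" using C_left uvx(1) unfolding R_def by blast
    show ?thesis unfolding R_def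
    proof (intro conjI allI impI)
      fix p q assume pq: "(p, u) \<in> C" "(q, x) \<in> C"
      show "path_component_of (subtopology (mtopology_of m) Q) p q"
        using uvx pq y unfolding R_def by (intro path_component_of_trans[of _ p y q]) simp_all
    qed (use uvx in \<open>auto simp: R_def\<close>)
  qed
  have Rrefl: "R u u" if u: "u \<in> U" for u
    unfolding R_def
  proof (intro conjI allI impI)
    show uP: "u \<in> P" "u \<in> P" using U(2) u by auto
    fix x y assume xy: "(x, u) \<in> C" "(y, u) \<in> C"
    have "mdist m x y < 2 * \<epsilon>" using d_le[OF xy] D_refl[OF uP(1)] eta by simp
    then show "path_component_of (subtopology (mtopology_of m) Q) x y"
      using Qnear[OF xy(1) UQ[OF u]] Qnear[OF xy(2) UQ[OF u]] C_points xy by (intro near_connects) auto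
  qed
  have Rcell: "R (bot_pt c) (top_pt c)" if c: "c \<in> cells" "c \<notin> removed" for c
    unfolding R_def
  proof (intro conjI allI impI)
    show "bot_pt c \<in> P" "top_pt c \<in> P" using pr_ends[OF c(1)] U(2) by auto
    fix x y assume xy: "(x, bot_pt c) \<in> C" "(y, top_pt c) \<in> C"
    show "path_component_of (subtopology (mtopology_of m) Q) x y"
    proof (rule cell_connects[OF c(1) xy])
      fix v s z assume s: "0 \<le> s" "s \<le> cl c" "(v, pr c s) \<in> C" "z \<in> mspace m" "mdist m v z < \<epsilon>"
      show "z \<in> Q" by (rule Qnear[OF s(3) _ s(4,5)]) (use same[OF c(1) _ _ s(1,2)] c(2) in blast)
    qed
  qed
  have Rblob: "R u v" if "K \<in> P1" "u \<in> K" "v \<in> K" for K u v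
  proof (rule P1_conn[OF Rsym Rtrans Rrefl _ that])
    show "R (bot_pt c) (top_pt c)" if "c \<in> Sh \<union> Co" for c using Rcell[of c] that disj sub by blast
  qed
  \<comment> \<open>Induction on the number of lower vertices: from any point of a cluster without
    \<open>r'\<close>, go inside the cluster to the top of its leg and down the leg, whose bottom is
    lower than the whole cluster.\<close>
  have root: "R u r'" if "u \<in> U" for u
    using that
  proof (induction "card {v \<in> U. ht v < ht u}" arbitrary: u rule: less_induct)
    case less
    note b = blob[OF less.prems]
    show ?case
    proof (cases "r' \<in> blob u")
      case True
      then show ?thesis by (rule Rblob[OF b])
    next
      case False
      note l = leg[OF b(1) False]
      have cc: "leg (blob u) \<in> cells" using l(1) by simp
      have ne: "blob u \<noteq> blob r'" using False blob(2)[OF U(3)] by auto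
      have nr: "leg (blob u) \<notin> removed" unfolding removed_def using b(1) ne by blast
      let ?b = "bot_pt (leg (blob u))"
      have bU: "?b \<in> U" using pr_ends[OF cc] by simp
      have "ht (top_pt (leg (blob u))) = ht ?b + cl (leg (blob u))" using ascending[OF l(1), of "cl (leg (blob u))"] cl_pos[OF cc] by simp
      then have lt: "ht ?b < ht u" using l(3)[OF b(2)] cl_pos[OF cc] by simp
      have "card {v \<in> U. ht v < ht ?b} < card {v \<in> U. ht v < ht u}"
        by (rule psubset_card_mono) (use U(1) lt bU in \<open>auto intro: less_trans\<close>)
      then have "R ?b r'" using less.hyps bU by blast
      moreover have "R u (top_pt (leg (blob u)))" by (rule Rblob[OF b l(2)])
      moreover have "R (top_pt (leg (blob u))) ?b" by (rule Rsym[OF Rcell[OF cc nr]])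
      ultimately show ?thesis using Rtrans[of u _ ?b] Rtrans[of u ?b r'] by blast
    qed
  qed
  have "int (card G) \<le> reeb_betti1 m r"
  proof (rule card_le_betti1)
    have "finite removed" using finite_subset[OF sub fin(3)] .
    then show "finite G" unfolding G_def by simp
    show "G \<subseteq> reeb_G m r - reeb_vertices m r" unfolding G_def g_def using h1(3) proj_in_G hX[of _ 0] by auto
    fix p assume "p \<in> G"
    then obtain c where c: "c \<in> removed" "p = g c" unfolding G_def by blast
    have cc: "c \<in> cells" using c(1) cells_sub by blast
    have "R (top_pt c) r'" using root pr_ends[OF cc] by blast
    then have "path_component_of (subtopology (mtopology_of m) Q) (xt c) r" unfolding R_def using xt[OF c(1)] rr by simp
    then obtain k where k: "pathin (subtopology (mtopology_of m) Q) k" "k 0 = xt c" "k 1 = r" unfolding path_component_of_def by (elim exE conjE)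
    have kX: "pathin (mtopology_of m) k" and kQ: "\<And>s. s \<in> {0..1} \<Longrightarrow> k s \<in> Q"
      using k(1) unfolding pathin_def by (auto simp: continuous_map_in_subtopology)
    \<comment> \<open>On the first half only the marker of \<open>c\<close> itself could be met, and
      not after the start, since the level there exceeds that of the marker. The second half lies in
      \<open>Q\<close>.\<close>
    define j where "j t = (if t \<le> 1/2 then h c (2 * t) else k (2 * t - 1))" for t :: real
    have jX: "pathin (mtopology_of m) j" unfolding j_def
      by (rule pathin_join[OF h1(1)[OF c(1)] kX]) (use h1(2)[OF c(1)] k(2) in simp_all)
    have h0: "h c 0 \<in> mspace m" using hX[OF c(1)] by simp
    have avoid: "proj (j s) \<notin> G" if s: "s \<in> {0<..1}" for s
    proof (cases "s \<le> 1/2")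
      case True
      then have s2: "2 * s \<in> {0<..1}" "2 * s \<in> {0..1}" using s by auto
      show ?thesis
      proof
        assume "proj (j s) \<in> G"
        then obtain d where d: "d \<in> removed" "proj (h c (2 * s)) = g d" unfolding G_def j_def using True by auto
        then have "d = c" using own[OF c(1) d(1) s2(2)] by simp
        then have "f (proj (h c (2 * s))) = f (proj (h c 0))" using d(2) unfolding g_def by simp
        then show False using f_proj[OF h0] f_proj[OF hX[OF c(1) s2(2)]] h1(4)[OF c(1) s2(1)] by simp
      qed
    next
      case False
      then have "j s \<in> Q" unfolding j_def using kQ[of "2 * s - 1"] s by auto
      then show ?thesis unfolding Q_def by simp
    qed
    have above: "f p < lvl (j s)" if "0 < s" "s < 1/2" for s
      using h1(4)[OF c(1), of "2 * s"] that f_proj[OF h0] unfolding c(2) g_def j_def by simp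
    have "proj (j 0) = p" "j 1 = r" unfolding j_def c(2) g_def using k(3) by simp_all
    moreover have "\<exists>d>0. \<forall>s. 0 < s \<longrightarrow> s < d \<longrightarrow> s \<le> 1 \<longrightarrow> f p < lvl (j s)" by (rule exI[of _ "1/2"]) (use above in simp)
    ultimately show "\<exists>c. pathin (mtopology_of m) c \<and> proj (c 0) = p \<and> c 1 = r \<and> (\<forall>s\<in>{0<..1}. proj (c s) \<notin> G) \<and>
      (\<exists>d>0. \<forall>s. 0 < s \<longrightarrow> s < d \<longrightarrow> s \<le> 1 \<longrightarrow> f p < lvl (c s))"
      using jX avoid by (intro exI[of _ j] conjI ballI)
  qed
  then show ?thesis unfolding G_def card_image[OF inj] .
qed


section \<open>The price of the jumps\<close>

text \<open>Jumps near the same cluster share a label, whatever their levels. Jumps on a long cell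
  may be far apart, so each such pair is its own label.\<close>

definition jump_label :: "('a \<Rightarrow> 'b) \<Rightarrow> 'a \<times> 'a \<Rightarrow> 'b set + 'a \<times> 'a" where
  "jump_label q = (\<lambda>(z, v). case label (lvl z) (q z) of Inl b \<Rightarrow> Inl b | Inr c \<Rightarrow> Inr (z, v))"

text \<open>The surplus over the flat price \<open>16 * \<epsilon> + \<eta>\<close> of every label.
  The value \<open>0\<close> outside \<open>P1\<close> keeps the price nonnegative for all labels,
  as the shortcut estimate for chains demands.\<close>

definition extra_cost :: "'b set + 'a \<times> 'a \<Rightarrow> real" where
  "extra_cost k = (case k of Inl b \<Rightarrow> if b \<in> P1 then w b else 0 | Inr _ \<Rightarrow> 0)"

lemma jump_cost:
  assumes q: "\<And>z. z \<in> mspace m \<Longrightarrow> (z, q z) \<in> C"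
    and X: "a \<in> mspace m" "b \<in> mspace m" "a' \<in> mspace m" "b' \<in> mspace m" and p: "proj a = proj b" "proj a' = proj b'"
    and eq: "jump_label q (a, b) = jump_label q (a', b')"
  shows "mdist m a b' \<le> (16 * \<epsilon> + \<eta>) + extra_cost (jump_label q (a, b))"
proof -
  have lvl: "lvl a = lvl b" "lvl a' = lvl b'" using p f_proj X by metis+
  have fib: "label (lvl a) (q a) = label (lvl b) (q b)" "label (lvl a') (q a') = label (lvl b') (q b')"
    using label_fibre[OF q[OF X(1)] q[OF X(2)] p(1)] label_fibre[OF q[OF X(3)] q[OF X(4)] p(2)] lvl by simp_all
  show ?thesis
  proof (cases "label (lvl a) (q a)")
    case (Inl K)
    then have lab: "label (lvl b') (q b') = Inl K"
      using eq fib(2) unfolding jump_label_def by (auto split: sum.splits)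
    have "mdist m a b' \<le> 16 * \<epsilon> + \<eta> + w K" by (rule dist_label_Inl[OF q[OF X(1)] q[OF X(4)] Inl lab])
    moreover have "extra_cost (jump_label q (a, b)) = w K"
      using Inl label_Inl(1)[OF q[OF X(1)] Inl] unfolding jump_label_def extra_cost_def by simp
    ultimately show ?thesis by simp
  next
    case (Inr c)
    then have "(a, b) = (a', b')" using eq unfolding jump_label_def by (auto split: sum.splits)
    then have ab: "b' = b" by simp
    have "label (lvl a) (q b) = Inr c" using fib(1) Inr lvl(1) by simp
    then have "mdist m a b \<le> 16 * \<epsilon> + \<eta>" by (rule dist_label_Inr[OF q[OF X(1)] q[OF X(2)] lvl(1)[symmetric] Inr])
    moreover have "extra_cost (jump_label q (a, b)) = 0" using Inr unfolding jump_label_def extra_cost_def by simp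
    ultimately show ?thesis unfolding ab by simp
  qed
qed

lemma sum_extra_cost: "finite A \<Longrightarrow> sum extra_cost A \<le> sum w P1"
proof -
  assume A: "finite A"
  have fP: "finite P1" using card_classes_minus(1)[OF P1] .
  have nn: "0 \<le> extra_cost k" for k unfolding extra_cost_def using w_nonneg by (auto split: sum.splits)
  have "sum extra_cost A \<le> sum extra_cost (A \<union> Inl ` P1)" using A fP nn by (intro sum_mono2) auto
  also have "\<dots> = sum extra_cost (Inl ` P1)"
    using A fP by (intro sum.mono_neutral_right) (auto simp: extra_cost_def split: sum.splits)
  also have "\<dots> = sum (\<lambda>K. extra_cost (Inl K)) P1" by (subst sum.reindex) (simp_all add: comp_def)
  also have "\<dots> = sum w P1" by (rule sum.cong) (simp_all add: extra_cost_def)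
  finally show ?thesis .
qed

text \<open>There are no more labels than jumps, so the flat price is paid at most
  \<open>reeb_betti1 m r + 1\<close> times. The diameter of a cluster is paid at most once, and the
  sum of the diameters is bounded by the short cells and the number of removed long cells.\<close>

lemma dist_le_reeb_dist_clustered:
  assumes x: "x \<in> mspace m" and y: "y \<in> mspace m"
  shows "mdist m x y \<le> reeb_dist m r (proj x) (proj y) + (16 * \<epsilon> + \<eta>) * (reeb_betti1 m r + 1)
    + sum cl Sh + 16 * \<epsilon> * reeb_betti1 m r"
proof (rule field_le_epsilon)
  fix e :: real assume e: "0 < e"
  have "reach x y (reeb_dist m r (proj x) (proj y) + e) (reeb_betti1 m r + 1)" by (rule reach_of_reeb_dist[OF x y]) (use e in simp)
  then obtain L js where L: "jump_chain (mdist m) (mspace m) x y L js" "L \<le> reeb_dist m r (proj x) (proj y) + e"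
    "int (length js) \<le> reeb_betti1 m r + 1" "fibre_jumps js" unfolding reach_def by (elim exE conjE)
  obtain q where q: "\<And>z. z \<in> mspace m \<Longrightarrow> (z, q z) \<in> C" using C_right by metis
  let ?A = "jump_label q ` set js"
  let ?c = "\<lambda>k. (16 * \<epsilon> + \<eta>) + extra_cost k"
  have nn: "0 \<le> extra_cost k" for k unfolding extra_cost_def using w_nonneg by (auto split: sum.splits)
  have "mdist m x y \<le> L + sum ?c ?A"
  proof (rule M.jump_chain_dist_le[OF L(1)])
    show "0 \<le> ?c k" for k using nn[of k] eps_pos eta by simp
    fix a b a' b' assume j: "(a, b) \<in> set js" "(a', b') \<in> set js" "jump_label q (a, b) = jump_label q (a', b')"
    have "a \<in> mspace m \<and> b \<in> mspace m \<and> proj a = proj b" "a' \<in> mspace m \<and> b' \<in> mspace m \<and> proj a' = proj b'"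
      using L(4) j(1,2) unfolding fibre_jumps_def by fastforce+
    then show "mdist m a b' \<le> ?c (jump_label q (a, b))" using jump_cost[OF q _ _ _ _ _ _ j(3)] by simp
  qed
  also have "sum ?c ?A = (16 * \<epsilon> + \<eta>) * real (card ?A) + sum extra_cost ?A" by (simp add: sum.distrib)
  also have "sum extra_cost ?A \<le> sum cl Sh + 16 * \<epsilon> * reeb_betti1 m r"
  proof -
    have "real (card P0) - real (card P1) \<le> reeb_betti1 m r" using card_removed card_removed_le by linarith
    then have "16 * \<epsilon> * (real (card P0) - real (card P1)) \<le> 16 * \<epsilon> * reeb_betti1 m r" using eps_pos by (intro mult_left_mono) auto
    then show ?thesis using w_sum sum_extra_cost[of ?A] by simp
  qed
  also have "(16 * \<epsilon> + \<eta>) * real (card ?A) \<le> (16 * \<epsilon> + \<eta>) * (reeb_betti1 m r + 1)"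
  proof (rule mult_left_mono)
    have "card ?A \<le> length js" using card_image_le[of "set js"] card_length[of js] by (meson List.finite_set le_trans)
    then show "real (card ?A) \<le> real_of_int (reeb_betti1 m r + 1)" using L(3) by linarith
  qed (use eps_pos eta in simp)
  finally show "mdist m x y \<le> reeb_dist m r (proj x) (proj y) + (16 * \<epsilon> + \<eta>) * (reeb_betti1 m r + 1)
    + sum cl Sh + 16 * \<epsilon> * reeb_betti1 m r + e" using L(2) by (simp add: algebra_simps)
qed

end

context cell_approximation
begin

lemma dist_le_reeb_dist:
  shows "0 \<le> reeb_betti1 m r"
    and "\<And>x y. x \<in> mspace m \<Longrightarrow> y \<in> mspace m \<Longrightarrow> mdist m x y \<le> reeb_dist m r (proj x) (proj y)
      + (16 * \<epsilon> + \<eta>) * (reeb_betti1 m r + 1) + sum cl Sh + 16 * \<epsilon> * reeb_betti1 m r"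
proof -
  obtain P0 P1 w where c: "partition_on U P0" "partition_on U P1"
     "\<forall>K\<in>P1. 0 \<le> w K \<and> (\<forall>u\<in>K. \<forall>v\<in>K. D u v \<le> w K)"
     "\<forall>c\<in>Sh. \<exists>K\<in>P0. bot_pt c \<in> K \<and> top_pt c \<in> K"
     "\<forall>c\<in>Sh \<union> Co. \<exists>K\<in>P1. bot_pt c \<in> K \<and> top_pt c \<in> K"
     "sum w P1 \<le> sum cl Sh + 16 * \<epsilon> * (real (card P0) - real (card P1))"
     "\<forall>R. (\<forall>x y. R x y \<longrightarrow> R y x) \<longrightarrow> (\<forall>x y z. R x y \<longrightarrow> R y z \<longrightarrow> R x z) \<longrightarrow> (\<forall>u\<in>U. R u u) \<longrightarrow>
        (\<forall>c\<in>Sh \<union> Co. R (bot_pt c) (top_pt c)) \<longrightarrow> (\<forall>K\<in>P1. \<forall>u\<in>K. \<forall>v\<in>K. R u v)"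
    using clusters_exist by (elim exE conjE)
  interpret clustered_approximation m r P D C r' \<epsilon> \<eta> U Sh Co Lg cl pr P0 P1 w
  proof
    show "D u v \<le> w K" if "K \<in> P1" "u \<in> K" "v \<in> K" for K u v using c(3) that by simp
    show "0 \<le> w K" if "K \<in> P1" for K using c(3) that by simp
    show "R u v" if "\<And>x y. R x y \<Longrightarrow> R y x" "\<And>x y z. R x y \<Longrightarrow> R y z \<Longrightarrow> R x z" "\<And>u. u \<in> U \<Longrightarrow> R u u"
        "\<And>c. c \<in> Sh \<union> Co \<Longrightarrow> R (bot_pt c) (top_pt c)" "K \<in> P1" "u \<in> K" "v \<in> K" for R K u v
    proof -
      have 1: "\<forall>x y. R x y \<longrightarrow> R y x" by (intro allI impI) (rule that(1))
      have 2: "\<forall>x y z. R x y \<longrightarrow> R y z \<longrightarrow> R x z" by (intro allI impI) (rule that(2))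
      have 3: "\<forall>u\<in>U. R u u" by (intro ballI) (rule that(3))
      have 4: "\<forall>c\<in>Sh \<union> Co. R (bot_pt c) (top_pt c)" by (intro ballI) (rule that(4))
      from c(7)[THEN spec, THEN mp, THEN mp, THEN mp, THEN mp, OF 1 2 3 4] that(5-7) show ?thesis by simp
    qed
  qed (use c(1,2,4-6) in simp_all)
  show "0 \<le> reeb_betti1 m r" using card_removed_le by linarith
  show "mdist m x y \<le> reeb_dist m r (proj x) (proj y)
      + (16 * \<epsilon> + \<eta>) * (reeb_betti1 m r + 1) + sum cl Sh + 16 * \<epsilon> * reeb_betti1 m r" if "x \<in> mspace m" "y \<in> mspace m" for x y
    by (rule dist_le_reeb_dist_clustered[OF that])
qed

end

section \<open>Metric graphs\<close>

text \<open>Walks with their cost as a relation over abstract parametrized edges. A subdivision then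
  replaces only \<open>E\<close>, \<open>L\<close> and \<open>pt\<close>, while points and distances
  remain the same objects.\<close>

inductive seg_walk :: "'e set \<Rightarrow> ('e \<Rightarrow> real) \<Rightarrow> ('e \<Rightarrow> real \<Rightarrow> 'p) \<Rightarrow> 'p \<Rightarrow> 'p \<Rightarrow> real \<Rightarrow> bool"
  for E L pt x where
  stay: "seg_walk E L pt x x 0"
| step: "seg_walk E L pt x (pt e s) c \<Longrightarrow> e \<in> E \<Longrightarrow> 0 \<le> s \<Longrightarrow> s \<le> L e \<Longrightarrow> 0 \<le> t \<Longrightarrow> t \<le> L e \<Longrightarrow>
    seg_walk E L pt x (pt e t) (c + \<bar>s - t\<bar>)"

definition walk_dist :: "'e set \<Rightarrow> ('e \<Rightarrow> real) \<Rightarrow> ('e \<Rightarrow> real \<Rightarrow> 'p) \<Rightarrow> 'p \<Rightarrow> 'p \<Rightarrow> real" where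
  "walk_dist E L pt x y = Inf {c. seg_walk E L pt x y c}"

definition seg_points :: "'e set \<Rightarrow> 'p set \<Rightarrow> ('e \<Rightarrow> real) \<Rightarrow> ('e \<Rightarrow> real \<Rightarrow> 'p) \<Rightarrow> 'p set" where
  "seg_points E N L pt = N \<union> (\<Union>e\<in>E. pt e ` {0..L e})"

lemma seg_walk_nonneg: "seg_walk E L pt x y c \<Longrightarrow> 0 \<le> c"
  by (induction rule: seg_walk.induct) auto

lemma seg_walk_append:
  assumes "seg_walk E L pt y z c'" "seg_walk E L pt x y c"
  shows "seg_walk E L pt x z (c + c')"
  using assms
proof (induction rule: seg_walk.induct)
  case (step e s c' t)
  show ?case using seg_walk.step[OF step.IH[OF step.prems] step.hyps(2-6)] by (simp add: add.assoc)
qed simp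

lemma seg_walk_edge:
  assumes "e \<in> E" "0 \<le> s" "s \<le> L e" "0 \<le> t" "t \<le> L e"
  shows "seg_walk E L pt (pt e s) (pt e t) \<bar>s - t\<bar>"
proof -
  have "seg_walk E L pt (pt e s) (pt e t) (0 + \<bar>s - t\<bar>)"
    by (rule seg_walk.step) (rule seg_walk.stay, fact+)
  then show ?thesis by simp
qed

lemma seg_walk_sym: "seg_walk E L pt x y c \<Longrightarrow> seg_walk E L pt y x c"
proof (induction rule: seg_walk.induct)
  case stay
  show ?case by (rule seg_walk.stay)
next
  case (step e s c t)
  have "seg_walk E L pt (pt e t) (pt e s) \<bar>t - s\<bar>" using step.hyps by (intro seg_walk_edge)
  from seg_walk_append[OF step.IH this] show ?case by (simp add: abs_minus_commute add.commute)
qed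

locale segment_graph =
  fixes E :: "'e set" and N :: "'p set" and L :: "'e \<Rightarrow> real" and pt :: "'e \<Rightarrow> real \<Rightarrow> 'p"
  assumes finE: "finite E" and finN: "finite N"
    and L_pos: "\<And>e. e \<in> E \<Longrightarrow> 0 < L e"
    and ends: "\<And>e. e \<in> E \<Longrightarrow> pt e 0 \<in> N" "\<And>e. e \<in> E \<Longrightarrow> pt e (L e) \<in> N"
    and interior: "\<And>e s. e \<in> E \<Longrightarrow> 0 < s \<Longrightarrow> s < L e \<Longrightarrow> pt e s \<notin> N"
    and interior_inj: "\<And>e e' s s'. e \<in> E \<Longrightarrow> e' \<in> E \<Longrightarrow> 0 < s \<Longrightarrow> s < L e \<Longrightarrow> 0 < s' \<Longrightarrow> s' < L e' \<Longrightarrow>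
        pt e s = pt e' s' \<Longrightarrow> e = e' \<and> s = s'"
    and linked: "\<And>x y. x \<in> seg_points E N L pt \<Longrightarrow> y \<in> seg_points E N L pt \<Longrightarrow> \<exists>c. seg_walk E L pt x y c"
begin

abbreviation "P \<equiv> seg_points E N L pt"
abbreviation "D \<equiv> walk_dist E L pt"
abbreviation "walk \<equiv> seg_walk E L pt"

lemma N_sub: "N \<subseteq> P" unfolding seg_points_def by blast

lemma pt_P: "e \<in> E \<Longrightarrow> 0 \<le> s \<Longrightarrow> s \<le> L e \<Longrightarrow> pt e s \<in> P"
  unfolding seg_points_def by (intro UnI2 UN_I[of e] imageI) auto

lemma point_cases:
  assumes "x \<in> P"
  obtains "x \<in> N" | e s where "e \<in> E" "0 < s" "s < L e" "x = pt e s" "x \<notin> N"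
proof (cases "x \<in> N")
  case False
  then have "x \<in> (\<Union>e\<in>E. pt e ` {0..L e})" using assms unfolding seg_points_def by blast
  then obtain e s where e: "e \<in> E" "s \<in> {0..L e}" "x = pt e s" by (elim UN_E imageE)
  have "s \<noteq> 0" "s \<noteq> L e" using ends[OF e(1)] e(3) False by auto
  then show ?thesis using that(2)[OF e(1) _ _ e(3) False] e(2) by simp
qed (rule that(1))

lemma D_le_walk: "walk x y c \<Longrightarrow> D x y \<le> c"
  unfolding walk_dist_def by (rule cInf_lower) (auto intro!: bdd_belowI seg_walk_nonneg)

lemma D_less: assumes "x \<in> P" "y \<in> P" "D x y < k" shows "\<exists>c<k. walk x y c"
proof -
  have "{c. walk x y c} \<noteq> {}" using linked[OF assms(1,2)] by simp
  from cInf_lessD[OF this assms(3)[unfolded walk_dist_def]] show ?thesis by auto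
qed

lemma le_D: assumes "x \<in> P" "y \<in> P" "\<And>c. walk x y c \<Longrightarrow> a \<le> c" shows "a \<le> D x y"
  unfolding walk_dist_def by (rule cInf_greatest) (use linked[OF assms(1,2)] assms(3) in auto)

lemma D_nonneg: "x \<in> P \<Longrightarrow> y \<in> P \<Longrightarrow> 0 \<le> D x y"
  by (rule le_D) (auto intro: seg_walk_nonneg)

lemma D_self: "x \<in> P \<Longrightarrow> D x x = 0"
  using D_le_walk[OF seg_walk.stay, of x] D_nonneg[of x x] by simp

lemma D_sym: "D x y = D y x"
proof -
  have "{c. walk x y c} = {c. walk y x c}" by (intro Collect_cong iffI) (rule seg_walk_sym, assumption)+
  then show ?thesis unfolding walk_dist_def by simp
qed

lemma D_tri: assumes "x \<in> P" "y \<in> P" "z \<in> P" shows "D x z \<le> D x y + D y z"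
proof (rule field_le_epsilon)
  fix e :: real assume e: "0 < e"
  obtain c where c: "c < D x y + e/2" "walk x y c" using D_less[OF assms(1,2), of "D x y + e/2"] e by auto
  obtain c' where c': "c' < D y z + e/2" "walk y z c'" using D_less[OF assms(2,3), of "D y z + e/2"] e by auto
  show "D x z \<le> D x y + D y z + e" using D_le_walk[OF seg_walk_append[OF c'(2) c(2)]] c(1) c'(1) by simp
qed

lemma D_edge: "e \<in> E \<Longrightarrow> 0 \<le> s \<Longrightarrow> s \<le> L e \<Longrightarrow> 0 \<le> t \<Longrightarrow> t \<le> L e \<Longrightarrow> D (pt e s) (pt e t) \<le> \<bar>s - t\<bar>"
  by (intro D_le_walk seg_walk_edge)

text \<open>Every corner \<open>p\<close> of a walk of cost less than \<open>k\<close> splits that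
  cost into a part from \<open>x\<close> and a part to \<open>y\<close>, which bound the two
  distances.\<close>

lemma chain:
  assumes "x \<in> P" "y \<in> P" "D x y < k"
  shows "(x, y) \<in> {(p, q). p \<in> P \<and> q \<in> P \<and> (\<exists>e\<in>E. p \<in> pt e ` {0..L e} \<and> q \<in> pt e ` {0..L e})
            \<and> D x p + D p y < k \<and> D x q + D q y < k}\<^sup>*"
proof -
  let ?R = "{(p, q). p \<in> P \<and> q \<in> P \<and> (\<exists>e\<in>E. p \<in> pt e ` {0..L e} \<and> q \<in> pt e ` {0..L e})
            \<and> D x p + D p y < k \<and> D x q + D q y < k}"
  obtain c where c: "c < k" "walk x y c" using D_less[OF assms] by blast
  have "(x, z) \<in> ?R\<^sup>*" if "walk x z a" "walk z y b" "a + b < k" for z a b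
    using that
  proof (induction arbitrary: b rule: seg_walk.induct)
    case (step e s a t)
    let ?p = "pt e s" and ?q = "pt e t"
    have pq: "walk ?p ?q \<bar>s - t\<bar>" using step.hyps by (intro seg_walk_edge)
    have py: "walk ?p y (\<bar>s - t\<bar> + b)" by (rule seg_walk_append[OF step.prems(1) pq])
    have xp: "(x, ?p) \<in> ?R\<^sup>*" using step.IH[OF py] step.prems(2) by (simp add: add.assoc)
    have "D x ?p + D ?p y < k" using D_le_walk[OF step.hyps(1)] D_le_walk[OF py] step.prems(2) by simp
    moreover have "D x ?q + D ?q y < k"
      using D_le_walk[OF seg_walk_append[OF pq step.hyps(1)]] D_le_walk[OF step.prems(1)] step.prems(2) by simp
    moreover have "?p \<in> pt e ` {0..L e}" "?q \<in> pt e ` {0..L e}" using step.hyps by simp_all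
    ultimately have "(?p, ?q) \<in> ?R" using step.hyps pt_P by blast
    with xp show ?case by (rule rtrancl_into_rtrancl)
  qed simp
  from this[OF c(2) seg_walk.stay] show ?thesis using c(1) by simp
qed

text \<open>A potential on the nodes that changes by at most the edge lengths extends to a 1-Lipschitz
  function: on an edge take the lower envelope of the two functions of slope 1 from its ends.\<close>

definition extend :: "('p \<Rightarrow> real) \<Rightarrow> 'p \<Rightarrow> real" where
  "extend g p = (if p \<in> N then g p else
     (let (e, s) = SOME (e, s). e \<in> E \<and> 0 < s \<and> s < L e \<and> p = pt e s in min (g (pt e 0) + s) (g (pt e (L e)) + (L e - s))))"

lemma extend_edge:
  assumes g: "\<And>e. e \<in> E \<Longrightarrow> \<bar>g (pt e 0) - g (pt e (L e))\<bar> \<le> L e" and e: "e \<in> E" "0 \<le> s" "s \<le> L e"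
  shows "extend g (pt e s) = min (g (pt e 0) + s) (g (pt e (L e)) + (L e - s))"
proof -
  consider "s = 0" | "s = L e" | "0 < s" "s < L e" using e by linarith
  then show ?thesis
  proof cases
    case 1
    then show ?thesis using ends[OF e(1)] g[OF e(1)] unfolding extend_def by simp
  next
    case 2
    then show ?thesis using ends[OF e(1)] g[OF e(1)] unfolding extend_def by simp
  next
    case 3
    have "(SOME (e', s'). e' \<in> E \<and> 0 < s' \<and> s' < L e' \<and> pt e s = pt e' s') = (e, s)"
    proof (rule some_equality)
      show "case (e, s) of (e', s') \<Rightarrow> e' \<in> E \<and> 0 < s' \<and> s' < L e' \<and> pt e s = pt e' s'" using 3 e by simp
      fix p assume "case p of (e', s') \<Rightarrow> e' \<in> E \<and> 0 < s' \<and> s' < L e' \<and> pt e s = pt e' s'"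
      then show "p = (e, s)" using interior_inj[OF e(1) _ 3] by (cases p) auto
    qed
    then show ?thesis using interior[OF e(1) 3] unfolding extend_def by simp
  qed
qed

lemma extend_walk:
  assumes g: "\<And>e. e \<in> E \<Longrightarrow> \<bar>g (pt e 0) - g (pt e (L e))\<bar> \<le> L e"
  shows "walk x y c \<Longrightarrow> extend g y \<le> extend g x + c"
proof (induction rule: seg_walk.induct)
  case (step e s c t)
  show ?case using step.IH extend_edge[where g = g, OF g step.hyps(2-4)] extend_edge[where g = g, OF g step.hyps(2,5,6)] by simp
qed simp

lemma extend_le:
  assumes g: "\<And>e. e \<in> E \<Longrightarrow> \<bar>g (pt e 0) - g (pt e (L e))\<bar> \<le> L e" and x: "x \<in> P" "y \<in> P"
  shows "extend g y - extend g x \<le> D x y"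
  by (rule le_D[OF x]) (use extend_walk[where g = g, OF g] in force)

text \<open>The upper bound goes through either end. For the lower bound the heights of the nodes
  are extended to a 1-Lipschitz function vanishing at \<open>r\<close>; no such function exceeds the
  distance from \<open>r\<close>.\<close>

lemma height_edge:
  assumes r: "r \<in> N" and e: "e \<in> E" "0 \<le> s" "s \<le> L e"
  shows "D r (pt e s) = min (D r (pt e 0) + s) (D r (pt e (L e)) + (L e - s))"
proof (rule antisym)
  have rP: "r \<in> P" using r N_sub by blast
  have LP: "0 \<le> L e" "L e \<le> L e" "0 \<le> (0::real)" using L_pos[OF e(1)] by simp_all
  have P: "pt e 0 \<in> P" "pt e (L e) \<in> P" "pt e s \<in> P" using pt_P e LP by auto
  have "D (pt e 0) (pt e s) \<le> s" "D (pt e (L e)) (pt e s) \<le> L e - s"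
    using D_edge[OF e(1) LP(3,1) e(2,3)] D_edge[OF e(1) LP(1,2) e(2,3)] e by simp_all
  then show "D r (pt e s) \<le> min (D r (pt e 0) + s) (D r (pt e (L e)) + (L e - s))"
    using D_tri[OF rP P(1,3)] D_tri[OF rP P(2,3)] by simp
  have lip: "\<bar>D r (pt e 0) - D r (pt e (L e))\<bar> \<le> L e" if "e \<in> E" for e
  proof -
    have L: "0 \<le> L e" using L_pos[OF that] by simp
    have P: "pt e 0 \<in> P" "pt e (L e) \<in> P" using pt_P[OF that] L by simp_all
    have "D (pt e 0) (pt e (L e)) \<le> L e" using D_edge[OF that, of 0 "L e"] L by simp
    then show ?thesis using D_tri[OF rP P] D_tri[OF rP P(2,1)] D_sym[of "pt e 0" "pt e (L e)"] by simp
  qed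
  have "extend (D r) (pt e s) - extend (D r) r \<le> D r (pt e s)" by (rule extend_le[OF lip rP P(3)])
  moreover have "extend (D r) r = 0" using r D_self[OF rP] unfolding extend_def by simp
  ultimately show "min (D r (pt e 0) + s) (D r (pt e (L e)) + (L e - s)) \<le> D r (pt e s)"
    using extend_edge[where g = "D r", OF lip e] by simp
qed

lemma height_diff: assumes r: "r \<in> N" and e: "e \<in> E" shows "\<bar>D r (pt e 0) - D r (pt e (L e))\<bar> \<le> L e"
  using height_edge[OF r e, of 0] height_edge[OF r e, of "L e"] L_pos[OF e] by simp

text \<open>Otherwise the height of \<open>v\<close> could be increased slightly, contradicting maximality of the
  distance from \<open>r\<close> among 1-Lipschitz functions vanishing at \<open>r\<close>.\<close>

lemma descending_edge:
  assumes r: "r \<in> N" and v: "v \<in> N" "v \<noteq> r"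
  shows "\<exists>e\<in>E. (pt e 0 = v \<and> D r v = D r (pt e (L e)) + L e) \<or> (pt e (L e) = v \<and> D r v = D r (pt e 0) + L e)"
proof (rule ccontr)
  assume no: "\<not> ?thesis"
  \<comment> \<open>The amounts by which the height of \<open>v\<close> may grow before some edge at
    \<open>v\<close> becomes too steep. All of them are positive if no edge descends from
    \<open>v\<close> at unit speed; the element \<open>1\<close> covers a node without
    edges.\<close>
  define A where "A = (\<lambda>e. D r (pt e (L e)) + L e - D r v) ` {e \<in> E. pt e 0 = v} \<union> (\<lambda>e. D r (pt e 0) + L e - D r v) ` {e \<in> E. pt e (L e) = v}"
  have finA: "finite A" unfolding A_def using finE by simp
  have posA: "0 < a" if "a \<in> A" for a
  proof -
    from that consider e where "e \<in> E" "pt e 0 = v" "a = D r (pt e (L e)) + L e - D r v" | e where "e \<in> E" "pt e (L e) = v" "a = D r (pt e 0) + L e - D r v"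
      unfolding A_def by auto
    then show ?thesis
    proof cases
      case 1 then show ?thesis using no height_diff[OF r 1(1)] by fastforce
    next
      case 2 then show ?thesis using no height_diff[OF r 2(1)] by fastforce
    qed
  qed
  define \<delta> where "\<delta> = Min (insert 1 A)"
  have \<delta>: "0 < \<delta>" "\<And>a. a \<in> A \<Longrightarrow> \<delta> \<le> a" unfolding \<delta>_def using finA posA by auto
  define g where "g = (D r)(v := D r v + \<delta>)"
  have lip: "\<bar>g (pt e 0) - g (pt e (L e))\<bar> \<le> L e" if e: "e \<in> E" for e
  proof -
    have a: "\<delta> \<le> D r (pt e (L e)) + L e - D r v" if "pt e 0 = v" by (rule \<delta>(2)) (use that e in \<open>auto simp: A_def\<close>)
    have b: "\<delta> \<le> D r (pt e 0) + L e - D r v" if "pt e (L e) = v" by (rule \<delta>(2)) (use that e in \<open>auto simp: A_def\<close>)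
    show ?thesis using height_diff[OF r e] a b \<delta>(1) L_pos[OF e] unfolding g_def by (auto simp: abs_le_iff)
  qed
  have P: "r \<in> P" "v \<in> P" using r v N_sub by auto
  have "extend g v - extend g r \<le> D r v" by (rule extend_le[OF lip P])
  moreover have "extend g v = D r v + \<delta>" "extend g r = 0" using r v D_self[OF P(1)] unfolding extend_def g_def by auto
  ultimately show False using \<delta>(1) by simp
qed

lemma bounded: "\<exists>B. \<forall>x\<in>P. \<forall>y\<in>P. D x y \<le> B"
proof -
  define S where "S = sum L E"
  define B where "B = (\<Sum>(u, v)\<in>N \<times> N. D u v)"
  have near: "\<exists>u\<in>N. D x u \<le> S" if "x \<in> P" for x
    using that
  proof (cases rule: point_cases)
    case 1
    then show ?thesis using D_self[OF that] sum_nonneg[of E L] L_pos unfolding S_def by (auto intro!: bexI[of _ x] simp: less_imp_le)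
  next
    case (2 e s)
    have "D x (pt e 0) \<le> s" using D_edge[OF 2(1), of s 0] 2 by simp
    also have "s \<le> S" unfolding S_def using member_le_sum[of e E L] 2 finE L_pos by (force simp: less_imp_le)
    finally show ?thesis using ends(1)[OF 2(1)] by blast
  qed
  have "D x y \<le> S + (B + S)" if xy: "x \<in> P" "y \<in> P" for x y
  proof -
    obtain u v where u: "u \<in> N" "D x u \<le> S" and v: "v \<in> N" "D y v \<le> S" using near xy by meson
    have P: "u \<in> P" "v \<in> P" using u v N_sub by auto
    have "(\<lambda>(u, v). D u v) (u, v) \<le> B" unfolding B_def
      by (rule member_le_sum) (use u v finN N_sub D_nonneg in \<open>auto dest: subsetD\<close>)
    then have "D u v \<le> B" by simp
    then show ?thesis using D_tri[OF xy(1) P(1) xy(2)] D_tri[OF P(1,2) xy(2)] u v D_sym[of v y] by linarith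
  qed
  then show ?thesis by blast
qed

end

section \<open>Subdivision of edges\<close>

text \<open>The flag tells the part beyond the cut point from the part before it. Parts of length
  zero are left out, so a cut at \<open>0\<close> keeps the edge whole, as its \<open>True\<close>
  piece.\<close>

definition pieces :: "'e set \<Rightarrow> ('e \<Rightarrow> real) \<Rightarrow> ('e \<Rightarrow> real) \<Rightarrow> ('e \<times> bool) set" where
  "pieces E L \<kappa> = {(e, i). e \<in> E \<and> (if i then \<kappa> e < L e else 0 < \<kappa> e)}"

definition piece_len :: "('e \<Rightarrow> real) \<Rightarrow> ('e \<Rightarrow> real) \<Rightarrow> 'e \<times> bool \<Rightarrow> real" where
  "piece_len L \<kappa> = (\<lambda>(e, i). if i then L e - \<kappa> e else \<kappa> e)"

text \<open>Both pieces of an edge are parametrized towards the cut point.\<close>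

definition piece_pt :: "('e \<Rightarrow> real) \<Rightarrow> ('e \<Rightarrow> real \<Rightarrow> 'p) \<Rightarrow> 'e \<times> bool \<Rightarrow> real \<Rightarrow> 'p" where
  "piece_pt L pt = (\<lambda>(e, i) s. pt e (if i then L e - s else s))"

lemmas piece_defs = pieces_def piece_len_def piece_pt_def

context segment_graph
begin

context
  fixes \<kappa> :: "'e \<Rightarrow> real"
  assumes \<kappa>: "\<And>e. e \<in> E \<Longrightarrow> 0 \<le> \<kappa> e" "\<And>e. e \<in> E \<Longrightarrow> \<kappa> e \<le> L e"
begin

abbreviation "E' \<equiv> pieces E L \<kappa>"
abbreviation "L' \<equiv> piece_len L \<kappa>"
abbreviation "pt' \<equiv> piece_pt L pt"
abbreviation "N' \<equiv> N \<union> (\<lambda>e. pt e (\<kappa> e)) ` E"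

lemma walk_piece:
  assumes e: "e \<in> E" and st: "s \<le> \<kappa> e \<and> t \<le> \<kappa> e \<or> \<kappa> e \<le> s \<and> \<kappa> e \<le> t" "0 \<le> s" "s \<le> L e" "0 \<le> t" "t \<le> L e"
  shows "seg_walk E' L' pt' (pt e s) (pt e t) \<bar>s - t\<bar>"
proof (cases "s = t")
  case True
  then show ?thesis by (simp add: seg_walk.stay)
next
  case False
  from st(1) show ?thesis
  proof
    assume k: "s \<le> \<kappa> e \<and> t \<le> \<kappa> e"
    have "seg_walk E' L' pt' (pt' (e, False) s) (pt' (e, False) t) \<bar>s - t\<bar>"
      by (rule seg_walk_edge) (use k st e False in \<open>auto simp: piece_defs\<close>)
    then show ?thesis by (simp add: piece_pt_def)
  next
    assume k: "\<kappa> e \<le> s \<and> \<kappa> e \<le> t"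
    have "seg_walk E' L' pt' (pt' (e, True) (L e - s)) (pt' (e, True) (L e - t)) \<bar>(L e - s) - (L e - t)\<bar>"
      by (rule seg_walk_edge) (use k st e False in \<open>auto simp: piece_defs\<close>)
    then show ?thesis by (simp add: piece_pt_def abs_minus_commute)
  qed
qed

text \<open>A step across the cut point is replaced by two steps through it, of the same total
  length. Hence subdivision does not change the cost of any connection, and with it the
  distance.\<close>

lemma walk_pieces:
  assumes e: "e \<in> E" and st: "0 \<le> s" "s \<le> L e" "0 \<le> t" "t \<le> L e"
  shows "seg_walk E' L' pt' (pt e s) (pt e t) \<bar>s - t\<bar>"
proof (cases "s \<le> \<kappa> e \<and> t \<le> \<kappa> e \<or> \<kappa> e \<le> s \<and> \<kappa> e \<le> t")
  case True
  show ?thesis by (rule walk_piece[OF e True st])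
next
  case False
  have 1: "seg_walk E' L' pt' (pt e s) (pt e (\<kappa> e)) \<bar>s - \<kappa> e\<bar>" "seg_walk E' L' pt' (pt e (\<kappa> e)) (pt e t) \<bar>\<kappa> e - t\<bar>"
    using \<kappa>[OF e] st by (intro walk_piece[OF e]; linarith)+
  have "\<bar>s - \<kappa> e\<bar> + \<bar>\<kappa> e - t\<bar> = \<bar>s - t\<bar>" using False by linarith
  then show ?thesis using seg_walk_append[OF 1(2,1)] by simp
qed

lemma seg_walk_pieces: "seg_walk E' L' pt' x y c \<longleftrightarrow> walk x y c"
proof
  assume "walk x y c"
  then show "seg_walk E' L' pt' x y c"
  proof (induction rule: seg_walk.induct)
    case (step e s c t)
    show ?case by (rule seg_walk_append[OF walk_pieces[OF step.hyps(2-6)] step.IH])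
  qed (rule seg_walk.stay)
next
  assume "seg_walk E' L' pt' x y c"
  then show "walk x y c"
  proof (induction rule: seg_walk.induct)
    case (step p s c t)
    obtain e i where p: "p = (e, i)" by (cases p)
    have e: "e \<in> E" using step.hyps(2) unfolding p pieces_def by simp
    have "walk (pt e (if i then L e - s else s)) (pt e (if i then L e - t else t)) \<bar>(if i then L e - s else s) - (if i then L e - t else t)\<bar>"
      by (rule seg_walk_edge[OF e]) (use step.hyps(3-6) \<kappa>[OF e] in \<open>auto simp: p piece_len_def split: if_splits\<close>)
    then have "walk (pt' p s) (pt' p t) \<bar>s - t\<bar>" unfolding p piece_pt_def by (cases i) (auto simp: abs_minus_commute)
    then show ?case by (rule seg_walk_append[OF _ step.IH])
  qed (rule seg_walk.stay)
qed

lemma walk_dist_pieces: "walk_dist E' L' pt' = D"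
  unfolding walk_dist_def seg_walk_pieces ..

lemma seg_points_pieces: "seg_points E' N' L' pt' = P"
proof (rule equalityI)
  have "pt e (\<kappa> e) \<in> P" if "e \<in> E" for e using pt_P[OF that \<kappa>[OF that]] .
  moreover have "pt' p s \<in> P" if "p \<in> E'" "0 \<le> s" "s \<le> L' p" for p s
  proof -
    obtain e i where p: "p = (e, i)" by (cases p)
    have e: "e \<in> E" using that unfolding p pieces_def by simp
    show ?thesis unfolding p piece_pt_def prod.case
      by (rule pt_P[OF e]) (use that \<kappa>[OF e] in \<open>auto simp: p piece_len_def split: if_splits\<close>)
  qed
  ultimately show "seg_points E' N' L' pt' \<subseteq> P"
    using N_sub unfolding seg_points_def[of E'] by (intro Un_least UN_least image_subsetI) auto
  show "P \<subseteq> seg_points E' N' L' pt'"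
  proof
    fix x assume "x \<in> P"
    then show "x \<in> seg_points E' N' L' pt'"
    proof (cases rule: point_cases)
      case 1
      then show ?thesis unfolding seg_points_def by simp
    next
      case (2 e s)
      show ?thesis
      proof (cases "s \<le> \<kappa> e")
        case True
        then have "(e, False) \<in> E'" "s \<in> {0..L' (e, False)}" "x = pt' (e, False) s" using 2 by (auto simp: piece_defs)
        then show ?thesis unfolding seg_points_def by blast
      next
        case False
        then have "(e, True) \<in> E'" "L e - s \<in> {0..L' (e, True)}" "x = pt' (e, True) (L e - s)" using 2 by (auto simp: piece_defs)
        then show ?thesis unfolding seg_points_def by blast
      qed
    qed
  qed
qed

lemma segment_graph_pieces: "segment_graph E' N' L' pt'"
proof
  show "finite E'" by (rule finite_subset[of _ "E \<times> UNIV"]) (use finE in \<open>auto simp: pieces_def\<close>)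
  show "finite N'" using finE finN by simp
  show "0 < L' p" if "p \<in> E'" for p using that by (auto simp: piece_defs split: if_splits)
  show "pt' p 0 \<in> N'" "pt' p (L' p) \<in> N'" if "p \<in> E'" for p
    using that ends by (auto simp: piece_defs split: if_splits)
  have interior_pos: "fst p \<in> E \<and> pt' p s = pt (fst p) \<sigma> \<and> 0 < \<sigma> \<and> \<sigma> < L (fst p) \<and> \<sigma> \<noteq> \<kappa> (fst p)"
    if "p \<in> E'" "0 < s" "s < L' p" "\<sigma> = (if snd p then L (fst p) - s else s)" for p s \<sigma>
    using that \<kappa>[of "fst p"] by (cases p) (auto simp: piece_defs split: if_splits)
  show "pt' p s \<notin> N'" if p: "p \<in> E'" "0 < s" "s < L' p" for p s
  proof -
    define \<sigma> where "\<sigma> = (if snd p then L (fst p) - s else s)"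
    note i = interior_pos[OF p \<sigma>_def]
    have notN: "pt' p s \<notin> N" using i interior[of "fst p" \<sigma>] by simp
    have "pt' p s \<noteq> pt e (\<kappa> e)" if e: "e \<in> E" for e
    proof
      assume eq: "pt' p s = pt e (\<kappa> e)"
      then have "\<kappa> e \<noteq> 0" "\<kappa> e \<noteq> L e" using ends[OF e] notN by auto
      then have "0 < \<kappa> e" "\<kappa> e < L e" using \<kappa>[OF e] by auto
      then have "fst p = e \<and> \<sigma> = \<kappa> e" using interior_inj[of "fst p" e \<sigma> "\<kappa> e"] i e eq by simp
      then show False using i by simp
    qed
    then show ?thesis using notN by blast
  qed
  show "p = p' \<and> s = s'" if p: "p \<in> E'" "p' \<in> E'" "0 < s" "s < L' p" "0 < s'" "s' < L' p'" and eq: "pt' p s = pt' p' s'" for p p' s s'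
  proof -
    define \<sigma> \<sigma>' where \<sigma>: "\<sigma> = (if snd p then L (fst p) - s else s)" "\<sigma>' = (if snd p' then L (fst p') - s' else s')"
    note i = interior_pos[OF p(1,3,4) \<sigma>(1)] interior_pos[OF p(2,5,6) \<sigma>(2)]
    have same: "fst p = fst p'" "\<sigma> = \<sigma>'" using interior_inj[of "fst p" "fst p'" \<sigma> \<sigma>'] i eq by simp_all
    have "snd p = (\<kappa> (fst p) < \<sigma>)" "snd p' = (\<kappa> (fst p') < \<sigma>')"
      using p unfolding \<sigma> by (cases p; cases p'; auto simp: piece_defs)+
    then have "snd p = snd p'" using same by simp
    then show ?thesis using same unfolding \<sigma> by (simp add: prod_eq_iff split: if_splits)
  qed
  show "\<exists>c. seg_walk E' L' pt' x y c" if "x \<in> seg_points E' N' L' pt'" "y \<in> seg_points E' N' L' pt'" for x y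
    using linked that unfolding seg_walk_pieces seg_points_pieces by simp
qed

end

end

section \<open>Cutting the edges at their highest points\<close>

locale graph_approximation = reeb_space m r + segment_graph E N L pt
  for m :: "'a metric" and r :: 'a and E :: "'e set" and N :: "'p set" and L :: "'e \<Rightarrow> real" and pt :: "'e \<Rightarrow> real \<Rightarrow> 'p" +
  fixes C :: "('a \<times> 'p) set" and r' :: 'p and \<epsilon> \<eta> :: real
  assumes corr: "correspondence (mspace m) (seg_points E N L pt) C"
    and distortion: "\<And>x x' y y'. (x, x') \<in> C \<Longrightarrow> (y, y') \<in> C \<Longrightarrow> \<bar>mdist m x y - walk_dist E L pt x' y'\<bar> \<le> \<eta>"
    and rr: "(r, r') \<in> C" and eta: "0 \<le> \<eta>" "\<eta> < 2 * \<epsilon>" and r'_N: "r' \<in> N"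
begin

text \<open>The height above \<open>r'\<close> rises along an edge up to the parameter \<open>peak\<close> and falls afterwards.\<close>

definition peak where "peak e = (D r' (pt e (L e)) - D r' (pt e 0) + L e) / 2"
text \<open>An edge is cut only if one of its two monotone parts is long. An edge left whole has two
  parts of at most 8\<epsilon>, so its length is at most 16\<epsilon>.\<close>

definition cut where "cut e \<longleftrightarrow> 8 * \<epsilon> < peak e \<or> 8 * \<epsilon> < L e - peak e"
definition \<kappa> where "\<kappa> e = (if cut e then peak e else 0)"

lemma peak: "e \<in> E \<Longrightarrow> 0 \<le> peak e" "e \<in> E \<Longrightarrow> peak e \<le> L e"
  using height_diff[OF r'_N, of e] unfolding peak_def by auto

lemma kappa: "e \<in> E \<Longrightarrow> 0 \<le> \<kappa> e" "e \<in> E \<Longrightarrow> \<kappa> e \<le> L e"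
  using peak[of e] L_pos[of e] unfolding \<kappa>_def by auto

lemma cut_long: "e \<in> E \<Longrightarrow> cut e \<Longrightarrow> 8 * \<epsilon> < L e"
  using peak[of e] unfolding cut_def by auto

abbreviation "pcs \<equiv> pieces E L \<kappa>"
abbreviation "pl \<equiv> piece_len L \<kappa>"
abbreviation "pp \<equiv> piece_pt L pt"

text \<open>The cells of \<open>Sh\<close> are whole edges, which is why their number is at most
  that of the short edges. Connectors are the remaining uncut edges and the short parts of cut ones;
  their lengths are charged to the Betti number instead.\<close>

definition "Sh = {p \<in> pcs. L (fst p) \<le> 8 * \<epsilon>}"
definition "Lg = {p \<in> pcs. cut (fst p) \<and> 8 * \<epsilon> < pl p}"
definition "Co = pcs - Sh - Lg"

lemma pcs_E: "p \<in> pcs \<Longrightarrow> fst p \<in> E" unfolding pieces_def by auto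

lemma cells_eq: "Sh \<union> Co \<union> Lg = pcs" unfolding Sh_def Lg_def Co_def by blast

lemma pl_le: "p \<in> pcs \<Longrightarrow> pl p \<le> L (fst p)"
  using kappa[of "fst p"] by (cases p) (auto simp: piece_defs split: if_splits)

lemma uncut: assumes "p \<in> pcs" "\<not> cut (fst p)" shows "p = (fst p, True)" "pl p = L (fst p)"
  using assms unfolding \<kappa>_def piece_defs by (cases p; auto split: if_splits)+

lemma uncutI: assumes "e \<in> E" "\<not> cut e" shows "(e, True) \<in> pcs"
  using assms L_pos[of e] unfolding \<kappa>_def piece_defs by auto

lemma ascending_piece:
  assumes p: "p \<in> pcs" "cut (fst p)" and s: "0 \<le> s" "s \<le> pl p"
  shows "D r' (pp p s) = D r' (pp p 0) + s"
proof -
  obtain e i where e: "p = (e, i)" by (cases p)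
  have eE: "e \<in> E" using pcs_E[OF p(1)] unfolding e by simp
  have k: "\<kappa> e = peak e" using p(2) unfolding e \<kappa>_def by simp
  note h = height_edge[OF r'_N eE]
  note pk = peak[OF eE]
  show ?thesis
  proof (cases i)
    case True
    have s': "0 \<le> L e - s" "L e - s \<le> L e" "s \<le> L e - peak e" using s pk k True unfolding e piece_len_def by auto
    then have "D r' (pt e (L e - s)) = D r' (pt e (L e)) + s" using h[OF s'(1,2)] unfolding peak_def by (simp add: min_def field_simps)
    then show ?thesis using True unfolding e piece_pt_def by simp
  next
    case False
    have s': "0 \<le> s" "s \<le> L e" "s \<le> peak e" using s pk k unfolding e piece_len_def using False by auto
    then have "D r' (pt e s) = D r' (pt e 0) + s" using h[OF s'(1,2)] unfolding peak_def by (simp add: min_def field_simps)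
    then show ?thesis using False unfolding e piece_pt_def by simp
  qed
qed

lemma long_top:
  assumes e: "e \<in> E" "cut e"
  shows "\<exists>c\<in>Lg. pp c (pl c) = pt e (peak e)"
proof -
  have k: "\<kappa> e = peak e" and eps: "0 < \<epsilon>" using e eta unfolding \<kappa>_def by simp_all
  from e(2) consider "8 * \<epsilon> < peak e" | "8 * \<epsilon> < L e - peak e" unfolding cut_def by blast
  then show ?thesis
  proof cases
    case 1
    then have "(e, False) \<in> Lg" "pp (e, False) (pl (e, False)) = pt e (peak e)" using e k eps unfolding Lg_def piece_defs by auto
    then show ?thesis by (rule bexI[rotated])
  next
    case 2
    then have "(e, True) \<in> Lg" "pp (e, True) (pl (e, True)) = pt e (peak e)" using e k eps unfolding Lg_def piece_defs by auto
    then show ?thesis by (rule bexI[rotated])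
  qed
qed

text \<open>The edge that descends from \<open>v\<close> at unit speed has its peak at
  \<open>v\<close>. If it is longer than 8\<epsilon>, its descending part is the whole edge, so it
  is cut and gives a long cell with top \<open>v\<close>; otherwise it is a cell of
  \<open>Sh\<close> that leads down.\<close>

lemma node_downward:
  assumes v: "v \<in> N" "v \<noteq> r'"
  shows "(\<exists>c\<in>Lg. pp c (pl c) = v) \<or>
    (\<exists>c\<in>Sh. (pp c 0 = v \<and> D r' (pp c (pl c)) < D r' v) \<or> (pp c (pl c) = v \<and> D r' (pp c 0) < D r' v))"
proof -
  have eps: "0 < \<epsilon>" using eta by simp
  obtain e where e: "e \<in> E" and or: "(pt e 0 = v \<and> D r' v = D r' (pt e (L e)) + L e) \<or> (pt e (L e) = v \<and> D r' v = D r' (pt e 0) + L e)"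
    using descending_edge[OF r'_N v] by blast
  have pk: "(pt e 0 = v \<and> peak e = 0) \<or> (pt e (L e) = v \<and> peak e = L e)" using or unfolding peak_def by auto
  show ?thesis
  proof (cases "L e \<le> 8 * \<epsilon>")
    case True
    then have nc: "\<not> cut e" using cut_long[OF e] by auto
    then have sh: "(e, True) \<in> Sh" using uncutI[OF e] True unfolding Sh_def by simp
    have "pp (e, True) 0 = pt e (L e)" "pp (e, True) (pl (e, True)) = pt e 0"
      using nc unfolding piece_defs \<kappa>_def by simp_all
    then have "(pp (e, True) 0 = v \<and> D r' (pp (e, True) (pl (e, True))) < D r' v) \<or> (pp (e, True) (pl (e, True)) = v \<and> D r' (pp (e, True) 0) < D r' v)"
      using or L_pos[OF e] by auto
    then show ?thesis using sh by blast
  next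
    case False
    then have "cut e" "pt e (peak e) = v" using pk unfolding cut_def by auto
    then show ?thesis using long_top[OF e] by simp
  qed
qed

lemma cells: "cell_approximation m r P D C r' \<epsilon> \<eta> (N \<union> (\<lambda>e. pt e (\<kappa> e)) ` E) Sh Co Lg pl pp"
proof -
  interpret S: segment_graph pcs "N \<union> (\<lambda>e. pt e (\<kappa> e)) ` E" pl pp by (rule segment_graph_pieces[OF kappa])
  have DS: "S.D = D" by (rule walk_dist_pieces[OF kappa])
  have PS: "S.P = P" by (rule seg_points_pieces[OF kappa])
  have eps: "0 < \<epsilon>" using eta by simp
  have r'P: "r' \<in> P" using r'_N N_sub by blast
  have fin: "finite pcs" by (rule S.finE)
  show ?thesis
  proof (unfold_locales, unfold cells_eq)
    show "D x x = 0" if "x \<in> P" for x using D_self[OF that] .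
    show "D x y = D y x" for x y by (rule D_sym)
    show "D x z \<le> D x y + D y z" if "x \<in> P" "y \<in> P" "z \<in> P" for x y z using D_tri[OF that] .
    show "0 \<le> D x y" if "x \<in> P" "y \<in> P" for x y using D_nonneg[OF that] .
    show "correspondence (mspace m) P C" by (rule corr)
    show "\<bar>mdist m x y - D x' y'\<bar> \<le> \<eta>" if "(x, x') \<in> C" "(y, y') \<in> C" for x x' y y' using distortion[OF that] .
    show "(r, r') \<in> C" "0 \<le> \<eta>" "\<eta> < 2 * \<epsilon>" by (fact rr eta)+
    show "finite (N \<union> (\<lambda>e. pt e (\<kappa> e)) ` E)" by (rule S.finN)
    show "N \<union> (\<lambda>e. pt e (\<kappa> e)) ` E \<subseteq> P" by (rule ord_le_eq_trans[OF S.N_sub PS])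
    show "r' \<in> N \<union> (\<lambda>e. pt e (\<kappa> e)) ` E" using r'_N by simp
    show "finite Sh" "finite Co" "finite Lg" using fin unfolding Sh_def Co_def Lg_def by auto
    show "(Sh \<union> Co) \<inter> Lg = {}" using cut_long pcs_E unfolding Sh_def Co_def Lg_def by fastforce
    show "0 < pl c" if "c \<in> pcs" for c using S.L_pos[OF that] .
    show "pp c s \<in> P" if "c \<in> pcs" "0 \<le> s" "s \<le> pl c" for c s using S.pt_P[OF that] unfolding PS .
    show "D (pp c s) (pp c t) \<le> \<bar>s - t\<bar>" if "c \<in> pcs" "0 \<le> s" "s \<le> pl c" "0 \<le> t" "t \<le> pl c" for c s t using S.D_edge[OF that] unfolding DS .
    show "pp c 0 \<in> N \<union> (\<lambda>e. pt e (\<kappa> e)) ` E \<and> pp c (pl c) \<in> N \<union> (\<lambda>e. pt e (\<kappa> e)) ` E" if "c \<in> pcs" for c using S.ends[OF that] by (rule conjI)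
    show "pp c s \<notin> N \<union> (\<lambda>e. pt e (\<kappa> e)) ` E" if "c \<in> pcs" "0 < s" "s < pl c" for c s using S.interior[OF that] .
    show "c = c'" if "c \<in> pcs" "c' \<in> pcs" "0 < s" "s < pl c" "0 < s'" "s' < pl c'" "pp c s = pp c' s'" for c c' s s'
      using S.interior_inj[OF that] by (rule conjunct1)
    show "P = N \<union> (\<lambda>e. pt e (\<kappa> e)) ` E \<union> (\<Union>c\<in>pcs. pp c ` {0..pl c})" using PS unfolding seg_points_def[of pcs] by (rule sym)
    \<comment> \<open>A connector is either a part of a cut edge that is not long, or an uncut edge,
      the sum of two parts of at most 8\<epsilon>.\<close>
    show "pl c \<le> 16 * \<epsilon>" if c: "c \<in> Sh \<union> Co" for c
    proof (cases "c \<in> Sh")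
      case True
      then show ?thesis using pl_le[of c] eps unfolding Sh_def by auto
    next
      case False
      then have p: "c \<in> pcs" "c \<notin> Lg" using c unfolding Co_def by auto
      have "fst c \<in> E" by (rule pcs_E[OF p(1)])
      note pk = peak[OF this]
      show ?thesis
      proof (cases "cut (fst c)")
        case True
        then show ?thesis using p eps unfolding Lg_def by auto
      next
        case False
        then show ?thesis using uncut(2)[OF p(1) False] unfolding cut_def by linarith
      qed
    qed
    show "8 * \<epsilon> < pl c" if "c \<in> Lg" for c using that unfolding Lg_def by simp
    show "D r' (pp c s) = D r' (pp c 0) + s" if "c \<in> Lg" "0 \<le> s" "s \<le> pl c" for c s
      using ascending_piece[OF _ _ that(2,3)] that(1) unfolding Lg_def by simp
    show "(x, y) \<in> {(p, q). p \<in> P \<and> q \<in> P \<and> (\<exists>c\<in>pcs. p \<in> pp c ` {0..pl c} \<and> q \<in> pp c ` {0..pl c})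
            \<and> D x p + D p y < k \<and> D x q + D q y < k}\<^sup>*" if "x \<in> P" "y \<in> P" "D x y < k" for x y k
      using S.chain[of x y k] that unfolding DS PS by blast
    show "(\<exists>c\<in>Lg. pp c (pl c) = v) \<or>
        (\<exists>c\<in>Sh. (pp c 0 = v \<and> D r' (pp c (pl c)) < D r' v) \<or> (pp c (pl c) = v \<and> D r' (pp c 0) < D r' v))"
      if v: "v \<in> N \<union> (\<lambda>e. pt e (\<kappa> e)) ` E" "v \<noteq> r'" for v
    proof (cases "v \<in> N")
      case True
      then show ?thesis by (rule node_downward[OF _ v(2)])
    next
      case False
      then obtain e where e: "e \<in> E" "v = pt e (\<kappa> e)" using v by blast
      then have "cut e" using False ends(1)[OF e(1)] unfolding \<kappa>_def by (auto split: if_splits)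
      then show ?thesis using long_top[OF e(1)] e(2) unfolding \<kappa>_def by simp
    qed
  qed
qed

lemma sum_short: "sum pl Sh \<le> sum L {e \<in> E. L e \<le> 8 * \<epsilon>}"
proof -
  have u: "p = (fst p, True) \<and> pl p = L (fst p)" if "p \<in> Sh" for p
  proof -
    have "p \<in> pcs" "L (fst p) \<le> 8 * \<epsilon>" using that unfolding Sh_def by simp_all
    moreover from this have "\<not> cut (fst p)" using cut_long[OF pcs_E, of p] by auto
    ultimately have "p \<in> pcs" "\<not> cut (fst p)" by simp_all
    then show ?thesis using uncut by blast
  qed
  have inj: "inj_on fst Sh" by (rule inj_onI) (use u in metis)
  have "sum pl Sh = sum (L \<circ> fst) Sh" by (rule sum.cong) (use u in auto)
  also have "\<dots> = sum L (fst ` Sh)" by (rule sum.reindex[OF inj, symmetric])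
  also have "\<dots> \<le> sum L {e \<in> E. L e \<le> 8 * \<epsilon>}"
    by (rule sum_mono2) (use finE pcs_E L_pos in \<open>auto simp: Sh_def intro: less_imp_le\<close>)
  finally show ?thesis .
qed

theorem dist_le:
  shows "0 \<le> reeb_betti1 m r"
    and "\<And>x y. x \<in> mspace m \<Longrightarrow> y \<in> mspace m \<Longrightarrow> mdist m x y \<le> reeb_dist m r (proj x) (proj y)
      + (16 * \<epsilon> + \<eta>) * (reeb_betti1 m r + 1) + sum L {e \<in> E. L e \<le> 8 * \<epsilon>} + 16 * \<epsilon> * reeb_betti1 m r"
proof -
  note A = cell_approximation.dist_le_reeb_dist[OF cells]
  show "0 \<le> reeb_betti1 m r" by (rule A(1))
  show "mdist m x y \<le> reeb_dist m r (proj x) (proj y)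
      + (16 * \<epsilon> + \<eta>) * (reeb_betti1 m r + 1) + sum L {e \<in> E. L e \<le> 8 * \<epsilon>} + 16 * \<epsilon> * reeb_betti1 m r"
    if "x \<in> mspace m" "y \<in> mspace m" for x y using A(2)[OF that] sum_short by simp
qed

end

section \<open>Turning the correspondent of the root into a node\<close>

context segment_graph
begin

text \<open>At most one edge has to be cut properly; the cut parameter \<open>0\<close> leaves all
  others whole.\<close>

lemma ex_cut_point:
  assumes "x \<in> P"
  shows "\<exists>\<kappa> e0. (\<forall>e\<in>E. 0 \<le> \<kappa> e \<and> \<kappa> e \<le> L e) \<and> x \<in> N \<union> (\<lambda>e. pt e (\<kappa> e)) ` E \<and> (\<forall>e\<in>E. e \<noteq> e0 \<longrightarrow> \<kappa> e = 0)"
  using assms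
proof (cases rule: point_cases)
  case 1
  then show ?thesis using L_pos by (intro exI[of _ "\<lambda>_. 0"]) (auto intro: less_imp_le)
next
  case (2 e s)
  have "x \<in> (\<lambda>e'. pt e' (if e' = e then s else 0)) ` E" using 2 by (intro image_eqI[of _ _ e]) auto
  then show ?thesis using L_pos 2 by (intro exI[of _ "\<lambda>e'. if e' = e then s else 0"] exI[of _ e]) (auto intro: less_imp_le)
qed

text \<open>Every edge other than \<open>e0\<close> stays whole and counts only if it was short
  before. The edge \<open>e0\<close> can produce two short pieces, which is the source of the
  additional \<open>2 * k\<close>.\<close>

lemma sum_short_pieces:
  assumes \<kappa>: "\<forall>e\<in>E. 0 \<le> \<kappa> e \<and> \<kappa> e \<le> L e" "\<forall>e\<in>E. e \<noteq> e0 \<longrightarrow> \<kappa> e = 0" and k: "0 \<le> k"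
  shows "sum (piece_len L \<kappa>) {p \<in> pieces E L \<kappa>. piece_len L \<kappa> p \<le> k} \<le> k * card {e \<in> E. L e \<le> k} + 2 * k"
proof -
  define S where "S = {p \<in> pieces E L \<kappa>. piece_len L \<kappa> p \<le> k}"
  define g where "g p = (if p \<in> S then piece_len L \<kappa> p else 0)" for p
  have sub: "S \<subseteq> E \<times> UNIV" unfolding S_def pieces_def by auto
  have "sum (piece_len L \<kappa>) S = sum g (E \<times> UNIV)"
    by (rule sum.mono_neutral_cong_left) (use sub finE in \<open>auto simp: g_def\<close>)
  also have "\<dots> = (\<Sum>e\<in>E. \<Sum>i\<in>UNIV. g (e, i))" by (simp add: sum.cartesian_product)
  also have "\<dots> \<le> (\<Sum>e\<in>E. (if L e \<le> k then k else 0) + (if e = e0 then 2 * k else 0))"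
  proof (rule sum_mono)
    fix e assume e: "e \<in> E"
    have sum_g: "(\<Sum>i\<in>UNIV. g (e, i)) = g (e, False) + g (e, True)" by (simp add: UNIV_bool)
    show "(\<Sum>i\<in>UNIV. g (e, i)) \<le> (if L e \<le> k then k else 0) + (if e = e0 then 2 * k else 0)"
    proof (cases "e = e0")
      case True
      have "g p \<le> k" for p unfolding g_def S_def using k by simp
      from this[of "(e, False)"] this[of "(e, True)"] show ?thesis unfolding sum_g using True k by simp
    next
      case False
      then have "\<kappa> e = 0" using \<kappa>(2) e by simp
      then have "g (e, False) = 0" "g (e, True) \<le> (if L e \<le> k then k else 0)" using k unfolding g_def S_def piece_defs by auto
      then show ?thesis unfolding sum_g using False by simp
    qed
  qed
  also have "\<dots> = (\<Sum>e\<in>E. if L e \<le> k then k else 0) + (\<Sum>e\<in>E. if e = e0 then 2 * k else 0)" by (rule sum.distrib)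
  also have "(\<Sum>e\<in>E. if L e \<le> k then k else 0) = k * card {e \<in> E. L e \<le> k}"
    using finE by (simp add: sum.If_cases Int_def)
  also have "(\<Sum>e\<in>E. if e = e0 then 2 * k else 0) \<le> 2 * k" using finE k by (simp add: sum.delta')
  finally show ?thesis unfolding S_def by simp
qed

end

section \<open>Simplicial metric graphs in barycentric coordinates\<close>

text \<open>An edge is an unordered pair; some orientation is chosen in order to parametrize it by
  arc length.\<close>

definition edge_ends :: "'v set \<Rightarrow> 'v \<times> 'v" where
  "edge_ends e = (SOME (u, w). u \<noteq> w \<and> e = {u, w})"

definition edge_pt :: "('v set \<Rightarrow> real) \<Rightarrow> 'v set \<Rightarrow> real \<Rightarrow> 'v \<Rightarrow> real" where
  "edge_pt len e s = (\<lambda>z. if z = fst (edge_ends e) then 1 - s / len e else if z = snd (edge_ends e) then s / len e else 0)"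

locale metric_graph =
  fixes V :: "'v set" and E :: "'v set set" and len :: "'v set \<Rightarrow> real"
  assumes graph: "finite_metric_graph V E len"
begin

lemma finV: "finite V" and len_pos: "e \<in> E \<Longrightarrow> 0 < len e"
  using graph unfolding finite_metric_graph_def simplicial_graph_def by auto

lemma edge_ends:
  assumes "e \<in> E"
  shows "fst (edge_ends e) \<in> V" "snd (edge_ends e) \<in> V" "fst (edge_ends e) \<noteq> snd (edge_ends e)" "e = {fst (edge_ends e), snd (edge_ends e)}"
proof -
  have "\<exists>u w. u \<in> V \<and> w \<in> V \<and> u \<noteq> w \<and> e = {u, w}" using graph assms unfolding finite_metric_graph_def simplicial_graph_def by simp
  then obtain u w where uw: "u \<in> V" "w \<in> V" "u \<noteq> w" "e = {u, w}" by (elim exE conjE)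
  have "case (SOME (u, w). u \<noteq> w \<and> e = {u, w}) of (u, w) \<Rightarrow> u \<noteq> w \<and> e = {u, w}"
    by (rule someI[of _ "(u, w)"]) (use uw in simp)
  then have *: "fst (edge_ends e) \<noteq> snd (edge_ends e)" "e = {fst (edge_ends e), snd (edge_ends e)}"
    unfolding edge_ends_def by (simp_all add: case_prod_unfold)
  then show "fst (edge_ends e) \<noteq> snd (edge_ends e)" "e = {fst (edge_ends e), snd (edge_ends e)}" by simp_all
  have "fst (edge_ends e) \<in> {u, w}" "snd (edge_ends e) \<in> {u, w}" using * uw(4) by (metis insertCI)+
  then show "fst (edge_ends e) \<in> V" "snd (edge_ends e) \<in> V" using uw(1,2) by auto
qed

lemma edge_pt_ends:
  assumes e: "e \<in> E"
  shows "edge_pt len e 0 = vert_pt (fst (edge_ends e))" "edge_pt len e (len e) = vert_pt (snd (edge_ends e))"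
  using len_pos[OF e] edge_ends(3)[OF e] unfolding edge_pt_def vert_pt_def by (auto simp: fun_eq_iff)

lemma sum_edge:
  assumes e: "e \<in> E"
  shows "sum g e = g (fst (edge_ends e)) + (g (snd (edge_ends e)) :: real)"
proof -
  have "sum g e = sum g {fst (edge_ends e), snd (edge_ends e)}" using edge_ends(4)[OF e] by (rule arg_cong)
  then show ?thesis using edge_ends(3)[OF e] by simp
qed

lemma mem_edge: "e \<in> E \<Longrightarrow> z \<in> e \<longleftrightarrow> z = fst (edge_ends e) \<or> z = snd (edge_ends e)"
  using edge_ends(4)[of e] by blast

lemma edge_seg_eq:
  assumes e: "e \<in> E"
  shows "edge_seg e = edge_pt len e ` {0..len e}"
proof (intro equalityI subsetI)
  note l = len_pos[OF e]
  fix x assume "x \<in> edge_seg e"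
  then have x: "\<forall>z\<in>e. 0 \<le> x z" "(\<Sum>z\<in>e. x z) = 1" "\<forall>z. z \<notin> e \<longrightarrow> x z = 0" unfolding edge_seg_def by auto
  let ?u = "fst (edge_ends e)" and ?w = "snd (edge_ends e)"
  have s: "x ?u + x ?w = 1" using x(2) unfolding sum_edge[OF e] .
  have nn: "0 \<le> x ?u" "0 \<le> x ?w" using x(1) mem_edge[OF e] by auto
  have "x ?w * len e \<le> 1 * len e" using s nn l by (intro mult_right_mono) auto
  then have "x ?w * len e \<in> {0..len e}" using nn l by simp
  moreover have "x = edge_pt len e (x ?w * len e)"
  proof
    fix z
    show "x z = edge_pt len e (x ?w * len e) z" using s l x(3)[rule_format, of z] mem_edge[OF e, of z] unfolding edge_pt_def by auto
  qed
  ultimately show "x \<in> edge_pt len e ` {0..len e}" by (rule rev_image_eqI)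
next
  note l = len_pos[OF e]
  fix x assume "x \<in> edge_pt len e ` {0..len e}"
  then obtain s where s: "0 \<le> s" "s \<le> len e" "x = edge_pt len e s" by auto
  have "s / len e \<le> 1" "0 \<le> s / len e" using s l by simp_all
  then show "x \<in> edge_seg e" unfolding edge_seg_def mem_Collect_eq sum_edge[OF e]
    using edge_ends(3)[OF e] mem_edge[OF e] unfolding s(3) edge_pt_def by auto
qed

text \<open>Moving along the edge changes both barycentric coordinates by the same amount, which the
  factor 1/2 in the distance compensates.\<close>

lemma seg_dist_edge_pt:
  assumes e: "e \<in> E"
  shows "seg_dist len e (edge_pt len e s) (edge_pt len e t) = \<bar>s - t\<bar>"
proof -
  note l = len_pos[OF e]
  have 1: "1 - s / len e - (1 - t / len e) = (t - s) / len e" "s / len e - t / len e = (s - t) / len e"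
    using l by (simp_all add: field_simps)
  show ?thesis unfolding seg_dist_def sum_edge[OF e] unfolding edge_pt_def using edge_ends(3)[OF e] l
    by (simp add: 1 abs_divide abs_minus_commute)
qed

lemma seg_points_eq: "seg_points E (vert_pt ` V) len (edge_pt len) = mg_carrier V E"
  unfolding seg_points_def mg_carrier_def using edge_seg_eq by auto

lemma seg_walk_of_mg_walk:
  assumes w: "mg_walk E xs es" and k: "k \<le> length es"
  shows "seg_walk E len (edge_pt len) (xs ! 0) (xs ! k) (\<Sum>i<k. seg_dist len (es ! i) (xs ! i) (xs ! Suc i))"
  using k
proof (induction k)
  case 0
  show ?case by (simp add: seg_walk.stay)
next
  case (Suc k)
  then have k: "k < length es" by simp
  have e: "es ! k \<in> E" "xs ! k \<in> edge_seg (es ! k)" "xs ! Suc k \<in> edge_seg (es ! k)" using w k unfolding mg_walk_def by auto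
  obtain s t where st: "s \<in> {0..len (es ! k)}" "xs ! k = edge_pt len (es ! k) s" "t \<in> {0..len (es ! k)}" "xs ! Suc k = edge_pt len (es ! k) t"
    using e(2,3) unfolding edge_seg_eq[OF e(1)] by (elim imageE)
  have "seg_walk E len (edge_pt len) (xs ! k) (xs ! Suc k) (seg_dist len (es ! k) (xs ! k) (xs ! Suc k))"
    unfolding st seg_dist_edge_pt[OF e(1)] by (rule seg_walk_edge[OF e(1)]) (use st in simp_all)
  from seg_walk_append[OF this Suc.IH] show ?case using k by simp
qed

lemma mg_walk_of_seg_walk:
  assumes "seg_walk E len (edge_pt len) x y c"
  shows "\<exists>xs es. c = (\<Sum>i < length es. seg_dist len (es ! i) (xs ! i) (xs ! Suc i)) \<and> mg_walk E xs es \<and> hd xs = x \<and> last xs = y"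
  using assms
proof (induction rule: seg_walk.induct)
  case stay
  show ?case by (rule exI[of _ "[x]"], rule exI[of _ "[]"]) (simp add: mg_walk_def)
next
  case (step e s c t)
  then obtain xs es where IH: "c = (\<Sum>i < length es. seg_dist len (es ! i) (xs ! i) (xs ! Suc i))" "mg_walk E xs es" "hd xs = x" "last xs = edge_pt len e s"
    by (elim exE conjE)
  have len: "xs \<noteq> []" "length xs = Suc (length es)" using IH(2) unfolding mg_walk_def by auto
  have lst: "xs ! length es = edge_pt len e s" using IH(4) len by (simp add: last_conv_nth)
  let ?xs = "xs @ [edge_pt len e t]" and ?es = "es @ [e]"
  have "(\<Sum>i < length ?es. seg_dist len (?es ! i) (?xs ! i) (?xs ! Suc i)) = (\<Sum>i < length es. seg_dist len (es ! i) (xs ! i) (xs ! Suc i)) + seg_dist len e (edge_pt len e s) (edge_pt len e t)"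
    using len lst by (simp add: nth_append)
  then have "c + \<bar>s - t\<bar> = (\<Sum>i < length ?es. seg_dist len (?es ! i) (?xs ! i) (?xs ! Suc i))" unfolding seg_dist_edge_pt[OF step.hyps(2)] IH(1) by simp
  moreover have "mg_walk E ?xs ?es"
    unfolding mg_walk_def
  proof (intro conjI allI impI)
    fix i assume i: "i < length ?es"
    have seg: "edge_pt len e s \<in> edge_seg e" "edge_pt len e t \<in> edge_seg e" unfolding edge_seg_eq[OF step.hyps(2)] using step.hyps(3-6) by auto
    have "?es ! i \<in> E \<and> ?xs ! i \<in> edge_seg (?es ! i) \<and> ?xs ! Suc i \<in> edge_seg (?es ! i)"
    proof (cases "i = length es")
      case True
      then have "?es ! i = e" "?xs ! i = edge_pt len e s" "?xs ! Suc i = edge_pt len e t" using len lst by (simp_all add: nth_append)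
      then show ?thesis using seg step.hyps(2) by (simp only: simp_thms)
    next
      case False
      then have il: "i < length es" using i by simp
      then have "?es ! i = es ! i" "?xs ! i = xs ! i" "?xs ! Suc i = xs ! Suc i" using len by (simp_all add: nth_append)
      then show ?thesis using IH(2) il unfolding mg_walk_def by (simp only: simp_thms)
    qed
    then show "?es ! i \<in> E" "?xs ! i \<in> edge_seg (?es ! i)" "?xs ! Suc i \<in> edge_seg (?es ! i)" by blast+
  qed (use len in simp_all)
  moreover have "hd ?xs = x" "last ?xs = edge_pt len e t" using IH(3) len(1) by simp_all
  ultimately show ?case by (intro exI[of _ ?xs] exI[of _ ?es] conjI)
qed

lemma seg_walk_iff:
  "seg_walk E len (edge_pt len) x y c \<longleftrightarrow>
    (\<exists>xs es. c = (\<Sum>i < length es. seg_dist len (es ! i) (xs ! i) (xs ! Suc i)) \<and> mg_walk E xs es \<and> hd xs = x \<and> last xs = y)"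
proof
  assume "\<exists>xs es. c = (\<Sum>i < length es. seg_dist len (es ! i) (xs ! i) (xs ! Suc i)) \<and> mg_walk E xs es \<and> hd xs = x \<and> last xs = y"
  then obtain xs es where w: "c = (\<Sum>i < length es. seg_dist len (es ! i) (xs ! i) (xs ! Suc i))" "mg_walk E xs es" "hd xs = x" "last xs = y"
    by (elim exE conjE)
  have "xs \<noteq> []" "length es = length xs - 1" using w(2) unfolding mg_walk_def by auto
  then have "xs ! 0 = x" "xs ! length es = y" using w(3,4) by (simp_all add: hd_conv_nth last_conv_nth)
  then show "seg_walk E len (edge_pt len) x y c" using seg_walk_of_mg_walk[OF w(2) order_refl] w(1) by simp
qed (rule mg_walk_of_seg_walk)

lemma walk_dist_eq: "walk_dist E len (edge_pt len) = mg_dist E len"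
  unfolding walk_dist_def mg_dist_def seg_walk_iff by (rule refl)

text \<open>An interior point thus determines its edge, which gives the disjointness of open
  edges.\<close>

lemma edge_pt_support:
  assumes e: "e \<in> E" and s: "0 < s" "s < len e"
  shows "{z. edge_pt len e s z \<noteq> 0} = e"
proof -
  have "s / len e \<noteq> 0" "1 - s / len e \<noteq> 0" using s by simp_all
  then show ?thesis using mem_edge[OF e] unfolding edge_pt_def by auto
qed

lemma segment_graph: "segment_graph E (vert_pt ` V) len (edge_pt len)"
proof
  have "E \<subseteq> Pow V" using edge_ends by (metis PowI insert_subset empty_subsetI subsetI)
  then show "finite E" using finV finite_subset by blast
  show "finite (vert_pt ` V)" using finV by simp
  show "0 < len e" if "e \<in> E" for e using len_pos[OF that] .
  show "edge_pt len e 0 \<in> vert_pt ` V" "edge_pt len e (len e) \<in> vert_pt ` V" if "e \<in> E" for e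
    using edge_pt_ends[OF that] edge_ends[OF that] by simp_all
  show "edge_pt len e s \<notin> vert_pt ` V" if e: "e \<in> E" "0 < s" "s < len e" for e s
  proof
    assume "edge_pt len e s \<in> vert_pt ` V"
    then obtain v where v: "edge_pt len e s = vert_pt v" by blast
    have "edge_pt len e s (snd (edge_ends e)) = s / len e" using edge_ends(3)[OF e(1)] unfolding edge_pt_def by auto
    then have "vert_pt v (snd (edge_ends e)) = s / len e" unfolding v .
    then show False using e unfolding vert_pt_def by (auto split: if_splits)
  qed
  show "e = e' \<and> s = s'" if e: "e \<in> E" "e' \<in> E" "0 < s" "s < len e" "0 < s'" "s' < len e'" "edge_pt len e s = edge_pt len e' s'" for e e' s s'
  proof -
    have ee: "e = e'" using edge_pt_support[OF e(1,3,4)] edge_pt_support[OF e(2,5,6)] e(7) by simp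
    have "edge_pt len e s (snd (edge_ends e)) = edge_pt len e s' (snd (edge_ends e))" using e(7) ee by simp
    then show ?thesis using edge_ends(3)[OF e(1)] len_pos[OF e(1)] ee unfolding edge_pt_def by auto
  qed
  show "\<exists>c. seg_walk E len (edge_pt len) x y c" if "x \<in> seg_points E (vert_pt ` V) len (edge_pt len)" "y \<in> seg_points E (vert_pt ` V) len (edge_pt len)" for x y
    using graph that unfolding seg_points_eq finite_metric_graph_def seg_walk_iff by blast
qed

end

section \<open>The Gromov-Hausdorff estimate\<close>

context reeb_space
begin

lemma mdist_bounded: "\<exists>B. \<forall>x\<in>mspace m. \<forall>y\<in>mspace m. mdist m x y \<le> B"
proof -
  have "compactin (mtopology_of m) (mspace m)" using compact unfolding compact_space_def by simp
  then have "compactin euclideanreal (lvl ` mspace m)" using image_compactin continuous_lvl by blast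
  then have "bounded (lvl ` mspace m)" by (simp add: compact_imp_bounded)
  then obtain B where B: "\<And>x. x \<in> mspace m \<Longrightarrow> \<bar>lvl x\<bar> \<le> B" unfolding bounded_iff by auto
  have "mdist m x y \<le> B + B" if "x \<in> mspace m" "y \<in> mspace m" for x y
    using M.triangle[OF that(1) r that(2)] B[OF that(1)] B[OF that(2)] M.commute[of x r] by simp
  then show ?thesis by blast
qed

text \<open>The correspondence is the graph of the quotient map. The map never increases distances,
  so its distortion is controlled by the one inequality that is assumed.\<close>

lemma gh_dist_reeb_le:
  assumes le: "\<And>x y. x \<in> mspace m \<Longrightarrow> y \<in> mspace m \<Longrightarrow> mdist m x y \<le> reeb_dist m r (proj x) (proj y) + \<Delta>" and \<Delta>: "0 \<le> \<Delta>"
  shows "gh_dist (mspace m) (mdist m) (reeb_G m r) (reeb_dist m r) \<le> \<Delta> / 2"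
  unfolding gh_dist_def
proof (rule cInf_lower)
  let ?C = "(\<lambda>x. (x, proj x)) ` mspace m"
  have "correspondence (mspace m) (reeb_G m r) ?C" unfolding correspondence_def reeb_G_def by (auto simp: image_image)
  moreover have "\<bar>mdist m x x' - reeb_dist m r y y'\<bar> \<le> \<Delta>" if "(x, y) \<in> ?C" "(x', y') \<in> ?C" for x y x' y'
    using le[of x x'] reeb_dist_le[of x x'] that \<Delta> by auto
  ultimately show "\<Delta> / 2 \<in> {\<eta> / 2 |\<eta>. 0 \<le> \<eta> \<and> (\<exists>C. correspondence (mspace m) (reeb_G m r) C \<and>
      (\<forall>x y x' y'. (x, y) \<in> C \<longrightarrow> (x', y') \<in> C \<longrightarrow> \<bar>mdist m x x' - reeb_dist m r y y'\<bar> \<le> \<eta>))}"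
    using \<Delta> by blast
qed (auto intro!: bdd_belowI[of _ 0])

end

text \<open>The real infimum of an empty set carries no information. Since both spaces are bounded,
  the full product is a correspondence of finite distortion, so the set is nonempty and some
  correspondence comes close to the infimum.\<close>

lemma gh_dist_correspondence:
  assumes gh: "gh_dist S d T d' < \<epsilon>" and ne: "S \<noteq> {}" "T \<noteq> {}"
    and S: "\<And>x y. x \<in> S \<Longrightarrow> y \<in> S \<Longrightarrow> 0 \<le> d x y \<and> d x y \<le> B" and T: "\<And>x y. x \<in> T \<Longrightarrow> y \<in> T \<Longrightarrow> 0 \<le> d' x y \<and> d' x y \<le> B'"
  shows "\<exists>\<eta> C. 0 \<le> \<eta> \<and> \<eta> < 2 * \<epsilon> \<and> correspondence S T C \<and>
    (\<forall>x y x' y'. (x, y) \<in> C \<longrightarrow> (x', y') \<in> C \<longrightarrow> \<bar>d x x' - d' y y'\<bar> \<le> \<eta>)"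
proof -
  let ?A = "{\<eta> / 2 | \<eta>. 0 \<le> \<eta> \<and> (\<exists>C. correspondence S T C \<and>
      (\<forall>x y x' y'. (x, y) \<in> C \<longrightarrow> (x', y') \<in> C \<longrightarrow> \<bar>d x x' - d' y y'\<bar> \<le> \<eta>))}"
  obtain s t where st: "s \<in> S" "t \<in> T" using ne by blast
  have "correspondence S T (S \<times> T)" unfolding correspondence_def using st by auto
  moreover have "\<bar>d x x' - d' y y'\<bar> \<le> B + B'" if "(x, y) \<in> S \<times> T" "(x', y') \<in> S \<times> T" for x y x' y'
    using S[of x x'] T[of y y'] that by auto
  moreover have "0 \<le> B + B'" using S[OF st(1) st(1)] T[OF st(2) st(2)] by linarith
  ultimately have "(B + B') / 2 \<in> ?A" by blast
  then have "?A \<noteq> {}" by blast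
  from cInf_lessD[OF this gh[unfolded gh_dist_def]] obtain \<eta> C where "0 \<le> \<eta>" "\<eta> / 2 < \<epsilon>" "correspondence S T C"
    "\<forall>x y x' y'. (x, y) \<in> C \<longrightarrow> (x', y') \<in> C \<longrightarrow> \<bar>d x x' - d' y y'\<bar> \<le> \<eta>" by blast
  then show ?thesis by (intro exI[of _ \<eta>] exI[of _ C]) simp
qed

lemma gh_dist_reeb_less:
  fixes m :: "'a metric" and V :: "'v set"
  assumes "compact_space (mtopology_of m)" "connected_space (mtopology_of m)" "path_metric_space m" "r \<in> mspace m"
    "finite_top_graph (reeb_top m r)" and eps: "0 < \<epsilon>" and G: "finite_metric_graph V E len"
    and gh: "gh_dist (mspace m) (mdist m) (mg_carrier V E) (mg_dist E len) < \<epsilon>"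
  shows "gh_dist (mspace m) (mdist m) (reeb_G m r) (reeb_dist m r)
           < (real_of_int (reeb_betti1 m r) + 1) * (17 + 8 * real (card {e \<in> E. len e \<le> 8 * \<epsilon>})) * \<epsilon>"
proof -
  interpret reeb_space m r by unfold_locales (fact assms)+
  interpret G: metric_graph V E len by unfold_locales (fact G)
  interpret S: segment_graph E "vert_pt ` V" len "edge_pt len" by (rule G.segment_graph)
  note P = G.seg_points_eq and D = G.walk_dist_eq
  obtain B where B: "\<And>x y. x \<in> mspace m \<Longrightarrow> y \<in> mspace m \<Longrightarrow> mdist m x y \<le> B" using mdist_bounded by blast
  obtain B' where B': "\<And>x y. x \<in> mg_carrier V E \<Longrightarrow> y \<in> mg_carrier V E \<Longrightarrow> mg_dist E len x y \<le> B'"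
    using S.bounded unfolding P D by blast
  have "mg_carrier V E \<noteq> {}" using G unfolding finite_metric_graph_def simplicial_graph_def mg_carrier_def by blast
  then have "\<exists>\<eta> C. 0 \<le> \<eta> \<and> \<eta> < 2 * \<epsilon> \<and> correspondence (mspace m) (mg_carrier V E) C \<and>
    (\<forall>x y x' y'. (x, y) \<in> C \<longrightarrow> (x', y') \<in> C \<longrightarrow> \<bar>mdist m x x' - mg_dist E len y y'\<bar> \<le> \<eta>)"
    using r B B' S.D_nonneg unfolding P D by (intro gh_dist_correspondence[OF gh]) auto
  then obtain \<eta> C where \<eta>: "0 \<le> \<eta>" "\<eta> < 2 * \<epsilon>" and C: "correspondence (mspace m) (mg_carrier V E) C"
    "\<forall>x y x' y'. (x, y) \<in> C \<longrightarrow> (x', y') \<in> C \<longrightarrow> \<bar>mdist m x x' - mg_dist E len y y'\<bar> \<le> \<eta>"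
    by (elim exE conjE)
  obtain r' where rr: "(r, r') \<in> C" using C(1) r unfolding correspondence_def by force
  then have "r' \<in> S.P" unfolding P using C(1) unfolding correspondence_def by auto
  from S.ex_cut_point[OF this]
  obtain \<kappa> e0 where k: "\<forall>e\<in>E. 0 \<le> \<kappa> e \<and> \<kappa> e \<le> len e" "r' \<in> vert_pt ` V \<union> (\<lambda>e. edge_pt len e (\<kappa> e)) ` E" "\<forall>e\<in>E. e \<noteq> e0 \<longrightarrow> \<kappa> e = 0"
    by (elim exE conjE)
  have k1: "0 \<le> \<kappa> e" "\<kappa> e \<le> len e" if "e \<in> E" for e using k(1) that by auto
  let ?E = "pieces E len \<kappa>" and ?N = "vert_pt ` V \<union> (\<lambda>e. edge_pt len e (\<kappa> e)) ` E" and ?L = "piece_len len \<kappa>" and ?pt = "piece_pt len (edge_pt len)"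
  have S': "segment_graph ?E ?N ?L ?pt" by (rule S.segment_graph_pieces[OF k1])
  have P': "seg_points ?E ?N ?L ?pt = mg_carrier V E" using S.seg_points_pieces[OF k1] P by simp
  have D': "walk_dist ?E ?L ?pt = mg_dist E len" using S.walk_dist_pieces[OF k1] D by simp
  have GA: "graph_approximation m r ?E ?N ?L ?pt C r' \<epsilon> \<eta>"
  proof (intro graph_approximation.intro graph_approximation_axioms.intro)
    show "reeb_space m r" by (rule reeb_space_axioms)
    show "segment_graph ?E ?N ?L ?pt" by (rule S')
    show "correspondence (mspace m) (seg_points ?E ?N ?L ?pt) C" unfolding P' by (rule C(1))
    show "\<bar>mdist m x y - walk_dist ?E ?L ?pt x' y'\<bar> \<le> \<eta>" if "(x, x') \<in> C" "(y, y') \<in> C" for x x' y y'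
      unfolding D' using C(2) that by simp
  qed (fact rr \<eta> k(2))+
  let ?b = "real_of_int (reeb_betti1 m r)" and ?n = "real (card {e \<in> E. len e \<le> 8 * \<epsilon>})"
  define \<Delta> where "\<Delta> = (16 * \<epsilon> + \<eta>) * (?b + 1) + (8 * \<epsilon> * ?n + 2 * (8 * \<epsilon>)) + 16 * \<epsilon> * ?b"
  have b: "0 \<le> ?b" using graph_approximation.dist_le(1)[OF GA] by simp
  have short: "sum ?L {p \<in> ?E. ?L p \<le> 8 * \<epsilon>} \<le> 8 * \<epsilon> * ?n + 2 * (8 * \<epsilon>)"
    using S.sum_short_pieces[OF k(1,3), of "8 * \<epsilon>"] eps by simp
  have "gh_dist (mspace m) (mdist m) (reeb_G m r) (reeb_dist m r) \<le> \<Delta> / 2"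
  proof (rule gh_dist_reeb_le)
    show "0 \<le> \<Delta>" unfolding \<Delta>_def using eps \<eta> b by simp
    show "mdist m x y \<le> reeb_dist m r (proj x) (proj y) + \<Delta>" if "x \<in> mspace m" "y \<in> mspace m" for x y
      using graph_approximation.dist_le(2)[OF GA that] short unfolding \<Delta>_def by simp
  qed
  \<comment> \<open>The inequality is strict because \<eta> < 2\<epsilon> and the Betti number is
    nonnegative; half of the bound is then below 17\<epsilon> times \<open>?b + 1\<close> plus
    4\<epsilon> times \<open>?n\<close>.\<close>
  also have "\<Delta> / 2 < (?b + 1) * (17 + 8 * ?n) * \<epsilon>"
  proof -
    have "\<eta> * (?b + 1) < 2 * \<epsilon> * (?b + 1)" using \<eta>(2) b by (intro mult_strict_right_mono) auto
    moreover have "0 \<le> \<epsilon> * ?n" "0 \<le> \<epsilon> * ?n * ?b" using eps b by simp_all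
    ultimately show ?thesis unfolding \<Delta>_def by (simp add: algebra_simps)
  qed
  finally show ?thesis .
qed

theorem theorem3:
  fixes m :: "'a metric" and r :: 'a and \<epsilon> :: real
    and V :: "'v set" and E :: "'v set set" and len :: "'v set \<Rightarrow> real"
  assumes "compact_space (mtopology_of m)"
    and "connected_space (mtopology_of m)"
    and "path_metric_space m"
    and "r \<in> mspace m"
    and "finite_top_graph (reeb_top m r)"
    and "\<epsilon> > 0"
    and "finite_metric_graph V E len"
    and "gh_dist (mspace m) (mdist m) (mg_carrier V E) (mg_dist E len) < \<epsilon>"
  shows "gh_dist (mspace m) (mdist m) (reeb_G m r) (reeb_dist m r)
           < (real_of_int (reeb_betti1 m r) + 1) * (17 + 8 * real (card {e \<in> E. len e \<le> 8 * \<epsilon>})) * \<epsilon>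
       \<and> ((\<forall>e\<in>E. len e > 8 * \<epsilon>) \<longrightarrow>
         gh_dist (mspace m) (mdist m) (reeb_G m r) (reeb_dist m r) < 17 * (real_of_int (reeb_betti1 m r) + 1) * \<epsilon>)"
proof (intro conjI impI)
  note main = gh_dist_reeb_less[OF assms]
  show "gh_dist (mspace m) (mdist m) (reeb_G m r) (reeb_dist m r)
           < (real_of_int (reeb_betti1 m r) + 1) * (17 + 8 * real (card {e \<in> E. len e \<le> 8 * \<epsilon>})) * \<epsilon>" by (rule main)
  assume "\<forall>e\<in>E. len e > 8 * \<epsilon>"
  then have "{e \<in> E. len e \<le> 8 * \<epsilon>} = {}" by fastforce
  then have "card {e \<in> E. len e \<le> 8 * \<epsilon>} = 0" by (simp only: card.empty)
  then show "gh_dist (mspace m) (mdist m) (reeb_G m r) (reeb_dist m r) < 17 * (real_of_int (reeb_betti1 m r) + 1) * \<epsilon>"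
    using main by (simp only: of_nat_0 mult_zero_right add_0_right mult.commute[of _ 17])
qed

end
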